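(* For any state $\rho_{ABEE'}$ (with Eve holding $EE'$), with $\rho_{ABE}=\mathrm{Tr}_{E'}\rho_{ABEE'}$, $$K_D(\rho_{ABEE'})\ge K_D(\rho_{ABE})-2S(\rho_{E'}),$$ and, if $E'$ is classical, $$K_D(\rho_{ABEE'})\ge K_D(\rho_{ABE})-S(\rho_{E'}).$$
   Context: Hilbert spaces are finite-dimensional and $\log$ is to base 2; $S$ denotes von Neumann entropy. $E'$ is classical if $\rho_{ABEE'}=\sum_kp_k\,\rho^k_{ABE}\otimes|k\rangle\langle k|_{E'}$ for an orthonormal basis $\{|k\rangle\}$. Key rate. A tripartite state $\rho_{ABE}$ is a density operator on $\mathcal H_A\otimes\mathcal H_B\otimes\mathcal H_E$, held by Alice, Bob and the adversary Eve. Distance: $\|\rho-\sigma\|:=\frac12\mathrm{Tr}|\rho-\sigma|$. LOPC operation: a concatenation of finitely many steps, each being either (i) a local quantum operation of Bob, $\rho_{ABE}\mapsto(I_{AE}\otimes\Lambda_B)(\rho_{ABE})$ with $\Lambda_B$ completely positive trace preserving (CPTP), or the analogue for Alice; or (ii) public classical communication from Alice to Bob: a state $\sum_i\rho^i_{ABE}\otimes|i\rangle\langle i|_{A'}$ ($A'$ a classical register of Alice) is transformed into $\sum_i\rho^i_{ABE}\otimes|iii\rangle\langle iii|_{A'B'E''}$ (with Eve's copy of the message stored in a new register $E''$), or the analogue from Bob to Alice. LOPC protocol: a family $\mathcal P=\{\Lambda_n\}_{n\in\mathbb N}$ of CPTP maps $\Lambda_n:(\mathcal H_A\otimes\mathcal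 H_B\otimes\mathcal H_E)^{\otimes n}\to\mathcal H_A^n\otimes\mathcal H_B^n\otimes\mathcal H_E^n$, each an LOPC operation. Let $\tau^\ell_{ABE}:=\frac1{2^\ell}\sum_{i=1}^{2^\ell}|ii\rangle\langle ii|_{AB}\otimes\tau_E$ for some arbitrary state $\tau_E$. $\mathcal P$ distills key at rate $R_{\mathcal P}$ from $\rho_{ABE}$ if there is a sequence $\{\ell_n\}$ with $\limsup_{n\to\infty}\ell_n/n=R_{\mathcal P}$ and $\lim_{n\to\infty}\|\Lambda_n(\rho_{ABE}^{\otimes n})-\tau^{\ell_n}_{ABE}\|=0$. The key rate is $K_D(\rho_{ABE}):=\sup_{\mathcal P}R_{\mathcal P}$. *)

theory Defs
  imports
    "Jordan_Normal_Form.Spectral_Radius"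
    "Jordan_Normal_Form.Schur_Decomposition"
    "HOL-Library.Extended_Real"
    "HOL-Library.Liminf_Limsup"
begin

text \<open>
  A finite-dimensional Hilbert space is \<open>\<complex>\<^sup>d\<close> with its computational basis
  \<open>|0\<rangle>, \<dots>, |d - 1\<rangle>\<close>; operators are matrices in \<open>carrier_mat d d\<close>.  The basis vector
  \<open>|x\<rangle> \<otimes> |y\<rangle>\<close> of \<open>\<complex>\<^sup>d \<otimes> \<complex>\<^sup>m\<close> has index \<open>x * m + y\<close>.
\<close>

section \<open>States, entropy, distance\<close>

definition mtrace :: "complex mat \<Rightarrow> complex" where
  "mtrace X = (\<Sum>i<dim_row X. X $$ (i, i))"

text \<open>The order on \<^typ>\<open>complex\<close> is that of \<open>Complex_Order\<close>: \<open>0 \<le> z\<close> says that \<open>z\<close> is real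
  and nonnegative.  In particular positive matrices are Hermitian.\<close>

definition psd :: "nat \<Rightarrow> complex mat \<Rightarrow> bool" where
  "psd d X \<longleftrightarrow> X \<in> carrier_mat d d \<and> (\<forall>v \<in> carrier_vec d. 0 \<le> (X *\<^sub>v v) \<bullet>c v)"

definition density_op :: "nat \<Rightarrow> complex mat \<Rightarrow> bool" where
  "density_op d \<rho> \<longleftrightarrow> psd d \<rho> \<and> mtrace \<rho> = 1"

definition kron :: "complex mat \<Rightarrow> complex mat \<Rightarrow> complex mat" where
  "kron X Y = mat (dim_row X * dim_row Y) (dim_col X * dim_col Y)
     (\<lambda>(i, j). X $$ (i div dim_row Y, j div dim_col Y) * Y $$ (i mod dim_row Y, j mod dim_col Y))"

definition proj :: "complex vec \<Rightarrow> complex mat" where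
  "proj v = mat (dim_vec v) (dim_vec v) (\<lambda>(i, j). v $ i * conjugate (v $ j))"

text \<open>Partial traces of an operator on \<open>\<complex>\<^sup>d \<otimes> \<complex>\<^sup>m\<close>, over the second and the first factor.\<close>

definition ptrace_snd :: "nat \<Rightarrow> nat \<Rightarrow> complex mat \<Rightarrow> complex mat" where
  "ptrace_snd d m X = mat d d (\<lambda>(x, x'). \<Sum>y<m. X $$ (x * m + y, x' * m + y))"

definition ptrace_fst :: "nat \<Rightarrow> nat \<Rightarrow> complex mat \<Rightarrow> complex mat" where
  "ptrace_fst d m X = mat m m (\<lambda>(y, y'). \<Sum>x<d. X $$ (x * m + y, x * m + y'))"

text \<open>\<open>S(\<rho>) = - Tr (\<rho> log \<rho>)\<close>, as the sum over the eigenvalues with multiplicity; the eigenvalue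
  0 contributes 0.\<close>

definition vn_entropy :: "complex mat \<Rightarrow> real" where
  "vn_entropy \<rho> =
     - (\<Sum>x \<in> spectrum \<rho>. real (Polynomial.order x (char_poly \<rho>)) * (Re x * log 2 (Re x)))"

text \<open>\<open>|X|\<close> is the unique positive square root of \<open>X\<^sup>\<dagger> X\<close>.\<close>

definition mat_abs :: "complex mat \<Rightarrow> complex mat" where
  "mat_abs X = (THE P. psd (dim_col X) P \<and> P * P = mat_adjoint X * X)"

definition trace_dist :: "complex mat \<Rightarrow> complex mat \<Rightarrow> real" where
  "trace_dist \<rho> \<sigma> = Re (mtrace (mat_abs (\<rho> - \<sigma>))) / 2"

text \<open>The second factor \<open>\<complex>\<^sup>m\<close> is classical, with respect to some orthonormal basis \<open>v\<close>.\<close>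

definition classical_snd :: "nat \<Rightarrow> nat \<Rightarrow> complex mat \<Rightarrow> bool" where
  "classical_snd d m \<rho> \<longleftrightarrow>
     (\<exists>(v :: nat \<Rightarrow> complex vec) (p :: nat \<Rightarrow> real) (\<sigma> :: nat \<Rightarrow> complex mat).
        (\<forall>k<m. v k \<in> carrier_vec m) \<and>
        (\<forall>j<m. \<forall>k<m. v j \<bullet>c v k = (if j = k then 1 else 0)) \<and>
        (\<forall>k<m. 0 \<le> p k) \<and> (\<Sum>k<m. p k) = 1 \<and>
        (\<forall>k<m. density_op d (\<sigma> k)) \<and>
        \<rho> = mat (d * m) (d * m)
               (\<lambda>(i, j). \<Sum>k<m. complex_of_real (p k) * kron (\<sigma> k) (proj (v k)) $$ (i, j)))"


section \<open>Quantum operations\<close>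

text \<open>\<open>(id \<otimes> \<Phi>) X\<close> on \<open>\<complex>\<^sup>k \<otimes> \<complex>\<^sup>d\<close>, where \<open>\<Phi>\<close> maps operators on \<open>\<complex>\<^sup>d\<close> to operators on
  \<open>\<complex>\<^sup>d\<^sup>'\<close>: \<open>\<Phi>\<close> is applied to every \<open>d \<times> d\<close> block of \<open>X\<close>.\<close>

definition ampliation ::
  "nat \<Rightarrow> nat \<Rightarrow> nat \<Rightarrow> (complex mat \<Rightarrow> complex mat) \<Rightarrow> complex mat \<Rightarrow> complex mat" where
  "ampliation k d d' \<Phi> X = mat (k * d') (k * d')
     (\<lambda>(i, j). \<Phi> (mat d d (\<lambda>(y, y'). X $$ ((i div d') * d + y, (j div d') * d + y')))
                 $$ (i mod d', j mod d'))"

definition completely_positive :: "nat \<Rightarrow> nat \<Rightarrow> (complex mat \<Rightarrow> complex mat) \<Rightarrow> bool" where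
  "completely_positive d d' \<Phi> \<longleftrightarrow>
     (\<forall>k X. psd (k * d) X \<longrightarrow> psd (k * d') (ampliation k d d' \<Phi> X))"

definition cptp :: "nat \<Rightarrow> nat \<Rightarrow> (complex mat \<Rightarrow> complex mat) \<Rightarrow> bool" where
  "cptp d d' \<Phi> \<longleftrightarrow>
     (\<forall>X \<in> carrier_mat d d. \<Phi> X \<in> carrier_mat d' d') \<and>
     (\<forall>X \<in> carrier_mat d d. \<forall>Y \<in> carrier_mat d d. \<Phi> (X + Y) = \<Phi> X + \<Phi> Y) \<and>
     (\<forall>c. \<forall>X \<in> carrier_mat d d. \<Phi> (c \<cdot>\<^sub>m X) = c \<cdot>\<^sub>m \<Phi> X) \<and>
     completely_positive d d' \<Phi> \<and>
     (\<forall>X \<in> carrier_mat d d. mtrace (\<Phi> X) = mtrace X)"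


section \<open>Tripartite systems\<close>

text \<open>A triple \<open>(dA, dB, dE)\<close> of dimensions stands for \<open>\<complex>\<^sup>d\<^sup>A \<otimes> \<complex>\<^sup>d\<^sup>B \<otimes> \<complex>\<^sup>d\<^sup>E\<close>; \<open>enc\<close> is the
  index of \<open>|a\<rangle> \<otimes> |b\<rangle> \<otimes> |e\<rangle>\<close> and \<open>dec\<close> its inverse.\<close>

type_synonym tri = "nat \<times> nat \<times> nat"

fun tdim :: "tri \<Rightarrow> nat" where
  "tdim (dA, dB, dE) = dA * dB * dE"

fun enc :: "tri \<Rightarrow> tri \<Rightarrow> nat" where
  "enc (dA, dB, dE) (a, b, e) = (a * dB + b) * dE + e"

fun dec :: "tri \<Rightarrow> nat \<Rightarrow> tri" where
  "dec (dA, dB, dE) x = (x div dE div dB, x div dE mod dB, x mod dE)"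

definition tmat :: "tri \<Rightarrow> (tri \<Rightarrow> tri \<Rightarrow> complex) \<Rightarrow> complex mat" where
  "tmat D f = mat (tdim D) (tdim D) (\<lambda>(x, y). f (dec D x) (dec D y))"

definition tent :: "tri \<Rightarrow> complex mat \<Rightarrow> tri \<Rightarrow> tri \<Rightarrow> complex" where
  "tent D X s t = X $$ (enc D s, enc D t)"

text \<open>\<open>\<Phi>\<^sub>A \<otimes> I\<^sub>B\<^sub>E\<close> and \<open>I\<^sub>A\<^sub>E \<otimes> \<Phi>\<^sub>B\<close> on operators on the system \<open>D\<close>; \<open>d'\<close> is the output dimension
  of \<open>\<Phi>\<close>.\<close>

fun local_A :: "tri \<Rightarrow> nat \<Rightarrow> (complex mat \<Rightarrow> complex mat) \<Rightarrow> complex mat \<Rightarrow> complex mat" where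
  "local_A (dA, dB, dE) d' \<Phi> X = tmat (d', dB, dE)
     (\<lambda>(a, b, e) (a', b', e').
        \<Phi> (mat dA dA (\<lambda>(x, x'). tent (dA, dB, dE) X (x, b, e) (x', b', e'))) $$ (a, a'))"

fun local_B :: "tri \<Rightarrow> nat \<Rightarrow> (complex mat \<Rightarrow> complex mat) \<Rightarrow> complex mat \<Rightarrow> complex mat" where
  "local_B (dA, dB, dE) d' \<Phi> X = tmat (dA, d', dE)
     (\<lambda>(a, b, e) (a', b', e').
        \<Phi> (mat dB dB (\<lambda>(y, y'). tent (dA, dB, dE) X (a, y, e) (a', y', e'))) $$ (b, b'))"

text \<open>
  Public communication from Alice to Bob.  Alice's space is \<open>\<complex>\<^sup>d\<^sup>A \<otimes> \<complex>\<^sup>m\<close>, whose second factor is the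
  register \<open>A'\<close>; Bob and Eve each receive a copy of it as a new last factor \<open>\<complex>\<^sup>m\<close>.  The map is
  \<open>X \<mapsto> \<Sum>\<^sub>i \<langle>i|X|i\<rangle>\<^sub>A\<^sub>' \<otimes> |iii\<rangle>\<langle>iii|\<close>, i.e. \<open>\<Sum>\<^sub>i \<rho>\<^sub>i \<otimes> |i\<rangle>\<langle>i| \<mapsto> \<Sum>\<^sub>i \<rho>\<^sub>i \<otimes> |iii\<rangle>\<langle>iii|\<close> for a
  classical register.  On other inputs it first measures \<open>A'\<close> in the computational basis, which is
  a local operation of Alice.
\<close>

fun public_AB :: "nat \<Rightarrow> tri \<Rightarrow> complex mat \<Rightarrow> complex mat" where
  "public_AB m (dA, dB, dE) X = tmat (dA * m, dB * m, dE * m)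
     (\<lambda>(a, b, e) (a', b', e').
        if \<forall>i \<in> {b, e, a', b', e'}. i mod m = a mod m
        then tent (dA * m, dB, dE) X (a, b div m, e div m) (a', b' div m, e' div m)
        else 0)"

fun public_BA :: "nat \<Rightarrow> tri \<Rightarrow> complex mat \<Rightarrow> complex mat" where
  "public_BA m (dA, dB, dE) X = tmat (dA * m, dB * m, dE * m)
     (\<lambda>(a, b, e) (a', b', e').
        if \<forall>i \<in> {a, e, a', b', e'}. i mod m = b mod m
        then tent (dA, dB * m, dE) X (a div m, b, e div m) (a' div m, b', e' div m)
        else 0)"

text \<open>\<open>lopc D D' \<Lambda>\<close>: \<open>\<Lambda>\<close> is an LOPC operation from the system \<open>D\<close> to the system \<open>D'\<close>.\<close>

inductive lopc :: "tri \<Rightarrow> tri \<Rightarrow> (complex mat \<Rightarrow> complex mat) \<Rightarrow> bool" for D :: tri where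
  none: "lopc D D (\<lambda>X. X)"
| local_A: "lopc D (dA, dB, dE) \<Lambda> \<Longrightarrow> cptp dA d' \<Phi> \<Longrightarrow>
    lopc D (d', dB, dE) (\<lambda>X. local_A (dA, dB, dE) d' \<Phi> (\<Lambda> X))"
| local_B: "lopc D (dA, dB, dE) \<Lambda> \<Longrightarrow> cptp dB d' \<Phi> \<Longrightarrow>
    lopc D (dA, d', dE) (\<lambda>X. local_B (dA, dB, dE) d' \<Phi> (\<Lambda> X))"
| public_AB: "lopc D (dA * m, dB, dE) \<Lambda> \<Longrightarrow>
    lopc D (dA * m, dB * m, dE * m) (\<lambda>X. public_AB m (dA, dB, dE) (\<Lambda> X))"
| public_BA: "lopc D (dA, dB * m, dE) \<Lambda> \<Longrightarrow>
    lopc D (dA * m, dB * m, dE * m) (\<lambda>X. public_BA m (dA, dB, dE) (\<Lambda> X))"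


section \<open>Key rate\<close>

text \<open>The \<open>n\<close>-fold tensor power of an operator on \<open>D\<close>, as an operator on
  \<open>\<H>\<^sub>A\<^sup>\<otimes>\<^sup>n \<otimes> \<H>\<^sub>B\<^sup>\<otimes>\<^sup>n \<otimes> \<H>\<^sub>E\<^sup>\<otimes>\<^sup>n\<close>: the basis vectors of \<open>(\<complex>\<^sup>d)\<^sup>\<otimes>\<^sup>n\<close> are numbered by their
  base-\<open>d\<close> digits.\<close>

definition digit :: "nat \<Rightarrow> nat \<Rightarrow> nat \<Rightarrow> nat" where
  "digit d k x = x div d ^ k mod d"

fun tpow :: "tri \<Rightarrow> nat \<Rightarrow> tri" where
  "tpow (dA, dB, dE) n = (dA ^ n, dB ^ n, dE ^ n)"

fun tdigit :: "tri \<Rightarrow> nat \<Rightarrow> tri \<Rightarrow> tri" where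
  "tdigit (dA, dB, dE) k (a, b, e) = (digit dA k a, digit dB k b, digit dE k e)"

definition tensor_power :: "tri \<Rightarrow> nat \<Rightarrow> complex mat \<Rightarrow> complex mat" where
  "tensor_power D n \<rho> =
     tmat (tpow D n) (\<lambda>s t. \<Prod>k<n. tent D \<rho> (tdigit D k s) (tdigit D k t))"

text \<open>\<open>2\<^sup>-\<^sup>l \<Sum>\<^sub>i |ii\<rangle>\<langle>ii| \<otimes> \<tau>\<close>, with \<open>i\<close> ranging over \<open>0, \<dots>, 2\<^sup>l - 1\<close>.\<close>

definition key_state :: "tri \<Rightarrow> nat \<Rightarrow> complex mat \<Rightarrow> complex mat" where
  "key_state D l \<tau> = tmat D
     (\<lambda>(a, b, e) (a', b', e').
        (\<Sum>i<2 ^ l. if a = i \<and> b = i \<and> a' = i \<and> b' = i then \<tau> $$ (e, e') else 0) / 2 ^ l)"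

text \<open>The family \<open>\<Lambda> n\<close>, with output systems \<open>D' n\<close>, is an LOPC protocol for the system \<open>D\<close>.\<close>

definition lopc_protocol ::
  "tri \<Rightarrow> (nat \<Rightarrow> tri) \<Rightarrow> (nat \<Rightarrow> complex mat \<Rightarrow> complex mat) \<Rightarrow> bool" where
  "lopc_protocol D D' \<Lambda> \<longleftrightarrow> (\<forall>n. lopc (tpow D n) (D' n) (\<Lambda> n))"

text \<open>The dimension bounds in the next definition say that Alice and Bob have room for the key,
  i.e. that \<open>key_state\<close> is a state.\<close>

definition distills_key ::
  "tri \<Rightarrow> complex mat \<Rightarrow> (nat \<Rightarrow> tri) \<Rightarrow> (nat \<Rightarrow> complex mat \<Rightarrow> complex mat) \<Rightarrow> ereal \<Rightarrow> bool" where
  "distills_key D \<rho> D' \<Lambda> R \<longleftrightarrow>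
     (\<exists>(l :: nat \<Rightarrow> nat) (\<tau> :: nat \<Rightarrow> complex mat).
        (\<forall>n. 2 ^ l n \<le> fst (D' n) \<and> 2 ^ l n \<le> fst (snd (D' n))) \<and>
        (\<forall>n. density_op (snd (snd (D' n))) (\<tau> n)) \<and>
        limsup (\<lambda>n. ereal (real (l n) / real n)) = R \<and>
        (\<lambda>n. trace_dist (\<Lambda> n (tensor_power D n \<rho>)) (key_state (D' n) (l n) (\<tau> n)))
           \<longlonglongrightarrow> 0)"

definition key_rate :: "tri \<Rightarrow> complex mat \<Rightarrow> ereal" where
  "key_rate D \<rho> = Sup {R. \<exists>D' \<Lambda>. lopc_protocol D D' \<Lambda> \<and> distills_key D \<rho> D' \<Lambda> R}"

end

theory Submission
  imports Defs "HOL-Analysis.L2_Norm"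
begin

text \<open>
  Run a protocol for \<open>\<rho>\<^sub>A\<^sub>B\<^sub>E\<close> on \<open>\<rho>\<^sub>A\<^sub>B\<^sub>E\<^sub>E\<^sub>'\<close>, ignoring \<open>E'\<close>.  Its output on \<open>ABE\<close> is close to \<open>l\<close> perfect key
  bits, and Alice and Bob restore secrecy against \<open>E'\<close> by hashing.  On \<open>E'\<^sup>n\<close> only the typical
  subspace matters, of rank \<open>r \<le> 2\<^sup>n\<^sup>(\<^sup>S\<^sup>+\<^sup>\<epsilon>\<^sup>)\<close>.  There \<open>\<sigma>\<^sub>E\<^sub>E\<^sub>' \<le> c (\<sigma>\<^sub>E \<otimes> 1)\<close>, with \<open>c = r\<close> for every state and
  \<open>c = 1\<close> if \<open>E'\<close> is classical, so the leftover hash lemma extracts \<open>l - log (r c)\<close> bits up to \<open>o(n)\<close>.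
  The state and the protocol are known, so one fixed hash function, found by averaging, suffices and
  no seed has to be communicated.
\<close>

section \<open>The spectral theorem\<close>

text \<open>The distance \<delta> of the given protocol's output from the ideal key tends to 0 at an
  uncontrolled speed, while all dimensions grow exponentially, so no error term may multiply
  \<delta> by a dimension. What closeness gives is an operator inequality: Eve's conditional states
  on E lie below \<tau> / L + D a, where L = 2^l and the traces of all D a add up to at most 2
  \<delta>. Before hashing they are replaced by states whose marginal on E lies below Q = (\<tau> +
  1 / e) / L, e being the dimension of E, at a price of order sqrt(2 \<delta> + \<eta>), where
  \<eta> is the atypical weight. The loss r c has two sources. The second moment is taken relative
  to Q \<otimes> 1 on the typical subspace, whose trace 2 r / L supplies r; comparing a state with
  its marginal supplies c. With r about 2^(n S) the loss is n S bits if c = 1 and 2 n S bits if c =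
  r. The test operator attaining the trace distance of the hashed state depends on the hash
  function. Hence the hashing bound has to be uniform over all contractions; it rests on one
  Hilbert-Schmidt estimate, which a single function can satisfy.\<close>

lemma mat_adjoint_dim [simp]:
  "dim_row (mat_adjoint A) = dim_col A" "dim_col (mat_adjoint A) = dim_row A"
  by (simp_all add: mat_adjoint_def)

lemma mat_adjoint_carrier [simp]: "A \<in> carrier_mat n m \<Longrightarrow> mat_adjoint A \<in> carrier_mat m n"
  by (intro carrier_matI) simp_all

lemma mat_adjoint_index [simp]:
  fixes A :: "complex mat"
  assumes "i < dim_col A" "j < dim_row A"
  shows "mat_adjoint A $$ (i, j) = cnj (A $$ (j, i))"
  using assms by (simp add: mat_adjoint_def mat_of_rows_index)

lemma mat_adjoint_mult:
  fixes A B :: "complex mat"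
  assumes "A \<in> carrier_mat n m" "B \<in> carrier_mat m k"
  shows "mat_adjoint (A * B) = mat_adjoint B * mat_adjoint A"
  using assms by (intro eq_matI) (auto simp: scalar_prod_def mult.commute intro!: sum.cong)

lemma mat_adjoint_adjoint: "mat_adjoint (mat_adjoint A) = (A :: complex mat)"
  by (intro eq_matI) auto

text \<open>The direct sum of a scalar and a matrix: the shape that a Hermitian matrix takes once an
  eigenvector has been rotated into the first basis vector.\<close>

definition corner_block :: "nat \<Rightarrow> complex \<Rightarrow> complex mat \<Rightarrow> complex mat" where
  "corner_block n a X = four_block_mat (mat 1 1 (\<lambda>_. a)) (0\<^sub>m 1 n) (0\<^sub>m n 1) X"

lemma corner_block_carrier:
  "X \<in> carrier_mat n n \<Longrightarrow> corner_block n a X \<in> carrier_mat (Suc n) (Suc n)"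
  unfolding corner_block_def
  by (metis One_nat_def four_block_carrier_mat mat_carrier plus_1_eq_Suc)

lemma corner_block_index:
  assumes "X \<in> carrier_mat n n" "i < Suc n" "j < Suc n"
  shows "corner_block n a X $$ (i, j) =
    (if i = 0 \<and> j = 0 then a else if i = 0 \<or> j = 0 then 0 else X $$ (i - 1, j - 1))"
  using assms by (auto simp: corner_block_def)

lemma corner_block_mult:
  assumes "X \<in> carrier_mat n n" "Y \<in> carrier_mat n n"
  shows "corner_block n a X * corner_block n b Y = corner_block n (a * b) (X * Y)"
proof -
  have "mat 1 1 (\<lambda>_. a) * mat 1 1 (\<lambda>_. b) = mat 1 1 (\<lambda>_. a * b)"
    by (intro eq_matI) (auto simp: scalar_prod_def)
  then show ?thesis unfolding corner_block_def
    apply (subst mult_four_block_mat[of _ 1 1 _ n _ n _ _ 1 _ n])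
    using assms by auto
qed

lemma corner_block_adjoint:
  assumes "X \<in> carrier_mat n n"
  shows "mat_adjoint (corner_block n a X) = corner_block n (cnj a) (mat_adjoint X)"
proof -
  have c: "corner_block n a X \<in> carrier_mat (Suc n) (Suc n)"
    "corner_block n (cnj a) (mat_adjoint X) \<in> carrier_mat (Suc n) (Suc n)"
    using assms by (simp_all add: corner_block_carrier)
  show ?thesis
  proof (intro eq_matI)
    fix i j assume "i < dim_row (corner_block n (cnj a) (mat_adjoint X))"
      "j < dim_col (corner_block n (cnj a) (mat_adjoint X))"
    then have ij: "i < Suc n" "j < Suc n" using c by auto
    then have "mat_adjoint (corner_block n a X) $$ (i, j) = cnj (corner_block n a X $$ (j, i))"
      using c by (intro mat_adjoint_index) auto
    also have "\<dots> = corner_block n (cnj a) (mat_adjoint X) $$ (i, j)"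
      unfolding corner_block_index[OF assms ij(2,1)]
        corner_block_index[OF mat_adjoint_carrier[OF assms] ij]
      using assms ij by auto
    finally show "mat_adjoint (corner_block n a X) $$ (i, j)
      = corner_block n (cnj a) (mat_adjoint X) $$ (i, j)" .
  qed (use c in auto)
qed

lemma corner_block_one: "corner_block n 1 (1\<^sub>m n) = 1\<^sub>m (Suc n)"
proof -
  have c: "corner_block n 1 (1\<^sub>m n) \<in> carrier_mat (Suc n) (Suc n)"
    by (simp add: corner_block_carrier)
  show ?thesis
  proof (intro eq_matI)
    fix i j assume "i < dim_row (1\<^sub>m (Suc n) :: complex mat)" "j < dim_col (1\<^sub>m (Suc n) :: complex mat)"
    then have ij: "i < Suc n" "j < Suc n" by auto
    then show "corner_block n 1 (1\<^sub>m n) $$ (i, j) = 1\<^sub>m (Suc n) $$ (i, j)"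
      unfolding corner_block_index[OF one_carrier_mat ij] by auto
  qed (use c in auto)
qed

text \<open>Gram-Schmidt never changes the first vector of its input, so applied to a basis that
  starts with \<open>v\<close> it keeps \<open>v\<close> in front.\<close>

lemma orthogonal_completion:
  fixes v :: "complex vec"
  assumes v: "v \<in> carrier_vec n" and v0: "v \<noteq> 0\<^sub>v n"
  shows "\<exists>us. length us = n \<and> us ! 0 = v \<and> set us \<subseteq> carrier_vec n \<and> corthogonal us"
proof -
  interpret cof_vec_space n "TYPE(complex)" .
  define us where "us = gram_schmidt n (basis_completion v)"
  note bc = basis_completion[OF v v0]
  note gs = gram_schmidt_result[OF bc(2) bc(4) bc(5) us_def]
  have len: "length us = n" using gs(4) bc(6) by simp
  have "n \<noteq> 0" using v v0 by (cases n) auto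
  then have ne: "us \<noteq> []" using len by auto
  obtain ws where ws: "basis_completion v = v # ws"
    by (simp add: basis_completion_def Let_def)
  have "hd us = v" unfolding us_def ws by (rule gram_schmidt_hd[OF v])
  then have "us ! 0 = v" using ne by (simp add: hd_conv_nth)
  then show ?thesis using len gs(2,3) by blast
qed

text \<open>Dividing the columns of an orthogonal completion by their lengths \<open>w\<close> makes
  the matrix unitary. Proportionality of the first column to \<open>v\<close> suffices for an
  eigenvector \<open>v\<close>, whose multiples satisfy the same eigenvalue equation.\<close>

lemma unitary_with_first_column:
  fixes v :: "complex vec"
  assumes v: "v \<in> carrier_vec n" and v0: "v \<noteq> 0\<^sub>v n"
  obtains U c where "U \<in> carrier_mat n n" "mat_adjoint U * U = 1\<^sub>m n" "col U 0 = c \<cdot>\<^sub>v v"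
proof -
  obtain us where len: "length us = n" and hd: "us ! 0 = v"
    and uc: "set us \<subseteq> carrier_vec n" and co: "corthogonal us"
    using orthogonal_completion[OF v v0] by blast
  have n0: "n > 0" using v v0 by (cases n) auto
  have us_c: "us ! i \<in> carrier_vec n" if "i < n" for i using uc len that by auto
  define w where "w i = sqrt (\<Sum>k<n. (cmod (us ! i $ k))\<^sup>2)" for i
  have sp: "us ! i \<bullet>c us ! j = (\<Sum>k<n. us ! i $ k * cnj (us ! j $ k))" if "i < n" "j < n" for i j
    using us_c[OF that(1)] us_c[OF that(2)] by (simp add: scalar_prod_def lessThan_atLeast0)
  have ww: "us ! i \<bullet>c us ! i = of_real ((w i)\<^sup>2)" if "i < n" for i
    unfolding sp[OF that that] w_def
    by (simp add: sum_nonneg complex_norm_square[symmetric])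
  have wpos: "w i \<noteq> 0" if "i < n" for i
    using ww[OF that] corthogonalD[OF co, of i i] len that by auto
  define U where "U = mat n n (\<lambda>(i, j). us ! j $ i / of_real (w j))"
  have U: "U \<in> carrier_mat n n" by (simp add: U_def)
  have "mat_adjoint U * U = 1\<^sub>m n"
  proof (intro eq_matI)
    fix i j assume "i < dim_row (1\<^sub>m n :: complex mat)" "j < dim_col (1\<^sub>m n :: complex mat)"
    then have ij: "i < n" "j < n" by auto
    have "(mat_adjoint U * U) $$ (i, j) = (\<Sum>k<n. cnj (us ! i $ k) / of_real (w i) * (us ! j $ k / of_real (w j)))"
      using ij U by (simp add: scalar_prod_def lessThan_atLeast0) (simp add: U_def)
    also have "\<dots> = (us ! j \<bullet>c us ! i) / (of_real (w i) * of_real (w j))"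
      unfolding sp[OF ij(2,1)] sum_divide_distrib by (intro sum.cong) auto
    also have "\<dots> = 1\<^sub>m n $$ (i, j)"
    proof (cases "i = j")
      case True
      then show ?thesis using ij wpos[of i] ww[of i] by (simp add: power2_eq_square)
    next
      case False
      then have "us ! j \<bullet>c us ! i = 0" using corthogonalD[OF co, of j i] len ij by auto
      then show ?thesis using False ij by simp
    qed
    finally show "(mat_adjoint U * U) $$ (i, j) = 1\<^sub>m n $$ (i, j)" .
  qed (use U in auto)
  moreover have "col U 0 = (1 / of_real (w 0)) \<cdot>\<^sub>v v"
    using n0 v hd by (intro eq_vecI) (auto simp: U_def)
  ultimately show ?thesis using that U by blast
qed

text \<open>Induction on the dimension by deflation: in a basis that starts with an eigenvector the
  matrix is a \<open>corner_block\<close>, and the remaining block is again Hermitian. The entries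
  of \<open>d\<close> are complex here; that they are real is extracted in
  \<open>hermitian_spectral\<close>.\<close>

theorem hermitian_spectral_mat:
  fixes A :: "complex mat"
  assumes "A \<in> carrier_mat n n" "mat_adjoint A = A"
  shows "\<exists>U d. U \<in> carrier_mat n n \<and> mat_adjoint U * U = 1\<^sub>m n \<and>
           A = U * mat_diag n d * mat_adjoint U"
  using assms
proof (induction n arbitrary: A)
  case 0
  then show ?case by (intro exI[of _ "1\<^sub>m 0"]) (auto intro!: eq_matI)
next
  case (Suc n)
  have A: "A \<in> carrier_mat (Suc n) (Suc n)" and H: "mat_adjoint A = A" by fact+
  obtain e where "e \<in> spectrum A" using spectrum_non_empty[OF A] by auto
  then obtain v where "eigenvector A v e" by (auto simp: spectrum_def eigenvalue_def)
  then have v: "v \<in> carrier_vec (Suc n)" "v \<noteq> 0\<^sub>v (Suc n)" "A *\<^sub>v v = e \<cdot>\<^sub>v v"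
    using A by (auto simp: eigenvector_def)
  obtain U c where U: "U \<in> carrier_mat (Suc n) (Suc n)" and UU: "mat_adjoint U * U = 1\<^sub>m (Suc n)"
    and col: "col U 0 = c \<cdot>\<^sub>v v" using unitary_with_first_column[OF v(1,2)] .
  define V where "V = mat_adjoint U"
  have V: "V \<in> carrier_mat (Suc n) (Suc n)" using U by (simp add: V_def)
  have VU: "V * U = 1\<^sub>m (Suc n)" using UU by (simp add: V_def)
  have UV: "U * V = 1\<^sub>m (Suc n)" using mat_mult_left_right_inverse[OF V U VU] .
  define A' where "A' = V * (A * U)"
  have A': "A' \<in> carrier_mat (Suc n) (Suc n)" using A U V by (simp add: A'_def)
  have H': "mat_adjoint A' = A'"
  proof -
    have "mat_adjoint A' = mat_adjoint (A * U) * U"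
      unfolding A'_def using A U V by (subst mat_adjoint_mult[of _ "Suc n" "Suc n" _ "Suc n"]) (auto simp: V_def mat_adjoint_adjoint)
    also have "mat_adjoint (A * U) = V * A"
      using A U H by (subst mat_adjoint_mult[of _ "Suc n" "Suc n" _ "Suc n"]) (auto simp: V_def)
    also have "V * A * U = A'" unfolding A'_def using A U V by (rule_tac assoc_mult_mat)
    finally show ?thesis .
  qed
  have c0: "A' $$ (i, 0) = (if i = 0 then e else 0)" if i: "i < Suc n" for i
  proof -
    have "A * U \<in> carrier_mat (Suc n) (Suc n)" using A U by simp
    then have "A' $$ (i, 0) = row V i \<bullet> col (A * U) 0"
      unfolding A'_def using V i by auto
    also have "col (A * U) 0 = A *\<^sub>v col U 0" using A U by (intro eq_vecI) auto
    also have "\<dots> = e \<cdot>\<^sub>v col U 0"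
      unfolding col using v A by (simp add: mult_mat_vec smult_smult_assoc mult.commute)
    also have "row V i \<bullet> (e \<cdot>\<^sub>v col U 0) = e * (row V i \<bullet> col U 0)"
      using U V i by (intro scalar_prod_smult_distrib[of _ "Suc n"]) (auto intro: row_carrier_vec col_carrier_vec)
    also have "row V i \<bullet> col U 0 = (V * U) $$ (i, 0)" using U V i by auto
    also have "\<dots> = (if i = 0 then 1 else 0)" using VU i by auto
    finally show ?thesis by simp
  qed
  \<comment> \<open>The first column vanishes below the corner because it comes from an eigenvector;
    Hermiticity transports this to the first row.\<close>
  have r0: "A' $$ (0, i) = (if i = 0 then e else 0)" if i: "i < Suc n" for i
  proof -
    have *: "A' $$ (0, i) = cnj (A' $$ (i, 0))"
      using mat_adjoint_index[of 0 A' i] A' i by (simp add: H')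
    show ?thesis
    proof (cases "i = 0")
      case True then show ?thesis using c0 by simp
    next
      case False then show ?thesis using * c0[OF i] by simp
    qed
  qed
  define B where "B = mat n n (\<lambda>(i, j). A' $$ (Suc i, Suc j))"
  have B: "B \<in> carrier_mat n n" by (simp add: B_def)
  have BH: "mat_adjoint B = B"
  proof (intro eq_matI)
    fix i j assume "i < dim_row B" "j < dim_col B"
    then show "mat_adjoint B $$ (i, j) = B $$ (i, j)"
      using mat_adjoint_index[of "Suc i" A' "Suc j"] A' B by (simp add: H') (simp add: B_def)
  qed (use B in auto)
  have A'B: "A' = corner_block n e B"
  proof (intro eq_matI)
    fix i j assume "i < dim_row (corner_block n e B)" "j < dim_col (corner_block n e B)"
    then have ij: "i < Suc n" "j < Suc n" using corner_block_carrier[OF B, of e] by auto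
    then show "A' $$ (i, j) = corner_block n e B $$ (i, j)"
      unfolding corner_block_index[OF B ij] using c0[of i] r0[of j] by (auto simp: B_def)
  qed (use A' corner_block_carrier[OF B, of e] in auto)
  obtain W d where W: "W \<in> carrier_mat n n" and WW: "mat_adjoint W * W = 1\<^sub>m n"
    and Bd: "B = W * mat_diag n d * mat_adjoint W" using Suc.IH[OF B BH] by blast
  define X where "X = U * corner_block n 1 W"
  define d' where "d' i = (case i of 0 \<Rightarrow> e | Suc i \<Rightarrow> d i)" for i
  have cW: "corner_block n 1 W \<in> carrier_mat (Suc n) (Suc n)"
    and cW': "corner_block n 1 (mat_adjoint W) \<in> carrier_mat (Suc n) (Suc n)"
    using corner_block_carrier W by auto
  have md: "mat_diag n d \<in> carrier_mat n n" "mat_diag (Suc n) d' \<in> carrier_mat (Suc n) (Suc n)" by auto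
  have X: "X \<in> carrier_mat (Suc n) (Suc n)" using U cW by (simp add: X_def)
  have aX: "mat_adjoint X = corner_block n 1 (mat_adjoint W) * V"
    unfolding X_def V_def using U cW W by (simp add: mat_adjoint_mult corner_block_adjoint)
  have dd: "mat_diag (Suc n) d' = corner_block n e (mat_diag n d)"
  proof (intro eq_matI)
    fix i j assume "i < dim_row (corner_block n e (mat_diag n d))" "j < dim_col (corner_block n e (mat_diag n d))"
    then have ij: "i < Suc n" "j < Suc n" using corner_block_carrier[OF md(1), of e] by auto
    then show "mat_diag (Suc n) d' $$ (i, j) = corner_block n e (mat_diag n d) $$ (i, j)"
      unfolding corner_block_index[OF md(1) ij]
      by (auto simp: mat_diag_def d'_def split: nat.splits)
  qed (use corner_block_carrier[OF md(1), of e] in \<open>auto simp: mat_diag_def\<close>)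
  have "mat_adjoint X * X = corner_block n 1 (mat_adjoint W) * (V * U) * corner_block n 1 W"
    unfolding aX unfolding X_def using cW cW' U V by (simp add: assoc_mult_mat[of _ "Suc n" "Suc n" _ "Suc n" _ "Suc n"])
  also have "\<dots> = 1\<^sub>m (Suc n)"
    using VU cW cW' W WW by (simp add: corner_block_mult corner_block_one)
  finally have XX: "mat_adjoint X * X = 1\<^sub>m (Suc n)" .
  have "X * mat_diag (Suc n) d' * mat_adjoint X =
      U * (corner_block n 1 W * corner_block n e (mat_diag n d) * corner_block n 1 (mat_adjoint W)) * V"
    unfolding aX dd unfolding X_def using cW cW' U V corner_block_carrier[OF md(1), of e]
    by (simp add: assoc_mult_mat[of _ "Suc n" "Suc n" _ "Suc n" _ "Suc n"])
  also have "\<dots> = U * A' * V"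
    unfolding A'B Bd using W md by (simp add: corner_block_mult)
  also have "\<dots> = (U * V) * A * (U * V)"
    unfolding A'_def using U V A
    by (simp add: assoc_mult_mat[of _ "Suc n" "Suc n" _ "Suc n" _ "Suc n"])
  also have "\<dots> = A" unfolding UV using A by simp
  finally show ?case using X XX by metis
qed

section \<open>Positive forms and contractions\<close>

text \<open>Positivity is stated for a form on an arbitrary index set rather than for a matrix,
  because the basis labels change constantly between numbers, pairs and triples.\<close>

definition posf :: "'i set \<Rightarrow> ('i \<Rightarrow> 'i \<Rightarrow> complex) \<Rightarrow> bool" where
  "posf I f \<longleftrightarrow> (\<forall>v. 0 \<le> (\<Sum>x\<in>I. \<Sum>y\<in>I. cnj (v x) * f x y * v y))"

definition nrm :: "'i set \<Rightarrow> ('i \<Rightarrow> complex) \<Rightarrow> real" where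
  "nrm I u = L2_set (\<lambda>x. cmod (u x)) I"

text \<open>Operator norm at most 1, written as a bound on the sesquilinear form: these are the test
  operators dual to the trace norm.\<close>

definition contraction :: "'i set \<Rightarrow> ('i \<Rightarrow> 'i \<Rightarrow> complex) \<Rightarrow> bool" where
  "contraction I W \<longleftrightarrow>
     (\<forall>u v. cmod (\<Sum>x\<in>I. \<Sum>y\<in>I. cnj (u x) * W x y * v y) \<le> nrm I u * nrm I v)"

text \<open>The conjugate sits on the first argument, opposite to \<open>\<bullet>c\<close>.\<close>

definition ip :: "nat \<Rightarrow> (nat \<Rightarrow> complex) \<Rightarrow> (nat \<Rightarrow> complex) \<Rightarrow> complex" where
  "ip n u v = (\<Sum>i<n. cnj (u i) * v i)"

definition ap :: "nat \<Rightarrow> (nat \<Rightarrow> nat \<Rightarrow> complex) \<Rightarrow> (nat \<Rightarrow> complex) \<Rightarrow> nat \<Rightarrow> complex" where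
  "ap n A v i = (\<Sum>j<n. A i j * v j)"

lemma nrm_nonneg [simp]: "0 \<le> nrm I u" by (simp add: nrm_def)

lemma nrm_sq: "(nrm I u)\<^sup>2 = (\<Sum>x\<in>I. (cmod (u x))\<^sup>2)"
  by (simp add: nrm_def L2_set_def sum_nonneg)

lemma cmod_ip_le: "cmod (\<Sum>x\<in>I. cnj (u x) * v x) \<le> nrm I u * nrm I v"
proof -
  have "cmod (\<Sum>x\<in>I. cnj (u x) * v x) \<le> (\<Sum>x\<in>I. \<bar>cmod (u x)\<bar> * \<bar>cmod (v x)\<bar>)"
    by (rule order_trans[OF norm_sum]) (simp add: norm_mult)
  also have "\<dots> \<le> nrm I u * nrm I v" unfolding nrm_def by (rule L2_set_mult_ineq)
  finally show ?thesis .
qed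

lemma cnj_mult_self: "cnj z * z = of_real ((cmod z)\<^sup>2)"
  using complex_norm_square[of z] by (simp add: mult.commute)

lemma ip_form: "(\<Sum>x<n. \<Sum>y<n. cnj (u x) * A x y * v y) = ip n u (ap n A v)"
  by (simp add: ip_def ap_def sum_distrib_left mult.assoc)

lemma ip_self: "ip n v v = of_real (\<Sum>i<n. (cmod (v i))\<^sup>2)"
  by (simp add: ip_def cnj_mult_self)

lemma posf_iff: "posf {..<n} A \<longleftrightarrow> (\<forall>v. 0 \<le> ip n v (ap n A v))"
  by (simp add: posf_def ip_form)

lemma posfD: "posf I f \<Longrightarrow> 0 \<le> (\<Sum>x\<in>I. \<Sum>y\<in>I. cnj (v x) * f x y * v y)"
  by (simp add: posf_def)

lemma contractionD:
  "contraction I W \<Longrightarrow> cmod (\<Sum>x\<in>I. \<Sum>y\<in>I. cnj (u x) * W x y * v y) \<le> nrm I u * nrm I v"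
  by (simp add: contraction_def)

lemma posf_cong: "(\<And>x y. x \<in> I \<Longrightarrow> y \<in> I \<Longrightarrow> f x y = g x y) \<Longrightarrow> posf I f = posf I g"
  unfolding posf_def by (intro arg_cong[where f = All] ext arg_cong2[where f = "(\<le>)"] sum.cong) auto

lemma posf_add:
  assumes "posf I f" "posf I g" shows "posf I (\<lambda>x y. f x y + g x y)"
  unfolding posf_def
proof
  fix v
  have "(\<Sum>x\<in>I. \<Sum>y\<in>I. cnj (v x) * (f x y + g x y) * v y)
      = (\<Sum>x\<in>I. \<Sum>y\<in>I. cnj (v x) * f x y * v y) + (\<Sum>x\<in>I. \<Sum>y\<in>I. cnj (v x) * g x y * v y)"
    by (simp add: algebra_simps sum.distrib)
  then show "0 \<le> (\<Sum>x\<in>I. \<Sum>y\<in>I. cnj (v x) * (f x y + g x y) * v y)"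
    using assms by (simp add: posf_def add_nonneg_nonneg)
qed

lemma posf_sum:
  assumes "\<And>a. a \<in> A \<Longrightarrow> posf I (f a)" shows "posf I (\<lambda>x y. \<Sum>a\<in>A. f a x y)"
  using assms
proof (induction A rule: infinite_finite_induct)
  case (insert a A)
  then show ?case using posf_add[of I "f a" "\<lambda>x y. \<Sum>a\<in>A. f a x y"] by simp
qed (simp_all add: posf_def)

lemma posf_conj_diag:
  assumes "posf I f" shows "posf I (\<lambda>x y. cnj (g x) * f x y * g y)"
  unfolding posf_def
proof
  fix v
  have "(\<Sum>x\<in>I. \<Sum>y\<in>I. cnj (v x) * (cnj (g x) * f x y * g y) * v y)
      = (\<Sum>x\<in>I. \<Sum>y\<in>I. cnj (g x * v x) * f x y * (g y * v y))"
    by (intro sum.cong refl) simp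
  then show "0 \<le> (\<Sum>x\<in>I. \<Sum>y\<in>I. cnj (v x) * (cnj (g x) * f x y * g y) * v y)"
    using posfD[OF assms, of "\<lambda>x. g x * v x"] by simp
qed

text \<open>The form at \<open>v\<close> equals the original form at the vector \<open>w\<close>
  that collects the values of \<open>v\<close> over each fibre of \<open>h\<close>; so
  \<open>h\<close> may identify indices.\<close>

lemma posf_pullback:
  assumes "posf I f" "finite J" "finite I" "h ` J \<subseteq> I"
  shows "posf J (\<lambda>x y. f (h x) (h y))"
  unfolding posf_def
proof
  fix v :: "'b \<Rightarrow> complex"
  define w where "w z = (\<Sum>x | x \<in> J \<and> h x = z. v x)" for z
  have g: "(\<Sum>z\<in>I. \<Sum>x | x \<in> J \<and> h x = z. F z x) = (\<Sum>x\<in>J. F (h x) x)" for F :: "_ \<Rightarrow> _ \<Rightarrow> complex"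
  proof -
    have "(\<Sum>z\<in>I. \<Sum>x | x \<in> J \<and> h x = z. F z x) = (\<Sum>z\<in>I. \<Sum>x | x \<in> J \<and> h x = z. F (h x) x)"
      by (intro sum.cong) auto
    also have "\<dots> = (\<Sum>x\<in>J. F (h x) x)" using assms by (intro sum.group) auto
    finally show ?thesis .
  qed
  have "(\<Sum>z\<in>I. \<Sum>z'\<in>I. cnj (w z) * f z z' * w z')
      = (\<Sum>z\<in>I. \<Sum>x | x \<in> J \<and> h x = z. cnj (v x) * (\<Sum>z'\<in>I. \<Sum>y | y \<in> J \<and> h y = z'. f z z' * v y))"
  proof (rule sum.cong[OF refl])
    fix z
    have "(\<Sum>z'\<in>I. cnj (w z) * f z z' * w z') = cnj (w z) * (\<Sum>z'\<in>I. f z z' * w z')"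
      by (simp add: sum_distrib_left mult.assoc)
    also have "\<dots> = (\<Sum>x | x \<in> J \<and> h x = z. cnj (v x) * (\<Sum>z'\<in>I. f z z' * w z'))"
      by (simp add: w_def sum_distrib_right)
    finally show "(\<Sum>z'\<in>I. cnj (w z) * f z z' * w z') =
      (\<Sum>x | x \<in> J \<and> h x = z. cnj (v x) * (\<Sum>z'\<in>I. \<Sum>y | y \<in> J \<and> h y = z'. f z z' * v y))"
      by (simp add: w_def sum_distrib_left)
  qed
  also have "\<dots> = (\<Sum>x\<in>J. \<Sum>y\<in>J. cnj (v x) * f (h x) (h y) * v y)"
    unfolding g by (simp add: sum_distrib_left mult.assoc)
  finally show "0 \<le> (\<Sum>x\<in>J. \<Sum>y\<in>J. cnj (v x) * f (h x) (h y) * v y)"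
    using posfD[OF assms(1), of w] by simp
qed

lemma posf_reindex:
  assumes "bij_betw h J I" "finite I"
  shows "posf J (\<lambda>x y. f (h x) (h y)) \<longleftrightarrow> posf I f"
proof
  have fJ: "finite J" using assms bij_betw_finite by blast
  show "posf I f \<Longrightarrow> posf J (\<lambda>x y. f (h x) (h y))"
    using posf_pullback[of I f J h] assms fJ by (simp add: bij_betw_def)
  assume a: "posf J (\<lambda>x y. f (h x) (h y))"
  have "posf I (\<lambda>x y. f (h (inv_into J h x)) (h (inv_into J h y)))"
    using posf_pullback[OF a, of I "inv_into J h"] assms fJ
    by (metis bij_betw_inv_into bij_betw_imp_surj_on subset_refl)
  then show "posf I f"
    using assms by (subst posf_cong[of I f "\<lambda>x y. f (h (inv_into J h x)) (h (inv_into J h y))"])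
      (auto simp: bij_betw_inv_into_right)
qed

lemma posf_gram: "posf I (\<lambda>x y. \<Sum>m\<in>M. g m x * cnj (g m y))"
proof (rule posf_sum)
  fix m
  show "posf I (\<lambda>x y. g m x * cnj (g m y))" unfolding posf_def
  proof
    fix v
    have "(\<Sum>x\<in>I. \<Sum>y\<in>I. cnj (v x) * (g m x * cnj (g m y)) * v y)
        = cnj (\<Sum>x\<in>I. cnj (g m x) * v x) * (\<Sum>x\<in>I. cnj (g m x) * v x)"
      unfolding cnj_sum sum_product by (intro sum.cong refl) simp
    also note cnj_mult_self
    finally show "0 \<le> (\<Sum>x\<in>I. \<Sum>y\<in>I. cnj (v x) * (g m x * cnj (g m y)) * v y)"
      by (simp only: less_eq_complex_def Re_complex_of_real Im_complex_of_real zero_complex.sel) simp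
  qed
qed

text \<open>The form is evaluated at the combination of two basis vectors with coefficients 1 and
  \<open>c\<close>. The values 0, 1 and \<i> of \<open>c\<close> yield nonnegative diagonal entries
  and Hermitian symmetry.\<close>

lemma posf_two:
  assumes "posf I f" "finite I" "x \<in> I" "y \<in> I"
  shows "0 \<le> f x x + c * f x y + cnj c * f y x + cnj c * c * f y y"
proof -
  define v where "v z = (if z = x then 1 else 0) + (if z = y then c else 0)" for z
  have i: "(\<Sum>z\<in>I. F z * v z) = F x + F y * c" for F
  proof -
    have "F z * v z = (if z = x then F z else 0) + (if z = y then F z * c else 0)" for z
      by (auto simp: v_def algebra_simps)
    then show ?thesis using assms(2-4) by (simp add: sum.distrib)
  qed
  have i': "(\<Sum>z\<in>I. cnj (v z) * F z) = F x + cnj c * F y" for F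
  proof -
    have "cnj (v z) * F z = (if z = x then F z else 0) + (if z = y then cnj c * F z else 0)" for z
      by (simp add: v_def algebra_simps)
    then show ?thesis using assms(2-4) by (simp add: sum.distrib)
  qed
  have "(\<Sum>a\<in>I. \<Sum>b\<in>I. cnj (v a) * f a b * v b) = (\<Sum>a\<in>I. cnj (v a) * (\<Sum>b\<in>I. f a b * v b))"
    by (simp add: sum_distrib_left mult.assoc)
  also have "\<dots> = f x x + c * f x y + cnj c * f y x + cnj c * c * f y y"
    unfolding i i' by (simp add: algebra_simps)
  finally show ?thesis using posfD[OF assms(1), of v] by simp
qed

lemma posf_diag: "posf I f \<Longrightarrow> finite I \<Longrightarrow> x \<in> I \<Longrightarrow> 0 \<le> f x x"
  using posf_two[of I f x x 0] by simp

lemma posf_hermitian: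
  assumes "posf I f" "finite I" "x \<in> I" "y \<in> I"
  shows "f x y = cnj (f y x)"
  using posf_two[OF assms, of 1] posf_two[OF assms, of \<i>]
    posf_diag[OF assms(1,2,3)] posf_diag[OF assms(1,2,4)]
  by (auto simp: complex_eq_iff less_eq_complex_def)

lemma contraction_subset:
  assumes "contraction I W" "finite I" "J \<subseteq> I" shows "contraction J W"
  unfolding contraction_def
proof (intro allI)
  fix u v :: "'a \<Rightarrow> complex"
  define u' v' where "u' x = (if x \<in> J then u x else 0)" and "v' x = (if x \<in> J then v x else 0)" for x
  have e: "(\<Sum>x\<in>I. if x \<in> J then F x else 0) = (\<Sum>x\<in>J. F x)" for F :: "_ \<Rightarrow> 'b::comm_monoid_add"
    using assms by (simp add: sum.If_cases Int_absorb1)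
  have n: "nrm I u' = nrm J u" "nrm I v' = nrm J v"
    unfolding nrm_def L2_set_def u'_def v'_def e[symmetric]
    by (auto intro!: sum.cong)
  have "(\<Sum>x\<in>I. \<Sum>y\<in>I. cnj (u' x) * W x y * v' y) =
     (\<Sum>x\<in>I. if x \<in> J then (\<Sum>y\<in>I. if y \<in> J then cnj (u x) * W x y * v y else 0) else 0)"
    by (intro sum.cong) (auto simp: u'_def v'_def intro!: sum.cong)
  then show "cmod (\<Sum>x\<in>J. \<Sum>y\<in>J. cnj (u x) * W x y * v y) \<le> nrm J u * nrm J v"
    using contractionD[OF assms(1), of u' v'] by (simp add: e n)
qed

text \<open>Injectivity makes this a relabelled submatrix; repeated indices could increase the
  norm.\<close>

lemma contraction_pullback:
  assumes "contraction I W" "finite I" "inj_on h J" "h ` J \<subseteq> I"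
  shows "contraction J (\<lambda>x y. W (h x) (h y))"
  unfolding contraction_def
proof (intro allI)
  fix u v :: "'b \<Rightarrow> complex"
  define u' v' where "u' = u \<circ> inv_into J h" and "v' = v \<circ> inv_into J h"
  have "contraction (h ` J) W" using contraction_subset assms by blast
  then have "cmod (\<Sum>x\<in>h ` J. \<Sum>y\<in>h ` J. cnj (u' x) * W x y * v' y) \<le> nrm (h ` J) u' * nrm (h ` J) v'"
    by (simp add: contraction_def)
  then show "cmod (\<Sum>x\<in>J. \<Sum>y\<in>J. cnj (u x) * W (h x) (h y) * v y) \<le> nrm J u * nrm J v"
    using assms(3) by (simp add: nrm_def L2_set_def sum.reindex u'_def v'_def)
qed

text \<open>The spectral theorem in terms of index functions. Each eigenvalue is the value of the
  form at a unit eigenvector, which Hermitian symmetry makes equal to its own conjugate.\<close>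

lemma hermitian_spectral:
  fixes A :: "nat \<Rightarrow> nat \<Rightarrow> complex"
  assumes H: "\<And>i j. i < n \<Longrightarrow> j < n \<Longrightarrow> A i j = cnj (A j i)"
  obtains u :: "nat \<Rightarrow> nat \<Rightarrow> complex" and d :: "nat \<Rightarrow> real" where
    "\<And>m k. m < n \<Longrightarrow> k < n \<Longrightarrow> ip n (u m) (u k) = (if m = k then 1 else 0)"
    "\<And>i j. i < n \<Longrightarrow> j < n \<Longrightarrow> (\<Sum>m<n. u m i * cnj (u m j)) = (if i = j then 1 else 0)"
    "\<And>i j. i < n \<Longrightarrow> j < n \<Longrightarrow> A i j = (\<Sum>m<n. of_real (d m) * u m i * cnj (u m j))"
proof -
  define M where "M = mat n n (\<lambda>(i, j). A i j)"
  have M: "M \<in> carrier_mat n n" by (simp add: M_def)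
  have MH: "mat_adjoint M = M"
  proof (intro eq_matI)
    fix i j assume "i < dim_row M" "j < dim_col M"
    then show "mat_adjoint M $$ (i, j) = M $$ (i, j)"
      using M H[of i j] by (simp add: M_def)
  qed (use M in auto)
  obtain U d where U: "U \<in> carrier_mat n n" and UU: "mat_adjoint U * U = 1\<^sub>m n"
    and MU: "M = U * mat_diag n d * mat_adjoint U"
    using hermitian_spectral_mat[OF M MH] by blast
  have UU': "U * mat_adjoint U = 1\<^sub>m n"
    using mat_mult_left_right_inverse[OF mat_adjoint_carrier[OF U] U UU] .
  define u where "u m i = U $$ (i, m)" for m i
  have 1: "ip n (u m) (u k) = (if m = k then 1 else 0)" if "m < n" "k < n" for m k
  proof -
    have "(mat_adjoint U * U) $$ (m, k) = ip n (u m) (u k)"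
      using U that by (simp add: scalar_prod_def ip_def u_def lessThan_atLeast0)
    then show ?thesis using that by (simp add: UU)
  qed
  have 2: "(\<Sum>m<n. u m i * cnj (u m j)) = (if i = j then 1 else 0)" if "i < n" "j < n" for i j
  proof -
    have "(U * mat_adjoint U) $$ (i, j) = (\<Sum>m<n. u m i * cnj (u m j))"
      using U that by (simp add: scalar_prod_def u_def lessThan_atLeast0)
    then show ?thesis using that by (simp add: UU')
  qed
  have UD: "(U * mat_diag n d) $$ (i, m) = U $$ (i, m) * d m" if "i < n" "m < n" for i m
    using that by (subst mat_diag_mult_right[OF U]) simp
  have 3: "A i j = (\<Sum>m<n. d m * u m i * cnj (u m j))" if "i < n" "j < n" for i j
  proof -
    define N where "N = U * mat_diag n d"
    have c: "N \<in> carrier_mat n n" using U by (simp add: N_def)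
    have "M $$ (i, j) = (\<Sum>m<n. N $$ (i, m) * cnj (U $$ (j, m)))"
      unfolding MU N_def[symmetric] using U c that by (simp add: scalar_prod_def lessThan_atLeast0)
    also have "\<dots> = (\<Sum>m<n. d m * u m i * cnj (u m j))"
      using UD that by (intro sum.cong) (auto simp: u_def N_def)
    finally show ?thesis using that by (simp add: M_def)
  qed
  have Au: "ap n A (u m) i = d m * u m i" if "m < n" "i < n" for m i
  proof -
    have "ap n A (u m) i = (\<Sum>j<n. \<Sum>k<n. d k * u k i * cnj (u k j) * u m j)"
      using that by (simp add: ap_def 3 sum_distrib_right)
    also have "\<dots> = (\<Sum>k<n. d k * u k i * ip n (u k) (u m))"
      by (subst sum.swap) (simp add: ip_def sum_distrib_left mult.assoc)
    also have "\<dots> = (\<Sum>k<n. if k = m then d k * u k i else 0)"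
      using that by (intro sum.cong) (auto simp: 1)
    also have "\<dots> = d m * u m i" using that by simp
    finally show ?thesis .
  qed
  have dreal: "d m = of_real (Re (d m))" if "m < n" for m
  proof -
    have s: "ip n (u m) (ap n A (u m)) = d m"
    proof -
      have "ip n (u m) (ap n A (u m)) = d m * ip n (u m) (u m)"
        using that by (simp add: ip_def Au sum_distrib_left algebra_simps)
      then show ?thesis using that by (simp add: 1)
    qed
    have "cnj (ip n (u m) (ap n A (u m))) = (\<Sum>i<n. \<Sum>j<n. u m i * cnj (A i j) * cnj (u m j))"
      by (simp add: ip_def ap_def sum_distrib_left mult.assoc)
    also have "\<dots> = (\<Sum>i<n. \<Sum>j<n. cnj (u m j) * A j i * u m i)"
      by (intro sum.cong refl) (simp, subst H, auto simp: mult_ac)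
    also have "\<dots> = ip n (u m) (ap n A (u m))"
      by (subst sum.swap) (simp add: ip_form)
    finally have "cnj (d m) = d m" by (simp add: s)
    then show ?thesis by (simp add: complex_eq_iff)
  qed
  show ?thesis
  proof (rule that[of u "\<lambda>m. Re (d m)"])
    show "A i j = (\<Sum>m<n. of_real (Re (d m)) * u m i * cnj (u m j))" if "i < n" "j < n" for i j
      unfolding 3[OF that] by (intro sum.cong refl arg_cong2[where f = "(*)"]) (use dreal in auto)
  qed (use 1 2 in auto)
qed

section \<open>Functional calculus in a fixed eigenbasis\<close>

definition onb :: "nat \<Rightarrow> (nat \<Rightarrow> nat \<Rightarrow> complex) \<Rightarrow> bool" where
  "onb n u \<longleftrightarrow> (\<forall>m<n. \<forall>k<n. ip n (u m) (u k) = (if m = k then 1 else 0)) \<and>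
     (\<forall>i<n. \<forall>j<n. (\<Sum>m<n. u m i * cnj (u m j)) = (if i = j then 1 else 0))"

text \<open>A function of an operator with eigenvectors \<open>u\<close>, where \<open>g\<close>
  lists the values on the spectrum. Square roots, signs, absolute values and inverses of one
  operator thus share \<open>u\<close> and multiply pointwise.\<close>

definition spectral_op :: "nat \<Rightarrow> (nat \<Rightarrow> nat \<Rightarrow> complex) \<Rightarrow> (nat \<Rightarrow> real) \<Rightarrow> nat \<Rightarrow> nat \<Rightarrow> complex" where
  "spectral_op n u g i j = (\<Sum>m<n. of_real (g m) * u m i * cnj (u m j))"

definition mm :: "nat \<Rightarrow> (nat \<Rightarrow> nat \<Rightarrow> complex) \<Rightarrow> (nat \<Rightarrow> nat \<Rightarrow> complex) \<Rightarrow> nat \<Rightarrow> nat \<Rightarrow> complex" where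
  "mm n A B i j = (\<Sum>k<n. A i k * B k j)"

lemma complex_of_real_nn_iff: "0 \<le> complex_of_real r \<longleftrightarrow> 0 \<le> r"
  by (simp add: less_eq_complex_def)

lemma spectral_onb:
  assumes "\<And>i j. i < n \<Longrightarrow> j < n \<Longrightarrow> A i j = cnj (A j i)"
  obtains u d where "onb n u" "\<And>i j. i < n \<Longrightarrow> j < n \<Longrightarrow> A i j = spectral_op n u d i j"
proof (rule hermitian_spectral[of n A, OF assms])
  fix u d
  assume "\<And>m k. m < n \<Longrightarrow> k < n \<Longrightarrow> ip n (u m) (u k) = (if m = k then 1 else 0)"
    "\<And>i j. i < n \<Longrightarrow> j < n \<Longrightarrow> (\<Sum>m<n. u m i * cnj (u m j)) = (if i = j then 1 else 0)"
    and A: "\<And>i j. i < n \<Longrightarrow> j < n \<Longrightarrow> A i j = (\<Sum>m<n. of_real (d m) * u m i * cnj (u m j))"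
  then have "onb n u" by (simp add: onb_def)
  then show thesis by (rule that) (simp add: A spectral_op_def)
qed

lemma ap_mm: "ap n (mm n A B) v i = ap n A (ap n B v) i"
  unfolding ap_def mm_def sum_distrib_left sum_distrib_right
  by (subst sum.swap) (simp add: mult.assoc)

lemma ap_cong:
  "(\<And>i j. i < n \<Longrightarrow> j < n \<Longrightarrow> A i j = B i j) \<Longrightarrow> (\<And>j. j < n \<Longrightarrow> v j = w j) \<Longrightarrow> i < n \<Longrightarrow>
    ap n A v i = ap n B w i"
  unfolding ap_def by (intro sum.cong) auto

lemma ip_cong:
  "(\<And>i. i < n \<Longrightarrow> u i = u' i) \<Longrightarrow> (\<And>i. i < n \<Longrightarrow> v i = v' i) \<Longrightarrow> ip n u v = ip n u' v'"
  unfolding ip_def by (intro sum.cong) auto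

lemma ip_ap_herm:
  assumes "\<And>i j. i < n \<Longrightarrow> j < n \<Longrightarrow> A i j = cnj (A j i)"
  shows "ip n u (ap n A v) = ip n (ap n A u) v"
proof -
  have "ip n u (ap n A v) = (\<Sum>j<n. \<Sum>i<n. cnj (u i) * A i j * v j)"
    unfolding ip_form[symmetric] by (rule sum.swap)
  also have "\<dots> = (\<Sum>j<n. \<Sum>i<n. cnj (A j i * u i) * v j)"
    by (intro sum.cong refl) (subst assms, auto)
  also have "\<dots> = ip n (ap n A u) v"
    by (simp add: ip_def ap_def sum_distrib_right)
  finally show ?thesis .
qed

lemma posf_herm: "posf {..<n :: nat} A \<Longrightarrow> i < n \<Longrightarrow> j < n \<Longrightarrow> A i j = cnj (A j i)"
  by (rule posf_hermitian[of "{..<n}"]) auto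

lemma ap_spectral_op: "ap n (spectral_op n u g) v i = (\<Sum>m<n. of_real (g m) * u m i * ip n (u m) v)"
  unfolding ap_def spectral_op_def sum_distrib_right ip_def sum_distrib_left
  by (subst sum.swap) (simp add: mult.assoc)

lemma ip_spectral_op: "ip n v (ap n (spectral_op n u g) w) = (\<Sum>m<n. of_real (g m) * cnj (ip n (u m) v) * ip n (u m) w)"
proof -
  have "ip n v (ap n (spectral_op n u g) w) = (\<Sum>i<n. \<Sum>m<n. cnj (v i) * (of_real (g m) * u m i * ip n (u m) w))"
    by (simp add: ip_def[of n v] ap_spectral_op sum_distrib_left)
  also have "\<dots> = (\<Sum>m<n. \<Sum>i<n. cnj (v i) * (of_real (g m) * u m i * ip n (u m) w))"
    by (rule sum.swap)
  also have "\<dots> = (\<Sum>m<n. of_real (g m) * cnj (ip n (u m) v) * ip n (u m) w)"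
    by (intro sum.cong refl)
      (simp add: ip_def[of n _ v] sum_distrib_left sum_distrib_right algebra_simps)
  finally show ?thesis .
qed

lemma spectral_op_herm: "spectral_op n u g i j = cnj (spectral_op n u g j i)"
  by (simp add: spectral_op_def mult_ac)

lemma spectral_op_mult:
  assumes "onb n u" shows "mm n (spectral_op n u g) (spectral_op n u h) i j = spectral_op n u (\<lambda>m. g m * h m) i j"
proof -
  have "mm n (spectral_op n u g) (spectral_op n u h) i j =
     (\<Sum>k<n. \<Sum>m<n. spectral_op n u g i k * (of_real (h m) * u m k * cnj (u m j)))"
    by (simp add: mm_def spectral_op_def[of n u h] sum_distrib_left)
  also have "\<dots> = (\<Sum>m<n. of_real (h m) * cnj (u m j) * ap n (spectral_op n u g) (u m) i)"
    by (subst sum.swap) (simp add: ap_def sum_distrib_left algebra_simps)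
  also have "\<dots> = (\<Sum>m<n. of_real (h m) * cnj (u m j) * (of_real (g m) * u m i))"
  proof (intro sum.cong refl arg_cong2[where f = "(*)"])
    fix m assume m: "m \<in> {..<n}"
    have "ap n (spectral_op n u g) (u m) i = (\<Sum>k<n. if k = m then of_real (g k) * u k i else 0)"
      unfolding ap_spectral_op using assms m by (intro sum.cong) (auto simp: onb_def)
    then show "ap n (spectral_op n u g) (u m) i = of_real (g m) * u m i" using m by simp
  qed
  finally show ?thesis by (simp add: spectral_op_def algebra_simps)
qed

lemma spectral_op_one:
  assumes "onb n u" "i < n" "j < n" shows "spectral_op n u (\<lambda>_. 1) i j = (if i = j then 1 else 0)"
  using assms by (auto simp: spectral_op_def onb_def)

lemma ap_one:
  assumes "onb n u" "i < n" shows "ap n (spectral_op n u (\<lambda>_. 1)) v i = v i"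
proof -
  have "ap n (spectral_op n u (\<lambda>_. 1)) v i = (\<Sum>j<n. if j = i then v j else 0)"
    unfolding ap_def using spectral_op_one[OF assms(1,2)] by (intro sum.cong) auto
  then show ?thesis using assms by simp
qed

lemma parseval:
  assumes "onb n u" shows "(\<Sum>m<n. (cmod (ip n (u m) v))\<^sup>2) = (\<Sum>i<n. (cmod (v i))\<^sup>2)"
proof -
  have "of_real (\<Sum>i<n. (cmod (v i))\<^sup>2) = ip n v (ap n (spectral_op n u (\<lambda>_. 1)) v)"
    unfolding ip_self[symmetric] by (intro ip_cong) (use ap_one[OF assms] in auto)
  also have "\<dots> = of_real (\<Sum>m<n. (cmod (ip n (u m) v))\<^sup>2)"
    unfolding ip_spectral_op by (simp add: cnj_mult_self)
  finally show ?thesis using of_real_eq_iff by (metis)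
qed

lemma spectral_op_form: "ip n v (ap n (spectral_op n u g) v) = of_real (\<Sum>m<n. g m * (cmod (ip n (u m) v))\<^sup>2)"
  unfolding ip_spectral_op by (simp add: mult.assoc cnj_mult_self)

lemma spectral_op_posf:
  assumes "\<And>m. m < n \<Longrightarrow> 0 \<le> g m" shows "posf {..<n} (spectral_op n u g)"
  unfolding posf_iff spectral_op_form complex_of_real_nn_iff using assms by (auto intro!: sum_nonneg)

lemma spectral_op_eigen:
  assumes "onb n u" "m < n" shows "ip n (u m) (ap n (spectral_op n u g) (u m)) = of_real (g m)"
proof -
  have "ip n (u m) (ap n (spectral_op n u g) (u m)) = (\<Sum>k<n. if k = m then of_real (g m) else 0)"
    unfolding ip_spectral_op using assms by (intro sum.cong) (auto simp: onb_def)
  then show ?thesis using assms by simp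
qed

lemma spectral_op_trace:
  assumes "onb n u" shows "(\<Sum>i<n. spectral_op n u g i i) = of_real (\<Sum>m<n. g m)"
proof -
  have "(\<Sum>i<n. spectral_op n u g i i) = (\<Sum>m<n. of_real (g m) * ip n (u m) (u m))"
    unfolding spectral_op_def by (subst sum.swap) (simp add: ip_def sum_distrib_left mult_ac)
  also have "\<dots> = of_real (\<Sum>m<n. g m)" using assms by (simp add: onb_def)
  finally show ?thesis .
qed

lemma posf_spectral:
  fixes A :: "nat \<Rightarrow> nat \<Rightarrow> complex"
  assumes "posf {..<n} A"
  obtains u d where "onb n u" "\<And>i j. i < n \<Longrightarrow> j < n \<Longrightarrow> A i j = spectral_op n u d i j"
    "\<And>m. m < n \<Longrightarrow> 0 \<le> d m"
proof -
  obtain u d where u: "onb n u" and A: "\<And>i j. i < n \<Longrightarrow> j < n \<Longrightarrow> A i j = spectral_op n u d i j"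
    by (rule spectral_onb[of n A]) (blast intro: posf_herm[OF assms])+
  have "0 \<le> d m" if "m < n" for m
  proof -
    have "ip n (u m) (ap n A (u m)) = ip n (u m) (ap n (spectral_op n u d) (u m))"
      using A by (intro ip_cong ap_cong) auto
    then have "ip n (u m) (ap n A (u m)) = of_real (d m)" using spectral_op_eigen[OF u that] by simp
    moreover have "0 \<le> ip n (u m) (ap n A (u m))" using assms by (simp add: posf_iff)
    ultimately show ?thesis by (simp add: complex_of_real_nn_iff)
  qed
  then show ?thesis using that u A by blast
qed

text \<open>The square roots of the eigenvalues are absorbed into the eigenvectors.\<close>

lemma posf_gram_ex:
  fixes A :: "nat \<Rightarrow> nat \<Rightarrow> complex"
  assumes "posf {..<n} A"
  shows "\<exists>x. \<forall>i<n. \<forall>j<n. A i j = (\<Sum>m<n. x m i * cnj (x m j))"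
proof -
  obtain u d where u: "onb n u" "\<And>i j. i < n \<Longrightarrow> j < n \<Longrightarrow> A i j = spectral_op n u d i j"
    "\<And>m. m < n \<Longrightarrow> 0 \<le> d m" using posf_spectral[OF assms] by blast
  have r: "of_real (sqrt (d m)) * of_real (sqrt (d m)) = (of_real (d m) :: complex)" if "m < n" for m
    using u(3)[OF that] unfolding of_real_mult[symmetric] by simp
  have *: "A i j = (\<Sum>m<n. (of_real (sqrt (d m)) * u m i) * cnj (of_real (sqrt (d m)) * u m j))" if "i < n" "j < n" for i j
    unfolding u(2)[OF that] spectral_op_def
  proof (intro sum.cong refl)
    fix m assume "m \<in> {..<n}"
    then have "m < n" by simp
    have "of_real (sqrt (d m)) * u m i * cnj (of_real (sqrt (d m)) * u m j) =
       (of_real (sqrt (d m)) * of_real (sqrt (d m))) * (u m i * cnj (u m j))" by simp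
    then show "of_real (d m) * u m i * cnj (u m j) = of_real (sqrt (d m)) * u m i * cnj (of_real (sqrt (d m)) * u m j)"
      unfolding r[OF \<open>m < n\<close>] by (simp only: mult.assoc)
  qed
  show ?thesis
    by (rule exI[of _ "\<lambda>m i. of_real (sqrt (d m)) * u m i"]) (intro allI impI *)
qed

section \<open>Square roots of positive operators\<close>

lemma posf_sqrt_ex:
  fixes A :: "nat \<Rightarrow> nat \<Rightarrow> complex"
  assumes "posf {..<n} A"
  shows "\<exists>S. posf {..<n} S \<and> (\<forall>i<n. \<forall>j<n. mm n S S i j = A i j)"
proof -
  obtain u d where u: "onb n u" "\<And>i j. i < n \<Longrightarrow> j < n \<Longrightarrow> A i j = spectral_op n u d i j"
    "\<And>m. m < n \<Longrightarrow> 0 \<le> d m" using posf_spectral[OF assms] by blast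
  have "mm n (spectral_op n u (\<lambda>m. sqrt (d m))) (spectral_op n u (\<lambda>m. sqrt (d m))) i j = spectral_op n u d i j" for i j
    unfolding spectral_op_mult[OF u(1)] using u(3) by (simp add: spectral_op_def)
  then show ?thesis using spectral_op_posf[of n "\<lambda>m. sqrt (d m)" u] u(2,3) by (intro exI[of _ "spectral_op n u (\<lambda>m. sqrt (d m))"]) auto
qed

text \<open>With \<open>A\<close> written as a Gram matrix of vectors \<open>x m\<close>, the trace
  of the product becomes a sum of values of the form \<open>B\<close>.\<close>

lemma trace_prod_nonneg:
  fixes A :: "nat \<Rightarrow> nat \<Rightarrow> complex"
  assumes "posf {..<n} A" "posf {..<n} B" shows "0 \<le> Re (\<Sum>i<n. \<Sum>j<n. A i j * B j i)"
proof -
  obtain x where x: "\<forall>i<n. \<forall>j<n. A i j = (\<Sum>m<n. x m i * cnj (x m j))"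
    using posf_gram_ex[OF assms(1)] by blast
  have "(\<Sum>i<n. \<Sum>j<n. A i j * B j i) = (\<Sum>i<n. \<Sum>j<n. \<Sum>m<n. cnj (x m j) * B j i * x m i)"
    using x by (intro sum.cong refl) (simp add: sum_distrib_left sum_distrib_right mult_ac)
  also have "\<dots> = (\<Sum>j<n. \<Sum>i<n. \<Sum>m<n. cnj (x m j) * B j i * x m i)" by (rule sum.swap)
  also have "\<dots> = (\<Sum>j<n. \<Sum>m<n. \<Sum>i<n. cnj (x m j) * B j i * x m i)"
    by (rule sum.cong[OF refl]) (rule sum.swap)
  also have "\<dots> = (\<Sum>m<n. \<Sum>j<n. \<Sum>i<n. cnj (x m j) * B j i * x m i)" by (rule sum.swap)
  also have "\<dots> = (\<Sum>m<n. ip n (x m) (ap n B (x m)))" by (simp add: ip_form)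
  finally show ?thesis using assms(2) unfolding posf_iff
    by (auto intro!: sum_nonneg simp: less_eq_complex_def)
qed

text \<open>The hypothesis on norms says A^2 \<le> B^2, so this is operator monotonicity of the
  square root. If B - A had a unit eigenvector v with eigenvalue d < 0, then A v = B v - d v would
  give |A v|^2 = |B v|^2 - 2 d <v, B v> + d^2 > |B v|^2.\<close>

lemma sqrt_monotone:
  fixes A :: "nat \<Rightarrow> nat \<Rightarrow> complex"
  assumes A: "posf {..<n} A" and B: "posf {..<n} B"
    and le: "\<And>v. (\<Sum>i<n. (cmod (ap n A v i))\<^sup>2) \<le> (\<Sum>i<n. (cmod (ap n B v i))\<^sup>2)"
  shows "posf {..<n} (\<lambda>i j. B i j - A i j)"
proof -
  define H where "H i j = B i j - A i j" for i j
  have Hh: "H i j = cnj (H j i)" if "i < n" "j < n" for i j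
    using posf_herm[OF A that] posf_herm[OF B that] by (simp add: H_def)
  obtain u d where u: "onb n u" and H: "\<And>i j. i < n \<Longrightarrow> j < n \<Longrightarrow> H i j = spectral_op n u d i j"
    by (rule spectral_onb[of n H]) (blast intro: Hh)+
  have "0 \<le> d m" if m: "m < n" for m
  proof (rule ccontr)
    assume neg: "\<not> 0 \<le> d m"
    define v where "v = u m"
    have Av: "ap n A v i = ap n B v i - of_real (d m) * v i" if i: "i < n" for i
    proof -
      have "ap n B v i - ap n A v i = ap n H v i"
        by (simp add: ap_def H_def algebra_simps sum_subtractf)
      also have "\<dots> = ap n (spectral_op n u d) v i" using H i by (intro ap_cong) auto
      also have "\<dots> = (\<Sum>k<n. if k = m then of_real (d m) * u m i else 0)"
        unfolding ap_spectral_op v_def using u m by (intro sum.cong) (auto simp: onb_def)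
      finally show ?thesis using m by (simp add: v_def algebra_simps)
    qed
    define r where "r i = Re (cnj (v i) * ap n B v i)" for i
    have sq: "(cmod (ap n A v i))\<^sup>2 = (cmod (ap n B v i))\<^sup>2 - 2 * d m * r i + (d m)\<^sup>2 * (cmod (v i))\<^sup>2"
      if "i < n" for i
      unfolding Av[OF that] cmod_power2 r_def by (simp add: power2_eq_square algebra_simps)
    have "Re (ip n v (ap n B v)) = (\<Sum>i<n. r i)" by (simp only: ip_def r_def Re_sum)
    then have "(\<Sum>i<n. (cmod (ap n A v i))\<^sup>2)
       = (\<Sum>i<n. (cmod (ap n B v i))\<^sup>2) - 2 * (d m * Re (ip n v (ap n B v))) + (d m)\<^sup>2 * (\<Sum>i<n. (cmod (v i))\<^sup>2)"
      by (simp add: sq sum.distrib sum_subtractf sum_distrib_left mult.assoc)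
    moreover have "(\<Sum>i<n. (cmod (v i))\<^sup>2) = 1"
    proof -
      have "complex_of_real (\<Sum>i<n. (cmod (v i))\<^sup>2) = 1"
        unfolding ip_self[symmetric] using u m by (simp add: v_def onb_def)
      then show ?thesis unfolding of_real_eq_1_iff .
    qed
    moreover have "0 \<le> Re (ip n v (ap n B v))"
      using B unfolding posf_iff less_eq_complex_def by simp
    moreover have "d m * Re (ip n v (ap n B v)) \<le> 0" using neg calculation(3)
      by (simp add: mult_nonpos_nonneg)
    moreover have "(d m)\<^sup>2 > 0" using neg by simp
    ultimately show False using le[of v] by (simp only: mult_1_right)
  qed
  then have "posf {..<n} (spectral_op n u d)" by (intro spectral_op_posf) auto
  then have "posf {..<n} H" using H by (subst posf_cong[of _ H "spectral_op n u d"]) auto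
  then show ?thesis by (simp add: H_def[abs_def])
qed

lemma posf_antisym:
  fixes A :: "nat \<Rightarrow> nat \<Rightarrow> complex"
  assumes "posf {..<n} (\<lambda>i j. B i j - A i j)" "posf {..<n} (\<lambda>i j. A i j - B i j)"
    and ij: "i < n" "j < n"
  shows "A i j = B i j"
proof -
  obtain u d where u: "onb n u" and H: "\<And>i j. i < n \<Longrightarrow> j < n \<Longrightarrow> B i j - A i j = spectral_op n u d i j"
    and d: "\<And>m. m < n \<Longrightarrow> 0 \<le> d m"
    using posf_spectral[OF assms(1)] by blast
  have "d m = 0" if m: "m < n" for m
  proof -
    have "0 \<le> ip n (u m) (ap n (\<lambda>i j. A i j - B i j) (u m))" using assms(2) by (simp add: posf_iff)
    also have "ip n (u m) (ap n (\<lambda>i j. A i j - B i j) (u m)) = ip n (u m) (ap n (\<lambda>i j. - spectral_op n u d i j) (u m))"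
      by (intro ip_cong ap_cong) (auto simp: H[symmetric])
    also have "\<dots> = - ip n (u m) (ap n (spectral_op n u d) (u m))" by (simp add: ip_def ap_def sum_negf)
    also have "\<dots> = - of_real (d m)" using spectral_op_eigen[OF u m] by simp
    finally show ?thesis using d[OF m] by (simp add: less_eq_complex_def)
  qed
  then have "spectral_op n u d i j = 0" by (simp add: spectral_op_def)
  then show ?thesis using H[OF ij] by simp
qed

lemma ap_norm_sq:
  fixes A :: "nat \<Rightarrow> nat \<Rightarrow> complex"
  assumes "posf {..<n} A"
  shows "of_real (\<Sum>i<n. (cmod (ap n A v i))\<^sup>2) = ip n v (ap n (mm n A A) v)"
proof -
  have "of_real (\<Sum>i<n. (cmod (ap n A v i))\<^sup>2) = ip n (ap n A v) (ap n A v)" by (simp add: ip_self)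
  also have "\<dots> = ip n v (ap n A (ap n A v))" 
    by (rule ip_ap_herm[symmetric]) (rule posf_herm[OF assms])
  finally show ?thesis by (simp add: ap_mm[abs_def])
qed

text \<open>Monotonicity in both directions. This uniqueness is what turns the definite description
  in \<open>mat_abs\<close> into a usable value.\<close>

lemma posf_sqrt_unique:
  fixes A :: "nat \<Rightarrow> nat \<Rightarrow> complex"
  assumes A: "posf {..<n} A" and B: "posf {..<n} B"
    and eq: "\<And>i j. i < n \<Longrightarrow> j < n \<Longrightarrow> mm n A A i j = mm n B B i j" and ij: "i < n" "j < n"
  shows "A i j = B i j"
proof (rule posf_antisym[OF _ _ ij])
  have "ip n v (ap n (mm n A A) v) = ip n v (ap n (mm n B B) v)" for v
    by (intro ip_cong ap_cong) (auto simp: eq)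
  then have "(\<Sum>i<n. (cmod (ap n A v i))\<^sup>2) = (\<Sum>i<n. (cmod (ap n B v i))\<^sup>2)" for v
    using ap_norm_sq[OF A, of v] ap_norm_sq[OF B, of v] by (simp only: of_real_eq_iff[symmetric, where 'a = complex])
  then show "posf {..<n} (\<lambda>i j. B i j - A i j)" "posf {..<n} (\<lambda>i j. A i j - B i j)"
    by (intro sqrt_monotone A B; simp)+
qed

lemma spectral_op_contraction:
  assumes u: "onb n u" and g: "\<And>m. m < n \<Longrightarrow> \<bar>g m\<bar> \<le> 1"
  shows "contraction {..<n} (spectral_op n u g)"
  unfolding contraction_def
proof (intro allI)
  fix a b :: "nat \<Rightarrow> complex"
  have "cmod (ip n a (ap n (spectral_op n u g) b)) \<le> (\<Sum>m<n. cmod (of_real (g m) * cnj (ip n (u m) a) * ip n (u m) b))"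
    unfolding ip_spectral_op by (rule norm_sum)
  also have "\<dots> \<le> (\<Sum>m<n. \<bar>cmod (ip n (u m) a)\<bar> * \<bar>cmod (ip n (u m) b)\<bar>)"
    using g by (intro sum_mono) (auto simp: norm_mult mult.assoc intro!: mult_left_le_one_le)
  also have "\<dots> \<le> L2_set (\<lambda>m. cmod (ip n (u m) a)) {..<n} * L2_set (\<lambda>m. cmod (ip n (u m) b)) {..<n}"
    by (rule L2_set_mult_ineq)
  also have "\<dots> = nrm {..<n} a * nrm {..<n} b"
    unfolding nrm_def L2_set_def by (simp add: parseval[OF u])
  finally show "cmod (\<Sum>x<n. \<Sum>y<n. cnj (a x) * spectral_op n u g x y * b y) \<le> nrm {..<n} a * nrm {..<n} b"
    by (simp add: ip_form)
qed

section \<open>Trace distance\<close>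

lemma psd_iff: "psd d X \<longleftrightarrow> X \<in> carrier_mat d d \<and> posf {..<d} (\<lambda>i j. X $$ (i, j))"
proof (cases "X \<in> carrier_mat d d")
  case True
  have e: "(X *\<^sub>v vec d v) \<bullet>c vec d v = ip d v (ap d (\<lambda>i j. X $$ (i, j)) v)" for v
    using True by (simp add: scalar_prod_def ip_def ap_def lessThan_atLeast0 mult.commute)
  have "(\<forall>w \<in> carrier_vec d. 0 \<le> (X *\<^sub>v w) \<bullet>c w) \<longleftrightarrow> (\<forall>v. 0 \<le> (X *\<^sub>v vec d v) \<bullet>c vec d v)"
  proof (intro iffI allI ballI)
    fix w :: "complex vec"
    assume a: "\<forall>v. 0 \<le> (X *\<^sub>v vec d v) \<bullet>c vec d v" and w: "w \<in> carrier_vec d"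
    have "vec d (\<lambda>i. w $ i) = w" using w by (intro eq_vecI) auto
    then show "0 \<le> (X *\<^sub>v w) \<bullet>c w" using a[rule_format, of "\<lambda>i. w $ i"] by simp
  qed simp
  then show ?thesis using True by (simp add: psd_def posf_iff e)
qed (simp add: psd_def)

lemma mat_abs_eq:
  assumes M: "psd n M" and X: "X \<in> carrier_mat n n" and e: "M * M = mat_adjoint X * X"
  shows "mat_abs X = M"
  unfolding mat_abs_def
proof (rule the_equality)
  show "psd (dim_col X) M \<and> M * M = mat_adjoint X * X" using M X e by simp
next
  fix P assume "psd (dim_col X) P \<and> P * P = mat_adjoint X * X"
  then have P: "psd n P" and PP: "P * P = M * M" using X e by auto
  have c: "P \<in> carrier_mat n n" "M \<in> carrier_mat n n" using P M by (auto simp: psd_iff)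
  have sq: "(Y * Y) $$ (i, j) = mm n (\<lambda>i j. Y $$ (i, j)) (\<lambda>i j. Y $$ (i, j)) i j"
    if "Y \<in> carrier_mat n n" "i < n" "j < n" for Y :: "complex mat" and i j
    using that by (simp add: scalar_prod_def mm_def lessThan_atLeast0)
  show "P = M"
  proof (intro eq_matI)
    fix i j assume "i < dim_row M" "j < dim_col M"
    then have ij: "i < n" "j < n" using c by auto
    show "P $$ (i, j) = M $$ (i, j)"
    proof (rule posf_sqrt_unique[of n "\<lambda>i j. P $$ (i, j)" "\<lambda>i j. M $$ (i, j)", OF _ _ _ ij])
      show "posf {..<n} (\<lambda>i j. P $$ (i, j))" "posf {..<n} (\<lambda>i j. M $$ (i, j))"
        using P M by (simp_all add: psd_iff)
      show "mm n (\<lambda>i j. P $$ (i, j)) (\<lambda>i j. P $$ (i, j)) k l = mm n (\<lambda>i j. M $$ (i, j)) (\<lambda>i j. M $$ (i, j)) k l"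
        if "k < n" "l < n" for k l
        by (simp only: sq[OF c(1) that, symmetric] sq[OF c(2) that, symmetric] PP)
    qed
  qed (use c in auto)
qed

text \<open>The witnesses are |P - Q| and sgn (P - Q) in a common eigenbasis. \<open>D\<close>
  serves when closeness is given: it dominates P - Q and has small trace. \<open>W\<close> serves
  when closeness is to be shown: the distance is then one value of a contraction, and bounds uniform
  over contractions apply.\<close>

lemma trace_dist_witness:
  assumes P: "P \<in> carrier_mat n n" and Q: "Q \<in> carrier_mat n n"
    and HP: "\<And>i j. i < n \<Longrightarrow> j < n \<Longrightarrow> P $$ (i, j) = cnj (P $$ (j, i))"
    and HQ: "\<And>i j. i < n \<Longrightarrow> j < n \<Longrightarrow> Q $$ (i, j) = cnj (Q $$ (j, i))"
  shows "\<exists>D W. posf {..<n} D \<and> posf {..<n} (\<lambda>i j. D i j - (P $$ (i, j) - Q $$ (i, j))) \<and>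
     Re (\<Sum>i<n. D i i) = 2 * trace_dist P Q \<and> contraction {..<n} W \<and>
     2 * trace_dist P Q = Re (\<Sum>i<n. \<Sum>j<n. W i j * (P $$ (j, i) - Q $$ (j, i)))"
proof -
  define A where "A i j = P $$ (i, j) - Q $$ (i, j)" for i j
  have AH: "A i j = cnj (A j i)" if "i < n" "j < n" for i j
    using HP[OF that] HQ[OF that] by (simp add: A_def)
  obtain u d where u: "onb n u" and Au: "\<And>i j. i < n \<Longrightarrow> j < n \<Longrightarrow> A i j = spectral_op n u d i j"
    by (rule spectral_onb[of n A]) (blast intro: AH)+
  define D where "D = spectral_op n u (\<lambda>m. \<bar>d m\<bar>)"
  define W where "W = spectral_op n u (\<lambda>m. sgn (d m))"
  define M where "M = mat n n (\<lambda>(i, j). D i j)"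
  have D: "posf {..<n} D" unfolding D_def by (rule spectral_op_posf) simp
  have Mc: "M \<in> carrier_mat n n" by (simp add: M_def)
  have "posf {..<n} (\<lambda>i j. M $$ (i, j)) = posf {..<n} D"
    by (rule posf_cong) (simp add: M_def)
  then have Mp: "psd n M" using D Mc by (simp add: psd_iff)
  have X: "P - Q \<in> carrier_mat n n" using Q by (rule minus_carrier_mat)
  have "M * M = mat_adjoint (P - Q) * (P - Q)"
  proof (intro eq_matI)
    fix i j assume "i < dim_row (mat_adjoint (P - Q) * (P - Q))" "j < dim_col (mat_adjoint (P - Q) * (P - Q))"
    then have ij: "i < n" "j < n" using X by auto
    have "(M * M) $$ (i, j) = mm n D D i j"
      using ij by (simp add: M_def scalar_prod_def mm_def lessThan_atLeast0)
    also have "\<dots> = spectral_op n u (\<lambda>m. d m * d m) i j"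
      unfolding D_def spectral_op_mult[OF u] by simp
    also have "\<dots> = mm n (spectral_op n u d) (spectral_op n u d) i j" unfolding spectral_op_mult[OF u] ..
    also have "\<dots> = (\<Sum>k<n. cnj (A k i) * A k j)"
      unfolding mm_def using ij by (intro sum.cong) (auto simp: Au spectral_op_herm[of n u d i])
    also have "\<dots> = (mat_adjoint (P - Q) * (P - Q)) $$ (i, j)"
      using ij P Q X by (simp add: scalar_prod_def lessThan_atLeast0 A_def)
    finally show "(M * M) $$ (i, j) = (mat_adjoint (P - Q) * (P - Q)) $$ (i, j)" .
  qed (use Mc X in auto)
  then have ab: "mat_abs (P - Q) = M" by (rule mat_abs_eq[OF Mp X])
  have td: "2 * trace_dist P Q = Re (\<Sum>i<n. D i i)"
    using Mc by (simp add: trace_dist_def ab mtrace_def M_def)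
  have "posf {..<n} (spectral_op n u (\<lambda>m. \<bar>d m\<bar> - d m))" by (rule spectral_op_posf) simp
  moreover have "posf {..<n} (\<lambda>i j. D i j - A i j) = posf {..<n} (spectral_op n u (\<lambda>m. \<bar>d m\<bar> - d m))"
    by (rule posf_cong) (simp add: D_def Au spectral_op_def algebra_simps sum_subtractf)
  ultimately have 1: "posf {..<n} (\<lambda>i j. D i j - A i j)" by simp
  have 2: "contraction {..<n} W" unfolding W_def by (rule spectral_op_contraction[OF u]) (simp add: sgn_if)
  have "(\<Sum>i<n. \<Sum>j<n. W i j * A j i) = (\<Sum>i<n. mm n W (spectral_op n u d) i i)"
    unfolding mm_def using Au by (intro sum.cong refl) auto
  also have "\<dots> = (\<Sum>i<n. D i i)"
    unfolding W_def D_def spectral_op_mult[OF u] by (simp add: abs_sgn mult.commute)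
  finally have 3: "2 * trace_dist P Q = Re (\<Sum>i<n. \<Sum>j<n. W i j * A j i)" using td by simp
  show ?thesis using D 1 2 3 td unfolding A_def by (intro exI[of _ D] exI[of _ W]) auto
qed

section \<open>Smoothing\<close>

lemma ap_spectral_op_spectral_op:
  assumes "onb n u" shows "ap n (spectral_op n u g) (ap n (spectral_op n u h) v) = ap n (spectral_op n u (\<lambda>m. g m * h m)) v"
proof
  fix i
  have "ap n (spectral_op n u g) (ap n (spectral_op n u h) v) i = ap n (mm n (spectral_op n u g) (spectral_op n u h)) v i"
    by (rule ap_mm[symmetric])
  also have "\<dots> = ap n (spectral_op n u (\<lambda>m. g m * h m)) v i"
    by (simp add: ap_def spectral_op_mult[OF assms])
  finally show "ap n (spectral_op n u g) (ap n (spectral_op n u h) v) i = ap n (spectral_op n u (\<lambda>m. g m * h m)) v i" .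
qed

lemma ip_ap_spectral_op: "ip n (ap n (spectral_op n u g) v) w = ip n v (ap n (spectral_op n u g) w)"
  by (rule ip_ap_herm[symmetric]) (rule spectral_op_herm)

lemma gram_form:
  "ip n w (ap n (\<lambda>i j. \<Sum>m\<in>M. x m i * cnj (x m j)) w) = of_real (\<Sum>m\<in>M. (cmod (ip n w (x m)))\<^sup>2)"
proof -
  have "ip n w (ap n (\<lambda>i j. \<Sum>m\<in>M. x m i * cnj (x m j)) w)
      = (\<Sum>i<n. \<Sum>j<n. \<Sum>m\<in>M. cnj (w i) * x m i * (cnj (x m j) * w j))"
    unfolding ip_form[symmetric]
    by (simp add: sum_distrib_left sum_distrib_right mult.assoc)
  also have "\<dots> = (\<Sum>i<n. \<Sum>m\<in>M. \<Sum>j<n. cnj (w i) * x m i * (cnj (x m j) * w j))"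
    by (rule sum.cong[OF refl]) (rule sum.swap)
  also have "\<dots> = (\<Sum>m\<in>M. \<Sum>i<n. \<Sum>j<n. cnj (w i) * x m i * (cnj (x m j) * w j))"
    by (rule sum.swap)
  also have "\<dots> = (\<Sum>m\<in>M. ip n w (x m) * cnj (ip n w (x m)))"
  proof (rule sum.cong[OF refl])
    fix m
    have c: "cnj (ip n w (x m)) = (\<Sum>j<n. cnj (x m j) * w j)" by (simp add: ip_def mult.commute)
    show "(\<Sum>i<n. \<Sum>j<n. cnj (w i) * x m i * (cnj (x m j) * w j)) = ip n w (x m) * cnj (ip n w (x m))"
      by (simp only: c) (simp only: ip_def sum_product)
  qed
  also have "\<dots> = of_real (\<Sum>m\<in>M. (cmod (ip n w (x m)))\<^sup>2)"
    by (simp only: of_real_sum complex_norm_square)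
  finally show ?thesis .
qed

lemma form_diff:
  "ip n w (ap n (\<lambda>i j. A i j - B i j) w) = ip n w (ap n A w) - ip n w (ap n B w)"
  by (simp add: ip_def ap_def sum_subtractf algebra_simps)

lemma form_add:
  "ip n w (ap n (\<lambda>i j. A i j + B i j) w) = ip n w (ap n A w) + ip n w (ap n B w)"
  by (simp add: ip_def ap_def sum.distrib algebra_simps)

lemma gram_le:
  assumes "posf {..<n} (\<lambda>i j. R i j - (\<Sum>m\<in>M. x m i * cnj (x m j)))"
  shows "(\<Sum>m\<in>M. (cmod (ip n w (x m)))\<^sup>2) \<le> Re (ip n w (ap n R w))"
proof -
  have "0 \<le> ip n w (ap n R w) - of_real (\<Sum>m\<in>M. (cmod (ip n w (x m)))\<^sup>2)"
    using assms unfolding posf_iff form_diff gram_form by blast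
  then show ?thesis by (simp add: less_eq_complex_def)
qed

text \<open>With \<open>R = Q + D\<close> and \<open>N = R\<^sup>-\<^sup>1\<^sup>/\<^sup>2\<close>, the operator \<open>G = Q\<^sup>1\<^sup>/\<^sup>2 R\<^sup>-\<^sup>1\<^sup>/\<^sup>2\<close> maps every \<open>P \<le> R\<close> to
  \<open>G P G\<^sup>\<dagger> \<le> Q\<close>.  It is close to the identity on \<open>P\<close>: \<open>Tr (1 - G) P (1 - G)\<^sup>\<dagger>\<close> is at most
  \<open>Tr (1 - G) R (1 - G)\<^sup>\<dagger> = Tr (R\<^sup>1\<^sup>/\<^sup>2 - Q\<^sup>1\<^sup>/\<^sup>2)\<^sup>2\<close>, to which the Powers-Stormer argument applies.\<close>

lemma smoothing:
  fixes Q S D :: "nat \<Rightarrow> nat \<Rightarrow> complex"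
  assumes S: "posf {..<n} S" and SS: "\<And>i j. i < n \<Longrightarrow> j < n \<Longrightarrow> mm n S S i j = Q i j"
    and D: "posf {..<n} D" and \<kappa>: "0 < \<kappa>"
    and Q\<kappa>: "\<And>v. \<kappa> * (\<Sum>i<n. (cmod (v i))\<^sup>2) \<le> Re (ip n v (ap n Q v))"
  shows "\<exists>N. (\<forall>i<n. \<forall>j<n. N i j = cnj (N j i)) \<and>
    (\<forall>v. (\<Sum>i<n. (cmod (ap n S (ap n N v) i))\<^sup>2) \<le> (\<Sum>i<n. (cmod (v i))\<^sup>2)) \<and>
    (\<forall>v. Re (ip n (ap n N v) (ap n (\<lambda>i j. Q i j + D i j) (ap n N v))) = (\<Sum>i<n. (cmod (v i))\<^sup>2)) \<and>
    (\<forall>(M :: 'm set) x. posf {..<n} (\<lambda>i j. Q i j + D i j - (\<Sum>m\<in>M. x m i * cnj (x m j))) \<longrightarrow>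
       (\<Sum>m\<in>M. \<Sum>i<n. (cmod (x m i - ap n S (ap n N (x m)) i))\<^sup>2) \<le> Re (\<Sum>i<n. D i i))"
proof -
  define R where "R i j = Q i j + D i j" for i j
  have Qf: "ip n v (ap n Q v) = of_real (\<Sum>i<n. (cmod (ap n S v i))\<^sup>2)" for v
    unfolding ap_norm_sq[OF S] by (intro ip_cong ap_cong) (auto simp: SS)
  have QR: "Re (ip n v (ap n Q v)) \<le> Re (ip n v (ap n R v))" for v
    unfolding R_def[abs_def] form_add using D[unfolded posf_iff, rule_format, of v]
    by (simp add: less_eq_complex_def)
  have Q: "posf {..<n} Q" unfolding posf_iff Qf complex_of_real_nn_iff by (auto intro: sum_nonneg)
  have R: "posf {..<n} R" unfolding R_def[abs_def] using posf_add[OF Q D] by simp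
  obtain u r where u: "onb n u" and Ru: "\<And>i j. i < n \<Longrightarrow> j < n \<Longrightarrow> R i j = spectral_op n u r i j"
    by (rule spectral_onb[of n R]) (blast intro: posf_herm[OF R])+
  have form_R: "ip n v (ap n R w) = ip n v (ap n (spectral_op n u r) w)" for v w
    by (intro ip_cong ap_cong) (auto simp: Ru)
  \<comment> \<open>The lower bound \<kappa> on Q passes to R = Q + D, so all eigenvalues of R are
    positive and R^(-1/2) exists.\<close>
  have rpos: "0 < r m" if m: "m < n" for m
  proof -
    have one: "(\<Sum>i<n. (cmod (u m i))\<^sup>2) = 1"
    proof -
      have "complex_of_real (\<Sum>i<n. (cmod (u m i))\<^sup>2) = 1"
        unfolding ip_self[symmetric] using u m by (simp add: onb_def)
      then show ?thesis unfolding of_real_eq_1_iff .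
    qed
    have "\<kappa> \<le> Re (ip n (u m) (ap n R (u m)))"
      using Q\<kappa>[of "u m"] QR[of "u m"] one by simp
    then show ?thesis using \<kappa> unfolding form_R spectral_op_eigen[OF u m] by simp
  qed
  \<comment> \<open>\<open>N\<close> is R^(-1/2) and \<open>T\<close> is R^(1/2). As
    \<open>S\<close> is Q^(1/2), the smoothing operator is G = S N, and S N T = S.\<close>
  define N where "N = spectral_op n u (\<lambda>m. 1 / sqrt (r m))"
  define T where "T = spectral_op n u (\<lambda>m. sqrt (r m))"
  have spectral_op_eq: "spectral_op n u g = spectral_op n u h" if "\<And>m. m < n \<Longrightarrow> g m = h m" for g h
    using that by (auto simp: spectral_op_def fun_eq_iff)
  have NRN: "ip n (ap n N v) (ap n R (ap n N v)) = of_real (\<Sum>i<n. (cmod (v i))\<^sup>2)" for v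
  proof -
    have "ip n (ap n N v) (ap n R (ap n N v)) = ip n v (ap n (spectral_op n u (\<lambda>m. 1 / sqrt (r m) * (r m * (1 / sqrt (r m))))) v)"
      by (simp only: form_R) (simp only: N_def ip_ap_spectral_op ap_spectral_op_spectral_op[OF u])
    also have "spectral_op n u (\<lambda>m. 1 / sqrt (r m) * (r m * (1 / sqrt (r m)))) = spectral_op n u (\<lambda>_. 1)"
      by (rule spectral_op_eq) (use rpos in \<open>fastforce simp: field_simps less_imp_le\<close>)
    also have "ip n v (ap n (spectral_op n u (\<lambda>_. 1)) v) = ip n v v"
      by (intro ip_cong) (auto simp: ap_one[OF u])
    finally show ?thesis by (simp only: ip_self)
  qed
  have T: "posf {..<n} T" unfolding T_def using rpos by (intro spectral_op_posf) (auto simp: less_imp_le)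
  have TT: "mm n T T i j = R i j" if "i < n" "j < n" for i j
  proof -
    have "mm n T T i j = spectral_op n u r i j" unfolding T_def spectral_op_mult[OF u]
      using rpos by (intro fun_cong[OF fun_cong[OF spectral_op_eq]]) (auto simp: less_imp_le)
    then show ?thesis using that by (simp add: Ru)
  qed
  have NT: "mm n N T i j = (if i = j then 1 else 0)" if "i < n" "j < n" for i j
  proof -
    have "spectral_op n u (\<lambda>m. 1 / sqrt (r m) * sqrt (r m)) = spectral_op n u (\<lambda>_. 1)"
      by (rule spectral_op_eq) (use rpos in fastforce)
    then show ?thesis unfolding N_def T_def spectral_op_mult[OF u] using spectral_op_one[OF u that] by simp
  qed
  have Tf: "ip n v (ap n R v) = of_real (\<Sum>i<n. (cmod (ap n T v i))\<^sup>2)" for v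
    unfolding ap_norm_sq[OF T] by (intro ip_cong ap_cong) (auto simp: TT)
  have ST: "posf {..<n} (\<lambda>i j. T i j - S i j)"
  proof (rule sqrt_monotone[OF S T])
    fix v show "(\<Sum>i<n. (cmod (ap n S v i))\<^sup>2) \<le> (\<Sum>i<n. (cmod (ap n T v i))\<^sup>2)"
      using QR[of v] unfolding Qf Tf by simp
  qed
  have herm_sq: "Re (\<Sum>i<n. mm n A A i i) = (\<Sum>i<n. \<Sum>k<n. (cmod (A i k))\<^sup>2)" if "posf {..<n} A" for A
  proof -
    have "A i k * A k i = of_real ((cmod (A i k))\<^sup>2)" if "i < n" "k < n" for i k
      unfolding complex_norm_square using posf_herm[OF \<open>posf {..<n} A\<close> that(2,1)] by simp
    then show ?thesis by (simp add: mm_def)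
  qed
  \<comment> \<open>Tr (T - S)^2 = Tr T^2 - Tr S^2 - 2 Tr S (T - S). The first two terms differ by
    Tr D, and the last trace is nonnegative since both of its factors are positive, T - S by
    monotonicity of the square root.\<close>
  have ps: "(\<Sum>i<n. \<Sum>k<n. (cmod (T i k - S i k))\<^sup>2) \<le> Re (\<Sum>i<n. D i i)"
  proof -
    have e: "(cmod (T i k - S i k))\<^sup>2 = (cmod (T i k))\<^sup>2 - (cmod (S i k))\<^sup>2 - 2 * Re (S i k * (T k i - S k i))"
      if "i < n" "k < n" for i k
      unfolding posf_herm[OF T that(2,1)] posf_herm[OF S that(2,1)] cmod_power2
      by (simp add: power2_eq_square algebra_simps)
    have "(\<Sum>i<n. \<Sum>k<n. (cmod (T i k - S i k))\<^sup>2)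
      = (\<Sum>i<n. \<Sum>k<n. (cmod (T i k))\<^sup>2 - (cmod (S i k))\<^sup>2 - 2 * Re (S i k * (T k i - S k i)))"
      by (intro sum.cong refl e) auto
    also have "\<dots> = (\<Sum>i<n. \<Sum>k<n. (cmod (T i k))\<^sup>2) - (\<Sum>i<n. \<Sum>k<n. (cmod (S i k))\<^sup>2)
       - 2 * Re (\<Sum>i<n. \<Sum>k<n. S i k * (T k i - S k i))"
      by (simp only: sum_subtractf sum_distrib_left Re_sum)
    also have "(\<Sum>i<n. \<Sum>k<n. (cmod (T i k))\<^sup>2) - (\<Sum>i<n. \<Sum>k<n. (cmod (S i k))\<^sup>2) = Re (\<Sum>i<n. D i i)"
      unfolding herm_sq[OF T, symmetric] herm_sq[OF S, symmetric]
      by (simp add: TT SS R_def sum.distrib)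
    finally show ?thesis using trace_prod_nonneg[OF S ST] by linarith
  qed
  have close: "(\<Sum>m\<in>M. \<Sum>i<n. (cmod (x m i - ap n S (ap n N (x m)) i))\<^sup>2) \<le> Re (\<Sum>i<n. D i i)"
    if P: "posf {..<n} (\<lambda>i j. R i j - (\<Sum>m\<in>M. x m i * cnj (x m j)))" for M :: "'m set" and x
  proof -
    \<comment> \<open>Conjugated rows of 1 - S N. The components of x - S N x are then the products
      \<open>ip n (w i) x\<close>, and T maps \<open>w i\<close> to a conjugated row of (1 - S N) T
      = T - S.\<close>
    define w where "w i k = cnj ((if i = k then 1 else 0) - mm n S N i k)" for i k
    have 1: "x m i - ap n S (ap n N (x m)) i = ip n (w i) (x m)" if "i < n" for m i
    proof -
      have "ip n (w i) (x m) = (\<Sum>k<n. (if i = k then x m k else 0) - mm n S N i k * x m k)"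
        unfolding ip_def w_def by (intro sum.cong) (auto simp: algebra_simps)
      also have "\<dots> = x m i - ap n (mm n S N) (x m) i"
        using that by (simp add: sum_subtractf ap_def)
      finally show ?thesis by (simp add: ap_mm)
    qed
    have 2: "ap n T (w i) k = cnj (T i k - S i k)" if "i < n" "k < n" for i k
    proof -
      have "ap n T (w i) k = (\<Sum>l<n. cnj (((if i = l then 1 else 0) - mm n S N i l) * T l k))"
        unfolding ap_def w_def using that
        by (intro sum.cong refl) (subst posf_herm[OF T], auto)
      also have "\<dots> = cnj (\<Sum>l<n. (if i = l then T l k else 0) - mm n S N i l * T l k)"
        unfolding cnj_sum by (intro sum.cong) (auto simp: algebra_simps)
      also have "(\<Sum>l<n. (if i = l then T l k else 0) - mm n S N i l * T l k) = T i k - mm n (mm n S N) T i k"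
        using that by (simp add: sum_subtractf mm_def)
      also have "mm n (mm n S N) T i k = ap n (mm n S N) (\<lambda>l. T l k) i" by (simp add: ap_def mm_def)
      also have "\<dots> = ap n S (ap n N (\<lambda>l. T l k)) i" by (rule ap_mm)
      also have "\<dots> = (\<Sum>l<n. S i l * mm n N T l k)" by (simp add: ap_def mm_def)
      also have "\<dots> = (\<Sum>l<n. if l = k then S i l else 0)"
        using that by (intro sum.cong) (auto simp: NT)
      also have "\<dots> = S i k" using that by simp
      finally show ?thesis .
    qed
    have "(\<Sum>m\<in>M. \<Sum>i<n. (cmod (x m i - ap n S (ap n N (x m)) i))\<^sup>2) = (\<Sum>i<n. \<Sum>m\<in>M. (cmod (ip n (w i) (x m)))\<^sup>2)"
      by (subst sum.swap) (simp add: 1)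
    also have "\<dots> \<le> (\<Sum>i<n. Re (ip n (w i) (ap n R (w i))))"
      by (intro sum_mono gram_le[OF P])
    also have "\<dots> = (\<Sum>i<n. \<Sum>k<n. (cmod (T i k - S i k))\<^sup>2)"
      by (simp add: Tf 2 flip: complex_cnj_diff)
    also note ps
    finally show ?thesis .
  qed
  have contr: "(\<Sum>i<n. (cmod (ap n S (ap n N v) i))\<^sup>2) \<le> (\<Sum>i<n. (cmod (v i))\<^sup>2)" for v
    using QR[of "ap n N v"] unfolding Qf NRN by simp
  have Nh: "N i j = cnj (N j i)" for i j unfolding N_def by (rule spectral_op_herm)
  show ?thesis
    unfolding R_def[symmetric]
    by (rule exI[of _ N]) (intro conjI allI impI; (rule Nh contr close | simp add: NRN); assumption?)
qed

section \<open>Privacy amplification\<close>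

lemma sum_mult_le_sqrt:
  fixes f g :: "'i \<Rightarrow> real"
  shows "(\<Sum>i\<in>A. f i * g i) \<le> sqrt (\<Sum>i\<in>A. (f i)\<^sup>2) * sqrt (\<Sum>i\<in>A. (g i)\<^sup>2)"
proof -
  have "(\<Sum>i\<in>A. f i * g i) \<le> (\<Sum>i\<in>A. \<bar>f i\<bar> * \<bar>g i\<bar>)"
    by (intro sum_mono) (metis abs_ge_self abs_mult)
  also have "\<dots> \<le> L2_set f A * L2_set g A" by (rule L2_set_mult_ineq)
  finally show ?thesis by (simp add: L2_set_def)
qed

lemma sum_pair: "(\<Sum>q\<in>A \<times> B. F q) = (\<Sum>a\<in>A. \<Sum>b\<in>B. F (a, b))"
  by (simp add: sum.cartesian_product)

text \<open>An operator and its adjoint have the same norm. The output \<open>g\<close> of the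
  adjoint is paired with itself, and the hypothesis at the conjugate of \<open>g\<close> gives |g|^2
  \<le> |g| sqrt(c) |a|, from which |g| is cancelled.\<close>

lemma gram_dual:
  assumes fin: "finite I" and le: "\<And>v. (\<Sum>m\<in>M. (cmod (\<Sum>i\<in>I. cnj (v i) * x m i))\<^sup>2) \<le> c * (\<Sum>i\<in>I. (cmod (v i))\<^sup>2)"
    and c: "0 \<le> c"
  shows "(\<Sum>i\<in>I. (cmod (\<Sum>m\<in>M. cnj (x m i) * a m))\<^sup>2) \<le> c * (\<Sum>m\<in>M. (cmod (a m))\<^sup>2)"
proof -
  define g where "g i = (\<Sum>m\<in>M. cnj (x m i) * a m)" for i
  define b where "b m = (\<Sum>i\<in>I. g i * x m i)" for m
  define G where "G = (\<Sum>i\<in>I. (cmod (g i))\<^sup>2)"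
  define F where "F = (\<Sum>m\<in>M. (cmod (a m))\<^sup>2)"
  have G0: "0 \<le> G" and F0: "0 \<le> F" by (simp_all add: G_def F_def sum_nonneg)
  have "(\<Sum>m\<in>M. (cmod (b m))\<^sup>2) \<le> c * G"
    using le[of "\<lambda>i. cnj (g i)"] by (simp add: b_def G_def)
  then have bG: "sqrt (\<Sum>m\<in>M. (cmod (b m))\<^sup>2) \<le> sqrt (c * G)" by simp
  have "of_real G = (\<Sum>i\<in>I. cnj (g i) * g i)" by (simp add: G_def cnj_mult_self)
  also have "\<dots> = (\<Sum>i\<in>I. \<Sum>m\<in>M. cnj (g i) * cnj (x m i) * a m)"
    unfolding g_def[of _, THEN arg_cong[where f = "(*) _"]] by (simp add: sum_distrib_left mult.assoc g_def)
  also have "\<dots> = (\<Sum>m\<in>M. cnj (b m) * a m)"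
    by (subst sum.swap) (simp add: b_def sum_distrib_right)
  finally have "cmod (of_real G) \<le> nrm M b * nrm M a" using cmod_ip_le[where u = b and v = a and I = M] by simp
  then have "G \<le> sqrt (\<Sum>m\<in>M. (cmod (b m))\<^sup>2) * sqrt F"
    using G0 by (simp add: nrm_def L2_set_def F_def)
  also have "\<dots> \<le> sqrt (c * G) * sqrt F" using bG F0 by (intro mult_right_mono) auto
  finally have "G \<le> sqrt G * sqrt (c * F)" by (simp add: real_sqrt_mult mult_ac)
  then have "sqrt G * sqrt G \<le> sqrt G * sqrt (c * F)" using G0 by simp
  then have "sqrt G \<le> sqrt (c * F) \<or> G = 0" using G0
    by (metis antisym_conv3 mult_le_cancel_left_pos real_sqrt_eq_zero_cancel_iff real_sqrt_ge_zero order_le_less)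
  then have "G \<le> c * F" using F0 c by auto
  then show ?thesis by (simp add: G_def F_def g_def)
qed

text \<open>The hash function is chosen greedily: averaged over the value of \<open>f\<close> at the last
  point, the cross term of the squared norm vanishes.\<close>

lemma hash_exists:
  fixes y :: "nat \<Rightarrow> 'i \<Rightarrow> complex"
  assumes K: "0 < (K :: nat)"
  shows "\<exists>f. (\<forall>a. f a < K) \<and>
    (\<Sum>z<K. \<Sum>i\<in>I. (cmod (\<Sum>a<L. of_real ((if f a = z then 1 else 0) - 1 / K) * y a i))\<^sup>2)
      \<le> (1 - 1 / K) * (\<Sum>a<L. \<Sum>i\<in>I. (cmod (y a i))\<^sup>2)"
proof (induction L)
  case 0
  show ?case using K by (intro exI[of _ "\<lambda>_. 0"]) simp
next
  case (Suc L)
  then obtain f where f: "\<forall>a. f a < K" and IH: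
    "(\<Sum>z<K. \<Sum>i\<in>I. (cmod (\<Sum>a<L. of_real ((if f a = z then 1 else 0) - 1 / K) * y a i))\<^sup>2)
      \<le> (1 - 1 / K) * (\<Sum>a<L. \<Sum>i\<in>I. (cmod (y a i))\<^sup>2)" by blast
  \<comment> \<open>The \<open>w\<close>-th point mass minus the uniform distribution. Over
    \<open>z\<close> its squares sum to 1 - 1/K; over \<open>w\<close> its entries sum to 0, which
    is why the cross term averages out.\<close>
  define c :: "nat \<Rightarrow> nat \<Rightarrow> real" where "c w z = (if w = z then 1 else 0) - 1 / K" for w z
  define s where "s z i = (\<Sum>a<L. of_real (c (f a) z) * y a i)" for z i
  define x where "x w = (\<Sum>z<K. c w z * (\<Sum>i\<in>I. Re (cnj (s z i) * y L i)))" for w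
  have cz: "(\<Sum>z<K. (c w z)\<^sup>2) = 1 - 1 / K" if "w < K" for w
  proof -
    have "(c w z)\<^sup>2 = (if z = w then 1 - 2 / K else 0) + 1 / (K * K)" for z
      using K by (auto simp: c_def power2_eq_square algebra_simps)
    then have "(\<Sum>z<K. (c w z)\<^sup>2) = (\<Sum>z<K. (if z = w then 1 - 2 / K else 0) + 1 / (K * K))"
      by (intro sum.cong refl)
    also have "\<dots> = 1 - 1 / K" using that K by (simp add: sum.distrib)
    finally show ?thesis .
  qed
  have "(\<Sum>w<K. c w z) = 0" if "z < K" for z
    using that K by (simp add: c_def sum_subtractf)
  then have "(\<Sum>w<K. x w) = 0"
    unfolding x_def by (subst sum.swap) (simp flip: sum_distrib_right)
  then obtain w where w: "w < K" "x w \<le> 0"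
    using sum_pos[of "{..<K}" x] K by (metis empty_iff finite_lessThan lessThan_iff not_le order_less_irrefl)
  define g where "g = f(L := w)"
  have gs: "(\<Sum>a<Suc L. of_real ((if g a = z then 1 else 0) - 1 / K) * y a i) = s z i + of_real (c w z) * y L i" for z i
    by (simp add: g_def s_def c_def)
  have sq: "(cmod (s z i + of_real (c w z) * y L i))\<^sup>2
     = (cmod (s z i))\<^sup>2 + 2 * (c w z * Re (cnj (s z i) * y L i)) + (c w z)\<^sup>2 * (cmod (y L i))\<^sup>2" for z i
    unfolding cmod_power2 by (simp add: power2_eq_square algebra_simps)
  have "(\<Sum>z<K. \<Sum>i\<in>I. (cmod (s z i + of_real (c w z) * y L i))\<^sup>2)
     = (\<Sum>z<K. \<Sum>i\<in>I. (cmod (s z i))\<^sup>2) + 2 * x w + (\<Sum>z<K. (c w z)\<^sup>2) * (\<Sum>i\<in>I. (cmod (y L i))\<^sup>2)"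
    unfolding sq sum.distrib x_def sum_distrib_left sum_distrib_right
    by (simp only: add_left_cancel) (rule sum.swap)
  also have "\<dots> \<le> (1 - 1 / K) * (\<Sum>a<L. \<Sum>i\<in>I. (cmod (y a i))\<^sup>2) + 0 + (1 - 1 / K) * (\<Sum>i\<in>I. (cmod (y L i))\<^sup>2)"
    unfolding cz[OF w(1)] using IH w(2) by (intro add_mono order_refl) (auto simp: s_def c_def)
  also have "\<dots> = (1 - 1 / K) * (\<Sum>a<Suc L. \<Sum>i\<in>I. (cmod (y a i))\<^sup>2)"
    by (simp add: algebra_simps)
  finally show ?case using f w by (intro exI[of _ g]) (simp only: gs, simp add: g_def)
qed

text \<open>The exact value is 2 (1 - 1/K), the l1 distance of a point mass from the uniform
  distribution.\<close>

lemma hash_coeff_sum: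
  assumes "w < (K :: nat)" shows "(\<Sum>z<K. \<bar>(if w = z then 1 else 0) - 1 / real K\<bar>) \<le> 2"
proof -
  have "(\<Sum>z<K. \<bar>(if w = z then 1 else 0) - 1 / real K\<bar>) \<le> (\<Sum>z<K. (if z = w then 1 else 0) + 1 / real K)"
    by (intro sum_mono) (auto simp: abs_if)
  also have "\<dots> \<le> 2" using assms by (simp add: sum.distrib)
  finally show ?thesis .
qed

definition bil :: "'i set \<Rightarrow> ('i \<Rightarrow> 'i \<Rightarrow> complex) \<Rightarrow> ('i \<Rightarrow> complex) \<Rightarrow> ('i \<Rightarrow> complex) \<Rightarrow> complex" where
  "bil I W u v = (\<Sum>p\<in>I. \<Sum>q\<in>I. cnj (u p) * W p q * v q)"

lemma bil_diff_left: "bil I W (\<lambda>p. u p - u' p) v = bil I W u v - bil I W u' v"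
  by (simp add: bil_def algebra_simps sum_subtractf)

lemma bil_diff_right: "bil I W u (\<lambda>p. v p - v' p) = bil I W u v - bil I W u v'"
  by (simp add: bil_def algebra_simps sum_subtractf)

lemma nrm_mono: "(\<Sum>x\<in>I. (cmod (u x))\<^sup>2) \<le> (\<Sum>x\<in>J. (cmod (v x))\<^sup>2) \<Longrightarrow> nrm I u \<le> nrm J v"
  by (simp add: nrm_def L2_set_def)

lemma bil_le: "contraction I W \<Longrightarrow> cmod (bil I W u v) \<le> nrm I u * nrm I v"
  by (simp add: bil_def contraction_def)

text \<open>The difference of the two quadratic values is split into two terms, each with u - v in
  one argument; the norm of the longer vector bounds the other argument.\<close>

lemma bil_close:
  assumes W: "contraction I W" and le: "nrm I v \<le> nrm I u"
  shows "cmod (bil I W u u - bil I W v v) \<le> 2 * (nrm I (\<lambda>p. u p - v p) * nrm I u)"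
proof -
  have "bil I W u u - bil I W v v = bil I W (\<lambda>p. u p - v p) u + bil I W v (\<lambda>p. u p - v p)"
    by (simp add: bil_diff_left bil_diff_right)
  also have "cmod \<dots> \<le> nrm I (\<lambda>p. u p - v p) * nrm I u + nrm I v * nrm I (\<lambda>p. u p - v p)"
    by (intro order_trans[OF norm_triangle_ineq] add_mono bil_le W)
  also have "\<dots> \<le> nrm I (\<lambda>p. u p - v p) * nrm I u + nrm I u * nrm I (\<lambda>p. u p - v p)"
    using le by (intro add_mono mult_right_mono) auto
  finally show ?thesis by (simp add: mult_ac)
qed

text \<open>The vectors \<open>\<psi> a \<mu>\<close> on \<open>\<complex>\<^sup>e \<otimes> \<complex>\<^sup>m\<close> decompose Eve's unnormalised conditional state
  \<open>\<sigma>\<^sub>a = \<Sum>\<^sub>\<mu> |\<psi> a \<mu>\<rangle>\<langle>\<psi> a \<mu>|\<close>; \<open>dom\<close> bounds its first marginal by \<open>\<tau> / L + D a\<close>, and \<open>side\<close> says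
  that \<open>\<sigma>\<^sub>a\<close>, compressed to the span of \<open>T\<close> in the second factor, is at most
  \<open>\<gamma> (Tr\<^sub>2 \<sigma>\<^sub>a \<otimes> 1)\<close>.  The number \<open>f a\<close> is the hashed key.\<close>

lemma privacy_amplification:
  fixes \<psi> :: "nat \<Rightarrow> nat \<Rightarrow> nat \<times> nat \<Rightarrow> complex"
    and \<tau> :: "nat \<Rightarrow> nat \<Rightarrow> complex" and D :: "nat \<Rightarrow> nat \<Rightarrow> nat \<Rightarrow> complex"
    and \<gamma> \<Delta> \<eta> :: real
  assumes pos: "0 < e" "0 < (L :: nat)" "0 < (K :: nat)" "0 \<le> \<gamma>"
    and T: "T \<subseteq> {..<m}"
    and \<tau>: "posf {..<e} \<tau>" "(\<Sum>x<e. \<tau> x x) = 1"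
    and D: "\<And>a. a < L \<Longrightarrow> posf {..<e} (D a)" "(\<Sum>a<L. Re (\<Sum>x<e. D a x x)) \<le> \<Delta>"
    and dom: "\<And>a. a < L \<Longrightarrow> posf {..<e} (\<lambda>x y. \<tau> x y / of_nat L + D a x y
        - (\<Sum>(\<mu>, j)\<in>{..<n}\<times>{..<m}. \<psi> a \<mu> (x, j) * cnj (\<psi> a \<mu> (y, j))))"
    and tail: "(\<Sum>a<L. \<Sum>\<mu><n. \<Sum>p\<in>{..<e}\<times>({..<m} - T). (cmod (\<psi> a \<mu> p))\<^sup>2) \<le> \<eta>"
    and total: "(\<Sum>a<L. \<Sum>\<mu><n. \<Sum>p\<in>{..<e}\<times>{..<m}. (cmod (\<psi> a \<mu> p))\<^sup>2) \<le> 1"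
    and side: "\<And>a v. a < L \<Longrightarrow> (\<Sum>\<mu><n. (cmod (\<Sum>j\<in>T. ip e (v j) (\<lambda>x. \<psi> a \<mu> (x, j))))\<^sup>2)
        \<le> \<gamma> * (\<Sum>j\<in>T. \<Sum>\<mu><n. \<Sum>j'<m. (cmod (ip e (v j) (\<lambda>x. \<psi> a \<mu> (x, j'))))\<^sup>2)"
  shows "\<exists>f. (\<forall>a. f a < K) \<and> (\<forall>W. (\<forall>z<K. contraction ({..<e}\<times>{..<m}) (W z)) \<longrightarrow>
     cmod (\<Sum>z<K. \<Sum>a<L. of_real ((if f a = z then 1 else 0) - 1 / K) *
        (\<Sum>\<mu><n. bil ({..<e}\<times>{..<m}) (W z) (\<psi> a \<mu>) (\<psi> a \<mu>)))
      \<le> 4 * sqrt (\<Delta> + \<eta>) + sqrt (2 * card T * \<gamma> * (real K - 1) / L))"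
proof -
  let ?I = "{..<e}\<times>{..<m}"
  let ?J = "{..<e}\<times>T"
  have fT: "finite T" using T finite_subset by blast
  \<comment> \<open>Mixing in the maximally mixed state bounds Q below by 1 / (e L), as the
    smoothing requires. The price is the trace 2 / L instead of 1 / L, which is the factor 2 under
    the final root.\<close>
  define Q where "Q x y = (\<tau> x y + (if x = y then 1 / of_nat e else 0)) / of_nat L" for x y
  have form_id: "ip e v (ap e (\<lambda>x y. if x = y then c else 0) v) = c * of_real (\<Sum>x<e. (cmod (v x))\<^sup>2)" for c v
  proof -
    have "ap e (\<lambda>x y. if x = y then c else 0) v x = c * v x" if "x < e" for x
    proof -
      have "ap e (\<lambda>x y. if x = y then c else 0) v x = (\<Sum>y<e. if y = x then c * v y else 0)"
        unfolding ap_def by (intro sum.cong) auto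
      then show ?thesis using that by simp
    qed
    then have "ip e v (ap e (\<lambda>x y. if x = y then c else 0) v) = ip e v (\<lambda>x. c * v x)"
      by (intro ip_cong) auto
    also have "\<dots> = c * ip e v v" by (simp add: ip_def sum_distrib_left algebra_simps)
    finally show ?thesis by (simp only: ip_self)
  qed
  have form_scale: "ip e v (ap e (\<lambda>x y. A x y / of_nat L) v) = ip e v (ap e A v) / of_nat L" for A v
    by (simp add: ip_def ap_def sum_divide_distrib sum_distrib_left)
  have Qform: "ip e v (ap e Q v) = (ip e v (ap e \<tau> v) + of_real (1 / e * (\<Sum>x<e. (cmod (v x))\<^sup>2))) / of_nat L" for v
    unfolding Q_def[abs_def] form_scale form_add form_id by simp
  have \<tau>f: "0 \<le> Re (ip e v (ap e \<tau> v))" "Im (ip e v (ap e \<tau> v)) = 0" for v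
    using \<tau>(1)[unfolded posf_iff, rule_format, of v] by (auto simp: less_eq_complex_def)
  have Q\<kappa>: "1 / (e * L) * (\<Sum>x<e. (cmod (v x))\<^sup>2) \<le> Re (ip e v (ap e Q v))" for v
    unfolding Qform using \<tau>f(1)[of v] pos by (simp add: field_simps)
  have Q: "posf {..<e} Q"
    unfolding posf_iff Qform using \<tau>f pos
    by (auto simp: less_eq_complex_def intro!: divide_nonneg_nonneg add_nonneg_nonneg sum_nonneg)
  obtain S where S: "posf {..<e} S" and SS: "\<And>i j. i < e \<Longrightarrow> j < e \<Longrightarrow> mm e S S i j = Q i j"
    using posf_sqrt_ex[OF Q] by auto
  have trS: "(\<Sum>x<e. \<Sum>y<e. (cmod (S x y))\<^sup>2) = 2 / L"
  proof -
    have "complex_of_real (\<Sum>x<e. \<Sum>y<e. (cmod (S x y))\<^sup>2) = (\<Sum>x<e. \<Sum>y<e. S x y * S y x)"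
      unfolding of_real_sum complex_norm_square
      by (intro sum.cong refl arg_cong2[where f = "(*)"] posf_herm[OF S, symmetric]) auto
    also have "\<dots> = (\<Sum>x<e. Q x x)" by (intro sum.cong refl) (simp add: SS[symmetric] mm_def)
    also have "\<dots> = of_real (2 / L)"
      using \<tau>(2) pos by (simp add: Q_def sum.distrib flip: sum_divide_distrib)
    finally show ?thesis unfolding of_real_eq_iff .
  qed
  \<comment> \<open>\<open>N\<close> stands for (Q + D a)^(-1/2), which depends on \<open>a\<close>,
    while the square root S of Q does not. This lets S leave the sum over \<open>a\<close> in the
    hashing estimate.\<close>
  define goodN where "goodN a N \<longleftrightarrow> (\<forall>i<e. \<forall>j<e. N i j = cnj (N j i)) \<and>
    (\<forall>v. (\<Sum>i<e. (cmod (ap e S (ap e N v) i))\<^sup>2) \<le> (\<Sum>i<e. (cmod (v i))\<^sup>2)) \<and>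
    (\<forall>v. Re (ip e (ap e N v) (ap e (\<lambda>i j. Q i j + D a i j) (ap e N v))) = (\<Sum>i<e. (cmod (v i))\<^sup>2)) \<and>
    (\<forall>(M :: (nat \<times> nat) set) x. posf {..<e} (\<lambda>i j. Q i j + D a i j - (\<Sum>m\<in>M. x m i * cnj (x m j))) \<longrightarrow>
       (\<Sum>m\<in>M. \<Sum>i<e. (cmod (x m i - ap e S (ap e N (x m)) i))\<^sup>2) \<le> Re (\<Sum>i<e. D a i i))" for a N
  have "\<exists>N. goodN a N" if "a < L" for a
    unfolding goodN_def using pos that by (intro smoothing[OF S SS D(1) _ Q\<kappa>]) auto
  then obtain N where N: "\<And>a. a < L \<Longrightarrow> goodN a (N a)" by metis
  note Nc = N[unfolded goodN_def]
  note N_herm = Nc[THEN conjunct1, rule_format]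
  note N_contr = Nc[THEN conjunct2, THEN conjunct1, rule_format]
  note N_inv = Nc[THEN conjunct2, THEN conjunct2, THEN conjunct1, rule_format]
  note N_close = Nc[THEN conjunct2, THEN conjunct2, THEN conjunct2, rule_format]
  define M where "M = {..<n}\<times>{..<m}"
  \<comment> \<open>For fixed \<open>a\<close>, the pairs of \<mu> and a register index label
    vectors on the first factor alone; their Gram operator is the marginal that \<open>dom\<close>
    bounds.\<close>
  define x where "x a \<mu>j i = \<psi> a (fst \<mu>j) (i, snd \<mu>j)" for a \<mu>j i
  have domQ: "posf {..<e} (\<lambda>i j. Q i j + D a i j - (\<Sum>q\<in>M. x a q i * cnj (x a q j)))" if "a < L" for a
  proof -
    have 1: "posf {..<e} (\<lambda>x y. if x = y then complex_of_real (1 / e / L) else 0)"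
      unfolding posf_iff form_id using pos by (simp add: less_eq_complex_def sum_nonneg)
    show ?thesis
      by (rule posf_cong[THEN iffD2, OF _ posf_add[OF dom[OF that] 1]])
        (auto simp: Q_def x_def M_def case_prod_unfold add_divide_distrib)
  qed
  \<comment> \<open>\<open>\<chi>\<close> is normalised by (Q + D a)^(-1/2) on the first factor.
    Applying S to it and cutting off the register outside T gives \<open>\<phi>\<close>, the
    smoothed version of \<open>\<psi>\<close>.\<close>
  define \<chi> where "\<chi> a \<mu> p = ap e (N a) (x a (\<mu>, snd p)) (fst p)" for a \<mu> p
  define \<phi> where "\<phi> a \<mu> p = (if snd p \<in> T then ap e S (ap e (N a) (x a (\<mu>, snd p))) (fst p) else 0)" for a \<mu> p
  have split: "(\<Sum>p\<in>?I. F p) = (\<Sum>j\<in>T. \<Sum>i<e. F (i, j)) + (\<Sum>p\<in>{..<e}\<times>({..<m} - T). F p)" for F :: "_ \<Rightarrow> real"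
  proof -
    have "(\<Sum>p\<in>?I. F p) = (\<Sum>j<m. \<Sum>i<e. F (i, j))"
      by (subst sum.swap) (simp add: sum_pair)
    also have "\<dots> = (\<Sum>j\<in>{..<m} - T. \<Sum>i<e. F (i, j)) + (\<Sum>j\<in>T. \<Sum>i<e. F (i, j))"
      using T by (intro sum.subset_diff) auto
    also have "(\<Sum>j\<in>{..<m} - T. \<Sum>i<e. F (i, j)) = (\<Sum>p\<in>{..<e}\<times>({..<m} - T). F p)"
      by (subst sum.swap) (simp add: sum_pair)
    finally show ?thesis by simp
  qed
  \<comment> \<open>Outside T the vector \<open>\<phi>\<close> is 0, so the error there is the tail;
    inside T it is at most what the smoothing allows.\<close>
  have close_a: "(\<Sum>\<mu><n. \<Sum>p\<in>?I. (cmod (\<psi> a \<mu> p - \<phi> a \<mu> p))\<^sup>2)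
     \<le> Re (\<Sum>i<e. D a i i) + (\<Sum>\<mu><n. \<Sum>p\<in>{..<e}\<times>({..<m} - T). (cmod (\<psi> a \<mu> p))\<^sup>2)" if a: "a < L" for a
  proof -
    define X where "X = (\<Sum>\<mu><n. \<Sum>j\<in>T. \<Sum>i<e. (cmod (x a (\<mu>, j) i - ap e S (ap e (N a) (x a (\<mu>, j))) i))\<^sup>2)"
    have 1: "(\<Sum>\<mu><n. \<Sum>p\<in>?I. (cmod (\<psi> a \<mu> p - \<phi> a \<mu> p))\<^sup>2)
      = X + (\<Sum>\<mu><n. \<Sum>p\<in>{..<e}\<times>({..<m} - T). (cmod (\<psi> a \<mu> p))\<^sup>2)"
      unfolding split sum.distrib X_def
      by (intro arg_cong2[where f = "(+)"] sum.cong refl) (auto simp: \<phi>_def x_def)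
    have "X \<le> (\<Sum>\<mu><n. \<Sum>j<m. \<Sum>i<e. (cmod (x a (\<mu>, j) i - ap e S (ap e (N a) (x a (\<mu>, j))) i))\<^sup>2)"
      using T unfolding X_def by (intro sum_mono sum_mono2) (auto intro!: sum_nonneg)
    also have "\<dots> = (\<Sum>q\<in>M. \<Sum>i<e. (cmod (x a q i - ap e S (ap e (N a) (x a q)) i))\<^sup>2)"
      unfolding M_def by (simp only: sum_pair)
    also have "\<dots> \<le> Re (\<Sum>i<e. D a i i)"
      using domQ[OF a] by (intro N_close[OF a, where M = M and x = "x a"])
    finally show ?thesis unfolding 1 by simp
  qed
  have close: "(\<Sum>a<L. \<Sum>\<mu><n. \<Sum>p\<in>?I. (cmod (\<psi> a \<mu> p - \<phi> a \<mu> p))\<^sup>2) \<le> \<Delta> + \<eta>"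
  proof -
    have "(\<Sum>a<L. \<Sum>\<mu><n. \<Sum>p\<in>?I. (cmod (\<psi> a \<mu> p - \<phi> a \<mu> p))\<^sup>2)
      \<le> (\<Sum>a<L. Re (\<Sum>i<e. D a i i) + (\<Sum>\<mu><n. \<Sum>p\<in>{..<e}\<times>({..<m} - T). (cmod (\<psi> a \<mu> p))\<^sup>2))"
      by (intro sum_mono close_a) auto
    then show ?thesis using D(2) tail by (simp add: sum.distrib)
  qed
  have \<phi>le: "(\<Sum>p\<in>?I. (cmod (\<phi> a \<mu> p))\<^sup>2) \<le> (\<Sum>p\<in>?I. (cmod (\<psi> a \<mu> p))\<^sup>2)" if a: "a < L" for a \<mu>
    unfolding split
  proof (rule add_mono; rule sum_mono)
    fix j assume "j \<in> T"
    then show "(\<Sum>i<e. (cmod (\<phi> a \<mu> (i, j)))\<^sup>2) \<le> (\<Sum>i<e. (cmod (\<psi> a \<mu> (i, j)))\<^sup>2)"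
      using N_contr[OF a, of "x a (\<mu>, j)"]
      by (simp add: \<phi>_def x_def)
  qed (auto simp: \<phi>_def)
  define F where "F = (\<Sum>a<L. \<Sum>\<mu><n. \<Sum>p\<in>?I. (cmod (\<phi> a \<mu> p))\<^sup>2)"
  have F1: "F \<le> 1" using total by (rule order_trans[rotated]) (auto simp: F_def intro!: sum_mono \<phi>le)
  \<comment> \<open>In operator form: the normalised conditional state compressed to T is at most
    \<gamma>, since \<open>side\<close> bounds it by \<gamma> times its marginal and the normalised
    marginal is at most 1.\<close>
  have dual_hyp: "(\<Sum>\<mu><n. (cmod (\<Sum>p\<in>?J. cnj (v p) * \<chi> a \<mu> p))\<^sup>2) \<le> \<gamma> * (\<Sum>p\<in>?J. (cmod (v p))\<^sup>2)"
    if a: "a < L" for a v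
  proof -
    define w where "w j = ap e (N a) (\<lambda>i. v (i, j))" for j
    have "(\<Sum>p\<in>?J. cnj (v p) * \<chi> a \<mu> p) = (\<Sum>j\<in>T. ip e (w j) (\<lambda>i. \<psi> a \<mu> (i, j)))" for \<mu>
    proof -
      have "(\<Sum>p\<in>?J. cnj (v p) * \<chi> a \<mu> p) = (\<Sum>j\<in>T. ip e (\<lambda>i. v (i, j)) (ap e (N a) (x a (\<mu>, j))))"
        unfolding ip_def by (subst sum.swap) (simp add: sum_pair \<chi>_def)
      also have "\<dots> = (\<Sum>j\<in>T. ip e (w j) (x a (\<mu>, j)))"
        unfolding w_def using ip_ap_herm[of e "N a", OF N_herm[OF a]] by simp
      finally show ?thesis by (simp add: x_def[abs_def])
    qed
    then have "(\<Sum>\<mu><n. (cmod (\<Sum>p\<in>?J. cnj (v p) * \<chi> a \<mu> p))\<^sup>2)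
       \<le> \<gamma> * (\<Sum>j\<in>T. \<Sum>\<mu><n. \<Sum>j'<m. (cmod (ip e (w j) (\<lambda>i. \<psi> a \<mu> (i, j'))))\<^sup>2)"
      using side[OF a] by simp
    also have "\<dots> \<le> \<gamma> * (\<Sum>j\<in>T. \<Sum>i<e. (cmod (v (i, j)))\<^sup>2)"
    proof (intro mult_left_mono sum_mono pos(4))
      fix j
      have "(\<Sum>\<mu><n. \<Sum>j'<m. (cmod (ip e (w j) (\<lambda>i. \<psi> a \<mu> (i, j'))))\<^sup>2) = (\<Sum>q\<in>M. (cmod (ip e (w j) (x a q)))\<^sup>2)"
        unfolding M_def sum_pair x_def[abs_def] by simp
      also have "\<dots> \<le> Re (ip e (w j) (ap e (\<lambda>i j. Q i j + D a i j) (w j)))" by (rule gram_le[OF domQ[OF a]])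
      also have "\<dots> = (\<Sum>i<e. (cmod (v (i, j)))\<^sup>2)"
        unfolding w_def by (rule N_inv[OF a])
      finally show "(\<Sum>\<mu><n. \<Sum>j'<m. (cmod (ip e (w j) (\<lambda>i. \<psi> a \<mu> (i, j'))))\<^sup>2) \<le> (\<Sum>i<e. (cmod (v (i, j)))\<^sup>2)" .
    qed
    also have "(\<Sum>j\<in>T. \<Sum>i<e. (cmod (v (i, j)))\<^sup>2) = (\<Sum>p\<in>?J. (cmod (v p))\<^sup>2)"
      by (subst sum.swap) (simp add: sum_pair)
    finally show ?thesis .
  qed
  \<comment> \<open>The part of the smoothed conditional state that depends on \<open>a\<close>: as
    \<open>\<phi>\<close> is S \<otimes> 1 applied to \<open>\<chi>\<close> on T, one factor S
    splits off on one side. The arrays \<open>G a\<close> are the vectors that get hashed.\<close>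
  define G where "G a r q = (\<Sum>\<mu><n. cnj (\<chi> a \<mu> r) * \<phi> a \<mu> q)" for a r q
  \<comment> \<open>Duality applies the bound \<gamma> to each row of coefficients
    \<open>\<phi> a \<mu> q\<close> with \<open>q\<close> fixed; the total weight of
    \<open>\<phi>\<close> is at most 1.\<close>
  have Gle: "(\<Sum>a<L. \<Sum>rq\<in>?J\<times>?I. (cmod (G a (fst rq) (snd rq)))\<^sup>2) \<le> \<gamma>"
  proof -
    have "(\<Sum>a<L. \<Sum>rq\<in>?J\<times>?I. (cmod (G a (fst rq) (snd rq)))\<^sup>2) = (\<Sum>a<L. \<Sum>q\<in>?I. \<Sum>r\<in>?J. (cmod (G a r q))\<^sup>2)"
      by (rule sum.cong[OF refl]) (subst sum.swap, simp add: sum_pair)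
    also have "\<dots> \<le> (\<Sum>a<L. \<Sum>q\<in>?I. \<gamma> * (\<Sum>\<mu><n. (cmod (\<phi> a \<mu> q))\<^sup>2))"
      unfolding G_def using fT pos by (intro sum_mono gram_dual dual_hyp) auto
    also have "\<dots> = \<gamma> * F"
      unfolding F_def sum_distrib_left by (intro sum.cong refl sum.swap)
    also have "\<dots> \<le> \<gamma>" using F1 pos by (simp add: mult_left_le)
    finally show ?thesis .
  qed
  obtain f where f: "\<forall>a. f a < K" and hash:
    "(\<Sum>z<K. \<Sum>rq\<in>?J\<times>?I. (cmod (\<Sum>a<L. of_real ((if f a = z then 1 else 0) - 1 / K) * G a (fst rq) (snd rq)))\<^sup>2)
      \<le> (1 - 1 / K) * (\<Sum>a<L. \<Sum>rq\<in>?J\<times>?I. (cmod (G a (fst rq) (snd rq)))\<^sup>2)"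
    using hash_exists[OF pos(3), where I = "?J\<times>?I" and L = L and y = "\<lambda>a rq. G a (fst rq) (snd rq)"] by auto
  define c where "c a z = (if f a = z then 1 else 0) - 1 / real K" for a z
  define g where "g z r q = (\<Sum>a<L. of_real (c a z) * G a r q)" for z r q
  have gle: "(\<Sum>z<K. \<Sum>rq\<in>?J\<times>?I. (cmod (g z (fst rq) (snd rq)))\<^sup>2) \<le> (1 - 1 / K) * \<gamma>"
    using hash Gle pos unfolding g_def c_def by (elim order_trans) (auto intro!: mult_left_mono)
  \<comment> \<open>Cauchy-Schwarz over the columns of S \<otimes> 1 and over the key values. The
    columns contribute card T times Tr Q = 2 / L, and the K key values turn the factor 1 - 1/K from
    hashing into K - 1.\<close>
  have main: "cmod (\<Sum>z<K. \<Sum>a<L. of_real (c a z) * (\<Sum>\<mu><n. bil ?I (W z) (\<phi> a \<mu>) (\<phi> a \<mu>)))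
      \<le> sqrt (2 * card T * \<gamma> * (real K - 1) / L)"
    if W: "\<And>z. z < K \<Longrightarrow> contraction ?I (W z)" for W
  proof -
    define s where "s r p = (if snd p = snd r then S (fst p) (fst r) else 0)" for r p :: "nat \<times> nat"
    have \<phi>s: "\<phi> a \<mu> p = (\<Sum>r\<in>?J. s r p * \<chi> a \<mu> r)" for a \<mu> p
    proof -
      have "(\<Sum>r\<in>?J. s r p * \<chi> a \<mu> r) = (\<Sum>i<e. \<Sum>j\<in>T. if j = snd p then S (fst p) i * \<chi> a \<mu> (i, j) else 0)"
        unfolding sum_pair by (auto intro!: sum.cong simp: s_def)
      also have "\<dots> = (\<Sum>i<e. if snd p \<in> T then S (fst p) i * \<chi> a \<mu> (i, snd p) else 0)"
        using fT by simp
      finally show ?thesis by (simp add: \<phi>_def \<chi>_def ap_def[of e S])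
    qed
    have rw: "(\<Sum>a<L. of_real (c a z) * (\<Sum>\<mu><n. bil ?I (W z) (\<phi> a \<mu>) (\<phi> a \<mu>))) = (\<Sum>r\<in>?J. bil ?I (W z) (s r) (g z r))" for z
    proof -
      have "bil ?I (W z) (\<phi> a \<mu>) (\<phi> a \<mu>) = (\<Sum>r\<in>?J. bil ?I (W z) (s r) (\<lambda>q. cnj (\<chi> a \<mu> r) * \<phi> a \<mu> q))" for a \<mu>
      proof -
        have "bil ?I (W z) (\<phi> a \<mu>) (\<phi> a \<mu>) = (\<Sum>p\<in>?I. \<Sum>q\<in>?I. \<Sum>r\<in>?J. cnj (s r p) * W z p q * (cnj (\<chi> a \<mu> r) * \<phi> a \<mu> q))"
          unfolding bil_def by (subst (1) \<phi>s) (simp add: sum_distrib_left sum_distrib_right algebra_simps)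
        also have "\<dots> = (\<Sum>p\<in>?I. \<Sum>r\<in>?J. \<Sum>q\<in>?I. cnj (s r p) * W z p q * (cnj (\<chi> a \<mu> r) * \<phi> a \<mu> q))"
          by (rule sum.cong[OF refl]) (rule sum.swap)
        also have "\<dots> = (\<Sum>r\<in>?J. \<Sum>p\<in>?I. \<Sum>q\<in>?I. cnj (s r p) * W z p q * (cnj (\<chi> a \<mu> r) * \<phi> a \<mu> q))"
          by (rule sum.swap)
        finally show ?thesis by (simp add: bil_def)
      qed
      then have "(\<Sum>a<L. of_real (c a z) * (\<Sum>\<mu><n. bil ?I (W z) (\<phi> a \<mu>) (\<phi> a \<mu>)))
        = (\<Sum>a<L. \<Sum>\<mu><n. \<Sum>r\<in>?J. of_real (c a z) * bil ?I (W z) (s r) (\<lambda>q. cnj (\<chi> a \<mu> r) * \<phi> a \<mu> q))"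
        by (simp only: sum_distrib_left)
      also have "\<dots> = (\<Sum>a<L. \<Sum>r\<in>?J. \<Sum>\<mu><n. of_real (c a z) * bil ?I (W z) (s r) (\<lambda>q. cnj (\<chi> a \<mu> r) * \<phi> a \<mu> q))"
        by (rule sum.cong[OF refl]) (rule sum.swap)
      also have "\<dots> = (\<Sum>r\<in>?J. \<Sum>a<L. \<Sum>\<mu><n. of_real (c a z) * bil ?I (W z) (s r) (\<lambda>q. cnj (\<chi> a \<mu> r) * \<phi> a \<mu> q))"
        by (rule sum.swap)
      also have "\<dots> = (\<Sum>r\<in>?J. bil ?I (W z) (s r) (g z r))"
      proof (rule sum.cong[OF refl])
        fix r
        have lin: "bil ?I (W z) (s r) (\<lambda>q. \<Sum>a\<in>A. h a q) = (\<Sum>a\<in>A. bil ?I (W z) (s r) (h a))" for A :: "nat set" and h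
        proof -
          have "bil ?I (W z) (s r) (\<lambda>q. \<Sum>a\<in>A. h a q) = (\<Sum>p\<in>?I. \<Sum>q\<in>?I. \<Sum>a\<in>A. cnj (s r p) * W z p q * h a q)"
            unfolding bil_def by (simp only: sum_distrib_left)
          also have "\<dots> = (\<Sum>p\<in>?I. \<Sum>a\<in>A. \<Sum>q\<in>?I. cnj (s r p) * W z p q * h a q)"
            by (rule sum.cong[OF refl]) (rule sum.swap)
          also have "\<dots> = (\<Sum>a\<in>A. \<Sum>p\<in>?I. \<Sum>q\<in>?I. cnj (s r p) * W z p q * h a q)" by (rule sum.swap)
          finally show ?thesis by (simp add: bil_def)
        qed
        have sc: "bil ?I (W z) (s r) (\<lambda>q. k * h q) = k * bil ?I (W z) (s r) h" for k h
          by (simp add: bil_def sum_distrib_left algebra_simps)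
        show "(\<Sum>a<L. \<Sum>\<mu><n. of_real (c a z) * bil ?I (W z) (s r) (\<lambda>q. cnj (\<chi> a \<mu> r) * \<phi> a \<mu> q)) = bil ?I (W z) (s r) (g z r)"
          unfolding g_def[abs_def] G_def lin sc sum_distrib_left ..
      qed
      finally show ?thesis .
    qed
    define X where "X = (\<Sum>r\<in>?J. (nrm ?I (s r))\<^sup>2)"
    define Y where "Y z = (\<Sum>r\<in>?J. (nrm ?I (g z r))\<^sup>2)" for z
    have X: "X \<le> card T * (2 / L)"
    proof -
      have "X = (\<Sum>y<e. \<Sum>j\<in>T. \<Sum>i<e. \<Sum>j'<m. if j' = j then (cmod (S i y))\<^sup>2 else 0)"
        unfolding X_def nrm_sq sum_pair
        by (intro sum.cong refl) (auto simp: s_def)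
      also have "\<dots> = (\<Sum>y<e. \<Sum>j\<in>T. \<Sum>i<e. (cmod (S i y))\<^sup>2)"
        using T by (intro sum.cong refl) auto
      also have "\<dots> = card T * (\<Sum>y<e. \<Sum>i<e. (cmod (S i y))\<^sup>2)" by (simp add: sum_distrib_left)
      also have "(\<Sum>y<e. \<Sum>i<e. (cmod (S i y))\<^sup>2) = 2 / L" by (subst sum.swap) (rule trS)
      finally show ?thesis by simp
    qed
    have X0: "0 \<le> X" "\<And>z. 0 \<le> Y z" by (auto simp: X_def Y_def intro: sum_nonneg)
    have Y: "(\<Sum>z<K. Y z) \<le> (1 - 1 / K) * \<gamma>"
      using gle unfolding Y_def nrm_sq sum_pair by simp
    have "cmod (\<Sum>z<K. \<Sum>r\<in>?J. bil ?I (W z) (s r) (g z r)) \<le> (\<Sum>z<K. \<Sum>r\<in>?J. nrm ?I (s r) * nrm ?I (g z r))"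
      by (intro order_trans[OF norm_sum] sum_mono bil_le W) auto
    also have "\<dots> \<le> (\<Sum>z<K. sqrt X * sqrt (Y z))"
      unfolding X_def Y_def by (intro sum_mono sum_mult_le_sqrt)
    also have "\<dots> = sqrt X * (\<Sum>z<K. 1 * sqrt (Y z))" by (simp add: sum_distrib_left)
    also have "\<dots> \<le> sqrt X * (sqrt (\<Sum>z<K. 1\<^sup>2) * sqrt (\<Sum>z<K. (sqrt (Y z))\<^sup>2))"
      using X0 by (intro mult_left_mono sum_mult_le_sqrt) auto
    also have "\<dots> = sqrt (X * (K * (\<Sum>z<K. Y z)))"
      using X0 by (simp add: real_sqrt_mult)
    also have "\<dots> \<le> sqrt ((card T * (2 / L)) * (K * ((1 - 1 / K) * \<gamma>)))"
      using X Y X0 pos by (intro real_sqrt_le_mono mult_mono mult_left_mono) (auto intro!: sum_nonneg mult_nonneg_nonneg)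
    also have "(card T * (2 / L)) * (K * ((1 - 1 / K) * \<gamma>)) = 2 * card T * \<gamma> * (real K - 1) / L"
      using pos by (simp add: field_simps)
    finally show ?thesis unfolding rw .
  qed
  \<comment> \<open>The constant 4 is 2 from the coefficients, by \<open>hash_coeff_sum\<close>,
    times 2 from \<open>bil_close\<close>; a further Cauchy-Schwarz turns the individual errors into
    one root.\<close>
  have diff: "cmod ((\<Sum>z<K. \<Sum>a<L. of_real (c a z) * (\<Sum>\<mu><n. bil ?I (W z) (\<psi> a \<mu>) (\<psi> a \<mu>)))
      - (\<Sum>z<K. \<Sum>a<L. of_real (c a z) * (\<Sum>\<mu><n. bil ?I (W z) (\<phi> a \<mu>) (\<phi> a \<mu>)))) \<le> 4 * sqrt (\<Delta> + \<eta>)"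
    if W: "\<And>z. z < K \<Longrightarrow> contraction ?I (W z)" for W
  proof -
    define d where "d a \<mu> = nrm ?I (\<lambda>p. \<psi> a \<mu> p - \<phi> a \<mu> p)" for a \<mu>
    have "cmod ((\<Sum>z<K. \<Sum>a<L. of_real (c a z) * (\<Sum>\<mu><n. bil ?I (W z) (\<psi> a \<mu>) (\<psi> a \<mu>)))
      - (\<Sum>z<K. \<Sum>a<L. of_real (c a z) * (\<Sum>\<mu><n. bil ?I (W z) (\<phi> a \<mu>) (\<phi> a \<mu>))))
      = cmod (\<Sum>z<K. \<Sum>a<L. of_real (c a z) * (\<Sum>\<mu><n. bil ?I (W z) (\<psi> a \<mu>) (\<psi> a \<mu>) - bil ?I (W z) (\<phi> a \<mu>) (\<phi> a \<mu>)))"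
      by (simp only: sum_subtractf right_diff_distrib)
    also have "\<dots> \<le> (\<Sum>z<K. \<Sum>a<L. \<bar>c a z\<bar> * (\<Sum>\<mu><n. 2 * (d a \<mu> * nrm ?I (\<psi> a \<mu>))))"
      unfolding d_def
      by (intro order_trans[OF norm_sum] sum_mono order_trans[OF norm_sum])
        (auto simp: norm_mult intro!: mult_left_mono order_trans[OF norm_sum] sum_mono bil_close W nrm_mono \<phi>le)
    also have "\<dots> = (\<Sum>a<L. (\<Sum>z<K. \<bar>c a z\<bar>) * (\<Sum>\<mu><n. 2 * (d a \<mu> * nrm ?I (\<psi> a \<mu>))))"
      by (subst sum.swap) (simp only: sum_distrib_right)
    also have "\<dots> \<le> (\<Sum>a<L. 2 * (\<Sum>\<mu><n. 2 * (d a \<mu> * nrm ?I (\<psi> a \<mu>))))"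
      using f unfolding c_def by (intro sum_mono mult_right_mono hash_coeff_sum) (auto simp: d_def intro!: sum_nonneg)
    also have "\<dots> = 4 * (\<Sum>a<L. \<Sum>\<mu><n. d a \<mu> * nrm ?I (\<psi> a \<mu>))"
      by (simp add: sum_distrib_left mult.assoc)
    also have "(\<Sum>a<L. \<Sum>\<mu><n. d a \<mu> * nrm ?I (\<psi> a \<mu>)) = (\<Sum>q\<in>{..<L}\<times>{..<n}. d (fst q) (snd q) * nrm ?I (\<psi> (fst q) (snd q)))"
      by (simp add: sum_pair)
    also have "\<dots> \<le> sqrt (\<Sum>q\<in>{..<L}\<times>{..<n}. (d (fst q) (snd q))\<^sup>2) * sqrt (\<Sum>q\<in>{..<L}\<times>{..<n}. (nrm ?I (\<psi> (fst q) (snd q)))\<^sup>2)"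
      by (rule sum_mult_le_sqrt)
    also have "\<dots> \<le> sqrt (\<Delta> + \<eta>) * sqrt 1"
    proof (intro mult_mono real_sqrt_le_mono)
      show "(\<Sum>q\<in>{..<L}\<times>{..<n}. (d (fst q) (snd q))\<^sup>2) \<le> \<Delta> + \<eta>"
        using close by (simp add: d_def nrm_sq sum_pair)
      show "(\<Sum>q\<in>{..<L}\<times>{..<n}. (nrm ?I (\<psi> (fst q) (snd q)))\<^sup>2) \<le> 1"
        using total by (simp add: nrm_sq sum_pair)
      have "0 \<le> (\<Sum>q\<in>{..<L}\<times>{..<n}. (d (fst q) (snd q))\<^sup>2)" by (simp add: sum_nonneg)
      also have "\<dots> \<le> \<Delta> + \<eta>"
        using close by (simp add: d_def nrm_sq sum_pair)
      finally show "0 \<le> sqrt (\<Delta> + \<eta>)" by simp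
    qed (auto intro: sum_nonneg)
    finally show ?thesis by simp
  qed
  show ?thesis
  proof (intro exI[of _ f] conjI allI impI)
    fix W assume "\<forall>z<K. contraction ?I (W z)"
    then have W: "\<And>z. z < K \<Longrightarrow> contraction ?I (W z)" by blast
    define A where "A = (\<Sum>z<K. \<Sum>a<L. of_real (c a z) * (\<Sum>\<mu><n. bil ?I (W z) (\<psi> a \<mu>) (\<psi> a \<mu>)))"
    define B where "B = (\<Sum>z<K. \<Sum>a<L. of_real (c a z) * (\<Sum>\<mu><n. bil ?I (W z) (\<phi> a \<mu>) (\<phi> a \<mu>)))"
    have "cmod A \<le> cmod (A - B) + cmod B" using norm_triangle_ineq[of "A - B" B] by simp
    also have "\<dots> \<le> 4 * sqrt (\<Delta> + \<eta>) + sqrt (2 * card T * \<gamma> * (real K - 1) / L)"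
      unfolding A_def B_def by (intro add_mono diff main W)
    finally show "cmod (\<Sum>z<K. \<Sum>a<L. of_real ((if f a = z then 1 else 0) - 1 / real K) *
        (\<Sum>\<mu><n. bil ?I (W z) (\<psi> a \<mu>) (\<psi> a \<mu>))) \<le> 4 * sqrt (\<Delta> + \<eta>) + sqrt (2 * card T * \<gamma> * (real K - 1) / L)"
      unfolding A_def c_def .
  qed (use f in blast)
qed

section \<open>Public communication protocols\<close>

fun box :: "tri \<Rightarrow> tri set" where
  "box (dA, dB, dE) = {..<dA} \<times> {..<dB} \<times> {..<dE}"

lemma finite_box [simp]: "finite (box D)" by (cases D) simp

lemma idx_less: "i < m \<Longrightarrow> j < n \<Longrightarrow> i * n + j < m * (n :: nat)"
proof -
  assume "i < m" "j < n"
  then have "i * n + j < Suc i * n" by simp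
  also have "Suc i * n \<le> m * n" using \<open>i < m\<close> by (intro mult_right_mono) auto
  finally show "i * n + j < m * n" .
qed

lemma idx_div: "j < n \<Longrightarrow> (i * n + j) div n = (i :: nat)" by simp

lemma idx_mod: "j < n \<Longrightarrow> (i * n + j) mod n = (j :: nat)" by simp

lemma dec_enc: "s \<in> box D \<Longrightarrow> dec D (enc D s) = s"
  by (cases D; cases s) auto

lemma enc_less: "s \<in> box D \<Longrightarrow> enc D s < tdim D"
  by (cases D; cases s) (auto intro!: idx_less)

lemma dec_box: "x < tdim D \<Longrightarrow> dec D x \<in> box D"
proof (cases D)
  case (fields dA dB dE)
  assume x: "x < tdim D"
  then have "x div dE < dA * dB" unfolding fields by (simp add: less_mult_imp_div_less)
  then have "x div dE div dB < dA" "0 < dB" by (simp_all add: less_mult_imp_div_less) (metis less_nat_zero_code mult_0_right gr0I)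
  moreover have "0 < dE" using x unfolding fields by (cases dE) auto
  ultimately show ?thesis unfolding fields by simp
qed

lemma enc_dec: "x < tdim D \<Longrightarrow> enc D (dec D x) = x"
  by (cases D) simp

lemma bij_enc: "bij_betw (enc D) (box D) {..<tdim D}"
  by (rule bij_betw_byWitness[where f' = "dec D"]) (auto simp: dec_enc enc_dec enc_less dec_box)

lemma tmat_carrier [simp]: "tmat D f \<in> carrier_mat (tdim D) (tdim D)"
  by (simp add: tmat_def)

lemma tent_tmat: "s \<in> box D \<Longrightarrow> t \<in> box D \<Longrightarrow> tent D (tmat D f) s t = f s t"
  by (simp add: tent_def tmat_def enc_less dec_enc)

lemma tent_add:
  "X \<in> carrier_mat (tdim D) (tdim D) \<Longrightarrow> Y \<in> carrier_mat (tdim D) (tdim D) \<Longrightarrow> s \<in> box D \<Longrightarrow> t \<in> box D \<Longrightarrow>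
    tent D (X + Y) s t = tent D X s t + tent D Y s t"
  by (simp add: tent_def enc_less)

lemma tent_smult:
  "X \<in> carrier_mat (tdim D) (tdim D) \<Longrightarrow> s \<in> box D \<Longrightarrow> t \<in> box D \<Longrightarrow>
    tent D (c \<cdot>\<^sub>m X) s t = c * tent D X s t"
  by (simp add: tent_def enc_less)

lemma mat_eq_tent:
  assumes "X \<in> carrier_mat (tdim D) (tdim D)" "Y \<in> carrier_mat (tdim D) (tdim D)"
    and "\<And>s t. s \<in> box D \<Longrightarrow> t \<in> box D \<Longrightarrow> tent D X s t = tent D Y s t"
  shows "X = Y"
proof (rule eq_matI)
  fix i j assume "i < dim_row Y" "j < dim_col Y"
  then have "i < tdim D" "j < tdim D" using assms by auto
  then show "X $$ (i, j) = Y $$ (i, j)"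
    using assms(3)[OF dec_box dec_box, of i j] by (simp add: tent_def enc_dec)
qed (use assms in auto)

lemma psd_tent:
  assumes "X \<in> carrier_mat (tdim D) (tdim D)"
  shows "psd (tdim D) X \<longleftrightarrow> posf (box D) (tent D X)"
proof -
  have "posf (box D) (\<lambda>x y. X $$ (enc D x, enc D y)) \<longleftrightarrow> posf {..<tdim D} (\<lambda>i j. X $$ (i, j))"
    by (rule posf_reindex[OF bij_enc, where f = "\<lambda>i j. X $$ (i, j)"]) simp
  then show ?thesis using assms by (simp add: psd_iff tent_def[abs_def])
qed

lemma mtrace_tent:
  assumes "X \<in> carrier_mat (tdim D) (tdim D)"
  shows "mtrace X = (\<Sum>s\<in>box D. tent D X s s)"
  using assms sum.reindex_bij_betw[OF bij_enc, of "\<lambda>i. X $$ (i, i)" D]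
  by (simp add: mtrace_def tent_def)

lemma sum_box: "(\<Sum>s\<in>box (dA, dB, dE). F s) = (\<Sum>a<dA. \<Sum>b<dB. \<Sum>e<dE. F (a, b, e))"
  by (simp add: sum_pair)

section \<open>Linearity, trace and positivity of local operations\<close>

definition linear_op :: "nat \<Rightarrow> nat \<Rightarrow> (complex mat \<Rightarrow> complex mat) \<Rightarrow> bool" where
  "linear_op d d' \<Phi> \<longleftrightarrow> (\<forall>X \<in> carrier_mat d d. \<Phi> X \<in> carrier_mat d' d') \<and>
     (\<forall>X \<in> carrier_mat d d. \<forall>Y \<in> carrier_mat d d. \<Phi> (X + Y) = \<Phi> X + \<Phi> Y) \<and>
     (\<forall>c. \<forall>X \<in> carrier_mat d d. \<Phi> (c \<cdot>\<^sub>m X) = c \<cdot>\<^sub>m \<Phi> X)"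

lemma linear_opD:
  assumes "linear_op d d' \<Phi>"
  shows "X \<in> carrier_mat d d \<Longrightarrow> \<Phi> X \<in> carrier_mat d' d'"
    "X \<in> carrier_mat d d \<Longrightarrow> Y \<in> carrier_mat d d \<Longrightarrow> \<Phi> (X + Y) = \<Phi> X + \<Phi> Y"
    "X \<in> carrier_mat d d \<Longrightarrow> \<Phi> (c \<cdot>\<^sub>m X) = c \<cdot>\<^sub>m \<Phi> X"
  using assms by (auto simp: linear_op_def)

lemma cptp_linear: "cptp d d' \<Phi> \<Longrightarrow> linear_op d d' \<Phi>"
  by (simp add: cptp_def linear_op_def)

lemma linear_op_comp: "linear_op d d' \<Phi> \<Longrightarrow> linear_op d' d'' \<Psi> \<Longrightarrow> linear_op d d'' (\<lambda>X. \<Psi> (\<Phi> X))"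
  by (simp add: linear_op_def)

definition trace_factor :: "nat \<Rightarrow> complex \<Rightarrow> (complex mat \<Rightarrow> complex mat) \<Rightarrow> bool" where
  "trace_factor d c \<Phi> \<longleftrightarrow> (\<forall>X \<in> carrier_mat d d. mtrace (\<Phi> X) = c * mtrace X)"

definition positive_op :: "nat \<Rightarrow> nat \<Rightarrow> (complex mat \<Rightarrow> complex mat) \<Rightarrow> bool" where
  "positive_op d d' \<Phi> \<longleftrightarrow> (\<forall>X. psd d X \<longrightarrow> psd d' (\<Phi> X))"

lemma mat_add: "mat d d (\<lambda>(x, y). f x y + g x y) = mat d d (\<lambda>(x, y). f x y) + mat d d (\<lambda>(x, y). g x y)"
  by (intro eq_matI) auto

lemma mat_smult: "mat d d (\<lambda>(x, y). c * f x y) = c \<cdot>\<^sub>m mat d d (\<lambda>(x, y). f x y)"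
  by (intro eq_matI) auto

lemma mat_index_add: "(B :: complex mat) \<in> carrier_mat n n \<Longrightarrow> i < n \<Longrightarrow> j < n \<Longrightarrow> (A + B) $$ (i, j) = A $$ (i, j) + B $$ (i, j)"
  by simp

lemma mat_index_smult: "(A :: complex mat) \<in> carrier_mat n n \<Longrightarrow> i < n \<Longrightarrow> j < n \<Longrightarrow> (k \<cdot>\<^sub>m A) $$ (i, j) = k * A $$ (i, j)"
  by simp

context
  fixes dA dB dE d' :: nat and \<Phi> :: "complex mat \<Rightarrow> complex mat"
begin

definition blockA :: "complex mat \<Rightarrow> nat \<Rightarrow> nat \<Rightarrow> nat \<Rightarrow> nat \<Rightarrow> complex mat" where
  "blockA X b e b' e' = mat dA dA (\<lambda>(x, x'). tent (dA, dB, dE) X (x, b, e) (x', b', e'))"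

definition blockB :: "complex mat \<Rightarrow> nat \<Rightarrow> nat \<Rightarrow> nat \<Rightarrow> nat \<Rightarrow> complex mat" where
  "blockB X a e a' e' = mat dB dB (\<lambda>(y, y'). tent (dA, dB, dE) X (a, y, e) (a', y', e'))"

lemma blockA_carrier: "blockA X b e b' e' \<in> carrier_mat dA dA" by (simp add: blockA_def)

lemma blockB_carrier: "blockB X b e b' e' \<in> carrier_mat dB dB" by (simp add: blockB_def)

lemma tent_local_A:
  assumes "(a, b, e) \<in> box (d', dB, dE)" "(a', b', e') \<in> box (d', dB, dE)"
  shows "tent (d', dB, dE) (local_A (dA, dB, dE) d' \<Phi> X) (a, b, e) (a', b', e') = \<Phi> (blockA X b e b' e') $$ (a, a')"
  using tent_tmat[OF assms] by (simp add: blockA_def)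

lemma tent_local_B:
  assumes "(a, b, e) \<in> box (dA, d', dE)" "(a', b', e') \<in> box (dA, d', dE)"
  shows "tent (dA, d', dE) (local_B (dA, dB, dE) d' \<Phi> X) (a, b, e) (a', b', e') = \<Phi> (blockB X a e a' e') $$ (b, b')"
  using tent_tmat[OF assms] by (simp add: blockB_def)

lemma linear_local_A:
  assumes "linear_op dA d' \<Phi>"
  shows "linear_op (tdim (dA, dB, dE)) (tdim (d', dB, dE)) (local_A (dA, dB, dE) d' \<Phi>)"
  unfolding linear_op_def
proof (intro conjI ballI allI)
  show c: "local_A (dA, dB, dE) d' \<Phi> X \<in> carrier_mat (tdim (d', dB, dE)) (tdim (d', dB, dE))" for X
    unfolding local_A.simps by (rule tmat_carrier)
  note L = linear_opD[OF assms]
  fix X :: "complex mat" assume X: "X \<in> carrier_mat (tdim (dA, dB, dE)) (tdim (dA, dB, dE))"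
  { fix Y :: "complex mat" assume Y: "Y \<in> carrier_mat (tdim (dA, dB, dE)) (tdim (dA, dB, dE))"
    have add: "blockA (X + Y) b e b' e' = blockA X b e b' e' + blockA Y b e b' e'"
      if "b < dB" "e < dE" "b' < dB" "e' < dE" for b e b' e'
      unfolding blockA_def mat_add[symmetric] using tent_add[OF X Y] that by (intro eq_matI) auto
    show "local_A (dA, dB, dE) d' \<Phi> (X + Y) = local_A (dA, dB, dE) d' \<Phi> X + local_A (dA, dB, dE) d' \<Phi> Y"
    proof (rule mat_eq_tent[OF c add_carrier_mat[OF c]])
      fix s t assume s: "s \<in> box (d', dB, dE)" and t: "t \<in> box (d', dB, dE)"
      obtain a b e a' b' e' where st: "s = (a, b, e)" "t = (a', b', e')" by (cases s; cases t) auto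
      show "tent (d', dB, dE) (local_A (dA, dB, dE) d' \<Phi> (X + Y)) s t =
        tent (d', dB, dE) (local_A (dA, dB, dE) d' \<Phi> X + local_A (dA, dB, dE) d' \<Phi> Y) s t"
        unfolding tent_add[OF c c s t] using s t L(1)[OF blockA_carrier] unfolding st
        by (simp add: tent_local_A add L(2)[OF blockA_carrier blockA_carrier] mat_index_add[OF L(1)[OF blockA_carrier]] del: local_A.simps)
    qed }
  fix k
  have sm: "blockA (k \<cdot>\<^sub>m X) b e b' e' = k \<cdot>\<^sub>m blockA X b e b' e'"
    if "b < dB" "e < dE" "b' < dB" "e' < dE" for b e b' e'
    unfolding blockA_def mat_smult[symmetric] using tent_smult[OF X] that by (intro eq_matI) auto
  show "local_A (dA, dB, dE) d' \<Phi> (k \<cdot>\<^sub>m X) = k \<cdot>\<^sub>m local_A (dA, dB, dE) d' \<Phi> X"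
  proof (rule mat_eq_tent[OF c smult_carrier_mat[OF c]])
    fix s t assume s: "s \<in> box (d', dB, dE)" and t: "t \<in> box (d', dB, dE)"
    obtain a b e a' b' e' where st: "s = (a, b, e)" "t = (a', b', e')" by (cases s; cases t) auto
    show "tent (d', dB, dE) (local_A (dA, dB, dE) d' \<Phi> (k \<cdot>\<^sub>m X)) s t =
      tent (d', dB, dE) (k \<cdot>\<^sub>m local_A (dA, dB, dE) d' \<Phi> X) s t"
      unfolding tent_smult[OF c s t] using s t L(1)[OF blockA_carrier] unfolding st
      by (simp add: tent_local_A sm L(3)[OF blockA_carrier] mat_index_smult[OF L(1)[OF blockA_carrier]] del: local_A.simps)
  qed
qed

lemma linear_local_B:
  assumes "linear_op dB d' \<Phi>"
  shows "linear_op (tdim (dA, dB, dE)) (tdim (dA, d', dE)) (local_B (dA, dB, dE) d' \<Phi>)"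
  unfolding linear_op_def
proof (intro conjI ballI allI)
  show c: "local_B (dA, dB, dE) d' \<Phi> X \<in> carrier_mat (tdim (dA, d', dE)) (tdim (dA, d', dE))" for X
    unfolding local_B.simps by (rule tmat_carrier)
  note L = linear_opD[OF assms]
  fix X :: "complex mat" assume X: "X \<in> carrier_mat (tdim (dA, dB, dE)) (tdim (dA, dB, dE))"
  { fix Y :: "complex mat" assume Y: "Y \<in> carrier_mat (tdim (dA, dB, dE)) (tdim (dA, dB, dE))"
    have add: "blockB (X + Y) b e b' e' = blockB X b e b' e' + blockB Y b e b' e'"
      if "b < dA" "e < dE" "b' < dA" "e' < dE" for b e b' e'
      unfolding blockB_def mat_add[symmetric] using tent_add[OF X Y] that by (intro eq_matI) auto
    show "local_B (dA, dB, dE) d' \<Phi> (X + Y) = local_B (dA, dB, dE) d' \<Phi> X + local_B (dA, dB, dE) d' \<Phi> Y"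
    proof (rule mat_eq_tent[OF c add_carrier_mat[OF c]])
      fix s t assume s: "s \<in> box (dA, d', dE)" and t: "t \<in> box (dA, d', dE)"
      obtain a b e a' b' e' where st: "s = (a, b, e)" "t = (a', b', e')" by (cases s; cases t) auto
      show "tent (dA, d', dE) (local_B (dA, dB, dE) d' \<Phi> (X + Y)) s t =
        tent (dA, d', dE) (local_B (dA, dB, dE) d' \<Phi> X + local_B (dA, dB, dE) d' \<Phi> Y) s t"
        unfolding tent_add[OF c c s t] using s t L(1)[OF blockB_carrier] unfolding st
        by (simp add: tent_local_B add L(2)[OF blockB_carrier blockB_carrier] mat_index_add[OF L(1)[OF blockB_carrier]] del: local_B.simps)
    qed }
  fix k
  have sm: "blockB (k \<cdot>\<^sub>m X) b e b' e' = k \<cdot>\<^sub>m blockB X b e b' e'"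
    if "b < dA" "e < dE" "b' < dA" "e' < dE" for b e b' e'
    unfolding blockB_def mat_smult[symmetric] using tent_smult[OF X] that by (intro eq_matI) auto
  show "local_B (dA, dB, dE) d' \<Phi> (k \<cdot>\<^sub>m X) = k \<cdot>\<^sub>m local_B (dA, dB, dE) d' \<Phi> X"
  proof (rule mat_eq_tent[OF c smult_carrier_mat[OF c]])
    fix s t assume s: "s \<in> box (dA, d', dE)" and t: "t \<in> box (dA, d', dE)"
    obtain a b e a' b' e' where st: "s = (a, b, e)" "t = (a', b', e')" by (cases s; cases t) auto
    show "tent (dA, d', dE) (local_B (dA, dB, dE) d' \<Phi> (k \<cdot>\<^sub>m X)) s t =
      tent (dA, d', dE) (k \<cdot>\<^sub>m local_B (dA, dB, dE) d' \<Phi> X) s t"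
      unfolding tent_smult[OF c s t] using s t L(1)[OF blockB_carrier] unfolding st
      by (simp add: tent_local_B sm L(3)[OF blockB_carrier] mat_index_smult[OF L(1)[OF blockB_carrier]] del: local_B.simps)
  qed
qed

lemma trace_local_A:
  assumes "cptp dA d' \<Phi>"
  shows "trace_factor (tdim (dA, dB, dE)) 1 (local_A (dA, dB, dE) d' \<Phi>)"
  unfolding trace_factor_def
proof
  fix X :: "complex mat" assume X: "X \<in> carrier_mat (tdim (dA, dB, dE)) (tdim (dA, dB, dE))"
  have c: "local_A (dA, dB, dE) d' \<Phi> X \<in> carrier_mat (tdim (d', dB, dE)) (tdim (d', dB, dE))"
    unfolding local_A.simps by (rule tmat_carrier)
  have t: "(\<Sum>a<d'. \<Phi> (blockA X b e b e) $$ (a, a)) = (\<Sum>x<dA. tent (dA, dB, dE) X (x, b, e) (x, b, e))" for b e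
  proof -
    have "mtrace (\<Phi> (blockA X b e b e)) = mtrace (blockA X b e b e)" "\<Phi> (blockA X b e b e) \<in> carrier_mat d' d'"
      using assms blockA_carrier by (auto simp: cptp_def)
    then show ?thesis by (simp add: mtrace_def blockA_def)
  qed
  have "mtrace (local_A (dA, dB, dE) d' \<Phi> X) = (\<Sum>a<d'. \<Sum>b<dB. \<Sum>e<dE. \<Phi> (blockA X b e b e) $$ (a, a))"
    unfolding mtrace_tent[OF c] sum_box by (intro sum.cong refl tent_local_A) auto
  also have "\<dots> = (\<Sum>b<dB. \<Sum>a<d'. \<Sum>e<dE. \<Phi> (blockA X b e b e) $$ (a, a))" by (rule sum.swap)
  also have "\<dots> = (\<Sum>b<dB. \<Sum>e<dE. \<Sum>a<d'. \<Phi> (blockA X b e b e) $$ (a, a))"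
    by (rule sum.cong[OF refl]) (rule sum.swap)
  also have "\<dots> = (\<Sum>b<dB. \<Sum>e<dE. \<Sum>a<dA. tent (dA, dB, dE) X (a, b, e) (a, b, e))" by (simp only: t)
  also have "\<dots> = (\<Sum>b<dB. \<Sum>a<dA. \<Sum>e<dE. tent (dA, dB, dE) X (a, b, e) (a, b, e))"
    by (rule sum.cong[OF refl]) (rule sum.swap)
  also have "\<dots> = (\<Sum>a<dA. \<Sum>b<dB. \<Sum>e<dE. tent (dA, dB, dE) X (a, b, e) (a, b, e))" by (rule sum.swap)
  also have "\<dots> = mtrace X" unfolding mtrace_tent[OF X] sum_box ..
  finally show "mtrace (local_A (dA, dB, dE) d' \<Phi> X) = 1 * mtrace X" by simp
qed

lemma trace_local_B:
  assumes "cptp dB d' \<Phi>"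
  shows "trace_factor (tdim (dA, dB, dE)) 1 (local_B (dA, dB, dE) d' \<Phi>)"
  unfolding trace_factor_def
proof
  fix X :: "complex mat" assume X: "X \<in> carrier_mat (tdim (dA, dB, dE)) (tdim (dA, dB, dE))"
  have c: "local_B (dA, dB, dE) d' \<Phi> X \<in> carrier_mat (tdim (dA, d', dE)) (tdim (dA, d', dE))"
    unfolding local_B.simps by (rule tmat_carrier)
  have t: "(\<Sum>b<d'. \<Phi> (blockB X a e a e) $$ (b, b)) = (\<Sum>x<dB. tent (dA, dB, dE) X (a, x, e) (a, x, e))" for a e
  proof -
    have "mtrace (\<Phi> (blockB X a e a e)) = mtrace (blockB X a e a e)" "\<Phi> (blockB X a e a e) \<in> carrier_mat d' d'"
      using assms blockB_carrier by (auto simp: cptp_def)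
    then show ?thesis by (simp add: mtrace_def blockB_def)
  qed
  have "mtrace (local_B (dA, dB, dE) d' \<Phi> X) = (\<Sum>a<dA. \<Sum>b<d'. \<Sum>e<dE. \<Phi> (blockB X a e a e) $$ (b, b))"
    unfolding mtrace_tent[OF c] sum_box by (intro sum.cong refl tent_local_B) auto
  also have "\<dots> = (\<Sum>a<dA. \<Sum>e<dE. \<Sum>b<d'. \<Phi> (blockB X a e a e) $$ (b, b))"
    by (rule sum.cong[OF refl]) (rule sum.swap)
  also have "\<dots> = (\<Sum>a<dA. \<Sum>e<dE. \<Sum>b<dB. tent (dA, dB, dE) X (a, b, e) (a, b, e))" by (simp only: t)
  also have "\<dots> = (\<Sum>a<dA. \<Sum>b<dB. \<Sum>e<dE. tent (dA, dB, dE) X (a, b, e) (a, b, e))"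
    by (rule sum.cong[OF refl]) (rule sum.swap)
  also have "\<dots> = mtrace X" unfolding mtrace_tent[OF X] sum_box ..
  finally show "mtrace (local_B (dA, dB, dE) d' \<Phi> X) = 1 * mtrace X" by simp
qed

end

lemma psd_carrier: "psd d X \<Longrightarrow> X \<in> carrier_mat d d"
  by (simp add: psd_def)

text \<open>\<open>ampliation\<close> has the ancilla as first factor, whereas Alice's system comes
  first in the triple. The basis is therefore reordered by \<open>h\<close>, with Bob and Eve
  together as the ancilla, and the result is read back in the old order through
  \<open>k\<close>.\<close>

lemma positive_local_A:
  assumes "cptp dA d' \<Phi>"
  shows "positive_op (tdim (dA, dB, dE)) (tdim (d', dB, dE)) (local_A (dA, dB, dE) d' \<Phi>)"
  unfolding positive_op_def
proof (intro allI impI)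
  fix X assume X: "psd (tdim (dA, dB, dE)) X"
  note Xc = psd_carrier[OF X]
  define h where "h i = (i mod dA, i div dA div dE, i div dA mod dE)" for i
  define Y where "Y = mat (dB * dE * dA) (dB * dE * dA) (\<lambda>(i, j). tent (dA, dB, dE) X (h i) (h j))"
  have hb: "h ` {..<dB * dE * dA} \<subseteq> box (dA, dB, dE)"
  proof
    fix s assume "s \<in> h ` {..<dB * dE * dA}"
    then obtain i where i: "s = h i" "i < dB * dE * dA" by auto
    then have "0 < dA" "0 < dE" by (auto intro!: gr0I)
    then show "s \<in> box (dA, dB, dE)" using i by (simp add: h_def less_mult_imp_div_less)
  qed
  have "posf {..<dB * dE * dA} (\<lambda>i j. tent (dA, dB, dE) X (h i) (h j))"
    using posf_pullback[of "box (dA, dB, dE)" "tent (dA, dB, dE) X" "{..<dB * dE * dA}" h] X psd_tent[OF Xc] hb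
      finite_box[of "(dA, dB, dE)"] by blast
  moreover have "posf {..<dB * dE * dA} (\<lambda>i j. Y $$ (i, j)) = posf {..<dB * dE * dA} (\<lambda>i j. tent (dA, dB, dE) X (h i) (h j))"
    by (rule posf_cong) (simp add: Y_def)
  ultimately have "psd (dB * dE * dA) Y" by (simp add: psd_iff Y_def)
  then have "psd (dB * dE * d') (ampliation (dB * dE) dA d' \<Phi> Y)"
    using assms unfolding cptp_def completely_positive_def by blast
  then have pa: "posf {..<dB * dE * d'} (\<lambda>i j. ampliation (dB * dE) dA d' \<Phi> Y $$ (i, j))"
    by (simp add: psd_iff)
  define k where "k = (\<lambda>(a, b, e). (b * dE + e) * d' + a)"
  have c: "local_A (dA, dB, dE) d' \<Phi> X \<in> carrier_mat (tdim (d', dB, dE)) (tdim (d', dB, dE))"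
    unfolding local_A.simps by (rule tmat_carrier)
  have kb: "k ` box (d', dB, dE) \<subseteq> {..<dB * dE * d'}"
    by (auto simp: k_def intro!: idx_less)
  have "posf (box (d', dB, dE)) (\<lambda>s t. ampliation (dB * dE) dA d' \<Phi> Y $$ (k s, k t))"
    by (rule posf_pullback[OF pa _ _ kb]) auto
  moreover have "posf (box (d', dB, dE)) (tent (d', dB, dE) (local_A (dA, dB, dE) d' \<Phi> X))
      = posf (box (d', dB, dE)) (\<lambda>s t. ampliation (dB * dE) dA d' \<Phi> Y $$ (k s, k t))"
  proof (rule posf_cong)
    fix s t assume s: "s \<in> box (d', dB, dE)" and t: "t \<in> box (d', dB, dE)"
    obtain a b e a' b' e' where st: "s = (a, b, e)" "t = (a', b', e')" by (cases s; cases t) auto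
    have r: "a < d'" "b < dB" "e < dE" "a' < d'" "b' < dB" "e' < dE" using s t st by auto
    have kst: "k s < dB * dE * d'" "k t < dB * dE * d'" using kb s t by auto
    have "ampliation (dB * dE) dA d' \<Phi> Y $$ (k s, k t) =
       \<Phi> (mat dA dA (\<lambda>(y, y'). Y $$ (k s div d' * dA + y, k t div d' * dA + y'))) $$ (k s mod d', k t mod d')"
      using kst by (simp add: ampliation_def)
    also have "mat dA dA (\<lambda>(y, y'). Y $$ (k s div d' * dA + y, k t div d' * dA + y')) = blockA dA dB dE X b e b' e'"
    proof (rule eq_matI)
      fix y y' assume "y < dim_row (blockA dA dB dE X b e b' e')" "y' < dim_col (blockA dA dB dE X b e b' e')"
      then have y: "y < dA" "y' < dA" by (auto simp: blockA_def)
      have i: "(b * dE + e) * dA + y < dB * dE * dA" "(b' * dE + e') * dA + y' < dB * dE * dA"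
        using r y by (auto intro!: idx_less)
      show "mat dA dA (\<lambda>(y, y'). Y $$ (k s div d' * dA + y, k t div d' * dA + y')) $$ (y, y') = blockA dA dB dE X b e b' e' $$ (y, y')"
        using y i r by (simp add: st k_def Y_def blockA_def h_def)
    qed (auto simp: blockA_def)
    finally show "tent (d', dB, dE) (local_A (dA, dB, dE) d' \<Phi> X) s t = ampliation (dB * dE) dA d' \<Phi> Y $$ (k s, k t)"
      unfolding st using r by (subst tent_local_A) (auto simp: k_def)
  qed
  ultimately show "psd (tdim (d', dB, dE)) (local_A (dA, dB, dE) d' \<Phi> X)"
    unfolding psd_tent[OF c] by simp
qed

lemma positive_local_B:
  assumes "cptp dB d' \<Phi>"
  shows "positive_op (tdim (dA, dB, dE)) (tdim (dA, d', dE)) (local_B (dA, dB, dE) d' \<Phi>)"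
  unfolding positive_op_def
proof (intro allI impI)
  fix X assume X: "psd (tdim (dA, dB, dE)) X"
  note Xc = psd_carrier[OF X]
  define h where "h i = (i div dB div dE, i mod dB, i div dB mod dE)" for i
  define Y where "Y = mat (dA * dE * dB) (dA * dE * dB) (\<lambda>(i, j). tent (dA, dB, dE) X (h i) (h j))"
  have hb: "h ` {..<dA * dE * dB} \<subseteq> box (dA, dB, dE)"
  proof
    fix s assume "s \<in> h ` {..<dA * dE * dB}"
    then obtain i where i: "s = h i" "i < dA * dE * dB" by auto
    then have "0 < dB" "0 < dE" by (auto intro!: gr0I)
    then show "s \<in> box (dA, dB, dE)" using i by (simp add: h_def less_mult_imp_div_less)
  qed
  have "posf {..<dA * dE * dB} (\<lambda>i j. tent (dA, dB, dE) X (h i) (h j))"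
    using posf_pullback[of "box (dA, dB, dE)" "tent (dA, dB, dE) X" "{..<dA * dE * dB}" h] X psd_tent[OF Xc] hb
      finite_box[of "(dA, dB, dE)"] by blast
  moreover have "posf {..<dA * dE * dB} (\<lambda>i j. Y $$ (i, j)) = posf {..<dA * dE * dB} (\<lambda>i j. tent (dA, dB, dE) X (h i) (h j))"
    by (rule posf_cong) (simp add: Y_def)
  ultimately have "psd (dA * dE * dB) Y" by (simp add: psd_iff Y_def)
  then have "psd (dA * dE * d') (ampliation (dA * dE) dB d' \<Phi> Y)"
    using assms unfolding cptp_def completely_positive_def by blast
  then have pa: "posf {..<dA * dE * d'} (\<lambda>i j. ampliation (dA * dE) dB d' \<Phi> Y $$ (i, j))"
    by (simp add: psd_iff)
  define k where "k = (\<lambda>(a, b, e). (a * dE + e) * d' + b)"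
  have c: "local_B (dA, dB, dE) d' \<Phi> X \<in> carrier_mat (tdim (dA, d', dE)) (tdim (dA, d', dE))"
    unfolding local_B.simps by (rule tmat_carrier)
  have kb: "k ` box (dA, d', dE) \<subseteq> {..<dA * dE * d'}"
    by (auto simp: k_def intro!: idx_less)
  have "posf (box (dA, d', dE)) (\<lambda>s t. ampliation (dA * dE) dB d' \<Phi> Y $$ (k s, k t))"
    by (rule posf_pullback[OF pa _ _ kb]) auto
  moreover have "posf (box (dA, d', dE)) (tent (dA, d', dE) (local_B (dA, dB, dE) d' \<Phi> X))
      = posf (box (dA, d', dE)) (\<lambda>s t. ampliation (dA * dE) dB d' \<Phi> Y $$ (k s, k t))"
  proof (rule posf_cong)
    fix s t assume s: "s \<in> box (dA, d', dE)" and t: "t \<in> box (dA, d', dE)"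
    obtain a b e a' b' e' where st: "s = (a, b, e)" "t = (a', b', e')" by (cases s; cases t) auto
    have r: "a < dA" "b < d'" "e < dE" "a' < dA" "b' < d'" "e' < dE" using s t st by auto
    have kst: "k s < dA * dE * d'" "k t < dA * dE * d'" using kb s t by auto
    have "ampliation (dA * dE) dB d' \<Phi> Y $$ (k s, k t) =
       \<Phi> (mat dB dB (\<lambda>(y, y'). Y $$ (k s div d' * dB + y, k t div d' * dB + y'))) $$ (k s mod d', k t mod d')"
      using kst by (simp add: ampliation_def)
    also have "mat dB dB (\<lambda>(y, y'). Y $$ (k s div d' * dB + y, k t div d' * dB + y')) = blockB dA dB dE X a e a' e'"
    proof (rule eq_matI)
      fix y y' assume "y < dim_row (blockB dA dB dE X a e a' e')" "y' < dim_col (blockB dA dB dE X a e a' e')"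
      then have y: "y < dB" "y' < dB" by (auto simp: blockB_def)
      have i: "(a * dE + e) * dB + y < dA * dE * dB" "(a' * dE + e') * dB + y' < dA * dE * dB"
        using r y by (auto intro!: idx_less)
      show "mat dB dB (\<lambda>(y, y'). Y $$ (k s div d' * dB + y, k t div d' * dB + y')) $$ (y, y') = blockB dA dB dE X a e a' e' $$ (y, y')"
        using y i r by (simp add: st k_def Y_def blockB_def h_def)
    qed (auto simp: blockB_def)
    finally show "tent (dA, d', dE) (local_B (dA, dB, dE) d' \<Phi> X) s t = ampliation (dA * dE) dB d' \<Phi> Y $$ (k s, k t)"
      unfolding st using r by (subst tent_local_B) (auto simp: k_def)
  qed
  ultimately show "psd (tdim (dA, d', dE)) (local_B (dA, dB, dE) d' \<Phi> X)"
    unfolding psd_tent[OF c] by simp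
qed

text \<open>Both directions of public communication have the form
  \<open>X \<mapsto> [s, t \<in> B \<and> r s = r t] X(h s, h t)\<close>, with \<open>r\<close> the value of the message.\<close>

definition copy_op :: "tri \<Rightarrow> tri \<Rightarrow> nat \<Rightarrow> tri set \<Rightarrow> (tri \<Rightarrow> nat) \<Rightarrow> (tri \<Rightarrow> tri) \<Rightarrow> complex mat \<Rightarrow> complex mat" where
  "copy_op D D' m B r h X = tmat D' (\<lambda>s t. if s \<in> B \<and> t \<in> B \<and> r s = r t then tent D X (h s) (h t) else 0)"

lemma linear_copy_op:
  assumes h: "h ` (box D' \<inter> B) \<subseteq> box D"
  shows "linear_op (tdim D) (tdim D') (copy_op D D' m B r h)"
  unfolding linear_op_def
proof (intro conjI ballI allI)
  show c: "copy_op D D' m B r h X \<in> carrier_mat (tdim D') (tdim D')" for X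
    unfolding copy_op_def by (rule tmat_carrier)
  have te: "tent D' (copy_op D D' m B r h X) s t = (if s \<in> B \<and> t \<in> B \<and> r s = r t then tent D X (h s) (h t) else 0)"
    if "s \<in> box D'" "t \<in> box D'" for X s t
    unfolding copy_op_def tent_tmat[OF that] ..
  fix X :: "complex mat" assume X: "X \<in> carrier_mat (tdim D) (tdim D)"
  { fix Y :: "complex mat" assume Y: "Y \<in> carrier_mat (tdim D) (tdim D)"
    show "copy_op D D' m B r h (X + Y) = copy_op D D' m B r h X + copy_op D D' m B r h Y"
      using h by (intro mat_eq_tent[OF c add_carrier_mat[OF c]])
        (auto simp: tent_add[OF c c] te intro!: tent_add[OF X Y]) }
  fix k
  show "copy_op D D' m B r h (k \<cdot>\<^sub>m X) = k \<cdot>\<^sub>m copy_op D D' m B r h X"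
    using h by (intro mat_eq_tent[OF c smult_carrier_mat[OF c]])
      (auto simp: tent_smult[OF c] te intro!: tent_smult[OF X])
qed

text \<open>The mask is the sum over message values \<open>i\<close> of \<open>g i s\<close> times
  \<open>g i t\<close>, so the output is a sum of diagonal conjugations of a pulled-back positive
  form.\<close>

lemma positive_copy_op:
  assumes h: "h ` (box D' \<inter> B) \<subseteq> box D" and r: "\<And>s. s \<in> box D' \<Longrightarrow> s \<in> B \<Longrightarrow> r s < m"
    and D: "box D' \<inter> B \<noteq> {} \<Longrightarrow> box D \<noteq> {}"
  shows "positive_op (tdim D) (tdim D') (copy_op D D' m B r h)"
  unfolding positive_op_def
proof (intro allI impI)
  fix X assume X: "psd (tdim D) X"
  have c: "copy_op D D' m B r h X \<in> carrier_mat (tdim D') (tdim D')"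
    unfolding copy_op_def by (rule tmat_carrier)
  have pX: "posf (box D) (tent D X)" using X psd_tent[OF psd_carrier[OF X]] by simp
  have te: "tent D' (copy_op D D' m B r h X) s t = (if s \<in> B \<and> t \<in> B \<and> r s = r t then tent D X (h s) (h t) else 0)"
    if "s \<in> box D'" "t \<in> box D'" for s t
    unfolding copy_op_def tent_tmat[OF that] ..
  show "psd (tdim D') (copy_op D D' m B r h X)"
  proof (cases "box D' \<inter> B = {}")
    case True
    have "posf (box D') (tent D' (copy_op D D' m B r h X)) = posf (box D') (\<lambda>_ _. 0)"
      using True by (intro posf_cong) (auto simp: te)
    then show ?thesis unfolding psd_tent[OF c] by (simp add: posf_def)
  next
    case False
    then obtain s0 where s0: "s0 \<in> box D" using D by blast
    \<comment> \<open>Outside \<open>B\<close> the mask vanishes; an arbitrary index is substituted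
      there so that the pullback stays within the index set.\<close>
    define h' where "h' s = (if s \<in> B then h s else s0)" for s
    define g :: "nat \<Rightarrow> tri \<Rightarrow> complex" where "g i s = (if s \<in> B \<and> r s = i then 1 else 0)" for i s
    have "posf (box D') (\<lambda>s t. tent D X (h' s) (h' t))"
      using h s0 by (intro posf_pullback[OF pX, of _ h']) (auto simp: h'_def)
    then have p: "posf (box D') (\<lambda>s t. \<Sum>i<m. cnj (g i s) * tent D X (h' s) (h' t) * g i t)"
      by (intro posf_sum posf_conj_diag)
    have "posf (box D') (tent D' (copy_op D D' m B r h X)) = posf (box D') (\<lambda>s t. \<Sum>i<m. cnj (g i s) * tent D X (h' s) (h' t) * g i t)"
    proof (rule posf_cong)
      fix s t assume s: "s \<in> box D'" and t: "t \<in> box D'"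
      have "(\<Sum>i<m. cnj (g i s) * tent D X (h' s) (h' t) * g i t)
        = (\<Sum>i<m. if i = r s then (if s \<in> B \<and> t \<in> B \<and> r s = r t then tent D X (h s) (h t) else 0) else 0)"
        by (intro sum.cong) (auto simp: g_def h'_def)
      also have "\<dots> = (if s \<in> B \<and> t \<in> B \<and> r s = r t then tent D X (h s) (h t) else 0)"
        using r[OF s] by (cases "s \<in> B") auto
      finally show "tent D' (copy_op D D' m B r h X) s t = (\<Sum>i<m. cnj (g i s) * tent D X (h' s) (h' t) * g i t)"
        using te[OF s t] by simp
    qed
    then show ?thesis unfolding psd_tent[OF c] using p by simp
  qed
qed

text \<open>The bijection matches the diagonal entries that survive the mask with all diagonal
  entries of the input.\<close>

lemma trace_copy_op:
  assumes b: "bij_betw h (box D' \<inter> B) (box D)"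
  shows "trace_factor (tdim D) 1 (copy_op D D' m B r h)"
  unfolding trace_factor_def
proof
  fix X :: "complex mat" assume X: "X \<in> carrier_mat (tdim D) (tdim D)"
  have c: "copy_op D D' m B r h X \<in> carrier_mat (tdim D') (tdim D')"
    unfolding copy_op_def by (rule tmat_carrier)
  have "mtrace (copy_op D D' m B r h X) = (\<Sum>s\<in>box D'. if s \<in> B then tent D X (h s) (h s) else 0)"
    unfolding mtrace_tent[OF c] by (intro sum.cong refl) (simp add: copy_op_def tent_tmat)
  also have "\<dots> = (\<Sum>s\<in>box D' \<inter> B. tent D X (h s) (h s))"
    by (simp add: sum.If_cases)
  also have "\<dots> = mtrace X" unfolding mtrace_tent[OF X] by (rule sum.reindex_bij_betw[OF b])
  finally show "mtrace (copy_op D D' m B r h X) = 1 * mtrace X" by simp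
qed

lemma public_AB_copy:
  "public_AB m (dA, dB, dE) = copy_op (dA * m, dB, dE) (dA * m, dB * m, dE * m) m
     {(a, b, e). b mod m = a mod m \<and> e mod m = a mod m} (\<lambda>(a, b, e). a mod m)
     (\<lambda>(a, b, e). (a, b div m, e div m))"
  unfolding copy_op_def public_AB.simps fun_eq_iff
  by (intro allI arg_cong[where f = "tmat _"] ext) (auto split: if_splits)

lemma public_BA_copy:
  "public_BA m (dA, dB, dE) = copy_op (dA, dB * m, dE) (dA * m, dB * m, dE * m) m
     {(a, b, e). a mod m = b mod m \<and> e mod m = b mod m} (\<lambda>(a, b, e). b mod m)
     (\<lambda>(a, b, e). (a div m, b, e div m))"
  unfolding copy_op_def public_BA.simps fun_eq_iff
  by (intro allI arg_cong[where f = "tmat _"] ext) (auto split: if_splits)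

lemma mult_pos_of_less: "i < d * (m :: nat) \<Longrightarrow> 0 < m" by (cases m) auto

lemma bij_copy_AB:
  assumes "0 < m"
  shows "bij_betw (\<lambda>(a, b, e). (a, b div m, e div m))
    (box (dA * m, dB * m, dE * m) \<inter> {(a, b, e). b mod m = a mod m \<and> e mod m = a mod m}) (box (dA * m, dB, dE))"
  using assms by (intro bij_betw_byWitness[where f' = "\<lambda>(a, b, e). (a, b * m + a mod m, e * m + a mod m)"])
    (auto simp: less_mult_imp_div_less intro!: idx_less, metis mod_div_mult_eq add.commute, metis mod_div_mult_eq add.commute)

lemma bij_copy_BA:
  assumes "0 < m"
  shows "bij_betw (\<lambda>(a, b, e). (a div m, b, e div m))
    (box (dA * m, dB * m, dE * m) \<inter> {(a, b, e). a mod m = b mod m \<and> e mod m = b mod m}) (box (dA, dB * m, dE))"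
  using assms by (intro bij_betw_byWitness[where f' = "\<lambda>(a, b, e). (a * m + b mod m, b, e * m + b mod m)"])
    (auto simp: less_mult_imp_div_less intro!: idx_less, metis mod_div_mult_eq add.commute, metis mod_div_mult_eq add.commute)

lemma positive_op_comp: "positive_op d d' \<Phi> \<Longrightarrow> positive_op d' d'' \<Psi> \<Longrightarrow> positive_op d d'' (\<lambda>X. \<Psi> (\<Phi> X))"
  by (simp add: positive_op_def)

lemma trace_factor_comp:
  "linear_op d d' \<Phi> \<Longrightarrow> trace_factor d c \<Phi> \<Longrightarrow> trace_factor d' c' \<Psi> \<Longrightarrow> trace_factor d (c' * c) (\<lambda>X. \<Psi> (\<Phi> X))"
  by (simp add: trace_factor_def linear_op_def)

lemma public_props:
  shows "linear_op (tdim (dA * m, dB, dE)) (tdim (dA * m, dB * m, dE * m)) (public_AB m (dA, dB, dE))"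
    and "linear_op (tdim (dA, dB * m, dE)) (tdim (dA * m, dB * m, dE * m)) (public_BA m (dA, dB, dE))"
    and "positive_op (tdim (dA * m, dB, dE)) (tdim (dA * m, dB * m, dE * m)) (public_AB m (dA, dB, dE))"
    and "positive_op (tdim (dA, dB * m, dE)) (tdim (dA * m, dB * m, dE * m)) (public_BA m (dA, dB, dE))"
    and "trace_factor (tdim (dA * m, dB, dE)) (if m = 0 then 0 else 1) (public_AB m (dA, dB, dE))"
    and "trace_factor (tdim (dA, dB * m, dE)) (if m = 0 then 0 else 1) (public_BA m (dA, dB, dE))"
proof -
  have hA: "(\<lambda>(a, b, e). (a, b div m, e div m)) ` (box (dA * m, dB * m, dE * m) \<inter> B) \<subseteq> box (dA * m, dB, dE)" for B
    by (auto simp: less_mult_imp_div_less)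
  have hB: "(\<lambda>(a, b, e). (a div m, b, e div m)) ` (box (dA * m, dB * m, dE * m) \<inter> B) \<subseteq> box (dA, dB * m, dE)" for B
    by (auto simp: less_mult_imp_div_less)
  show "linear_op (tdim (dA * m, dB, dE)) (tdim (dA * m, dB * m, dE * m)) (public_AB m (dA, dB, dE))"
    unfolding public_AB_copy by (rule linear_copy_op[OF hA])
  show "linear_op (tdim (dA, dB * m, dE)) (tdim (dA * m, dB * m, dE * m)) (public_BA m (dA, dB, dE))"
    unfolding public_BA_copy by (rule linear_copy_op[OF hB])
  show "positive_op (tdim (dA * m, dB, dE)) (tdim (dA * m, dB * m, dE * m)) (public_AB m (dA, dB, dE))"
    unfolding public_AB_copy
  proof (rule positive_copy_op[OF hA])
    show "(\<lambda>(a, b, e). a mod m) s < m" if "s \<in> box (dA * m, dB * m, dE * m)" for s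
      using that by (cases s) (auto dest: mult_pos_of_less)
  qed (use hA in blast)
  show "positive_op (tdim (dA, dB * m, dE)) (tdim (dA * m, dB * m, dE * m)) (public_BA m (dA, dB, dE))"
    unfolding public_BA_copy
  proof (rule positive_copy_op[OF hB])
    show "(\<lambda>(a, b, e). b mod m) s < m" if "s \<in> box (dA * m, dB * m, dE * m)" for s
      using that by (cases s) (auto dest: mult_pos_of_less)
  qed (use hB in blast)
  show "trace_factor (tdim (dA * m, dB, dE)) (if m = 0 then 0 else 1) (public_AB m (dA, dB, dE))"
  proof (cases "m = 0")
    case True
    then show ?thesis by (simp add: trace_factor_def mtrace_def tmat_def)
  next
    case False
    then show ?thesis unfolding public_AB_copy by (simp only: if_False) (rule trace_copy_op, rule bij_copy_AB, simp)
  qed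
  show "trace_factor (tdim (dA, dB * m, dE)) (if m = 0 then 0 else 1) (public_BA m (dA, dB, dE))"
  proof (cases "m = 0")
    case True
    then show ?thesis by (simp add: trace_factor_def mtrace_def tmat_def)
  next
    case False
    then show ?thesis unfolding public_BA_copy by (simp only: if_False) (rule trace_copy_op, rule bij_copy_BA, simp)
  qed
qed

text \<open>An operation that communicates a message from an empty alphabet has a zero-dimensional
  output; it kills the trace, and every later step keeps it zero.\<close>

lemma lopc_props:
  assumes "lopc D D' \<Lambda>"
  shows "linear_op (tdim D) (tdim D') \<Lambda> \<and> positive_op (tdim D) (tdim D') \<Lambda> \<and>
    (\<exists>c \<in> {0, 1}. trace_factor (tdim D) c \<Lambda>)"
  using assms
proof (induction rule: lopc.induct)
  case none
  show ?case by (auto simp: linear_op_def positive_op_def trace_factor_def)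
next
  case (local_A dA dB dE \<Lambda> d' \<Phi>)
  then obtain c where c: "c \<in> {0, 1}" "trace_factor (tdim D) c \<Lambda>" by blast
  have L: "linear_op (tdim D) (tdim (dA, dB, dE)) \<Lambda>" using local_A by blast
  have "trace_factor (tdim D) (1 * c) (\<lambda>X. local_A (dA, dB, dE) d' \<Phi> (\<Lambda> X))"
    by (rule trace_factor_comp[OF L c(2) trace_local_A[OF local_A(2)]])
  then have "\<exists>c \<in> {0, 1}. trace_factor (tdim D) c (\<lambda>X. local_A (dA, dB, dE) d' \<Phi> (\<Lambda> X))"
    using c by (intro bexI[of _ c]) simp_all
  moreover have "positive_op (tdim D) (tdim (d', dB, dE)) (\<lambda>X. local_A (dA, dB, dE) d' \<Phi> (\<Lambda> X))"
    using local_A by (intro positive_op_comp[OF _ positive_local_A]) auto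
  moreover have "linear_op (tdim D) (tdim (d', dB, dE)) (\<lambda>X. local_A (dA, dB, dE) d' \<Phi> (\<Lambda> X))"
    using local_A by (intro linear_op_comp[OF L linear_local_A]) (auto intro: cptp_linear)
  ultimately show ?case by blast
next
  case (local_B dA dB dE \<Lambda> d' \<Phi>)
  then obtain c where c: "c \<in> {0, 1}" "trace_factor (tdim D) c \<Lambda>" by blast
  have L: "linear_op (tdim D) (tdim (dA, dB, dE)) \<Lambda>" using local_B by blast
  have "trace_factor (tdim D) (1 * c) (\<lambda>X. local_B (dA, dB, dE) d' \<Phi> (\<Lambda> X))"
    by (rule trace_factor_comp[OF L c(2) trace_local_B[OF local_B(2)]])
  then have "\<exists>c \<in> {0, 1}. trace_factor (tdim D) c (\<lambda>X. local_B (dA, dB, dE) d' \<Phi> (\<Lambda> X))"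
    using c by (intro bexI[of _ c]) simp_all
  moreover have "positive_op (tdim D) (tdim (dA, d', dE)) (\<lambda>X. local_B (dA, dB, dE) d' \<Phi> (\<Lambda> X))"
    using local_B by (intro positive_op_comp[OF _ positive_local_B]) auto
  moreover have "linear_op (tdim D) (tdim (dA, d', dE)) (\<lambda>X. local_B (dA, dB, dE) d' \<Phi> (\<Lambda> X))"
    using local_B by (intro linear_op_comp[OF L linear_local_B]) (auto intro: cptp_linear)
  ultimately show ?case by blast
next
  case (public_AB dA m dB dE \<Lambda>)
  then obtain c where c: "c \<in> {0, 1}" "trace_factor (tdim D) c \<Lambda>" by blast
  have L: "linear_op (tdim D) (tdim (dA * m, dB, dE)) \<Lambda>" using public_AB by blast
  have P: "positive_op (tdim D) (tdim (dA * m, dB, dE)) \<Lambda>" using public_AB by blast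
  have "trace_factor (tdim D) ((if m = 0 then 0 else 1) * c) (\<lambda>X. public_AB m (dA, dB, dE) (\<Lambda> X))"
    by (rule trace_factor_comp[OF L c(2) public_props(5)])
  then have "\<exists>c \<in> {0, 1}. trace_factor (tdim D) c (\<lambda>X. public_AB m (dA, dB, dE) (\<Lambda> X))"
    using c by (intro bexI[of _ "(if m = 0 then 0 else 1) * c"]) simp_all
  then show ?case using linear_op_comp[OF L public_props(1)] positive_op_comp[OF P public_props(3)] by blast
next
  case (public_BA dA dB m dE \<Lambda>)
  then obtain c where c: "c \<in> {0, 1}" "trace_factor (tdim D) c \<Lambda>" by blast
  have L: "linear_op (tdim D) (tdim (dA, dB * m, dE)) \<Lambda>" using public_BA by blast
  have P: "positive_op (tdim D) (tdim (dA, dB * m, dE)) \<Lambda>" using public_BA by blast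
  have "trace_factor (tdim D) ((if m = 0 then 0 else 1) * c) (\<lambda>X. public_BA m (dA, dB, dE) (\<Lambda> X))"
    by (rule trace_factor_comp[OF L c(2) public_props(6)])
  then have "\<exists>c \<in> {0, 1}. trace_factor (tdim D) c (\<lambda>X. public_BA m (dA, dB, dE) (\<Lambda> X))"
    using c by (intro bexI[of _ "(if m = 0 then 0 else 1) * c"]) simp_all
  then show ?case using linear_op_comp[OF L public_props(2)] positive_op_comp[OF P public_props(4)] by blast
qed

section \<open>Eve's additional register as a spectator of the protocol\<close>

fun add_eve :: "nat \<Rightarrow> tri \<Rightarrow> tri" where
  "add_eve m (dA, dB, dE) = (dA, dB, dE * m)"

fun put_eve :: "(nat \<times> nat \<Rightarrow> nat) \<Rightarrow> nat \<Rightarrow> tri \<Rightarrow> tri" where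
  "put_eve g j (a, b, e) = (a, b, g (e, j))"

text \<open>The operator \<open><j| X |k>\<close> with respect to Eve's additional register, acting
  on the system without that register.\<close>

definition eve_block :: "tri \<Rightarrow> nat \<Rightarrow> (nat \<times> nat \<Rightarrow> nat) \<Rightarrow> nat \<Rightarrow> nat \<Rightarrow> complex mat \<Rightarrow> complex mat" where
  "eve_block D m g j k X = tmat D (\<lambda>s t. tent (add_eve m D) X (put_eve g j s) (put_eve g k t))"

lemma tent_eve_block:
  "s \<in> box D \<Longrightarrow> t \<in> box D \<Longrightarrow>
    tent D (eve_block D m g j k X) s t = tent (add_eve m D) X (put_eve g j s) (put_eve g k t)"
  by (simp add: eve_block_def tent_tmat)

lemma eve_block_carrier: "eve_block D m g j k X \<in> carrier_mat (tdim D) (tdim D)"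
  by (simp only: eve_block_def tmat_carrier)

text \<open>A register \<open>\<complex>\<^sup>m\<close> of Eve is a spectator: the operation acts on each of its blocks
  separately.  The map \<open>g\<close> records where its basis ends up among Eve's indices, because public
  messages are appended behind it.\<close>

lemma bij_put_eve:
  assumes "bij_betw g ({..<dE} \<times> {..<m}) {..<dE * m}" "j < m" "(a, b, e) \<in> box (dA, dB, dE)"
  shows "(a, b, g (e, j)) \<in> box (dA, dB, dE * m)"
  using assms by (auto simp: bij_betw_def)

text \<open>A message of \<open>m0\<close> values becomes the last digit of Eve's index. On the
  small system it sits behind \<open>e\<close>; on the large one it sits behind the index that
  \<open>g\<close> assigns to \<open>e\<close> and the register together.\<close>

definition shift_eve :: "nat \<Rightarrow> (nat \<times> nat \<Rightarrow> nat) \<Rightarrow> nat \<times> nat \<Rightarrow> nat" where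
  "shift_eve m0 g = (\<lambda>(e, j). g (e div m0, j) * m0 + e mod m0)"

lemma bij_shift_eve:
  assumes g: "bij_betw g ({..<dE} \<times> {..<m}) {..<dE * m}"
  shows "bij_betw (shift_eve m0 g) ({..<dE * m0} \<times> {..<m}) {..<dE * m0 * m}"
proof (cases "m0 = 0")
  case True
  then show ?thesis by (simp add: bij_betw_def)
next
  case False
  have inj: "inj_on (shift_eve m0 g) ({..<dE * m0} \<times> {..<m})"
  proof (rule inj_onI, clarify)
    fix e j e' j' assume r: "e < dE * m0" "e' < dE * m0" "j < m" "j' < m"
      and eq: "shift_eve m0 g (e, j) = shift_eve m0 g (e', j')"
    have mm: "e mod m0 < m0" "e' mod m0 < m0" using False by auto
    have "g (e div m0, j) = g (e' div m0, j')"
      using arg_cong[OF eq, of "\<lambda>x. x div m0"] idx_div[OF mm(1)] idx_div[OF mm(2)] by (simp add: shift_eve_def)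
    moreover have "e mod m0 = e' mod m0"
      using arg_cong[OF eq, of "\<lambda>x. x mod m0"] idx_mod[OF mm(1)] idx_mod[OF mm(2)] by (simp add: shift_eve_def)
    moreover have "(e div m0, j) = (e' div m0, j')"
      using r calculation(1)
      by (intro inj_onD[OF bij_betw_imp_inj_on[OF g]]) (auto simp: less_mult_imp_div_less)
    ultimately show "e = e' \<and> j = j'" by (metis div_mult_mod_eq prod.inject)
  qed
  have sub: "shift_eve m0 g ` ({..<dE * m0} \<times> {..<m}) \<subseteq> {..<dE * m0 * m}"
  proof (rule image_subsetI)
    fix p assume "p \<in> {..<dE * m0} \<times> {..<m}"
    then obtain e j where p: "p = (e, j)" and r: "e \<in> {..<dE * m0}" "j \<in> {..<m}" by auto
    then have "g (e div m0, j) < dE * m" using g by (auto simp: bij_betw_def less_mult_imp_div_less)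
    then have "g (e div m0, j) * m0 + e mod m0 < dE * m * m0" using False by (intro idx_less) auto
    then show "shift_eve m0 g p \<in> {..<dE * m0 * m}" unfolding p by (simp add: shift_eve_def mult_ac)
  qed
  have "card (shift_eve m0 g ` ({..<dE * m0} \<times> {..<m})) = card {..<dE * m0 * m}"
    using card_image[OF inj] by simp
  then have "shift_eve m0 g ` ({..<dE * m0} \<times> {..<m}) = {..<dE * m0 * m}"
    using sub by (intro card_subset_eq) auto
  then show ?thesis using inj by (simp add: bij_betw_def)
qed

lemma shift_eve_div: "0 < m0 \<Longrightarrow> shift_eve m0 g (e, j) div m0 = g (e div m0, j)"
  by (simp add: shift_eve_def)

lemma shift_eve_mod: "0 < m0 \<Longrightarrow> shift_eve m0 g (e, j) mod m0 = e mod m0"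
  by (simp add: shift_eve_def)

text \<open>The same steps are carried out with Eve's dimension enlarged by the factor
  \<open>m\<close>. No step mixes different values of the register, so each acts on every block
  separately; local steps leave the labelling \<open>g\<close> alone, and messages replace it by
  \<open>shift_eve\<close>.\<close>

lemma lopc_extend:
  assumes "lopc D D' \<Lambda>" and g: "bij_betw g ({..<snd (snd D)} \<times> {..<m}) {..<snd (snd D) * m}"
  shows "\<exists>\<Lambda>' g'. lopc (add_eve m D) (add_eve m D') \<Lambda>' \<and>
     bij_betw g' ({..<snd (snd D')} \<times> {..<m}) {..<snd (snd D') * m} \<and>
     (\<forall>X \<in> carrier_mat (tdim (add_eve m D)) (tdim (add_eve m D)).
        \<forall>j<m. \<forall>k<m. eve_block D' m g' j k (\<Lambda>' X) = \<Lambda> (eve_block D m g j k X))"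
  using assms(1)
proof (induction rule: lopc.induct)
  case none
  show ?case using g lopc.none[of "add_eve m D"] by (intro exI[of _ "\<lambda>X. X"] exI[of _ g]) auto
next
  case (local_A dA dB dE \<Lambda> d' \<Phi>)
  then obtain \<Lambda>' g' where IH: "lopc (add_eve m D) (add_eve m (dA, dB, dE)) \<Lambda>'"
    "bij_betw g' ({..<dE} \<times> {..<m}) {..<dE * m}"
    "\<And>X j k. X \<in> carrier_mat (tdim (add_eve m D)) (tdim (add_eve m D)) \<Longrightarrow> j < m \<Longrightarrow> k < m \<Longrightarrow>
       eve_block (dA, dB, dE) m g' j k (\<Lambda>' X) = \<Lambda> (eve_block D m g j k X)" by auto
  have lo: "lopc (add_eve m D) (add_eve m (d', dB, dE)) (\<lambda>X. local_A (dA, dB, dE * m) d' \<Phi> (\<Lambda>' X))"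
    using lopc.local_A[OF IH(1)[unfolded add_eve.simps] local_A(2)] by simp
  have "eve_block (d', dB, dE) m g' j k (local_A (dA, dB, dE * m) d' \<Phi> Y)
      = local_A (dA, dB, dE) d' \<Phi> (eve_block (dA, dB, dE) m g' j k Y)" if jk: "j < m" "k < m" for Y j k
  proof (rule mat_eq_tent[of _ "(d', dB, dE)"])
    fix s t assume s: "s \<in> box (d', dB, dE)" and t: "t \<in> box (d', dB, dE)"
    obtain a b e a' b' e' where st: "s = (a, b, e)" "t = (a', b', e')" by (cases s; cases t) auto
    note put = bij_put_eve[OF IH(2) jk(1) s[unfolded st]] bij_put_eve[OF IH(2) jk(2) t[unfolded st]]
    have "blockA dA dB (dE * m) Y b (g' (e, j)) b' (g' (e', k)) = blockA dA dB dE (eve_block (dA, dB, dE) m g' j k Y) b e b' e'"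
      unfolding blockA_def using s t st by (intro eq_matI) (auto simp: tent_eve_block)
    then show "tent (d', dB, dE) (eve_block (d', dB, dE) m g' j k (local_A (dA, dB, dE * m) d' \<Phi> Y)) s t =
      tent (d', dB, dE) (local_A (dA, dB, dE) d' \<Phi> (eve_block (dA, dB, dE) m g' j k Y)) s t"
      unfolding tent_eve_block[OF s t] unfolding st put_eve.simps add_eve.simps
      by (simp only: tent_local_A[OF put] tent_local_A[OF s[unfolded st] t[unfolded st]])
  qed (simp_all only: eve_block_carrier tmat_carrier local_A.simps local_B.simps public_AB.simps public_BA.simps)
  then show ?case using lo IH by (intro exI[of _ "\<lambda>X. local_A (dA, dB, dE * m) d' \<Phi> (\<Lambda>' X)"] exI[of _ g']) (simp del: local_A.simps)
next
  case (local_B dA dB dE \<Lambda> d' \<Phi>)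
  then obtain \<Lambda>' g' where IH: "lopc (add_eve m D) (add_eve m (dA, dB, dE)) \<Lambda>'"
    "bij_betw g' ({..<dE} \<times> {..<m}) {..<dE * m}"
    "\<And>X j k. X \<in> carrier_mat (tdim (add_eve m D)) (tdim (add_eve m D)) \<Longrightarrow> j < m \<Longrightarrow> k < m \<Longrightarrow>
       eve_block (dA, dB, dE) m g' j k (\<Lambda>' X) = \<Lambda> (eve_block D m g j k X)" by auto
  have lo: "lopc (add_eve m D) (add_eve m (dA, d', dE)) (\<lambda>X. local_B (dA, dB, dE * m) d' \<Phi> (\<Lambda>' X))"
    using lopc.local_B[OF IH(1)[unfolded add_eve.simps] local_B(2)] by simp
  have "eve_block (dA, d', dE) m g' j k (local_B (dA, dB, dE * m) d' \<Phi> Y)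
      = local_B (dA, dB, dE) d' \<Phi> (eve_block (dA, dB, dE) m g' j k Y)" if jk: "j < m" "k < m" for Y j k
  proof (rule mat_eq_tent[of _ "(dA, d', dE)"])
    fix s t assume s: "s \<in> box (dA, d', dE)" and t: "t \<in> box (dA, d', dE)"
    obtain a b e a' b' e' where st: "s = (a, b, e)" "t = (a', b', e')" by (cases s; cases t) auto
    note put = bij_put_eve[OF IH(2) jk(1) s[unfolded st]] bij_put_eve[OF IH(2) jk(2) t[unfolded st]]
    have "blockB dA dB (dE * m) Y a (g' (e, j)) a' (g' (e', k)) = blockB dA dB dE (eve_block (dA, dB, dE) m g' j k Y) a e a' e'"
      unfolding blockB_def using s t st by (intro eq_matI) (auto simp: tent_eve_block)
    then show "tent (dA, d', dE) (eve_block (dA, d', dE) m g' j k (local_B (dA, dB, dE * m) d' \<Phi> Y)) s t =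
      tent (dA, d', dE) (local_B (dA, dB, dE) d' \<Phi> (eve_block (dA, dB, dE) m g' j k Y)) s t"
      unfolding tent_eve_block[OF s t] unfolding st put_eve.simps add_eve.simps
      by (simp only: tent_local_B[OF put] tent_local_B[OF s[unfolded st] t[unfolded st]])
  qed (simp_all only: eve_block_carrier tmat_carrier local_A.simps local_B.simps public_AB.simps public_BA.simps)
  then show ?case using lo IH by (intro exI[of _ "\<lambda>X. local_B (dA, dB, dE * m) d' \<Phi> (\<Lambda>' X)"] exI[of _ g']) (simp del: local_B.simps)
next
  case (public_AB dA m0 dB dE \<Lambda>)
  then obtain \<Lambda>' g' where IH: "lopc (add_eve m D) (add_eve m (dA * m0, dB, dE)) \<Lambda>'"
    "bij_betw g' ({..<dE} \<times> {..<m}) {..<dE * m}"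
    "\<And>X j k. X \<in> carrier_mat (tdim (add_eve m D)) (tdim (add_eve m D)) \<Longrightarrow> j < m \<Longrightarrow> k < m \<Longrightarrow>
       eve_block (dA * m0, dB, dE) m g' j k (\<Lambda>' X) = \<Lambda> (eve_block D m g j k X)" by auto
  define g'' where "g'' = shift_eve m0 g'"
  have g'': "bij_betw g'' ({..<dE * m0} \<times> {..<m}) {..<dE * m0 * m}" unfolding g''_def by (rule bij_shift_eve[OF IH(2)])
  have comm: "dE * m * m0 = dE * m0 * m" by (simp add: mult_ac)
  have lo: "lopc (add_eve m D) (add_eve m (dA * m0, dB * m0, dE * m0)) (\<lambda>X. public_AB m0 (dA, dB, dE * m) (\<Lambda>' X))"
    using lopc.public_AB[OF IH(1)[unfolded add_eve.simps]] by (simp only: comm add_eve.simps)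
  have "eve_block (dA * m0, dB * m0, dE * m0) m g'' j k (public_AB m0 (dA, dB, dE * m) Y)
      = public_AB m0 (dA, dB, dE) (eve_block (dA * m0, dB, dE) m g' j k Y)" if jk: "j < m" "k < m" for Y j k
  proof (rule mat_eq_tent[of _ "(dA * m0, dB * m0, dE * m0)"])
    fix s t assume s: "s \<in> box (dA * m0, dB * m0, dE * m0)" and t: "t \<in> box (dA * m0, dB * m0, dE * m0)"
    obtain a b e a' b' e' where st: "s = (a, b, e)" "t = (a', b', e')" by (cases s; cases t) auto
    have m0: "0 < m0" using s st by (auto dest: mult_pos_of_less)
    note put = bij_put_eve[OF g'' jk(1) s[unfolded st], folded comm] bij_put_eve[OF g'' jk(2) t[unfolded st], folded comm]
    have q: "(a, b div m0, e div m0) \<in> box (dA * m0, dB, dE)" "(a', b' div m0, e' div m0) \<in> box (dA * m0, dB, dE)"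
      using s t st by (auto simp: less_mult_imp_div_less)
    show "tent (dA * m0, dB * m0, dE * m0) (eve_block (dA * m0, dB * m0, dE * m0) m g'' j k (public_AB m0 (dA, dB, dE * m) Y)) s t =
      tent (dA * m0, dB * m0, dE * m0) (public_AB m0 (dA, dB, dE) (eve_block (dA * m0, dB, dE) m g' j k Y)) s t"
      unfolding tent_eve_block[OF s t] unfolding st put_eve.simps add_eve.simps public_AB.simps comm[symmetric]
        tent_tmat[OF put] tent_tmat[OF s[unfolded st] t[unfolded st]]
      using tent_eve_block[OF q] m0 by (simp add: g''_def shift_eve_div shift_eve_mod)
  qed (simp_all only: eve_block_carrier tmat_carrier local_A.simps local_B.simps public_AB.simps public_BA.simps)
  then show ?case using lo IH g'' by (intro exI[of _ "\<lambda>X. public_AB m0 (dA, dB, dE * m) (\<Lambda>' X)"] exI[of _ g'']) (simp del: public_AB.simps)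
next
  case (public_BA dA dB m0 dE \<Lambda>)
  then obtain \<Lambda>' g' where IH: "lopc (add_eve m D) (add_eve m (dA, dB * m0, dE)) \<Lambda>'"
    "bij_betw g' ({..<dE} \<times> {..<m}) {..<dE * m}"
    "\<And>X j k. X \<in> carrier_mat (tdim (add_eve m D)) (tdim (add_eve m D)) \<Longrightarrow> j < m \<Longrightarrow> k < m \<Longrightarrow>
       eve_block (dA, dB * m0, dE) m g' j k (\<Lambda>' X) = \<Lambda> (eve_block D m g j k X)" by auto
  define g'' where "g'' = shift_eve m0 g'"
  have g'': "bij_betw g'' ({..<dE * m0} \<times> {..<m}) {..<dE * m0 * m}" unfolding g''_def by (rule bij_shift_eve[OF IH(2)])
  have comm: "dE * m * m0 = dE * m0 * m" by (simp add: mult_ac)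
  have lo: "lopc (add_eve m D) (add_eve m (dA * m0, dB * m0, dE * m0)) (\<lambda>X. public_BA m0 (dA, dB, dE * m) (\<Lambda>' X))"
    using lopc.public_BA[OF IH(1)[unfolded add_eve.simps]] by (simp only: comm add_eve.simps)
  have "eve_block (dA * m0, dB * m0, dE * m0) m g'' j k (public_BA m0 (dA, dB, dE * m) Y)
      = public_BA m0 (dA, dB, dE) (eve_block (dA, dB * m0, dE) m g' j k Y)" if jk: "j < m" "k < m" for Y j k
  proof (rule mat_eq_tent[of _ "(dA * m0, dB * m0, dE * m0)"])
    fix s t assume s: "s \<in> box (dA * m0, dB * m0, dE * m0)" and t: "t \<in> box (dA * m0, dB * m0, dE * m0)"
    obtain a b e a' b' e' where st: "s = (a, b, e)" "t = (a', b', e')" by (cases s; cases t) auto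
    have m0: "0 < m0" using s st by (auto dest: mult_pos_of_less)
    note put = bij_put_eve[OF g'' jk(1) s[unfolded st], folded comm] bij_put_eve[OF g'' jk(2) t[unfolded st], folded comm]
    have q: "(a div m0, b, e div m0) \<in> box (dA, dB * m0, dE)" "(a' div m0, b', e' div m0) \<in> box (dA, dB * m0, dE)"
      using s t st by (auto simp: less_mult_imp_div_less)
    show "tent (dA * m0, dB * m0, dE * m0) (eve_block (dA * m0, dB * m0, dE * m0) m g'' j k (public_BA m0 (dA, dB, dE * m) Y)) s t =
      tent (dA * m0, dB * m0, dE * m0) (public_BA m0 (dA, dB, dE) (eve_block (dA, dB * m0, dE) m g' j k Y)) s t"
      unfolding tent_eve_block[OF s t] unfolding st put_eve.simps add_eve.simps public_BA.simps comm[symmetric]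
        tent_tmat[OF put] tent_tmat[OF s[unfolded st] t[unfolded st]]
      using tent_eve_block[OF q] m0 by (simp add: g''_def shift_eve_div shift_eve_mod)
  qed (simp_all only: eve_block_carrier tmat_carrier local_A.simps local_B.simps public_AB.simps public_BA.simps)
  then show ?case using lo IH g'' by (intro exI[of _ "\<lambda>X. public_BA m0 (dA, dB, dE * m) (\<Lambda>' X)"] exI[of _ g'']) (simp del: public_BA.simps)
qed

section \<open>Hashing of the raw keys\<close>

definition hash_op :: "nat \<Rightarrow> nat \<Rightarrow> (nat \<Rightarrow> nat) \<Rightarrow> complex mat \<Rightarrow> complex mat" where
  "hash_op d K f X = mat K K (\<lambda>(z, z'). if z = z' then \<Sum>a<d. if f a = z then X $$ (a, a) else 0 else 0)"

text \<open>The Kraus operators are \<open>|f a><a|\<close>: for each \<open>a\<close> the form is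
  pulled back to the entries with register value \<open>a\<close> and multiplied by the indicator of
  the output value \<open>f a\<close>.\<close>

lemma cptp_hash_op:
  assumes f: "\<And>a. a < d \<Longrightarrow> f a < K"
  shows "cptp d K (hash_op d K f)"
  unfolding cptp_def
proof (intro conjI ballI allI)
  show "hash_op d K f X \<in> carrier_mat K K" for X by (simp add: hash_op_def)
next
  fix X Y :: "complex mat" assume X: "X \<in> carrier_mat d d" and Y: "Y \<in> carrier_mat d d"
  have "(\<Sum>a<d. if f a = z then (X + Y) $$ (a, a) else 0) =
      (\<Sum>a<d. if f a = z then X $$ (a, a) else 0) + (\<Sum>a<d. if f a = z then Y $$ (a, a) else 0)" for z
    unfolding sum.distrib[symmetric] using X Y by (intro sum.cong) auto
  then show "hash_op d K f (X + Y) = hash_op d K f X + hash_op d K f Y"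
    by (intro eq_matI) (simp_all add: hash_op_def)
next
  fix c :: complex and X :: "complex mat" assume X: "X \<in> carrier_mat d d"
  have "(\<Sum>a<d. if f a = z then (c \<cdot>\<^sub>m X) $$ (a, a) else 0) = c * (\<Sum>a<d. if f a = z then X $$ (a, a) else 0)" for z
    unfolding sum_distrib_left using X by (intro sum.cong) auto
  then show "hash_op d K f (c \<cdot>\<^sub>m X) = c \<cdot>\<^sub>m hash_op d K f X"
    by (intro eq_matI) (simp_all add: hash_op_def)
next
  fix X :: "complex mat" assume X: "X \<in> carrier_mat d d"
  have "mtrace (hash_op d K f X) = (\<Sum>z<K. \<Sum>a<d. if f a = z then X $$ (a, a) else 0)"
    by (simp add: mtrace_def hash_op_def)
  also have "\<dots> = (\<Sum>a<d. \<Sum>z<K. if f a = z then X $$ (a, a) else 0)" by (rule sum.swap)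
  also have "\<dots> = mtrace X" using X f by (simp add: mtrace_def)
  finally show "mtrace (hash_op d K f X) = mtrace X" .
next
  show "completely_positive d K (hash_op d K f)"
    unfolding completely_positive_def
  proof (intro allI impI)
    fix k X assume X: "psd (k * d) X"
    define h where "h a i = i div K * d + a" for a i
    define g :: "nat \<Rightarrow> nat \<Rightarrow> complex" where "g a i = (if f a = i mod K then 1 else 0)" for a i
    have pX: "posf {..<k * d} (\<lambda>i j. X $$ (i, j))" using X by (simp add: psd_iff)
    have p: "posf {..<k * K} (\<lambda>i j. \<Sum>a<d. cnj (g a i) * X $$ (h a i, h a j) * g a j)"
    proof (intro posf_sum posf_conj_diag)
      fix a assume a: "a \<in> {..<d}"
      show "posf {..<k * K} (\<lambda>i j. X $$ (h a i, h a j))"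
        using a by (intro posf_pullback[OF pX, of _ "h a"]) (auto simp: h_def less_mult_imp_div_less intro!: idx_less)
    qed
    have "posf {..<k * K} (\<lambda>i j. ampliation k d K (hash_op d K f) X $$ (i, j)) =
        posf {..<k * K} (\<lambda>i j. \<Sum>a<d. cnj (g a i) * X $$ (h a i, h a j) * g a j)"
    proof (rule posf_cong)
      fix i j assume ij: "i \<in> {..<k * K}" "j \<in> {..<k * K}"
      then have "0 < K" by (auto dest: mult_pos_of_less)
      then have m: "i mod K < K" "j mod K < K" by auto
      have "ampliation k d K (hash_op d K f) X $$ (i, j) =
        (if i mod K = j mod K then \<Sum>a<d. if f a = i mod K then X $$ (h a i, h a j) else 0 else 0)"
        using ij m by (simp add: ampliation_def hash_op_def h_def cong: if_cong)
      also have "\<dots> = (\<Sum>a<d. cnj (g a i) * X $$ (h a i, h a j) * g a j)"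
        by (auto simp: g_def intro!: sum.cong sum.neutral)
      finally show "ampliation k d K (hash_op d K f) X $$ (i, j) = (\<Sum>a<d. cnj (g a i) * X $$ (h a i, h a j) * g a j)" .
    qed
    then show "psd (k * K) (ampliation k d K (hash_op d K f) X)"
      using p by (simp add: psd_iff ampliation_def)
  qed
qed

definition hash_AB :: "tri \<Rightarrow> nat \<Rightarrow> (nat \<Rightarrow> nat) \<Rightarrow> complex mat \<Rightarrow> complex mat" where
  "hash_AB D K f X = local_B (K, fst (snd D), snd (snd D)) K (hash_op (fst (snd D)) K f)
     (local_A D K (hash_op (fst D) K f) X)"

lemma lopc_hash_AB:
  assumes "lopc D (dA, dB, dE) \<Lambda>" "\<And>a. f a < K"
  shows "lopc D (K, K, dE) (\<lambda>X. hash_AB (dA, dB, dE) K f (\<Lambda> X))"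
  using lopc.local_B[OF lopc.local_A[OF assms(1) cptp_hash_op[of dA f K]] cptp_hash_op[of dB f K]] assms(2)
  by (simp only: hash_AB_def fst_conv snd_conv)

text \<open>Hashing measures both raw keys, so the output is diagonal in the hashed keys and only
  diagonal entries in the raw keys contribute.\<close>

lemma tent_hash_AB:
  assumes "x < dE" "y < dE" "z < K" "z' < K" "w < K" "w' < K"
  shows "tent (K, K, dE) (hash_AB (dA, dB, dE) K f X) (z, w, x) (z', w', y) =
    (if z = z' \<and> w = w' then \<Sum>a<dA. \<Sum>b<dB. if f a = z \<and> f b = w then tent (dA, dB, dE) X (a, b, x) (a, b, y) else 0 else 0)"
proof -
  let ?Y = "local_A (dA, dB, dE) K (hash_op dA K f) X"
  have A: "tent (K, dB, dE) ?Y (z, b, x) (z', b, y) =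
      (if z = z' then \<Sum>a<dA. if f a = z then tent (dA, dB, dE) X (a, b, x) (a, b, y) else 0 else 0)" if "b < dB" for b
    using that assms by (subst tent_local_A) (auto simp: hash_op_def blockA_def cong: if_cong)
  have "tent (K, K, dE) (hash_AB (dA, dB, dE) K f X) (z, w, x) (z', w', y)
     = (if w = w' then \<Sum>b<dB. if f b = w then tent (K, dB, dE) ?Y (z, b, x) (z', b, y) else 0 else 0)"
    unfolding hash_AB_def fst_conv snd_conv using assms
    by (subst tent_local_B) (auto simp: hash_op_def blockB_def simp del: local_A.simps cong: if_cong)
  also have "(\<Sum>b<dB. if f b = w then tent (K, dB, dE) ?Y (z, b, x) (z', b, y) else 0) =
     (\<Sum>b<dB. if f b = w then (if z = z' then \<Sum>a<dA. if f a = z then tent (dA, dB, dE) X (a, b, x) (a, b, y) else 0 else 0) else 0)"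
    by (intro sum.cong refl) (simp add: A del: local_A.simps)
  also have "(if w = w' then \<dots> else 0) = (if z = z' \<and> w = w' then \<Sum>b<dB. \<Sum>a<dA. if f a = z \<and> f b = w then tent (dA, dB, dE) X (a, b, x) (a, b, y) else 0 else 0)"
    by (auto intro!: sum.cong sum.neutral)
  also have "\<dots> = (if z = z' \<and> w = w' then \<Sum>a<dA. \<Sum>b<dB. if f a = z \<and> f b = w then tent (dA, dB, dE) X (a, b, x) (a, b, y) else 0 else 0)"
    by (auto intro: sum.swap)
  finally show ?thesis .
qed

section \<open>Tensor powers\<close>

lemma sum_divmod:
  "(\<Sum>x<d * m. F (x div m) (x mod m)) = (\<Sum>q<d. \<Sum>r<(m :: nat). F q r)"
proof (cases "m = 0")
  case False
  have "bij_betw (\<lambda>x. (x div m, x mod m)) {..<d * m} ({..<d} \<times> {..<m})"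
    using False by (intro bij_betw_byWitness[where f' = "\<lambda>(q, r). q * m + r"])
      (auto simp: less_mult_imp_div_less intro!: idx_less)
  from sum.reindex_bij_betw[OF this, of "\<lambda>(q, r). F q r"] show ?thesis
    by (simp add: sum_pair)
qed simp

lemma digit_less: "0 < d \<Longrightarrow> digit d k x < d"
  by (simp add: digit_def)

lemma base_pos: "x < d ^ n \<Longrightarrow> k < n \<Longrightarrow> 0 < (d :: nat)"
  by (cases "d = 0") (auto simp: zero_power)

lemma digit_mod:
  assumes "k < n" shows "digit d k (x mod d ^ n) = digit d k x"
proof -
  have e: "d ^ n = d ^ k * (d * d ^ (n - Suc k))"
  proof -
    have "d ^ n = d ^ (k + Suc (n - Suc k))" using assms by simp
    then show ?thesis by (simp only: power_add power_Suc)
  qed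
  have "x mod d ^ n div d ^ k = x div d ^ k mod (d * d ^ (n - Suc k))" if "d \<noteq> 0"
    unfolding e mod_mult2_eq using that by simp
  then show ?thesis
    using assms by (cases "d = 0") (simp_all add: digit_def mod_mod_cancel zero_power)
qed

lemma digit_top: "x < d ^ Suc n \<Longrightarrow> digit d n x = x div d ^ n"
  by (simp add: digit_def less_mult_imp_div_less)

lemma digit_inj:
  "x < d ^ n \<Longrightarrow> y < d ^ n \<Longrightarrow> (\<And>k. k < n \<Longrightarrow> digit d k x = digit d k y) \<Longrightarrow> x = y"
proof (induction n arbitrary: x y)
  case (Suc n)
  have "0 < d" using Suc.prems(1) by (cases d) auto
  then have "x mod d ^ n = y mod d ^ n"
    using Suc.prems(3) by (rule_tac Suc.IH) (simp_all add: digit_mod)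
  moreover have "x div d ^ n = y div d ^ n"
    using digit_top Suc.prems by (metis lessI)
  ultimately show ?case by (metis div_mult_mod_eq)
qed simp

lemma undigit:
  assumes "\<And>k. k < n \<Longrightarrow> h k < d"
  shows "(\<Sum>k<n. h k * d ^ k) < d ^ n \<and> (\<forall>k<n. digit d k (\<Sum>k<n. h k * d ^ k) = h k)"
  using assms
proof (induction n)
  case (Suc n)
  define s where "s = (\<Sum>k<n. h k * d ^ k)"
  have IH: "s < d ^ n" "\<And>k. k < n \<Longrightarrow> digit d k s = h k" using Suc by (auto simp: s_def)
  have e: "(\<Sum>k<Suc n. h k * d ^ k) = h n * d ^ n + s" by (simp add: s_def)
  have "h n < d" using Suc.prems by simp
  then have "h n * d ^ n + s < d * d ^ n" using IH by (intro idx_less)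
  moreover have "digit d k (h n * d ^ n + s) = h k" if "k < Suc n" for k
  proof (cases "k = n")
    case True
    then show ?thesis using idx_div[OF IH(1)] \<open>h n < d\<close> by (simp add: digit_def)
  next
    case False
    then have "k < n" using that by simp
    then show ?thesis using digit_mod[of k n d "h n * d ^ n + s"] IH by simp
  qed
  ultimately show ?case unfolding e by simp
qed simp

text \<open>The distributive law, with words of length \<open>n\<close> encoded as numbers by their
  digits. Traces, marginals and orthonormality of product objects all factorise through it.\<close>

lemma sum_prod_digits:
  fixes F :: "nat \<Rightarrow> nat \<Rightarrow> 'a :: comm_semiring_1"
  shows "(\<Sum>x<d ^ n. \<Prod>k<n. F k (digit d k x)) = (\<Prod>k<n. \<Sum>y<d. F k y)"
proof (induction n)
  case (Suc n)
  have "(\<Sum>x<d ^ Suc n. \<Prod>k<Suc n. F k (digit d k x))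
     = (\<Sum>x<d * d ^ n. (\<lambda>q r. F n q * (\<Prod>k<n. F k (digit d k r))) (x div d ^ n) (x mod d ^ n))"
    by (intro sum.cong) (auto simp: digit_mod digit_top mult.commute)
  also have "\<dots> = (\<Sum>q<d. \<Sum>r<d ^ n. F n q * (\<Prod>k<n. F k (digit d k r)))"
    by (rule sum_divmod)
  also have "\<dots> = (\<Sum>q<d. F n q) * (\<Sum>r<d ^ n. \<Prod>k<n. F k (digit d k r))"
    by (simp only: sum_product)
  finally show ?case by (simp add: Suc mult.commute)
qed simp

lemma sum2_prod_digits:
  fixes F :: "nat \<Rightarrow> nat \<Rightarrow> nat \<Rightarrow> 'a :: comm_semiring_1"
  shows "(\<Sum>x<d ^ n. \<Sum>y<c ^ n. \<Prod>k<n. F k (digit d k x) (digit c k y)) = (\<Prod>k<n. \<Sum>x<d. \<Sum>y<c. F k x y)"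
proof -
  have "(\<Sum>y<c ^ n. \<Prod>k<n. F k (digit d k x) (digit c k y)) = (\<Prod>k<n. \<Sum>y<c. F k (digit d k x) y)" for x
    by (rule sum_prod_digits)
  then show ?thesis using sum_prod_digits[where F = "\<lambda>k x. \<Sum>y<c. F k x y"] by simp
qed

lemma tdigit_box: "s \<in> box (tpow D n) \<Longrightarrow> tdigit D k s \<in> box D" if "k < n"
proof -
  assume s: "s \<in> box (tpow D n)"
  obtain dA dB dE a b e where D: "D = (dA, dB, dE)" "s = (a, b, e)" by (cases D; cases s) auto
  have "0 < dA" "0 < dB" "0 < dE" using s that unfolding D by (auto intro: base_pos)
  then show ?thesis unfolding D by (simp add: digit_less)
qed

lemma sum_box_prod:
  fixes F :: "nat \<Rightarrow> tri \<Rightarrow> complex"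
  shows "(\<Sum>s\<in>box (tpow D n). \<Prod>k<n. F k (tdigit D k s)) = (\<Prod>k<n. \<Sum>s\<in>box D. F k s)"
proof -
  obtain dA dB dE where D: "D = (dA, dB, dE)" by (cases D)
  have "(\<Sum>s\<in>box (tpow D n). \<Prod>k<n. F k (tdigit D k s))
     = (\<Sum>a<dA ^ n. \<Sum>b<dB ^ n. \<Sum>e<dE ^ n. \<Prod>k<n. F k (digit dA k a, digit dB k b, digit dE k e))"
    unfolding D tpow.simps sum_box by simp
  also have "\<dots> = (\<Sum>a<dA ^ n. \<Prod>k<n. \<Sum>b<dB. \<Sum>e<dE. F k (digit dA k a, b, e))"
    by (intro sum.cong refl sum2_prod_digits)
  also have "\<dots> = (\<Prod>k<n. \<Sum>a<dA. \<Sum>b<dB. \<Sum>e<dE. F k (a, b, e))"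
    by (rule sum_prod_digits)
  also have "\<dots> = (\<Prod>k<n. \<Sum>s\<in>box D. F k s)" unfolding D sum_box ..
  finally show ?thesis .
qed

text \<open>The factors may vary with the position, as they do for the blocks of a tensor power
  between two words.\<close>

definition prod_op :: "tri \<Rightarrow> nat \<Rightarrow> (nat \<Rightarrow> tri \<Rightarrow> tri \<Rightarrow> complex) \<Rightarrow> complex mat" where
  "prod_op D n F = tmat (tpow D n) (\<lambda>s t. \<Prod>k<n. F k (tdigit D k s) (tdigit D k t))"

lemma tensor_power_prod_op: "tensor_power D n \<rho> = prod_op D n (\<lambda>_. tent D \<rho>)"
  by (simp add: tensor_power_def prod_op_def)

lemma prod_op_carrier: "prod_op D n F \<in> carrier_mat (tdim (tpow D n)) (tdim (tpow D n))"
  by (simp only: prod_op_def tmat_carrier)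

lemma tent_prod_op:
  "s \<in> box (tpow D n) \<Longrightarrow> t \<in> box (tpow D n) \<Longrightarrow>
    tent (tpow D n) (prod_op D n F) s t = (\<Prod>k<n. F k (tdigit D k s) (tdigit D k t))"
  by (simp add: prod_op_def tent_tmat)

lemma trace_prod_op: "mtrace (prod_op D n F) = (\<Prod>k<n. \<Sum>s\<in>box D. F k s s)"
proof -
  have "mtrace (prod_op D n F) = (\<Sum>s\<in>box (tpow D n). \<Prod>k<n. F k (tdigit D k s) (tdigit D k s))"
    unfolding mtrace_tent[OF prod_op_carrier] by (intro sum.cong refl tent_prod_op)
  then show ?thesis using sum_box_prod[where F = "\<lambda>k s. F k s s"] by simp
qed

lemma gram_tent:
  assumes "psd (tdim D) \<rho>"
  shows "\<exists>x. \<forall>s\<in>box D. \<forall>t\<in>box D. tent D \<rho> s t = (\<Sum>m<tdim D. x m s * cnj (x m t))"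
proof -
  obtain x where x: "\<forall>i<tdim D. \<forall>j<tdim D. \<rho> $$ (i, j) = (\<Sum>m<tdim D. x m i * cnj (x m j))"
    using posf_gram_ex[of "tdim D" "\<lambda>i j. \<rho> $$ (i, j)"] assms by (auto simp: psd_iff)
  show ?thesis by (rule exI[of _ "\<lambda>m s. x m (enc D s)"]) (use x in \<open>auto simp: tent_def enc_less\<close>)
qed

text \<open>Products of the Gram vectors of the single factor are Gram vectors of the tensor
  power.\<close>

lemma psd_tensor_power:
  assumes "psd (tdim D) \<rho>"
  shows "psd (tdim (tpow D n)) (tensor_power D n \<rho>)"
proof -
  obtain x where x: "\<forall>s\<in>box D. \<forall>t\<in>box D. tent D \<rho> s t = (\<Sum>m<tdim D. x m s * cnj (x m t))"
    using gram_tent[OF assms] by auto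
  define y where "y m s = (\<Prod>k<n. x (digit (tdim D) k m) (tdigit D k s))" for m s
  have "tent (tpow D n) (tensor_power D n \<rho>) s t = (\<Sum>m<tdim D ^ n. y m s * cnj (y m t))"
    if st: "s \<in> box (tpow D n)" "t \<in> box (tpow D n)" for s t
  proof -
    have "tent (tpow D n) (tensor_power D n \<rho>) s t
        = (\<Prod>k<n. \<Sum>m<tdim D. x m (tdigit D k s) * cnj (x m (tdigit D k t)))"
      unfolding tensor_power_prod_op tent_prod_op[OF st]
      using x st by (intro prod.cong refl) (simp add: tdigit_box)
    also have "\<dots> = (\<Sum>m<tdim D ^ n. \<Prod>k<n. x (digit (tdim D) k m) (tdigit D k s) * cnj (x (digit (tdim D) k m) (tdigit D k t)))"
      by (rule sum_prod_digits[symmetric])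
    also have "\<dots> = (\<Sum>m<tdim D ^ n. y m s * cnj (y m t))"
      by (simp add: y_def prod.distrib)
    finally show ?thesis .
  qed
  then have "posf (box (tpow D n)) (tent (tpow D n) (tensor_power D n \<rho>))
     = posf (box (tpow D n)) (\<lambda>s t. \<Sum>m<tdim D ^ n. y m s * cnj (y m t))"
    by (intro posf_cong) auto
  then show ?thesis
    using psd_tent[OF prod_op_carrier] by (simp add: tensor_power_prod_op posf_gram)
qed

text \<open>Eve's \<open>n\<close> copies of EE' are numbered copy by copy, but a protocol for E
  needs the copies of E and those of E' as two separate registers. This is the corresponding
  relabelling of her basis, and the initial \<open>g\<close> of the spectator argument.\<close>

definition merge_digits :: "nat \<Rightarrow> nat \<Rightarrow> nat \<Rightarrow> nat \<times> nat \<Rightarrow> nat" where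
  "merge_digits d m n = (\<lambda>(e, j). \<Sum>k<n. (digit d k e * m + digit m k j) * (d * m) ^ k)"

lemma merge_digits:
  assumes "e < d ^ n" "j < m ^ n"
  shows "merge_digits d m n (e, j) < (d * m) ^ n"
    and "k < n \<Longrightarrow> digit (d * m) k (merge_digits d m n (e, j)) = digit d k e * m + digit m k j"
proof -
  have l: "digit d k e * m + digit m k j < d * m" if "k < n" for k
  proof -
    have "0 < d" "0 < m" using assms that by (auto intro: base_pos)
    then show ?thesis by (intro idx_less digit_less)
  qed
  then show "merge_digits d m n (e, j) < (d * m) ^ n"
    and "k < n \<Longrightarrow> digit (d * m) k (merge_digits d m n (e, j)) = digit d k e * m + digit m k j"
    using undigit[of n "\<lambda>k. digit d k e * m + digit m k j" "d * m"] by (simp_all add: merge_digits_def)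
qed

lemma bij_merge_digits:
  "bij_betw (merge_digits d m n) ({..<d ^ n} \<times> {..<m ^ n}) {..<d ^ n * m ^ n}"
proof -
  have inj: "inj_on (merge_digits d m n) ({..<d ^ n} \<times> {..<m ^ n})"
  proof (rule inj_onI)
    fix p p' assume "p \<in> {..<d ^ n} \<times> {..<m ^ n}" "p' \<in> {..<d ^ n} \<times> {..<m ^ n}"
      and eq: "merge_digits d m n p = merge_digits d m n p'"
    then obtain e j e' j' where p: "p = (e, j)" "p' = (e', j')"
      and r: "e < d ^ n" "j < m ^ n" "e' < d ^ n" "j' < m ^ n" by auto
    have dd: "digit d k e = digit d k e' \<and> digit m k j = digit m k j'" if k: "k < n" for k
    proof -
      have "0 < m" using r k by (auto intro: base_pos)
      then have l: "digit m k j < m" "digit m k j' < m" by (auto intro: digit_less)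
      have e: "digit d k e * m + digit m k j = digit d k e' * m + digit m k j'"
        using eq merge_digits(2)[OF r(1,2) k] merge_digits(2)[OF r(3,4) k] unfolding p by simp
      show ?thesis
        using arg_cong[OF e, of "\<lambda>x. x div m"] arg_cong[OF e, of "\<lambda>x. x mod m"] l by simp
    qed
    then show "p = p'" unfolding p using r by (auto intro: digit_inj)
  qed
  have "merge_digits d m n ` ({..<d ^ n} \<times> {..<m ^ n}) \<subseteq> {..<d ^ n * m ^ n}"
    using merge_digits(1) by (auto simp: power_mult_distrib)
  moreover have "card (merge_digits d m n ` ({..<d ^ n} \<times> {..<m ^ n})) = card {..<d ^ n * m ^ n}"
    using card_image[OF inj] by simp
  ultimately have "merge_digits d m n ` ({..<d ^ n} \<times> {..<m ^ n}) = {..<d ^ n * m ^ n}"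
    by (intro card_subset_eq) auto
  then show ?thesis using inj by (simp add: bij_betw_def)
qed

text \<open>The operator \<open><v \<kappa>| \<rho> |v \<kappa>'>\<close> on ABE, with E' taken in
  the basis \<open>v\<close>.\<close>

definition rot_block :: "tri \<Rightarrow> nat \<Rightarrow> (nat \<Rightarrow> nat \<Rightarrow> complex) \<Rightarrow> complex mat \<Rightarrow> nat \<Rightarrow> nat \<Rightarrow> tri \<Rightarrow> tri \<Rightarrow> complex" where
  "rot_block D m v \<rho> \<kappa> \<kappa>' s t = (\<Sum>j<m. \<Sum>j'<m. cnj (v \<kappa> j) *
     tent (add_eve m D) \<rho> (put_eve (\<lambda>(e, j). e * m + j) j s) (put_eve (\<lambda>(e, j). e * m + j) j' t) * v \<kappa>' j')"

definition vpow :: "nat \<Rightarrow> nat \<Rightarrow> (nat \<Rightarrow> nat \<Rightarrow> complex) \<Rightarrow> nat \<Rightarrow> nat \<Rightarrow> complex" where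
  "vpow m n v \<kappa> j = (\<Prod>k<n. v (digit m k \<kappa>) (digit m k j))"

lemma tpow_add_eve: "tpow (add_eve m D) n = add_eve (m ^ n) (tpow D n)"
  by (cases D) (simp add: power_mult_distrib)

text \<open>Both the product basis and the tensor power are products over positions, so the double
  sum over words splits digit by digit.\<close>

lemma rot_tensor_power:
  assumes s: "s \<in> box (tpow D n)" and t: "t \<in> box (tpow D n)"
    and dE: "snd (snd D) = dE"
  shows "(\<Sum>j<m ^ n. \<Sum>j'<m ^ n. cnj (vpow m n v \<kappa> j) *
      tent (add_eve (m ^ n) (tpow D n)) (tensor_power (add_eve m D) n \<rho>)
        (put_eve (merge_digits dE m n) j s) (put_eve (merge_digits dE m n) j' t) * vpow m n v \<kappa>' j')
    = (\<Prod>k<n. rot_block D m v \<rho> (digit m k \<kappa>) (digit m k \<kappa>') (tdigit D k s) (tdigit D k t))"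
proof -
  have b: "put_eve (merge_digits dE m n) j s \<in> box (tpow (add_eve m D) n)"
    if "s \<in> box (tpow D n)" "j < m ^ n" for s j
    using that dE merge_digits(1)[of "snd (snd s)" dE n j m] by (cases D; cases s) auto
  have td: "tdigit (add_eve m D) k (put_eve (merge_digits dE m n) j s)
      = put_eve (\<lambda>(e, j). e * m + j) (digit m k j) (tdigit D k s)"
    if "s \<in> box (tpow D n)" "j < m ^ n" "k < n" for s j k
    using that dE merge_digits(2)[of "snd (snd s)" dE n j m k] by (cases D; cases s) auto
  have "(\<Sum>j<m ^ n. \<Sum>j'<m ^ n. cnj (vpow m n v \<kappa> j) *
      tent (add_eve (m ^ n) (tpow D n)) (tensor_power (add_eve m D) n \<rho>)
        (put_eve (merge_digits dE m n) j s) (put_eve (merge_digits dE m n) j' t) * vpow m n v \<kappa>' j')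
    = (\<Sum>j<m ^ n. \<Sum>j'<m ^ n. \<Prod>k<n. cnj (v (digit m k \<kappa>) (digit m k j)) *
        tent (add_eve m D) \<rho> (put_eve (\<lambda>(e, j). e * m + j) (digit m k j) (tdigit D k s))
          (put_eve (\<lambda>(e, j). e * m + j) (digit m k j') (tdigit D k t)) * v (digit m k \<kappa>') (digit m k j'))"
  proof (intro sum.cong refl)
    fix j j' assume j: "j \<in> {..<m ^ n}" and j': "j' \<in> {..<m ^ n}"
    have "tent (add_eve (m ^ n) (tpow D n)) (tensor_power (add_eve m D) n \<rho>)
        (put_eve (merge_digits dE m n) j s) (put_eve (merge_digits dE m n) j' t)
      = (\<Prod>k<n. tent (add_eve m D) \<rho> (put_eve (\<lambda>(e, j). e * m + j) (digit m k j) (tdigit D k s))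
          (put_eve (\<lambda>(e, j). e * m + j) (digit m k j') (tdigit D k t)))"
      unfolding tpow_add_eve[symmetric] tensor_power_prod_op
      using b s t j j' td by (subst tent_prod_op) (auto intro!: prod.cong)
    then show "cnj (vpow m n v \<kappa> j) *
      tent (add_eve (m ^ n) (tpow D n)) (tensor_power (add_eve m D) n \<rho>)
        (put_eve (merge_digits dE m n) j s) (put_eve (merge_digits dE m n) j' t) * vpow m n v \<kappa>' j'
      = (\<Prod>k<n. cnj (v (digit m k \<kappa>) (digit m k j)) *
        tent (add_eve m D) \<rho> (put_eve (\<lambda>(e, j). e * m + j) (digit m k j) (tdigit D k s))
          (put_eve (\<lambda>(e, j). e * m + j) (digit m k j') (tdigit D k t)) * v (digit m k \<kappa>') (digit m k j'))"
      by (simp add: vpow_def prod.distrib)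
  qed
  also have "\<dots> = (\<Prod>k<n. rot_block D m v \<rho> (digit m k \<kappa>) (digit m k \<kappa>') (tdigit D k s) (tdigit D k t))"
    unfolding rot_block_def
    by (rule sum2_prod_digits[where F = "\<lambda>k x y. cnj (v (digit m k \<kappa>) x) *
        tent (add_eve m D) \<rho> (put_eve (\<lambda>(e, j). e * m + j) x (tdigit D k s))
          (put_eve (\<lambda>(e, j). e * m + j) y (tdigit D k t)) * v (digit m k \<kappa>') y"])
  finally show ?thesis .
qed

lemma onb_vpow:
  assumes "onb m v" shows "onb (m ^ n) (vpow m n v)"
  unfolding onb_def
proof (intro conjI allI impI)
  fix x y assume xy: "x < m ^ n" "y < m ^ n"
  have dl: "digit m k z < m" if "k < n" for k z
    using xy that by (intro digit_less) (auto intro: base_pos)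
  have one: "(\<Prod>k<n. if digit m k x = digit m k y then 1 else 0 :: complex) = (if x = y then 1 else 0)"
  proof (cases "x = y")
    case False
    then obtain k where "k < n" "digit m k x \<noteq> digit m k y" using digit_inj[OF xy] by auto
    then show ?thesis using False by (auto intro!: prod_zero)
  qed simp
  have "ip (m ^ n) (vpow m n v x) (vpow m n v y)
      = (\<Sum>j<m ^ n. \<Prod>k<n. cnj (v (digit m k x) (digit m k j)) * v (digit m k y) (digit m k j))"
    by (simp add: ip_def vpow_def prod.distrib)
  also have "\<dots> = (\<Prod>k<n. ip m (v (digit m k x)) (v (digit m k y)))"
    unfolding ip_def by (rule sum_prod_digits[where F = "\<lambda>k j. cnj (v (digit m k x) j) * v (digit m k y) j"])
  also have "\<dots> = (\<Prod>k<n. if digit m k x = digit m k y then 1 else 0)"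
    using assms dl by (intro prod.cong) (auto simp: onb_def)
  finally show "ip (m ^ n) (vpow m n v x) (vpow m n v y) = (if x = y then 1 else 0)" using one by simp
  have "(\<Sum>j<m ^ n. vpow m n v j x * cnj (vpow m n v j y))
      = (\<Sum>j<m ^ n. \<Prod>k<n. v (digit m k j) (digit m k x) * cnj (v (digit m k j) (digit m k y)))"
    by (simp add: vpow_def prod.distrib)
  also have "\<dots> = (\<Prod>k<n. \<Sum>j<m. v j (digit m k x) * cnj (v j (digit m k y)))"
    by (rule sum_prod_digits[where F = "\<lambda>k j. v j (digit m k x) * cnj (v j (digit m k y))"])
  also have "\<dots> = (\<Prod>k<n. if digit m k x = digit m k y then 1 else 0)"
    using assms dl by (intro prod.cong) (auto simp: onb_def)
  finally show "(\<Sum>j<m ^ n. vpow m n v j x * cnj (vpow m n v j y)) = (if x = y then 1 else 0)" using one by simp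
qed

section \<open>Typical eigenvalues\<close>

text \<open>Only a lower bound on the probability is imposed: it limits the number of words, and
  with \<open>r\<close> above the entropy the words violating it have vanishing weight.\<close>

definition typical :: "nat \<Rightarrow> (nat \<Rightarrow> real) \<Rightarrow> nat \<Rightarrow> real \<Rightarrow> nat set" where
  "typical m p n r = {\<kappa>. \<kappa> < m ^ n \<and> 2 powr (- real n * r) \<le> (\<Prod>k<n. p (digit m k \<kappa>))}"

text \<open>Every typical word weighs at least 2^(-n r), and all words together weigh 1.\<close>

lemma card_typical:
  assumes p: "\<And>k. k < m \<Longrightarrow> 0 \<le> p k" "(\<Sum>k<m. p k) = 1"
  shows "real (card (typical m p n r)) \<le> 2 powr (real n * r)"
proof -
  have T: "typical m p n r \<subseteq> {..<m ^ n}" by (auto simp: typical_def)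
  have nn: "0 \<le> (\<Prod>k<n. p (digit m k \<kappa>))" if "\<kappa> < m ^ n" for \<kappa>
    using that p(1) by (intro prod_nonneg) (auto intro!: digit_less intro: base_pos)
  have "real (card (typical m p n r)) * 2 powr (- real n * r) = (\<Sum>\<kappa>\<in>typical m p n r. 2 powr (- real n * r))"
    by simp
  also have "\<dots> \<le> (\<Sum>\<kappa>\<in>typical m p n r. \<Prod>k<n. p (digit m k \<kappa>))"
    by (intro sum_mono) (auto simp: typical_def)
  also have "\<dots> \<le> (\<Sum>\<kappa><m ^ n. \<Prod>k<n. p (digit m k \<kappa>))"
    using T nn by (intro sum_mono2) auto
  also have "\<dots> = 1" using sum_prod_digits[where F = "\<lambda>_. p" and n = n and d = m] p(2) by simp
  finally have "real (card (typical m p n r)) * 2 powr (- real n * r) * 2 powr (real n * r) \<le> 1 * 2 powr (real n * r)"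
    by (intro mult_right_mono) auto
  then show ?thesis by (simp add: mult.assoc flip: powr_add)
qed

text \<open>Chernoff bound: the derivative of \<open>s \<mapsto> \<Sum> p\<^sup>1\<^sup>-\<^sup>s - 2\<^sup>s\<^sup>r\<close> at 0 is \<open>(H(p) - r) ln 2\<close>.\<close>

lemma renyi_less:
  assumes p: "\<And>k. k < m \<Longrightarrow> 0 \<le> p k" "(\<Sum>k<m. p k) = 1"
    and r: "- (\<Sum>k<m. p k * log 2 (p k)) < r"
  shows "\<exists>s>0. (\<Sum>k<m. if p k = 0 then 0 else p k powr (1 - s)) < 2 powr (s * r)"
proof -
  define h where "h s = (\<Sum>k<m. if p k = 0 then 0 else p k powr (1 - s)) - 2 powr (s * r)" for s
  have d1: "((\<lambda>s. if p k = 0 then 0 else p k powr (1 - s)) has_real_derivative - (p k * ln (p k))) (at 0)"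
    if "k < m" for k
  proof (cases "p k = 0")
    case False
    then have pk: "0 < p k" using p(1)[OF that] by simp
    have "((\<lambda>s. p k powr (1 - s)) has_real_derivative - (p k * ln (p k))) (at 0)"
      using pk by (auto intro!: derivative_eq_intros)
    then show ?thesis using False by simp
  qed simp
  have d2: "((\<lambda>s. 2 powr (s * r)) has_real_derivative r * ln 2) (at 0)"
    by (auto intro!: derivative_eq_intros)
  have "(h has_real_derivative (\<Sum>k<m. - (p k * ln (p k))) - r * ln 2) (at 0)"
    unfolding h_def by (intro DERIV_diff DERIV_sum d1 d2) auto
  moreover have "(\<Sum>k<m. - (p k * ln (p k))) - r * ln 2 < 0"
  proof -
    have "(\<Sum>k<m. - (p k * ln (p k))) = - (\<Sum>k<m. p k * log 2 (p k)) * ln 2"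
      by (simp add: log_def sum_negf sum_distrib_right)
    also have "\<dots> < r * ln 2" using r by (intro mult_strict_right_mono) auto
    finally show ?thesis by simp
  qed
  ultimately obtain d where d: "d > 0" "\<And>s. s > 0 \<Longrightarrow> s < d \<Longrightarrow> h (0 + s) < h 0"
    using DERIV_neg_dec_right by blast
  have "(\<Sum>k<m. if p k = 0 then 0 else p k powr (1 - 0)) = (\<Sum>k<m. p k)"
    using p(1) by (intro sum.cong) auto
  then have "h 0 = 0" using p by (simp add: h_def)
  then have "h (d / 2) < 0" using d(2)[of "d / 2"] d(1) by simp
  then show ?thesis using d(1) by (intro exI[of _ "d / 2"]) (simp add: h_def)
qed

text \<open>A violating word of weight P has P^s \<le> 2^(-n r s), hence P \<le> 2^(-n r s) P^(1-s).
  Summed over all words the right-hand side is the n-th power of a number that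
  \<open>renyi_less\<close> makes smaller than 1.\<close>

lemma atypical_tendsto_0:
  assumes p: "\<And>k. k < m \<Longrightarrow> 0 \<le> p k" "(\<Sum>k<m. p k) = 1"
    and r: "- (\<Sum>k<m. p k * log 2 (p k)) < r"
  shows "(\<lambda>n. \<Sum>\<kappa>\<in>{..<m ^ n} - typical m p n r. \<Prod>k<n. p (digit m k \<kappa>)) \<longlonglongrightarrow> 0"
proof -
  obtain s where s: "s > 0" "(\<Sum>k<m. if p k = 0 then 0 else p k powr (1 - s)) < 2 powr (s * r)"
    using renyi_less[OF assms] by blast
  define q where "q k = (if p k = 0 then 0 else p k powr (1 - s))" for k
  define c where "c = (\<Sum>k<m. q k) * 2 powr (- (s * r))"
  have q0: "0 \<le> q k" for k by (simp add: q_def)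
  have c0: "0 \<le> c" by (simp add: c_def sum_nonneg q0)
  have "(\<Sum>k<m. q k) * 2 powr (- (s * r)) < 2 powr (s * r) * 2 powr (- (s * r))"
    using s(2) unfolding q_def by (intro mult_strict_right_mono) auto
  then have c1: "c < 1" by (simp add: c_def flip: powr_add)
  have le: "(\<Sum>\<kappa>\<in>{..<m ^ n} - typical m p n r. \<Prod>k<n. p (digit m k \<kappa>)) \<le> c ^ n" for n
  proof -
    have dl: "0 \<le> p (digit m k \<kappa>)" if "\<kappa> < m ^ n" "k < n" for k \<kappa>
      using that by (intro p(1) digit_less base_pos)
    have "(\<Prod>k<n. p (digit m k \<kappa>)) \<le> 2 powr (- real n * r * s) * (\<Prod>k<n. q (digit m k \<kappa>))"
      if \<kappa>: "\<kappa> \<in> {..<m ^ n} - typical m p n r" for \<kappa>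
    proof (cases "\<exists>k<n. p (digit m k \<kappa>) = 0")
      case True
      then have "(\<Prod>k<n. p (digit m k \<kappa>)) = 0" by (auto intro!: prod_zero)
      then show ?thesis by (simp only:) (intro mult_nonneg_nonneg prod_nonneg q0 powr_ge_zero)
    next
      case False
      define P where "P = (\<Prod>k<n. p (digit m k \<kappa>))"
      have pos: "0 < p (digit m k \<kappa>)" if "k < n" for k
        using False dl[of \<kappa> k] \<kappa> that by (auto simp: less_le)
      then have P: "0 < P" unfolding P_def by (intro prod_pos) auto
      have "P < 2 powr (- real n * r)" using \<kappa> by (auto simp: typical_def P_def)
      then have "P powr s \<le> (2 powr (- real n * r)) powr s" using P s by (intro powr_mono2) auto
      then have "P powr s \<le> 2 powr (- real n * r * s)" by (simp add: powr_powr)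
      moreover have "P powr (1 - s) = (\<Prod>k<n. q (digit m k \<kappa>))"
        unfolding P_def q_def using pos by (subst prod_powr_distrib) (auto intro!: prod.cong less_imp_le dest: less_imp_neq)
      moreover have "P = P powr s * P powr (1 - s)" using P by (simp flip: powr_add)
      ultimately show ?thesis unfolding P_def[symmetric]
        by (metis mult_right_mono powr_ge_zero)
    qed
    then have "(\<Sum>\<kappa>\<in>{..<m ^ n} - typical m p n r. \<Prod>k<n. p (digit m k \<kappa>))
       \<le> (\<Sum>\<kappa>\<in>{..<m ^ n} - typical m p n r. 2 powr (- real n * r * s) * (\<Prod>k<n. q (digit m k \<kappa>)))"
      by (rule sum_mono)
    also have "\<dots> \<le> (\<Sum>\<kappa><m ^ n. 2 powr (- real n * r * s) * (\<Prod>k<n. q (digit m k \<kappa>)))"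
      by (intro sum_mono2) (auto intro!: mult_nonneg_nonneg prod_nonneg q0)
    also have "\<dots> = 2 powr (- real n * r * s) * (\<Sum>k<m. q k) ^ n"
      using sum_prod_digits[where F = "\<lambda>_. q" and n = n and d = m] by (simp flip: sum_distrib_left)
    also have "\<dots> = c ^ n"
      by (simp add: c_def power_mult_distrib powr_powr mult_ac flip: powr_realpow)
    finally show ?thesis .
  qed
  have nn: "0 \<le> (\<Sum>\<kappa>\<in>{..<m ^ n} - typical m p n r. \<Prod>k<n. p (digit m k \<kappa>))" for n
    by (intro sum_nonneg prod_nonneg) (auto intro!: p(1) digit_less intro: base_pos)
  have "(\<lambda>n. c ^ n) \<longlonglongrightarrow> 0" using c0 c1 by (intro LIMSEQ_realpow_zero)
  then show ?thesis
    by (rule tendsto_sandwich[where f = "\<lambda>_. 0" and h = "\<lambda>n. c ^ n", rotated 3])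
      (simp_all add: nn le)
qed

section \<open>The entropy as a sum over an eigenbasis\<close>

lemma order_prod_linear:
  fixes m :: nat
  shows "Polynomial.order x (\<Prod>k<m. [:- c k, 1:]) = card {k \<in> {..<m}. c k = (x :: complex)}"
proof (induction m)
  case (Suc m)
  have nz: "(\<Prod>k<m. [:- c k, 1:]) * [:- c m, 1:] \<noteq> 0" by (simp del: mult_pCons_right mult_pCons_left)
  have l: "Polynomial.order x [:- c m, 1:] = (if c m = x then 1 else 0)"
  proof (cases "c m = x")
    case True
    then show ?thesis using order_power_n_n[of x 1] by simp
  next
    case False
    then show ?thesis by (auto intro!: order_0I)
  qed
  have "{k \<in> {..<Suc m}. c k = x} = {k \<in> {..<m}. c k = x} \<union> (if c m = x then {m} else {})"
    by (auto simp: less_Suc_eq)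
  then have "card {k \<in> {..<Suc m}. c k = x} = card {k \<in> {..<m}. c k = x} + (if c m = x then 1 else 0)"
    by (simp add: card_insert_if)
  then show ?case unfolding prod.lessThan_Suc order_mult[OF nz] l Suc by simp
qed (simp add: order_0I)

text \<open>\<open>vn_entropy\<close> runs over distinct eigenvalues with multiplicities.
  Diagonalisation makes the characteristic polynomial the product of the factors X - p k, so a
  multiplicity counts the indices that share a value, and the sum can be regrouped by index.\<close>

lemma vn_entropy_spectral:
  assumes v: "onb m v" and M: "M \<in> carrier_mat m m"
    and Mv: "\<And>i j. i < m \<Longrightarrow> j < m \<Longrightarrow> M $$ (i, j) = spectral_op m v p i j"
  shows "vn_entropy M = - (\<Sum>k<m. p k * log 2 (p k))"
proof -
  define U where "U = mat m m (\<lambda>(i, k). v k i)"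
  define E where "E = mat m m (\<lambda>(i, j). if i = j then complex_of_real (p i) else 0)"
  have U: "U \<in> carrier_mat m m" and E: "E \<in> carrier_mat m m" by (auto simp: U_def E_def)
  have aU: "mat_adjoint U \<in> carrier_mat m m" using U by simp
  have 1: "mat_adjoint U * U = 1\<^sub>m m"
    using v U by (intro eq_matI) (auto simp: scalar_prod_def U_def onb_def ip_def lessThan_atLeast0)
  have 2: "U * mat_adjoint U = 1\<^sub>m m" by (rule mat_mult_left_right_inverse[OF aU U 1])
  have UE: "(U * E) $$ (i, k) = v k i * of_real (p k)" if "i < m" "k < m" for i k
  proof -
    have "(U * E) $$ (i, k) = (\<Sum>l<m. v l i * (if l = k then of_real (p l) else 0))"
      using that U E by (simp add: scalar_prod_def lessThan_atLeast0 U_def E_def)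
    also have "\<dots> = (\<Sum>l<m. if l = k then v l i * of_real (p l) else 0)" by (intro sum.cong) auto
    finally have "(U * E) $$ (i, k) = (\<Sum>l<m. if l = k then v l i * of_real (p l) else 0)" .
    then show ?thesis using that by simp
  qed
  define F where "F = U * E"
  have F: "F \<in> carrier_mat m m" using U E by (simp add: F_def)
  have "M = F * mat_adjoint U"
  proof (rule eq_matI)
    fix i j assume "i < dim_row (F * mat_adjoint U)" "j < dim_col (F * mat_adjoint U)"
    then have ij: "i < m" "j < m" using F U by auto
    have "(F * mat_adjoint U) $$ (i, j) = (\<Sum>k<m. F $$ (i, k) * cnj (U $$ (j, k)))"
      using ij F U by (simp add: scalar_prod_def lessThan_atLeast0)
    also have "\<dots> = spectral_op m v p i j"
      unfolding spectral_op_def F_def using UE ij by (intro sum.cong) (auto simp: U_def mult_ac)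
    finally show "M $$ (i, j) = (F * mat_adjoint U) $$ (i, j)" using Mv ij by simp
  qed (use M F U in auto)
  then have ME: "M = U * E * mat_adjoint U" by (simp only: F_def)
  have "similar_mat M E"
    by (rule similar_matI[of M E U "mat_adjoint U" m, OF _ 2 1 ME]) (use M U E aU in blast)
  then have "char_poly M = char_poly E" by (rule char_poly_similar)
  also have "\<dots> = (\<Prod>a\<leftarrow>diag_mat E. [:- a, 1:])"
    using E by (intro char_poly_upper_triangular) (auto simp: upper_triangular_def E_def)
  also have "\<dots> = (\<Prod>k<m. [:- complex_of_real (p k), 1:])"
  proof -
    have "diag_mat E = map (\<lambda>k. complex_of_real (p k)) [0..<m]"
      using E by (auto simp: diag_mat_def E_def)
    then show ?thesis
      using prod.distinct_set_conv_list[of "[0..<m]" "\<lambda>k. [:- complex_of_real (p k), 1:]"]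
      by (simp add: o_def lessThan_atLeast0)
  qed
  finally have cp: "char_poly M = (\<Prod>k<m. [:- complex_of_real (p k), 1:])" .
  have sp: "spectrum M = (\<lambda>k. complex_of_real (p k)) ` {..<m}"
    unfolding spectrum_def using eigenvalue_root_char_poly[OF M] by (auto simp: cp poly_prod)
  have "(\<Sum>x\<in>spectrum M. real (Polynomial.order x (char_poly M)) * (Re x * log 2 (Re x)))
    = (\<Sum>x\<in>(\<lambda>k. complex_of_real (p k)) ` {..<m}. \<Sum>k\<in>{k \<in> {..<m}. complex_of_real (p k) = x}. p k * log 2 (p k))"
    unfolding sp cp order_prod_linear
  proof (rule sum.cong[OF refl])
    fix x
    have "(\<Sum>k\<in>{k \<in> {..<m}. complex_of_real (p k) = x}. p k * log 2 (p k))
       = (\<Sum>k\<in>{k \<in> {..<m}. complex_of_real (p k) = x}. Re x * log 2 (Re x))"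
      by (intro sum.cong) auto
    then show "real (card {k \<in> {..<m}. complex_of_real (p k) = x}) * (Re x * log 2 (Re x))
      = (\<Sum>k\<in>{k \<in> {..<m}. complex_of_real (p k) = x}. p k * log 2 (p k))" by simp
  qed
  also have "\<dots> = (\<Sum>k<m. p k * log 2 (p k))"
    by (rule sum.image_gen[symmetric]) simp
  finally show ?thesis by (simp add: vn_entropy_def)
qed

section \<open>The spectator register in its eigenbasis\<close>

lemma linear_sum:
  assumes L: "linear_op (tdim D) (tdim D') \<Lambda>" and fin: "finite J"
    and X: "\<And>j. j \<in> J \<Longrightarrow> X j \<in> carrier_mat (tdim D) (tdim D)"
    and s: "s \<in> box D'" and t: "t \<in> box D'"
  shows "tent D' (\<Lambda> (tmat D (\<lambda>s t. \<Sum>j\<in>J. c j * tent D (X j) s t))) s t = (\<Sum>j\<in>J. c j * tent D' (\<Lambda> (X j)) s t)"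
  using fin X
proof (induction J rule: finite_induct)
  case empty
  \<comment> \<open>The empty sum is the zero operator, which is 0 times itself; homogeneity makes
    its image 0.\<close>
  have "tmat D (\<lambda>_ _. 0) = 0 \<cdot>\<^sub>m tmat D (\<lambda>_ _. 0)"
    by (rule mat_eq_tent[of _ D]) (auto simp: tent_tmat tent_smult)
  then have "\<Lambda> (tmat D (\<lambda>_ _. 0)) = 0 \<cdot>\<^sub>m \<Lambda> (tmat D (\<lambda>_ _. 0))"
    using linear_opD(3)[OF L tmat_carrier, of 0] by metis
  then have "tent D' (\<Lambda> (tmat D (\<lambda>_ _. 0))) s t = 0 * tent D' (\<Lambda> (tmat D (\<lambda>_ _. 0))) s t"
    using tent_smult[OF linear_opD(1)[OF L tmat_carrier] s t, of 0] by metis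
  then show ?case by simp
next
  case (insert j J)
  define Y where "Y = tmat D (\<lambda>s t. \<Sum>j\<in>J. c j * tent D (X j) s t)"
  have Xj: "X j \<in> carrier_mat (tdim D) (tdim D)" using insert by simp
  have Y: "Y \<in> carrier_mat (tdim D) (tdim D)" by (simp add: Y_def)
  have "tmat D (\<lambda>s t. \<Sum>j\<in>insert j J. c j * tent D (X j) s t) = c j \<cdot>\<^sub>m X j + Y"
    using insert(1,2) Xj Y
    by (intro mat_eq_tent[of _ D]) (auto simp: tent_tmat tent_add tent_smult Y_def)
  then have "\<Lambda> (tmat D (\<lambda>s t. \<Sum>j\<in>insert j J. c j * tent D (X j) s t)) = c j \<cdot>\<^sub>m \<Lambda> (X j) + \<Lambda> Y"
    using linear_opD[OF L] Xj Y by simp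
  then show ?case
    using insert linear_opD(1)[OF L Xj] linear_opD(1)[OF L Y] s t
    by (simp add: tent_add tent_smult Y_def)
qed

lemma put_eve_box:
  "s \<in> box D \<Longrightarrow> j < m \<Longrightarrow> put_eve (\<lambda>(e, j). e * m + j) j s \<in> box (add_eve m D)"
  by (cases D; cases s) (auto intro: idx_less)

lemma enc_put_eve: "enc (add_eve m D) (put_eve (\<lambda>(e, j). e * m + j) j s) = enc D s * m + j"
  by (cases D; cases s) (simp add: algebra_simps)

lemma tent_ptrace_snd:
  assumes "s \<in> box D" "t \<in> box D"
  shows "tent D (ptrace_snd (tdim D) m \<rho>) s t = (\<Sum>j<m. tent (add_eve m D) \<rho>
    (put_eve (\<lambda>(e, j). e * m + j) j s) (put_eve (\<lambda>(e, j). e * m + j) j t))"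
  using assms by (simp add: tent_def ptrace_snd_def enc_less enc_put_eve)

lemma ptrace_fst_tent:
  assumes "j < m" "j' < m"
  shows "ptrace_fst (tdim D) m \<rho> $$ (j, j') = (\<Sum>s\<in>box D. tent (add_eve m D) \<rho>
    (put_eve (\<lambda>(e, j). e * m + j) j s) (put_eve (\<lambda>(e, j). e * m + j) j' s))"
  using assms sum.reindex_bij_betw[OF bij_enc, of "\<lambda>x. \<rho> $$ (x * m + j, x * m + j')" D]
  by (simp add: tent_def ptrace_fst_def enc_put_eve)

text \<open>Completeness of \<open>v\<close>: the partial trace over E' does not depend on the
  orthonormal basis in which it is taken.\<close>

lemma sum_rot_block:
  assumes v: "onb m v" and s: "s \<in> box D" and t: "t \<in> box D"
  shows "(\<Sum>\<kappa><m. rot_block D m v \<rho> \<kappa> \<kappa> s t) = tent D (ptrace_snd (tdim D) m \<rho>) s t"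
proof -
  let ?R = "\<lambda>j j'. tent (add_eve m D) \<rho> (put_eve (\<lambda>(e, j). e * m + j) j s) (put_eve (\<lambda>(e, j). e * m + j) j' t)"
  have "(\<Sum>\<kappa><m. rot_block D m v \<rho> \<kappa> \<kappa> s t) = (\<Sum>\<kappa><m. \<Sum>j<m. \<Sum>j'<m. cnj (v \<kappa> j) * ?R j j' * v \<kappa> j')"
    by (simp add: rot_block_def)
  also have "\<dots> = (\<Sum>j<m. \<Sum>\<kappa><m. \<Sum>j'<m. cnj (v \<kappa> j) * ?R j j' * v \<kappa> j')" by (rule sum.swap)
  also have "\<dots> = (\<Sum>j<m. \<Sum>j'<m. \<Sum>\<kappa><m. cnj (v \<kappa> j) * ?R j j' * v \<kappa> j')"
    by (rule sum.cong[OF refl]) (rule sum.swap)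
  also have "\<dots> = (\<Sum>j<m. \<Sum>j'<m. (\<Sum>\<kappa><m. v \<kappa> j' * cnj (v \<kappa> j)) * ?R j j')"
    by (simp add: sum_distrib_right mult_ac)
  also have "\<dots> = (\<Sum>j<m. \<Sum>j'<m. if j' = j then ?R j j' else 0)"
    using v by (intro sum.cong refl) (auto simp: onb_def)
  also have "\<dots> = tent D (ptrace_snd (tdim D) m \<rho>) s t"
    unfolding tent_ptrace_snd[OF s t] by simp
  finally show ?thesis .
qed

text \<open>The trace of a diagonal block is the value of the marginal on E' at the eigenvector
  \<open>v \<kappa>\<close>, hence its eigenvalue.\<close>

lemma trace_rot_block:
  assumes v: "onb m v" and \<kappa>: "\<kappa> < m"
    and marg: "\<And>j j'. j < m \<Longrightarrow> j' < m \<Longrightarrow> ptrace_fst (tdim D) m \<rho> $$ (j, j') = spectral_op m v p j j'"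
  shows "(\<Sum>s\<in>box D. rot_block D m v \<rho> \<kappa> \<kappa> s s) = of_real (p \<kappa>)"
proof -
  let ?R = "\<lambda>j j' s. tent (add_eve m D) \<rho> (put_eve (\<lambda>(e, j). e * m + j) j s) (put_eve (\<lambda>(e, j). e * m + j) j' s)"
  have "(\<Sum>s\<in>box D. rot_block D m v \<rho> \<kappa> \<kappa> s s) = (\<Sum>s\<in>box D. \<Sum>j<m. \<Sum>j'<m. cnj (v \<kappa> j) * ?R j j' s * v \<kappa> j')"
    by (simp add: rot_block_def)
  also have "\<dots> = (\<Sum>j<m. \<Sum>s\<in>box D. \<Sum>j'<m. cnj (v \<kappa> j) * ?R j j' s * v \<kappa> j')" by (rule sum.swap)
  also have "\<dots> = (\<Sum>j<m. \<Sum>j'<m. \<Sum>s\<in>box D. cnj (v \<kappa> j) * ?R j j' s * v \<kappa> j')"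
    by (rule sum.cong[OF refl]) (rule sum.swap)
  also have "\<dots> = (\<Sum>j<m. \<Sum>j'<m. cnj (v \<kappa> j) * ptrace_fst (tdim D) m \<rho> $$ (j, j') * v \<kappa> j')"
    by (intro sum.cong refl) (simp add: ptrace_fst_tent sum_distrib_left sum_distrib_right)
  also have "\<dots> = ip m (v \<kappa>) (ap m (spectral_op m v p) (v \<kappa>))"
    unfolding ip_form[symmetric] by (intro sum.cong refl) (simp add: marg)
  also have "\<dots> = of_real (p \<kappa>)" by (rule spectral_op_eigen[OF v \<kappa>])
  finally show ?thesis .
qed

definition rot_op :: "tri \<Rightarrow> nat \<Rightarrow> (nat \<Rightarrow> nat \<Rightarrow> complex) \<Rightarrow> nat \<Rightarrow> complex mat \<Rightarrow> nat \<Rightarrow> nat \<Rightarrow> complex mat" where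
  "rot_op D m v n \<rho> \<kappa> \<kappa>' = prod_op D n (\<lambda>k. rot_block D m v \<rho> (digit m k \<kappa>) (digit m k \<kappa>'))"

lemma rot_op_carrier: "rot_op D m v n \<rho> \<kappa> \<kappa>' \<in> carrier_mat (tdim (tpow D n)) (tdim (tpow D n))"
  by (simp only: rot_op_def prod_op_carrier)

lemma sum_rot_op:
  assumes v: "onb m v" and s: "s \<in> box (tpow D n)" and t: "t \<in> box (tpow D n)"
  shows "(\<Sum>\<kappa><m ^ n. tent (tpow D n) (rot_op D m v n \<rho> \<kappa> \<kappa>) s t)
    = tent (tpow D n) (tensor_power D n (ptrace_snd (tdim D) m \<rho>)) s t"
proof -
  have "(\<Sum>\<kappa><m ^ n. tent (tpow D n) (rot_op D m v n \<rho> \<kappa> \<kappa>) s t)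
     = (\<Sum>\<kappa><m ^ n. \<Prod>k<n. rot_block D m v \<rho> (digit m k \<kappa>) (digit m k \<kappa>) (tdigit D k s) (tdigit D k t))"
    unfolding rot_op_def tent_prod_op[OF s t] ..
  also have "\<dots> = (\<Prod>k<n. \<Sum>\<kappa><m. rot_block D m v \<rho> \<kappa> \<kappa> (tdigit D k s) (tdigit D k t))"
    by (rule sum_prod_digits[where F = "\<lambda>k \<kappa>. rot_block D m v \<rho> \<kappa> \<kappa> (tdigit D k s) (tdigit D k t)"])
  also have "\<dots> = tent (tpow D n) (tensor_power D n (ptrace_snd (tdim D) m \<rho>)) s t"
    unfolding tensor_power_prod_op tent_prod_op[OF s t]
    using s t by (intro prod.cong refl sum_rot_block[OF v]) (auto intro: tdigit_box)
  finally show ?thesis .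
qed

lemma trace_rot_op:
  assumes v: "onb m v" and \<kappa>: "\<kappa> < m ^ n"
    and marg: "\<And>j j'. j < m \<Longrightarrow> j' < m \<Longrightarrow> ptrace_fst (tdim D) m \<rho> $$ (j, j') = spectral_op m v p j j'"
  shows "mtrace (rot_op D m v n \<rho> \<kappa> \<kappa>) = of_real (\<Prod>k<n. p (digit m k \<kappa>))"
proof -
  have "mtrace (rot_op D m v n \<rho> \<kappa> \<kappa>) = (\<Prod>k<n. \<Sum>s\<in>box D. rot_block D m v \<rho> (digit m k \<kappa>) (digit m k \<kappa>) s s)"
    unfolding rot_op_def trace_prod_op ..
  also have "\<dots> = (\<Prod>k<n. of_real (p (digit m k \<kappa>)))"
    using \<kappa> by (intro prod.cong refl trace_rot_block[OF v _ marg]) (auto intro!: digit_less intro: base_pos)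
  finally show ?thesis by simp
qed

text \<open>Two different words differ at some position, and the factor there is an off-diagonal
  block, which vanishes by assumption.\<close>

lemma rot_op_zero:
  assumes \<kappa>: "\<kappa> < m ^ n" "\<kappa>' < m ^ n" "\<kappa> \<noteq> \<kappa>'"
    and z: "\<And>k k' s t. k < m \<Longrightarrow> k' < m \<Longrightarrow> k \<noteq> k' \<Longrightarrow> s \<in> box D \<Longrightarrow> t \<in> box D \<Longrightarrow> rot_block D m v \<rho> k k' s t = 0"
  shows "rot_op D m v n \<rho> \<kappa> \<kappa>' = tmat (tpow D n) (\<lambda>_ _. 0)"
proof (rule mat_eq_tent[OF rot_op_carrier tmat_carrier])
  fix s t assume s: "s \<in> box (tpow D n)" and t: "t \<in> box (tpow D n)"
  obtain k where k: "k < n" "digit m k \<kappa> \<noteq> digit m k \<kappa>'" using digit_inj[OF \<kappa>(1,2)] \<kappa>(3) by auto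
  have "0 < m" using \<kappa>(1) k(1) by (rule base_pos)
  then have "rot_block D m v \<rho> (digit m k \<kappa>) (digit m k \<kappa>') (tdigit D k s) (tdigit D k t) = 0"
    using s t k by (intro z digit_less tdigit_box) auto
  then show "tent (tpow D n) (rot_op D m v n \<rho> \<kappa> \<kappa>') s t = tent (tpow D n) (tmat (tpow D n) (\<lambda>_ _. 0)) s t"
    unfolding tent_tmat[OF s t] rot_op_def tent_prod_op[OF s t] using k(1) by (auto intro!: prod_zero)
qed

text \<open>The extended protocol acts on computational blocks of the register, and linearity of
  \<open>\<Lambda>\<close> carries the change to the eigenbasis through it. This reduces statements
  about the unknown extended output to \<open>\<Lambda>\<close> and explicit product
  operators.\<close>

lemma spectator_block:
  assumes L: "linear_op (tdim (tpow D n)) (tdim D') \<Lambda>"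
    and ext: "\<And>j k. j < m ^ n \<Longrightarrow> k < m ^ n \<Longrightarrow> eve_block D' (m ^ n) g' j k Y
        = \<Lambda> (eve_block (tpow D n) (m ^ n) (merge_digits (snd (snd D)) m n) j k (tensor_power (add_eve m D) n \<rho>))"
    and s: "s \<in> box D'" and t: "t \<in> box D'"
  shows "(\<Sum>j<m ^ n. \<Sum>j'<m ^ n. cnj (vpow m n v \<kappa> j) *
      tent (add_eve (m ^ n) D') Y (put_eve g' j s) (put_eve g' j' t) * vpow m n v \<kappa>' j')
    = tent D' (\<Lambda> (rot_op D m v n \<rho> \<kappa> \<kappa>')) s t"
proof -
  let ?P = "tensor_power (add_eve m D) n \<rho>" and ?g = "merge_digits (snd (snd D)) m n"
  let ?X = "\<lambda>q. eve_block (tpow D n) (m ^ n) ?g (fst q) (snd q) ?P"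
  let ?c = "\<lambda>q. cnj (vpow m n v \<kappa> (fst q)) * vpow m n v \<kappa>' (snd q)"
  let ?J = "{..<m ^ n} \<times> {..<m ^ n}"
  have "(\<Sum>j<m ^ n. \<Sum>j'<m ^ n. cnj (vpow m n v \<kappa> j) *
      tent (add_eve (m ^ n) D') Y (put_eve g' j s) (put_eve g' j' t) * vpow m n v \<kappa>' j')
    = (\<Sum>q\<in>?J. ?c q * tent D' (\<Lambda> (?X q)) s t)"
    unfolding sum_pair
    by (intro sum.cong refl) (simp add: ext[symmetric] tent_eve_block[OF s t])
  also have "\<dots> = tent D' (\<Lambda> (tmat (tpow D n) (\<lambda>s t. \<Sum>q\<in>?J. ?c q * tent (tpow D n) (?X q) s t))) s t"
    by (rule linear_sum[OF L _ _ s t, symmetric]) (auto intro: eve_block_carrier)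
  also have "tmat (tpow D n) (\<lambda>s t. \<Sum>q\<in>?J. ?c q * tent (tpow D n) (?X q) s t) = rot_op D m v n \<rho> \<kappa> \<kappa>'"
  proof (rule mat_eq_tent[OF tmat_carrier rot_op_carrier])
    fix s t assume s: "s \<in> box (tpow D n)" and t: "t \<in> box (tpow D n)"
    have "(\<Sum>q\<in>?J. ?c q * tent (tpow D n) (?X q) s t) = (\<Sum>j<m ^ n. \<Sum>j'<m ^ n. cnj (vpow m n v \<kappa> j) *
      tent (add_eve (m ^ n) (tpow D n)) ?P (put_eve ?g j s) (put_eve ?g j' t) * vpow m n v \<kappa>' j')"
      unfolding sum_pair by (intro sum.cong refl) (simp add: tent_eve_block[OF s t])
    also have "\<dots> = (\<Prod>k<n. rot_block D m v \<rho> (digit m k \<kappa>) (digit m k \<kappa>') (tdigit D k s) (tdigit D k t))"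
      by (rule rot_tensor_power[OF s t refl])
    finally show "tent (tpow D n) (tmat (tpow D n) (\<lambda>s t. \<Sum>q\<in>?J. ?c q * tent (tpow D n) (?X q) s t)) s t
       = tent (tpow D n) (rot_op D m v n \<rho> \<kappa> \<kappa>') s t"
      unfolding tent_tmat[OF s t] rot_op_def tent_prod_op[OF s t] .
  qed
  finally show ?thesis .
qed

section \<open>Passing between the eigenbasis and the computational basis of the register\<close>

lemma onb_unitary:
  assumes "onb m v" shows "(\<Sum>j<m. (cmod (\<Sum>\<kappa><m. v \<kappa> j * u \<kappa>))\<^sup>2) = (\<Sum>\<kappa><m. (cmod (u \<kappa>))\<^sup>2)"
proof -
  have "ip m (v k) (\<lambda>j. \<Sum>\<kappa><m. v \<kappa> j * u \<kappa>) = u k" if k: "k < m" for k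
  proof -
    have "ip m (v k) (\<lambda>j. \<Sum>\<kappa><m. v \<kappa> j * u \<kappa>) = (\<Sum>j<m. \<Sum>\<kappa><m. cnj (v k j) * v \<kappa> j * u \<kappa>)"
      by (simp add: ip_def sum_distrib_left mult.assoc)
    also have "\<dots> = (\<Sum>\<kappa><m. ip m (v k) (v \<kappa>) * u \<kappa>)"
      by (subst sum.swap) (simp add: ip_def sum_distrib_right)
    also have "\<dots> = (\<Sum>\<kappa><m. if \<kappa> = k then u \<kappa> else 0)"
      using assms k by (intro sum.cong) (auto simp: onb_def)
    finally show ?thesis using k by simp
  qed
  then show ?thesis using parseval[OF assms, of "\<lambda>j. \<Sum>\<kappa><m. v \<kappa> j * u \<kappa>"] by simp
qed

text \<open>Coordinates in the basis \<open>v\<close> are turned into computational ones. Privacy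
  amplification runs in the eigenbasis, where the typical subspace is spanned by basis vectors,
  while the trace distance is tested in the computational basis.\<close>

definition rot_vec :: "nat \<Rightarrow> (nat \<Rightarrow> nat \<Rightarrow> complex) \<Rightarrow> (nat \<times> nat \<Rightarrow> complex) \<Rightarrow> nat \<times> nat \<Rightarrow> complex" where
  "rot_vec m v u = (\<lambda>(x, j). \<Sum>\<kappa><m. v \<kappa> j * u (x, \<kappa>))"

definition rot_test :: "nat \<Rightarrow> (nat \<Rightarrow> nat \<Rightarrow> complex) \<Rightarrow> (nat \<times> nat \<Rightarrow> nat \<times> nat \<Rightarrow> complex) \<Rightarrow> nat \<times> nat \<Rightarrow> nat \<times> nat \<Rightarrow> complex" where
  "rot_test m v W = (\<lambda>(x, \<kappa>) (y, \<kappa>'). \<Sum>j<m. \<Sum>j'<m. cnj (v \<kappa> j) * W (x, j) (y, j') * v \<kappa>' j')"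

lemma nrm_rot_vec:
  assumes "onb m v" shows "nrm ({..<e} \<times> {..<m}) (rot_vec m v u) = nrm ({..<e} \<times> {..<m}) u"
  unfolding nrm_def L2_set_def sum_pair by (simp add: rot_vec_def onb_unitary[OF assms])

lemma bil_rot_test:
  "bil ({..<e} \<times> {..<m}) (rot_test m v W) u w = bil ({..<e} \<times> {..<m}) W (rot_vec m v u) (rot_vec m v w)"
proof -
  let ?F = "\<lambda>x y \<kappa> \<kappa>' j j'. cnj (u (x, \<kappa>)) * (cnj (v \<kappa> j) * W (x, j) (y, j') * v \<kappa>' j') * w (y, \<kappa>')"
  have "bil ({..<e} \<times> {..<m}) W (rot_vec m v u) (rot_vec m v w)
     = (\<Sum>x<e. \<Sum>j<m. \<Sum>y<e. \<Sum>j'<m. \<Sum>\<kappa><m. \<Sum>\<kappa>'<m. ?F x y \<kappa> \<kappa>' j j')"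
    unfolding bil_def sum_pair
  proof (intro sum.cong refl)
    fix x j y j'
    have "cnj (rot_vec m v u (x, j)) * W (x, j) (y, j') * rot_vec m v w (y, j')
       = (\<Sum>\<kappa><m. cnj (v \<kappa> j) * cnj (u (x, \<kappa>)) * W (x, j) (y, j')) * (\<Sum>\<kappa>'<m. v \<kappa>' j' * w (y, \<kappa>'))"
      by (simp add: rot_vec_def sum_distrib_right)
    also have "\<dots> = (\<Sum>\<kappa><m. \<Sum>\<kappa>'<m. ?F x y \<kappa> \<kappa>' j j')"
      unfolding sum_product by (intro sum.cong refl) (simp add: mult_ac)
    finally show "cnj (rot_vec m v u (x, j)) * W (x, j) (y, j') * rot_vec m v w (y, j') = (\<Sum>\<kappa><m. \<Sum>\<kappa>'<m. ?F x y \<kappa> \<kappa>' j j')" .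
  qed
  \<comment> \<open>The six sums are flattened into one sum over tuples, where the exchange of the
    summation order is a bijection.\<close>
  also have "\<dots> = (\<Sum>q\<in>{..<e}\<times>{..<m}\<times>{..<e}\<times>{..<m}\<times>{..<m}\<times>{..<m}. (\<lambda>(x, j, y, j', \<kappa>, \<kappa>'). ?F x y \<kappa> \<kappa>' j j') q)"
    unfolding sum_pair by simp
  also have "\<dots> = (\<Sum>q\<in>{..<e}\<times>{..<m}\<times>{..<e}\<times>{..<m}\<times>{..<m}\<times>{..<m}. (\<lambda>(x, \<kappa>, y, \<kappa>', j, j'). ?F x y \<kappa> \<kappa>' j j') q)"
    by (rule sum.reindex_bij_witness[where i = "\<lambda>(x, \<kappa>, y, \<kappa>', j, j'). (x, j, y, j', \<kappa>, \<kappa>')"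
        and j = "\<lambda>(x, j, y, j', \<kappa>, \<kappa>'). (x, \<kappa>, y, \<kappa>', j, j')"]) auto
  also have "\<dots> = bil ({..<e} \<times> {..<m}) (rot_test m v W) u w"
    unfolding sum_pair bil_def rot_test_def by (simp add: sum_distrib_left sum_distrib_right)
  finally show ?thesis ..
qed

lemma contraction_rot_test:
  assumes "onb m v" "contraction ({..<e} \<times> {..<m}) W"
  shows "contraction ({..<e} \<times> {..<m}) (rot_test m v W)"
  unfolding contraction_def
proof (intro allI)
  fix u w
  show "cmod (\<Sum>x\<in>{..<e} \<times> {..<m}. \<Sum>y\<in>{..<e} \<times> {..<m}. cnj (u x) * rot_test m v W x y * w y)
     \<le> nrm ({..<e} \<times> {..<m}) u * nrm ({..<e} \<times> {..<m}) w"
    using bil_le[OF assms(2), of "rot_vec m v u" "rot_vec m v w"]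
    unfolding bil_rot_test[symmetric] nrm_rot_vec[OF assms(1)] by (simp add: bil_def)
qed

section \<open>One-shot key distillation\<close>

lemma contraction_enc:
  assumes "contraction {..<tdim D} W"
  shows "contraction (box D) (\<lambda>s t. W (enc D s) (enc D t))"
  using bij_enc[of D] by (intro contraction_pullback[OF assms]) (auto simp: bij_betw_def)

lemma bil_reindex:
  assumes "bij_betw h J I"
  shows "bil I W u v = bil J (\<lambda>x y. W (h x) (h y)) (\<lambda>x. u (h x)) (\<lambda>y. v (h y))"
  unfolding bil_def sum.reindex_bij_betw[OF assms, symmetric] ..

lemma key_state_carrier: "key_state D l \<tau> \<in> carrier_mat (tdim D) (tdim D)"
  by (simp only: key_state_def tmat_carrier)

lemma tent_key_state:
  assumes "(a, b, x) \<in> box D" "(a', b', y) \<in> box D"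
  shows "tent D (key_state D l \<tau>) (a, b, x) (a', b', y)
    = (if a < 2 ^ l \<and> b = a \<and> a' = a \<and> b' = a then \<tau> $$ (x, y) / 2 ^ l else 0)"
proof -
  have "(\<Sum>i<2 ^ l. if a = i \<and> b = i \<and> a' = i \<and> b' = i then \<tau> $$ (x, y) else 0)
     = (\<Sum>i<2 ^ l. if i = a then (if b = a \<and> a' = a \<and> b' = a then \<tau> $$ (x, y) else 0) else 0)"
    by (intro sum.cong) auto
  then show ?thesis unfolding key_state_def tent_tmat[OF assms] by simp
qed

lemma psd_hermitian: "psd d X \<Longrightarrow> i < d \<Longrightarrow> j < d \<Longrightarrow> X $$ (i, j) = cnj (X $$ (j, i))"
  using posf_herm[of d "\<lambda>i j. X $$ (i, j)" i j] unfolding psd_iff by blast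

lemma tent_hermitian:
  assumes "\<And>s t. s \<in> box D \<Longrightarrow> t \<in> box D \<Longrightarrow> tent D X s t = cnj (tent D X t s)" "i < tdim D" "j < tdim D"
  shows "X $$ (i, j) = cnj (X $$ (j, i))"
  using assms(1)[OF dec_box[OF assms(2)] dec_box[OF assms(3)]] assms(2,3) by (simp add: tent_def enc_dec)

lemma key_state_hermitian:
  assumes "psd (snd (snd D)) \<tau>" "i < tdim D" "j < tdim D"
  shows "key_state D l \<tau> $$ (i, j) = cnj (key_state D l \<tau> $$ (j, i))"
proof (rule tent_hermitian[OF _ assms(2,3)])
  fix s t assume s: "s \<in> box D" and t: "t \<in> box D"
  obtain a b x a' b' y where st: "s = (a, b, x)" "t = (a', b', y)" by (cases s; cases t) auto
  have "x < snd (snd D)" "y < snd (snd D)" using s t st by (cases D; auto)+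
  then have "\<tau> $$ (x, y) = cnj (\<tau> $$ (y, x))" using psd_hermitian[OF assms(1)] by blast
  then show "tent D (key_state D l \<tau>) s t = cnj (tent D (key_state D l \<tau>) t s)"
    unfolding st tent_key_state[OF s[unfolded st] t[unfolded st]] tent_key_state[OF t[unfolded st] s[unfolded st]]
    by auto
qed

text \<open>The witnesses of \<open>trace_dist_witness\<close>, transported along \<open>enc\<close>
  to index triples.\<close>

lemma trace_dist_box:
  assumes P: "P \<in> carrier_mat (tdim D) (tdim D)" and Q: "Q \<in> carrier_mat (tdim D) (tdim D)"
    and HP: "\<And>i j. i < tdim D \<Longrightarrow> j < tdim D \<Longrightarrow> P $$ (i, j) = cnj (P $$ (j, i))"
    and HQ: "\<And>i j. i < tdim D \<Longrightarrow> j < tdim D \<Longrightarrow> Q $$ (i, j) = cnj (Q $$ (j, i))"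
  shows "\<exists>E W. posf (box D) E \<and> posf (box D) (\<lambda>s t. E s t - (tent D P s t - tent D Q s t)) \<and>
     Re (\<Sum>s\<in>box D. E s s) = 2 * trace_dist P Q \<and> contraction (box D) W \<and>
     2 * trace_dist P Q = Re (\<Sum>s\<in>box D. \<Sum>t\<in>box D. W s t * (tent D P t s - tent D Q t s))"
proof -
  obtain E W where EW: "posf {..<tdim D} E" "posf {..<tdim D} (\<lambda>i j. E i j - (P $$ (i, j) - Q $$ (i, j)))"
     "Re (\<Sum>i<tdim D. E i i) = 2 * trace_dist P Q" "contraction {..<tdim D} W"
     "2 * trace_dist P Q = Re (\<Sum>i<tdim D. \<Sum>j<tdim D. W i j * (P $$ (j, i) - Q $$ (j, i)))"
    using trace_dist_witness[OF P Q HP HQ] by auto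
  note re = sum.reindex_bij_betw[OF bij_enc[of D], symmetric]
  note rp = posf_reindex[OF bij_enc[of D] finite_lessThan]
  show ?thesis
  proof (rule exI[of _ "\<lambda>s t. E (enc D s) (enc D t)"], rule exI[of _ "\<lambda>s t. W (enc D s) (enc D t)"], intro conjI)
    show "posf (box D) (\<lambda>s t. E (enc D s) (enc D t))" using EW(1) rp[of E] by simp
    show "posf (box D) (\<lambda>s t. E (enc D s) (enc D t) - (tent D P s t - tent D Q s t))"
      using EW(2) rp[of "\<lambda>i j. E i j - (P $$ (i, j) - Q $$ (i, j))"] by (simp add: tent_def)
    show "Re (\<Sum>s\<in>box D. E (enc D s) (enc D s)) = 2 * trace_dist P Q"
      using EW(3) by (simp only: re)
    show "contraction (box D) (\<lambda>s t. W (enc D s) (enc D t))" by (rule contraction_enc[OF EW(4)])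
    show "2 * trace_dist P Q = Re (\<Sum>s\<in>box D. \<Sum>t\<in>box D. W (enc D s) (enc D t) * (tent D P t s - tent D Q t s))"
      using EW(5) by (simp only: re tent_def)
  qed
qed

text \<open>Cauchy-Schwarz over \<open>T\<close>. In operator form, a positive operator with r
  blocks is at most r times its block diagonal part; this is the origin of c = r.\<close>

lemma quantum_side:
  fixes z :: "nat \<Rightarrow> nat \<Rightarrow> complex"
  assumes T: "T \<subseteq> {..<m}"
  shows "(\<Sum>\<mu><N. (cmod (\<Sum>j\<in>T. z \<mu> j))\<^sup>2) \<le> card T * (\<Sum>\<mu><N. \<Sum>j\<in>T. (cmod (z \<mu> j))\<^sup>2)"
proof -
  have "(cmod (\<Sum>j\<in>T. z \<mu> j))\<^sup>2 \<le> card T * (\<Sum>j\<in>T. (cmod (z \<mu> j))\<^sup>2)" for \<mu>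
  proof -
    have "cmod (\<Sum>j\<in>T. z \<mu> j) \<le> (\<Sum>j\<in>T. 1 * cmod (z \<mu> j))" using norm_sum[of "z \<mu>" T] by simp
    also have "\<dots> \<le> sqrt (\<Sum>j\<in>T. 1\<^sup>2) * sqrt (\<Sum>j\<in>T. (cmod (z \<mu> j))\<^sup>2)" by (rule sum_mult_le_sqrt)
    also have "\<dots> = sqrt (card T * (\<Sum>j\<in>T. (cmod (z \<mu> j))\<^sup>2))" by (simp add: real_sqrt_mult)
    finally have "(cmod (\<Sum>j\<in>T. z \<mu> j))\<^sup>2 \<le> (sqrt (card T * (\<Sum>j\<in>T. (cmod (z \<mu> j))\<^sup>2)))\<^sup>2"
      by (intro power_mono) auto
    then show ?thesis by (simp add: sum_nonneg)
  qed
  then have "(\<Sum>\<mu><N. (cmod (\<Sum>j\<in>T. z \<mu> j))\<^sup>2) \<le> (\<Sum>\<mu><N. card T * (\<Sum>j\<in>T. (cmod (z \<mu> j))\<^sup>2))"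
    by (intro sum_mono)
  then show ?thesis by (simp add: sum_distrib_left)
qed

text \<open>For a classical register the blocks between different basis vectors vanish, so the cross
  terms drop out; this is the origin of c = 1.\<close>

lemma classical_side:
  fixes z :: "nat \<Rightarrow> nat \<Rightarrow> complex"
  assumes T: "finite T" and o: "\<And>j j'. j \<in> T \<Longrightarrow> j' \<in> T \<Longrightarrow> j \<noteq> j' \<Longrightarrow> (\<Sum>\<mu><N. z \<mu> j * cnj (z \<mu> j')) = 0"
  shows "(\<Sum>\<mu><N. (cmod (\<Sum>j\<in>T. z \<mu> j))\<^sup>2) = (\<Sum>\<mu><N. \<Sum>j\<in>T. (cmod (z \<mu> j))\<^sup>2)"
proof -
  have "complex_of_real (\<Sum>\<mu><N. (cmod (\<Sum>j\<in>T. z \<mu> j))\<^sup>2) = (\<Sum>\<mu><N. \<Sum>j\<in>T. \<Sum>j'\<in>T. z \<mu> j * cnj (z \<mu> j'))"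
    unfolding of_real_sum complex_norm_square cnj_sum sum_product ..
  also have "\<dots> = (\<Sum>j\<in>T. \<Sum>\<mu><N. \<Sum>j'\<in>T. z \<mu> j * cnj (z \<mu> j'))" by (rule sum.swap)
  also have "\<dots> = (\<Sum>j\<in>T. \<Sum>j'\<in>T. \<Sum>\<mu><N. z \<mu> j * cnj (z \<mu> j'))"
    by (rule sum.cong[OF refl]) (rule sum.swap)
  also have "\<dots> = (\<Sum>j\<in>T. \<Sum>j'\<in>T. if j' = j then \<Sum>\<mu><N. z \<mu> j * cnj (z \<mu> j) else 0)"
    using o by (intro sum.cong refl) auto
  also have "\<dots> = (\<Sum>j\<in>T. \<Sum>\<mu><N. z \<mu> j * cnj (z \<mu> j))" using T by simp
  also have "\<dots> = (\<Sum>\<mu><N. \<Sum>j\<in>T. z \<mu> j * cnj (z \<mu> j))" by (rule sum.swap)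
  also have "\<dots> = complex_of_real (\<Sum>\<mu><N. \<Sum>j\<in>T. (cmod (z \<mu> j))\<^sup>2)"
    by (simp only: of_real_sum complex_norm_square)
  finally show ?thesis unfolding of_real_eq_iff .
qed

text \<open>\<open>C z w a b\<close> is the test value contributed by raw keys \<open>a\<close>,
  \<open>b\<close> when the hashed keys are \<open>z\<close>, \<open>w\<close>; the subtracted
  average belongs to a uniform common key. Equal raw keys below \<open>L\<close> are left to privacy
  amplification, and any other pair costs at most twice its weight \<open>N a b\<close>.\<close>

lemma hashed_test:
  fixes C :: "nat \<Rightarrow> nat \<Rightarrow> nat \<Rightarrow> nat \<Rightarrow> complex"
  assumes L: "L \<le> A" "L \<le> B" and K: "0 < (K :: nat)" and f: "\<And>a. f a < K"
    and le: "\<And>z w a b. z < K \<Longrightarrow> w < K \<Longrightarrow> a < A \<Longrightarrow> b < B \<Longrightarrow> cmod (C z w a b) \<le> N a b"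
    and main: "cmod (\<Sum>z<K. \<Sum>a<L. of_real ((if f a = z then 1 else 0) - 1 / K) * C z z a a) \<le> \<epsilon>"
    and off: "(\<Sum>a<A. \<Sum>b<B. if a < L \<and> b = a then 0 else N a b) \<le> \<beta>"
  shows "cmod ((\<Sum>a<A. \<Sum>b<B. C (f a) (f b) a b) - (\<Sum>z<K. \<Sum>a<A. \<Sum>b<B. C z z a b) / K) \<le> \<epsilon> + 2 * \<beta>"
proof -
  define d where "d a b \<longleftrightarrow> a < L \<and> b = a" for a b :: nat
  define U where "U a b = C (f a) (f b) a b - (\<Sum>z<K. C z z a b) / K" for a b
  have e: "(\<Sum>a<A. \<Sum>b<B. C (f a) (f b) a b) - (\<Sum>z<K. \<Sum>a<A. \<Sum>b<B. C z z a b) / K = (\<Sum>a<A. \<Sum>b<B. U a b)"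
  proof -
    have "(\<Sum>z<K. \<Sum>a<A. \<Sum>b<B. C z z a b) = (\<Sum>a<A. \<Sum>z<K. \<Sum>b<B. C z z a b)" by (rule sum.swap)
    also have "\<dots> = (\<Sum>a<A. \<Sum>b<B. \<Sum>z<K. C z z a b)" by (rule sum.cong[OF refl]) (rule sum.swap)
    finally show ?thesis by (simp add: U_def sum_subtractf sum_divide_distrib)
  qed
  have s: "U a b = (if d a b then U a b else 0) + (if d a b then 0 else U a b)" for a b by simp
  have dg: "(\<Sum>a<A. \<Sum>b<B. if d a b then U a b else 0) = (\<Sum>z<K. \<Sum>a<L. of_real ((if f a = z then 1 else 0) - 1 / K) * C z z a a)"
  proof -
    have "(\<Sum>a<A. \<Sum>b<B. if d a b then U a b else 0) = (\<Sum>a<A. if a < L then U a a else 0)"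
    proof (rule sum.cong[OF refl])
      fix a assume "a \<in> {..<A}"
      have "(\<Sum>b<B. if d a b then U a b else 0) = (\<Sum>b<B. if b = a then (if a < L then U a a else 0) else 0)"
        by (intro sum.cong) (auto simp: d_def)
      then show "(\<Sum>b<B. if d a b then U a b else 0) = (if a < L then U a a else 0)" using L by auto
    qed
    also have "\<dots> = (\<Sum>a\<in>{a \<in> {..<A}. a < L}. U a a)" by (rule sum.inter_filter[symmetric]) simp
    also have "{a \<in> {..<A}. a < L} = {..<L}" using L by auto
    also have "(\<Sum>a<L. U a a) = (\<Sum>a<L. \<Sum>z<K. of_real ((if f a = z then 1 else 0) - 1 / K) * C z z a a)"
    proof (rule sum.cong[OF refl])
      fix a
      have "(\<Sum>z<K. of_real ((if f a = z then 1 else 0) - 1 / K) * C z z a a)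
         = (\<Sum>z<K. (if z = f a then C z z a a else 0) - C z z a a / K)"
        by (intro sum.cong) (auto simp: algebra_simps)
      also have "\<dots> = U a a" using f[of a] by (simp add: sum_subtractf U_def sum_divide_distrib)
      finally show "U a a = (\<Sum>z<K. of_real ((if f a = z then 1 else 0) - 1 / K) * C z z a a)" ..
    qed
    also have "\<dots> = (\<Sum>z<K. \<Sum>a<L. of_real ((if f a = z then 1 else 0) - 1 / K) * C z z a a)" by (rule sum.swap)
    finally show ?thesis .
  qed
  have Ule: "cmod (U a b) \<le> 2 * N a b" if "a < A" "b < B" for a b
  proof -
    have "cmod (\<Sum>z<K. C z z a b) \<le> (\<Sum>z<K. N a b)"
      using le that by (intro order_trans[OF norm_sum] sum_mono) auto
    then have "cmod ((\<Sum>z<K. C z z a b) / K) \<le> N a b"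
      using K by (simp add: norm_divide field_simps)
    moreover have "cmod (C (f a) (f b) a b) \<le> N a b" by (rule le[OF f f that])
    moreover have "cmod (U a b) \<le> cmod (C (f a) (f b) a b) + cmod ((\<Sum>z<K. C z z a b) / K)"
      unfolding U_def by (rule norm_triangle_ineq4)
    ultimately show ?thesis by linarith
  qed
  have "cmod (\<Sum>a<A. \<Sum>b<B. if d a b then 0 else U a b) \<le> (\<Sum>a<A. \<Sum>b<B. 2 * (if d a b then 0 else N a b))"
    using Ule by (intro order_trans[OF norm_sum] sum_mono) auto
  also have "\<dots> = 2 * (\<Sum>a<A. \<Sum>b<B. if d a b then 0 else N a b)" by (simp only: sum_distrib_left)
  also have "\<dots> \<le> 2 * \<beta>" using off by (simp add: d_def)
  finally have o: "cmod (\<Sum>a<A. \<Sum>b<B. if d a b then 0 else U a b) \<le> 2 * \<beta>" .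
  have "(\<Sum>a<A. \<Sum>b<B. U a b) = (\<Sum>a<A. \<Sum>b<B. if d a b then U a b else 0) + (\<Sum>a<A. \<Sum>b<B. if d a b then 0 else U a b)"
    unfolding sum.distrib[symmetric] by (intro sum.cong refl s)
  then show ?thesis unfolding e using o main unfolding dg
    by (simp only:) (intro order_trans[OF norm_triangle_ineq] add_mono)
qed

lemma sum_delta2:
  assumes "z < K" "w < (K :: nat)"
  shows "(\<Sum>z'<K. \<Sum>w'<K. \<Sum>q\<in>I. if z' = z \<and> w' = w then G z' w' q else 0) = (\<Sum>q\<in>I. G z w q :: complex)"
proof -
  have "(\<Sum>q\<in>I. if z' = z \<and> w' = w then G z' w' q else 0)
     = (if w' = w then (if z' = z then (\<Sum>q\<in>I. G z w q) else 0) else 0)" for z' w'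
    by (cases "z' = z"; cases "w' = w") simp_all
  then show ?thesis using assms by (simp only: sum.delta finite_lessThan lessThan_iff if_True)
qed

text \<open>Both states are diagonal in the hashed keys, so only blocks of \<open>W\<close> with the
  same keys on both sides enter. The state \<open>k\<close> has a uniform common key and the same
  reduced state of Eve as the hashed output \<open>F\<close>.\<close>

lemma test_value:
  fixes Y :: "nat \<Rightarrow> nat \<Rightarrow> nat \<Rightarrow> nat \<Rightarrow> complex" and W :: "tri \<Rightarrow> tri \<Rightarrow> complex"
  assumes f: "\<And>a. f a < (K :: nat)"
    and F: "\<And>z w x z' w' y. z < K \<Longrightarrow> w < K \<Longrightarrow> z' < K \<Longrightarrow> w' < K \<Longrightarrow> x < d \<Longrightarrow> y < d \<Longrightarrow>
      F (z, w, x) (z', w', y) = (if z = z' \<and> w = w' then \<Sum>a<A. \<Sum>b<B. if f a = z \<and> f b = w then Y a b x y else 0 else 0)"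
    and key: "\<And>z w x z' w' y. z < K \<Longrightarrow> w < K \<Longrightarrow> z' < K \<Longrightarrow> w' < K \<Longrightarrow> x < d \<Longrightarrow> y < d \<Longrightarrow>
      k (z, w, x) (z', w', y) = (if w = z \<and> z' = z \<and> w' = z then (\<Sum>a<A. \<Sum>b<B. Y a b x y) / of_nat K else 0)"
    and C: "\<And>z w a b. C z w a b = (\<Sum>p<d. \<Sum>q<d. W (z, w, p) (z, w, q) * Y a b q p)"
  shows "(\<Sum>s\<in>box (K, K, d). \<Sum>t\<in>box (K, K, d). W s t * (F t s - k t s))
    = (\<Sum>a<A. \<Sum>b<B. C (f a) (f b) a b) - (\<Sum>z<K. \<Sum>a<A. \<Sum>b<B. C z z a b) / of_nat K"
proof -
  have 1: "(\<Sum>t\<in>box (K, K, d). W (z, w, p) t * F t (z, w, p))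
     = (\<Sum>q<d. W (z, w, p) (z, w, q) * (\<Sum>a<A. \<Sum>b<B. if f a = z \<and> f b = w then Y a b q p else 0))"
    if "z < K" "w < K" "p < d" for z w p
  proof -
    have "(\<Sum>t\<in>box (K, K, d). W (z, w, p) t * F t (z, w, p))
       = (\<Sum>z'<K. \<Sum>w'<K. \<Sum>q<d. if z' = z \<and> w' = w then W (z, w, p) (z', w', q) *
            (\<Sum>a<A. \<Sum>b<B. if f a = z' \<and> f b = w' then Y a b q p else 0) else 0)"
      unfolding sum_box using that by (intro sum.cong refl) (simp add: F)
    then show ?thesis by (simp only: sum_delta2[OF that(1,2)])
  qed
  have 2: "(\<Sum>t\<in>box (K, K, d). W (z, w, p) t * k t (z, w, p))
     = (if w = z then \<Sum>q<d. W (z, w, p) (z, w, q) * ((\<Sum>a<A. \<Sum>b<B. Y a b q p) / of_nat K) else 0)"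
    if "z < K" "w < K" "p < d" for z w p
  proof -
    have "(\<Sum>t\<in>box (K, K, d). W (z, w, p) t * k t (z, w, p))
       = (\<Sum>z'<K. \<Sum>w'<K. \<Sum>q<d. if z' = z \<and> w' = w then (if w = z then W (z, w, p) (z', w', q) *
            ((\<Sum>a<A. \<Sum>b<B. Y a b q p) / of_nat K) else 0) else 0)"
      unfolding sum_box using that by (intro sum.cong refl) (auto simp: key)
    then show ?thesis by (simp only: sum_delta2[OF that(1,2)]) simp
  qed
  have FF: "(\<Sum>s\<in>box (K, K, d). \<Sum>t\<in>box (K, K, d). W s t * F t s) = (\<Sum>a<A. \<Sum>b<B. C (f a) (f b) a b)"
  proof -
    have "(\<Sum>s\<in>box (K, K, d). \<Sum>t\<in>box (K, K, d). W s t * F t s) =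
      (\<Sum>z<K. \<Sum>w<K. \<Sum>p<d. \<Sum>q<d. W (z, w, p) (z, w, q) * (\<Sum>a<A. \<Sum>b<B. if f a = z \<and> f b = w then Y a b q p else 0))"
      unfolding sum_box[of "\<lambda>s. \<Sum>t\<in>box (K, K, d). W s t * F t s"] by (intro sum.cong refl 1) auto
    also have "\<dots> = (\<Sum>z<K. \<Sum>w<K. \<Sum>pq\<in>{..<d}\<times>{..<d}. \<Sum>ab\<in>{..<A}\<times>{..<B}. if f (fst ab) = z \<and> f (snd ab) = w then
        W (z, w, fst pq) (z, w, snd pq) * Y (fst ab) (snd ab) (snd pq) (fst pq) else 0)"
      unfolding sum_pair by (intro sum.cong refl) (auto simp: sum_distrib_left intro!: sum.cong)
    also have "\<dots> = (\<Sum>z<K. \<Sum>w<K. \<Sum>ab\<in>{..<A}\<times>{..<B}. \<Sum>pq\<in>{..<d}\<times>{..<d}. if f (fst ab) = z \<and> f (snd ab) = w then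
        W (z, w, fst pq) (z, w, snd pq) * Y (fst ab) (snd ab) (snd pq) (fst pq) else 0)"
      by (rule sum.cong[OF refl], rule sum.cong[OF refl], rule sum.swap)
    also have "\<dots> = (\<Sum>zw\<in>{..<K}\<times>{..<K}. \<Sum>ab\<in>{..<A}\<times>{..<B}. if f (fst ab) = fst zw \<and> f (snd ab) = snd zw then
        C (fst zw) (snd zw) (fst ab) (snd ab) else 0)"
      unfolding sum_pair[of _ "{..<K}"] C by (intro sum.cong refl) (auto simp: sum_pair)
    also have "\<dots> = (\<Sum>ab\<in>{..<A}\<times>{..<B}. \<Sum>zw\<in>{..<K}\<times>{..<K}. if f (fst ab) = fst zw \<and> f (snd ab) = snd zw then
        C (fst zw) (snd zw) (fst ab) (snd ab) else 0)" by (rule sum.swap)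
    also have "\<dots> = (\<Sum>ab\<in>{..<A}\<times>{..<B}. \<Sum>zw\<in>{..<K}\<times>{..<K}. if zw = (f (fst ab), f (snd ab)) then
        C (f (fst ab)) (f (snd ab)) (fst ab) (snd ab) else 0)"
      by (intro sum.cong refl) auto
    also have "\<dots> = (\<Sum>ab\<in>{..<A}\<times>{..<B}. C (f (fst ab)) (f (snd ab)) (fst ab) (snd ab))"
      using f by (intro sum.cong refl) simp
    finally show ?thesis by (simp add: sum_pair)
  qed
  have KK: "(\<Sum>s\<in>box (K, K, d). \<Sum>t\<in>box (K, K, d). W s t * k t s) = (\<Sum>z<K. \<Sum>a<A. \<Sum>b<B. C z z a b) / of_nat K"
  proof -
    have "(\<Sum>s\<in>box (K, K, d). \<Sum>t\<in>box (K, K, d). W s t * k t s) =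
      (\<Sum>z<K. \<Sum>w<K. \<Sum>p<d. if w = z then \<Sum>q<d. W (z, w, p) (z, w, q) * ((\<Sum>a<A. \<Sum>b<B. Y a b q p) / of_nat K) else 0)"
      unfolding sum_box[of "\<lambda>s. \<Sum>t\<in>box (K, K, d). W s t * k t s"] by (intro sum.cong refl 2) auto
    also have "\<dots> = (\<Sum>z<K. \<Sum>w<K. if w = z then \<Sum>p<d. \<Sum>q<d. W (z, z, p) (z, z, q) * ((\<Sum>a<A. \<Sum>b<B. Y a b q p) / of_nat K) else 0)"
      by (intro sum.cong refl) auto
    also have "\<dots> = (\<Sum>z<K. \<Sum>p<d. \<Sum>q<d. W (z, z, p) (z, z, q) * ((\<Sum>a<A. \<Sum>b<B. Y a b q p) / of_nat K))" by simp
    also have "\<dots> = (\<Sum>z<K. \<Sum>pq\<in>{..<d}\<times>{..<d}. \<Sum>ab\<in>{..<A}\<times>{..<B}. W (z, z, fst pq) (z, z, snd pq) * Y (fst ab) (snd ab) (snd pq) (fst pq) / of_nat K)"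
      unfolding sum_pair by (intro sum.cong refl) (simp add: sum_distrib_left sum_divide_distrib)
    also have "\<dots> = (\<Sum>z<K. \<Sum>ab\<in>{..<A}\<times>{..<B}. \<Sum>pq\<in>{..<d}\<times>{..<d}. W (z, z, fst pq) (z, z, snd pq) * Y (fst ab) (snd ab) (snd pq) (fst pq) / of_nat K)"
      by (rule sum.cong[OF refl], rule sum.swap)
    also have "\<dots> = (\<Sum>z<K. \<Sum>a<A. \<Sum>b<B. C z z a b) / of_nat K"
      unfolding sum_pair C by (simp add: sum_divide_distrib)
    finally show ?thesis .
  qed
  have "(\<Sum>s\<in>box (K, K, d). \<Sum>t\<in>box (K, K, d). W s t * (F t s - k t s))
     = (\<Sum>s\<in>box (K, K, d). \<Sum>t\<in>box (K, K, d). W s t * F t s) - (\<Sum>s\<in>box (K, K, d). \<Sum>t\<in>box (K, K, d). W s t * k t s)"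
    by (simp only: right_diff_distrib sum_subtractf)
  then show ?thesis unfolding FF KK .
qed

lemma sum_diag_le:
  fixes h :: "nat \<Rightarrow> nat \<Rightarrow> real"
  assumes "L \<le> A" "L \<le> B" "\<And>a b. 0 \<le> h a b"
  shows "(\<Sum>a<L. h a a) \<le> (\<Sum>a<A. \<Sum>b<B. h a b)"
proof -
  have "(\<Sum>a<L. h a a) \<le> (\<Sum>a<L. \<Sum>b<B. h a b)"
    using assms by (intro sum_mono member_le_sum) auto
  also have "\<dots> \<le> (\<Sum>a<A. \<Sum>b<B. h a b)"
    using assms by (intro sum_mono2) (auto intro: sum_nonneg)
  finally show ?thesis .
qed

text \<open>The protocol runs with E' as a spectator, followed by hashing to \<open>k\<close> bits.
  The first root collects the smoothing error 2 \<delta> and the atypical weight \<eta>, the second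
  is the leftover hash term, and 4 \<delta> pays for raw keys that disagree or leave the key range.
  The number \<gamma> is the constant in the comparison of a state with its marginal.\<close>

lemma one_shot:
  fixes \<rho> :: "complex mat" and p :: "nat \<Rightarrow> real" and \<gamma> \<eta> :: real
    and dA dB dE d' n A B e l k :: nat and \<Lambda> :: "complex mat \<Rightarrow> complex mat" and \<tau> :: "complex mat"
  defines "D \<equiv> (dA, dB, dE)" and "m \<equiv> d' ^ n"
  assumes \<rho>: "psd (tdim (add_eve d' D)) \<rho>"
    and v: "onb d' v" and p: "\<And>k. k < d' \<Longrightarrow> 0 \<le> p k" "(\<Sum>k<d'. p k) = 1"
    and marg: "\<And>j j'. j < d' \<Longrightarrow> j' < d' \<Longrightarrow> ptrace_fst (tdim D) d' \<rho> $$ (j, j') = spectral_op d' v p j j'"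
    and lo: "lopc (tpow D n) (A, B, e) \<Lambda>" and tr: "trace_factor (tdim (tpow D n)) 1 \<Lambda>"
    and L: "2 ^ l \<le> A" "2 ^ l \<le> B" and \<tau>: "density_op e \<tau>"
    and T: "T \<subseteq> {..<m}" and \<eta>: "(\<Sum>\<kappa>\<in>{..<m} - T. \<Prod>k<n. p (digit d' k \<kappa>)) \<le> \<eta>"
    and \<gamma>: "\<gamma> = card T \<or> \<gamma> = 1 \<and> (\<forall>k<d'. \<forall>k'<d'. \<forall>s\<in>box D. \<forall>t\<in>box D. k \<noteq> k' \<longrightarrow> rot_block D d' v \<rho> k k' s t = 0)"
  defines "\<delta> \<equiv> trace_dist (\<Lambda> (tensor_power D n (ptrace_snd (tdim D) d' \<rho>))) (key_state (A, B, e) l \<tau>)"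
  shows "\<exists>\<Lambda>'' \<tau>''. lopc (tpow (add_eve d' D) n) (2 ^ k, 2 ^ k, e * m) \<Lambda>'' \<and> density_op (e * m) \<tau>'' \<and>
    2 * trace_dist (\<Lambda>'' (tensor_power (add_eve d' D) n \<rho>)) (key_state (2 ^ k, 2 ^ k, e * m) k \<tau>'')
      \<le> 4 * sqrt (2 * \<delta> + \<eta>) + sqrt (2 * card T * \<gamma> * (2 ^ k - 1) / 2 ^ l) + 4 * \<delta>"
proof -
  let ?D' = "(A, B, e)" and ?D3 = "(A, B, e * m)" and ?D2 = "add_eve d' D"
  let ?g = "merge_digits dE d' n" and ?P = "tensor_power (add_eve d' D) n \<rho>"
  let ?I = "{..<e} \<times> {..<m}"
  define K :: nat where "K = 2 ^ k"
  have K: "0 < K" by (simp add: K_def)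
  define vn where "vn = vpow d' n v"
  have vn: "onb m vn" unfolding vn_def m_def by (rule onb_vpow[OF v])
  have lin: "linear_op (tdim (tpow D n)) (tdim ?D') \<Lambda>" using lopc_props[OF lo] by blast
  have e0: "0 < e"
  proof (rule ccontr)
    assume "\<not> 0 < e"
    then show False using \<tau> by (auto simp: density_op_def psd_def mtrace_def)
  qed
  have Pc: "?P \<in> carrier_mat (tdim (add_eve m (tpow D n))) (tdim (add_eve m (tpow D n)))"
    unfolding m_def tpow_add_eve[symmetric] tensor_power_prod_op by (rule prod_op_carrier)
  have gb: "bij_betw ?g ({..<snd (snd (tpow D n))} \<times> {..<m}) {..<snd (snd (tpow D n)) * m}"
    using bij_merge_digits[of dE d' n] by (simp add: D_def m_def)
  obtain \<Lambda>' g' where lo': "lopc (add_eve m (tpow D n)) ?D3 \<Lambda>'"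
    and g': "bij_betw g' ?I {..<e * m}"
    and ext: "\<And>j k. j < m \<Longrightarrow> k < m \<Longrightarrow> eve_block ?D' m g' j k (\<Lambda>' ?P) = \<Lambda> (eve_block (tpow D n) m ?g j k ?P)"
    using lopc_extend[OF lo gb] Pc by auto
  define Y where "Y = \<Lambda>' ?P"
  have "psd (tdim ?D3) Y"
    using lopc_props[OF lo'] psd_tensor_power[OF \<rho>, of n]
    unfolding Y_def positive_op_def m_def tpow_add_eve by blast
  then obtain \<xi> where \<xi>: "\<And>s t. s \<in> box ?D3 \<Longrightarrow> t \<in> box ?D3 \<Longrightarrow> tent ?D3 Y s t = (\<Sum>\<mu><tdim ?D3. \<xi> \<mu> s * cnj (\<xi> \<mu> t))"
    using gram_tent[of ?D3 Y] by auto
  define N where "N = tdim ?D3"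
  note \<xi> = \<xi>[folded N_def]
  have put: "(a, b, g' (x, j)) \<in> box ?D3" if "(a, b, x) \<in> box ?D'" "j < m" for a b x j
    by (rule bij_put_eve[OF g' that(2,1)])
  \<comment> \<open>The Gram vectors of the extended output, expressed in the eigenbasis of the
    register; their Gram matrix is \<open>\<Lambda>\<close> applied to blocks of the input.\<close>
  define \<psi> where "\<psi> a b \<mu> = (\<lambda>(x, \<kappa>). \<Sum>j<m. cnj (vn \<kappa> j) * \<xi> \<mu> (a, b, g' (x, j)))" for a b \<mu>
  have KI: "(\<Sum>\<mu><N. \<psi> a b \<mu> (x, \<kappa>) * cnj (\<psi> a' b' \<mu> (y, \<kappa>'))) = tent ?D' (\<Lambda> (rot_op D d' v n \<rho> \<kappa> \<kappa>')) (a, b, x) (a', b', y)"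
    if s: "(a, b, x) \<in> box ?D'" and t: "(a', b', y) \<in> box ?D'" for a b x a' b' y \<kappa> \<kappa>'
  proof -
    have "(\<Sum>\<mu><N. \<psi> a b \<mu> (x, \<kappa>) * cnj (\<psi> a' b' \<mu> (y, \<kappa>')))
       = (\<Sum>\<mu><N. \<Sum>j<m. \<Sum>j'<m. cnj (vn \<kappa> j) * (\<xi> \<mu> (a, b, g' (x, j)) * cnj (\<xi> \<mu> (a', b', g' (y, j')))) * vn \<kappa>' j')"
      unfolding \<psi>_def case_prod_conv cnj_sum sum_product by (intro sum.cong refl) (simp add: mult_ac)
    also have "\<dots> = (\<Sum>j<m. \<Sum>\<mu><N. \<Sum>j'<m. cnj (vn \<kappa> j) * (\<xi> \<mu> (a, b, g' (x, j)) * cnj (\<xi> \<mu> (a', b', g' (y, j')))) * vn \<kappa>' j')"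
      by (rule sum.swap)
    also have "\<dots> = (\<Sum>j<m. \<Sum>j'<m. \<Sum>\<mu><N. cnj (vn \<kappa> j) * (\<xi> \<mu> (a, b, g' (x, j)) * cnj (\<xi> \<mu> (a', b', g' (y, j')))) * vn \<kappa>' j')"
      by (rule sum.cong[OF refl]) (rule sum.swap)
    also have "\<dots> = (\<Sum>j<m. \<Sum>j'<m. cnj (vn \<kappa> j) * tent ?D3 Y (a, b, g' (x, j)) (a', b', g' (y, j')) * vn \<kappa>' j')"
      by (intro sum.cong refl) (simp add: \<xi>[OF put[OF s] put[OF t]] sum_distrib_left sum_distrib_right)
    also have "\<dots> = tent ?D' (\<Lambda> (rot_op D d' v n \<rho> \<kappa> \<kappa>')) (a, b, x) (a', b', y)"
      using spectator_block[OF lin _ s t, of d' g' Y \<rho> v \<kappa> \<kappa>'] ext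
      unfolding vn_def m_def Y_def D_def by simp
    finally show ?thesis .
  qed
  have rotvec: "rot_vec m vn (\<psi> a b \<mu>) q = \<xi> \<mu> (a, b, g' q)" if q: "q \<in> ?I" for a b \<mu> q
  proof -
    obtain x j where xj: "q = (x, j)" "j < m" using q by auto
    have "rot_vec m vn (\<psi> a b \<mu>) (x, j) = (\<Sum>\<kappa><m. \<Sum>j'<m. vn \<kappa> j * cnj (vn \<kappa> j') * \<xi> \<mu> (a, b, g' (x, j')))"
      by (simp add: rot_vec_def \<psi>_def sum_distrib_left mult.assoc)
    also have "\<dots> = (\<Sum>j'<m. (\<Sum>\<kappa><m. vn \<kappa> j * cnj (vn \<kappa> j')) * \<xi> \<mu> (a, b, g' (x, j')))"
      by (subst sum.swap) (simp add: sum_distrib_right)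
    also have "\<dots> = (\<Sum>j'<m. if j' = j then \<xi> \<mu> (a, b, g' (x, j')) else 0)"
      using vn xj by (intro sum.cong refl) (auto simp: onb_def)
    finally show ?thesis using xj by simp
  qed
  define Pm where "Pm = \<Lambda> (tensor_power D n (ptrace_snd (tdim D) d' \<rho>))"
  have Pmc: "Pm \<in> carrier_mat (tdim ?D') (tdim ?D')"
    unfolding Pm_def tensor_power_prod_op by (rule linear_opD(1)[OF lin prod_op_carrier])
  \<comment> \<open>Summing over the register recovers the output of the original protocol, the
    state whose distance from a key is \<delta>.\<close>
  have Pmt: "tent ?D' Pm (a, b, x) (a', b', y) = (\<Sum>\<kappa><m. \<Sum>\<mu><N. \<psi> a b \<mu> (x, \<kappa>) * cnj (\<psi> a' b' \<mu> (y, \<kappa>)))"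
    if s: "(a, b, x) \<in> box ?D'" and t: "(a', b', y) \<in> box ?D'" for a b x a' b' y
  proof -
    have "tensor_power D n (ptrace_snd (tdim D) d' \<rho>)
       = tmat (tpow D n) (\<lambda>s t. \<Sum>\<kappa><m. 1 * tent (tpow D n) (rot_op D d' v n \<rho> \<kappa> \<kappa>) s t)"
    proof (rule mat_eq_tent[OF _ tmat_carrier])
      show "tensor_power D n (ptrace_snd (tdim D) d' \<rho>) \<in> carrier_mat (tdim (tpow D n)) (tdim (tpow D n))"
        unfolding tensor_power_prod_op by (rule prod_op_carrier)
    qed (simp add: tent_tmat sum_rot_op[OF v] m_def)
    then show ?thesis
      unfolding Pm_def using linear_sum[OF lin _ _ s t, of "{..<m}" "\<lambda>\<kappa>. rot_op D d' v n \<rho> \<kappa> \<kappa>" "\<lambda>_. 1"]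
      by (simp add: rot_op_carrier KI[OF s t])
  qed
  have PmH: "Pm $$ (i, j) = cnj (Pm $$ (j, i))" if ij: "i < tdim ?D'" "j < tdim ?D'" for i j
  proof (rule tent_hermitian[OF _ ij])
    fix s t assume s: "s \<in> box ?D'" and t: "t \<in> box ?D'"
    obtain a b x a' b' y where st: "s = (a, b, x)" "t = (a', b', y)" by (cases s; cases t) auto
    show "tent ?D' Pm s t = cnj (tent ?D' Pm t s)"
      unfolding st Pmt[OF s[unfolded st] t[unfolded st]] Pmt[OF t[unfolded st] s[unfolded st]]
      by (simp add: mult.commute)
  qed
  have \<tau>p: "psd e \<tau>" using \<tau> by (simp add: density_op_def)
  obtain E where E: "posf (box ?D') E"
    and dom: "posf (box ?D') (\<lambda>s t. E s t - (tent ?D' Pm s t - tent ?D' (key_state ?D' l \<tau>) s t))"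
    and trE: "Re (\<Sum>s\<in>box ?D'. E s s) = 2 * \<delta>"
    using trace_dist_box[OF Pmc key_state_carrier PmH key_state_hermitian] \<tau>p
    unfolding \<delta>_def Pm_def[symmetric] by auto
  \<comment> \<open>The joint weight of the raw keys \<open>a\<close>, \<open>b\<close> and the
    eigenvector word \<kappa>.\<close>
  define w where "w a b \<kappa> = (\<Sum>\<mu><N. \<Sum>x<e. (cmod (\<psi> a b \<mu> (x, \<kappa>)))\<^sup>2)" for a b \<kappa>
  have w0: "0 \<le> w a b \<kappa>" for a b \<kappa> by (simp add: w_def sum_nonneg)
  have wab: "of_real (w a b \<kappa>) = (\<Sum>x<e. tent ?D' (\<Lambda> (rot_op D d' v n \<rho> \<kappa> \<kappa>)) (a, b, x) (a, b, x))"
    if "a < A" "b < B" for a b \<kappa>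
  proof -
    have "complex_of_real (w a b \<kappa>) = (\<Sum>x<e. \<Sum>\<mu><N. \<psi> a b \<mu> (x, \<kappa>) * cnj (\<psi> a b \<mu> (x, \<kappa>)))"
      unfolding w_def of_real_sum complex_norm_square by (rule sum.swap)
    also have "\<dots> = (\<Sum>x<e. tent ?D' (\<Lambda> (rot_op D d' v n \<rho> \<kappa> \<kappa>)) (a, b, x) (a, b, x))"
      using that by (intro sum.cong refl KI) auto
    finally show ?thesis .
  qed
  \<comment> \<open>The protocol preserves the trace of each diagonal block, so the distribution of
    \<kappa> is given by the product eigenvalues, whatever is done on ABE.\<close>
  have wsum: "(\<Sum>a<A. \<Sum>b<B. w a b \<kappa>) = (\<Prod>k<n. p (digit d' k \<kappa>))" if \<kappa>: "\<kappa> < m" for \<kappa>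
  proof -
    have "complex_of_real (\<Sum>a<A. \<Sum>b<B. w a b \<kappa>) = (\<Sum>s\<in>box ?D'. tent ?D' (\<Lambda> (rot_op D d' v n \<rho> \<kappa> \<kappa>)) s s)"
      unfolding of_real_sum sum_box by (intro sum.cong refl wab) auto
    also have "\<dots> = mtrace (\<Lambda> (rot_op D d' v n \<rho> \<kappa> \<kappa>))"
      by (rule mtrace_tent[symmetric, OF linear_opD(1)[OF lin rot_op_carrier]])
    also have "\<dots> = mtrace (rot_op D d' v n \<rho> \<kappa> \<kappa>)"
      using tr rot_op_carrier unfolding trace_factor_def by simp
    also have "\<dots> = of_real (\<Prod>k<n. p (digit d' k \<kappa>))"
      using \<kappa> unfolding m_def by (intro trace_rot_op[OF v _ marg])
    finally show ?thesis unfolding of_real_eq_iff .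
  qed
  define Nab where "Nab a b = (\<Sum>\<mu><N. (nrm ?I (\<psi> a b \<mu>))\<^sup>2)" for a b
  have Nw: "Nab a b = (\<Sum>\<kappa><m. w a b \<kappa>)" for a b
  proof -
    have "Nab a b = (\<Sum>\<mu><N. \<Sum>\<kappa><m. \<Sum>x<e. (cmod (\<psi> a b \<mu> (x, \<kappa>)))\<^sup>2)"
      unfolding Nab_def nrm_sq sum_pair by (intro sum.cong refl sum.swap)
    also have "\<dots> = (\<Sum>\<kappa><m. w a b \<kappa>)" unfolding w_def by (rule sum.swap)
    finally show ?thesis .
  qed
  have Ntot: "(\<Sum>a<A. \<Sum>b<B. Nab a b) = 1"
  proof -
    have "(\<Sum>a<A. \<Sum>b<B. Nab a b) = (\<Sum>\<kappa><m. \<Sum>a<A. \<Sum>b<B. w a b \<kappa>)"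
    proof -
      have "(\<Sum>a<A. \<Sum>b<B. Nab a b) = (\<Sum>a<A. \<Sum>\<kappa><m. \<Sum>b<B. w a b \<kappa>)"
        unfolding Nw by (rule sum.cong[OF refl]) (rule sum.swap)
      also have "\<dots> = (\<Sum>\<kappa><m. \<Sum>a<A. \<Sum>b<B. w a b \<kappa>)" by (rule sum.swap)
      finally show ?thesis .
    qed
    also have "\<dots> = (\<Sum>\<kappa><m. \<Prod>k<n. p (digit d' k \<kappa>))" by (intro sum.cong refl wsum) auto
    also have "\<dots> = 1" unfolding m_def using sum_prod_digits[where F = "\<lambda>_. p" and n = n and d = d'] p(2) by simp
    finally show ?thesis .
  qed
  have Ediag: "0 \<le> Re (E s s)" if "s \<in> box ?D'" for s
    using posf_diag[OF E _ that] by (simp add: less_eq_complex_def)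
  have ReE: "(\<Sum>a<A. \<Sum>b<B. Re (\<Sum>x<e. E (a, b, x) (a, b, x))) = 2 * \<delta>"
    using trE unfolding sum_box by simp
  have Eab: "0 \<le> Re (\<Sum>x<e. E (a, b, x) (a, b, x))" if "a < A" "b < B" for a b
    using that by (auto intro!: sum_nonneg Ediag)
  have \<delta>0: "0 \<le> \<delta>"
  proof -
    have "0 \<le> (\<Sum>a<A. \<Sum>b<B. Re (\<Sum>x<e. E (a, b, x) (a, b, x)))" by (intro sum_nonneg Eab) auto
    then show ?thesis unfolding ReE by simp
  qed
  \<comment> \<open>The ideal state has no weight on these pairs, so \<open>E\<close> dominates the
    diagonal of the actual state there, and the total trace of \<open>E\<close> is 2
    \<delta>.\<close>
  have off: "(\<Sum>a<A. \<Sum>b<B. if a < 2 ^ l \<and> b = a then 0 else Nab a b) \<le> 2 * \<delta>"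
  proof -
    have "(\<Sum>a<A. \<Sum>b<B. if a < 2 ^ l \<and> b = a then 0 else Nab a b) \<le> (\<Sum>a<A. \<Sum>b<B. Re (\<Sum>x<e. E (a, b, x) (a, b, x)))"
    proof (rule sum_mono, rule sum_mono)
      fix a b assume ab: "a \<in> {..<A}" "b \<in> {..<B}"
      show "(if a < 2 ^ l \<and> b = a then 0 else Nab a b) \<le> Re (\<Sum>x<e. E (a, b, x) (a, b, x))"
      proof (cases "a < 2 ^ l \<and> b = a")
        case True
        then show ?thesis using Eab ab by simp
      next
        case False
        have "complex_of_real (Nab a b) = (\<Sum>\<kappa><m. \<Sum>x<e. \<Sum>\<mu><N. \<psi> a b \<mu> (x, \<kappa>) * cnj (\<psi> a b \<mu> (x, \<kappa>)))"
          unfolding Nw w_def of_real_sum complex_norm_square by (rule sum.cong[OF refl]) (rule sum.swap)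
        also have "\<dots> = (\<Sum>x<e. \<Sum>\<kappa><m. \<Sum>\<mu><N. \<psi> a b \<mu> (x, \<kappa>) * cnj (\<psi> a b \<mu> (x, \<kappa>)))" by (rule sum.swap)
        also have "\<dots> = (\<Sum>x<e. tent ?D' Pm (a, b, x) (a, b, x))"
          using ab by (intro sum.cong refl Pmt[symmetric]) auto
        finally have N: "Nab a b = Re (\<Sum>x<e. tent ?D' Pm (a, b, x) (a, b, x))" by (metis Re_complex_of_real)
        have "Re (tent ?D' Pm (a, b, x) (a, b, x)) \<le> Re (E (a, b, x) (a, b, x))" if "x < e" for x
        proof -
          have s: "(a, b, x) \<in> box ?D'" using ab that by simp
          have "tent ?D' (key_state ?D' l \<tau>) (a, b, x) (a, b, x) = 0"
            unfolding tent_key_state[OF s s] using False by auto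
          then show ?thesis using posf_diag[OF dom _ s] by (simp add: less_eq_complex_def)
        qed
        then show ?thesis using False unfolding N Re_sum by (auto intro!: sum_mono)
      qed
    qed
    then show ?thesis unfolding ReE .
  qed
  have diag_sub: "(a, a, x) \<in> box ?D'" if "a < 2 ^ l" "x < e" for a x using that L by auto
  \<comment> \<open>Equal raw keys below 2^l index Eve's conditional states. Their excess over the
    ideal state is bounded by the diagonal blocks of \<open>E\<close>, which play the role of
    \<open>D\<close>.\<close>
  have "\<exists>f. (\<forall>a. f a < K) \<and> (\<forall>W. (\<forall>z<K. contraction ?I (W z)) \<longrightarrow>
     cmod (\<Sum>z<K. \<Sum>a<2 ^ l. of_real ((if f a = z then 1 else 0) - 1 / K) *
        (\<Sum>\<mu><N. bil ?I (W z) (\<psi> a a \<mu>) (\<psi> a a \<mu>)))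
      \<le> 4 * sqrt (2 * \<delta> + \<eta>) + sqrt (2 * card T * \<gamma> * (real K - 1) / real (2 ^ l)))"
  proof (rule privacy_amplification[where \<psi> = "\<lambda>a. \<psi> a a" and \<tau> = "\<lambda>x y. \<tau> $$ (x, y)" and D = "\<lambda>a x y. E (a, a, x) (a, a, y)"])
    show "0 < e" "0 < (2 ^ l :: nat)" "0 < K" "T \<subseteq> {..<m}" using e0 K T by auto
    show "0 \<le> \<gamma>" using \<gamma> by auto
    show "posf {..<e} (\<lambda>x y. \<tau> $$ (x, y))" using \<tau>p by (simp add: psd_iff)
    show "(\<Sum>x<e. \<tau> $$ (x, x)) = 1" using \<tau> by (auto simp: density_op_def mtrace_def psd_def)
    show "posf {..<e} (\<lambda>x y. E (a, a, x) (a, a, y))" if "a < 2 ^ l" for a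
      using diag_sub[OF that] by (intro posf_pullback[OF E, of _ "\<lambda>x. (a, a, x)"]) auto
    have "(\<Sum>a<2 ^ l. Re (\<Sum>x<e. E (a, a, x) (a, a, x))) \<le> (\<Sum>a<A. \<Sum>b<B. if a < A \<and> b < B then Re (\<Sum>x<e. E (a, b, x) (a, b, x)) else 0)"
    proof -
      have "(\<Sum>a<2 ^ l. Re (\<Sum>x<e. E (a, a, x) (a, a, x))) = (\<Sum>a<2 ^ l. if a < A \<and> a < B then Re (\<Sum>x<e. E (a, a, x) (a, a, x)) else 0)"
        using L by (intro sum.cong) auto
      also have "\<dots> \<le> (\<Sum>a<A. \<Sum>b<B. if a < A \<and> b < B then Re (\<Sum>x<e. E (a, b, x) (a, b, x)) else 0)"
        by (rule sum_diag_le[OF L]) (use Eab in simp)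
      finally show ?thesis .
    qed
    also have "\<dots> = 2 * \<delta>" unfolding ReE[symmetric] by (intro sum.cong refl) auto
    finally show "(\<Sum>a<2 ^ l. Re (\<Sum>x<e. E (a, a, x) (a, a, x))) \<le> 2 * \<delta>" .
    show "posf {..<e} (\<lambda>x y. \<tau> $$ (x, y) / of_nat (2 ^ l) + E (a, a, x) (a, a, y)
        - (\<Sum>(\<mu>, j)\<in>{..<N} \<times> {..<m}. \<psi> a a \<mu> (x, j) * cnj (\<psi> a a \<mu> (y, j))))" if a: "a < 2 ^ l" for a
    proof -
      have "posf {..<e} (\<lambda>x y. E (a, a, x) (a, a, y) - (tent ?D' Pm (a, a, x) (a, a, y) - tent ?D' (key_state ?D' l \<tau>) (a, a, x) (a, a, y)))"
        using diag_sub[OF a] by (intro posf_pullback[OF dom, of _ "\<lambda>x. (a, a, x)"]) auto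
      moreover have "(\<Sum>(\<mu>, j)\<in>{..<N} \<times> {..<m}. \<psi> a a \<mu> (x, j) * cnj (\<psi> a a \<mu> (y, j))) = tent ?D' Pm (a, a, x) (a, a, y)"
        if "x < e" "y < e" for x y
        unfolding Pmt[OF diag_sub[OF a that(1)] diag_sub[OF a that(2)]] sum_pair case_prod_conv by (rule sum.swap)
      ultimately show ?thesis
        using a by (subst posf_cong[of _ _ "\<lambda>x y. E (a, a, x) (a, a, y) - (tent ?D' Pm (a, a, x) (a, a, y) - tent ?D' (key_state ?D' l \<tau>) (a, a, x) (a, a, y))"])
          (auto simp: tent_key_state[OF diag_sub[OF a] diag_sub[OF a]])
    qed
    have part: "(\<Sum>a<2 ^ l. \<Sum>\<mu><N. \<Sum>q\<in>{..<e} \<times> S. (cmod (\<psi> a a \<mu> q))\<^sup>2) \<le> (\<Sum>\<kappa>\<in>S. \<Prod>k<n. p (digit d' k \<kappa>))"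
      if S: "S \<subseteq> {..<m}" for S
    proof -
      have "(\<Sum>a<2 ^ l. \<Sum>\<mu><N. \<Sum>q\<in>{..<e} \<times> S. (cmod (\<psi> a a \<mu> q))\<^sup>2) = (\<Sum>a<2 ^ l. \<Sum>\<kappa>\<in>S. w a a \<kappa>)"
      proof (rule sum.cong[OF refl])
        fix a
        have "(\<Sum>\<mu><N. \<Sum>q\<in>{..<e} \<times> S. (cmod (\<psi> a a \<mu> q))\<^sup>2) = (\<Sum>\<mu><N. \<Sum>\<kappa>\<in>S. \<Sum>x<e. (cmod (\<psi> a a \<mu> (x, \<kappa>)))\<^sup>2)"
          unfolding sum_pair by (intro sum.cong refl sum.swap)
        also have "\<dots> = (\<Sum>\<kappa>\<in>S. w a a \<kappa>)" unfolding w_def by (rule sum.swap)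
        finally show "(\<Sum>\<mu><N. \<Sum>q\<in>{..<e} \<times> S. (cmod (\<psi> a a \<mu> q))\<^sup>2) = (\<Sum>\<kappa>\<in>S. w a a \<kappa>)" .
      qed
      also have "\<dots> \<le> (\<Sum>a<A. \<Sum>b<B. \<Sum>\<kappa>\<in>S. w a b \<kappa>)"
        by (rule sum_diag_le[OF L]) (simp add: sum_nonneg w0)
      also have "\<dots> = (\<Sum>a<A. \<Sum>\<kappa>\<in>S. \<Sum>b<B. w a b \<kappa>)" by (rule sum.cong[OF refl]) (rule sum.swap)
      also have "\<dots> = (\<Sum>\<kappa>\<in>S. \<Sum>a<A. \<Sum>b<B. w a b \<kappa>)" by (rule sum.swap)
      also have "\<dots> = (\<Sum>\<kappa>\<in>S. \<Prod>k<n. p (digit d' k \<kappa>))" using S by (intro sum.cong refl wsum) auto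
      finally show ?thesis .
    qed
    show "(\<Sum>a<2 ^ l. \<Sum>\<mu><N. \<Sum>q\<in>{..<e} \<times> ({..<m} - T). (cmod (\<psi> a a \<mu> q))\<^sup>2) \<le> \<eta>"
      using part[of "{..<m} - T"] \<eta> by auto
    show "(\<Sum>a<2 ^ l. \<Sum>\<mu><N. \<Sum>q\<in>?I. (cmod (\<psi> a a \<mu> q))\<^sup>2) \<le> 1"
      using part[of "{..<m}"] sum_prod_digits[where F = "\<lambda>_. p" and n = n and d = d'] p(2) unfolding m_def by simp
    show "(\<Sum>\<mu><N. (cmod (\<Sum>j\<in>T. ip e (u j) (\<lambda>x. \<psi> a a \<mu> (x, j))))\<^sup>2)
        \<le> \<gamma> * (\<Sum>j\<in>T. \<Sum>\<mu><N. \<Sum>j'<m. (cmod (ip e (u j) (\<lambda>x. \<psi> a a \<mu> (x, j'))))\<^sup>2)" if a: "a < 2 ^ l" for a u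
    proof -
      define z where "z \<mu> j = ip e (u j) (\<lambda>x. \<psi> a a \<mu> (x, j))" for \<mu> j
      have "(\<Sum>\<mu><N. (cmod (\<Sum>j\<in>T. z \<mu> j))\<^sup>2) \<le> \<gamma> * (\<Sum>\<mu><N. \<Sum>j\<in>T. (cmod (z \<mu> j))\<^sup>2)"
      proof (cases "\<gamma> = card T")
        case True
        then show ?thesis using quantum_side[OF T] by simp
      next
        case False
        then have g1: "\<gamma> = 1" and cl: "\<And>k k' s t. k < d' \<Longrightarrow> k' < d' \<Longrightarrow> k \<noteq> k' \<Longrightarrow> s \<in> box D \<Longrightarrow> t \<in> box D \<Longrightarrow> rot_block D d' v \<rho> k k' s t = 0"
          using \<gamma> by blast+
        have "(\<Sum>\<mu><N. z \<mu> j * cnj (z \<mu> j')) = 0" if jj: "j \<in> T" "j' \<in> T" "j \<noteq> j'" for j j'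
        proof -
          have ro: "rot_op D d' v n \<rho> j j' = tmat (tpow D n) (\<lambda>_ _. 0)"
            using jj T unfolding m_def by (intro rot_op_zero cl) auto
          have zero: "(\<Sum>\<mu><N. \<psi> a a \<mu> (x, j) * cnj (\<psi> a a \<mu> (y, j'))) = 0" if "x < e" "y < e" for x y
            unfolding KI[OF diag_sub[OF a that(1)] diag_sub[OF a that(2)]] ro
            using linear_sum[OF lin _ _ diag_sub[OF a that(1)] diag_sub[OF a that(2)], of "{}" "\<lambda>_ :: nat. tmat (tpow D n) (\<lambda>_ _. 0)" "\<lambda>_. 0"] by simp
          have "(\<Sum>\<mu><N. z \<mu> j * cnj (z \<mu> j'))
             = (\<Sum>\<mu><N. \<Sum>x<e. \<Sum>y<e. cnj (u j x) * u j' y * (\<psi> a a \<mu> (x, j) * cnj (\<psi> a a \<mu> (y, j'))))"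
            unfolding z_def ip_def cnj_sum sum_product by (intro sum.cong refl) (simp add: mult_ac)
          also have "\<dots> = (\<Sum>x<e. \<Sum>\<mu><N. \<Sum>y<e. cnj (u j x) * u j' y * (\<psi> a a \<mu> (x, j) * cnj (\<psi> a a \<mu> (y, j'))))"
            by (rule sum.swap)
          also have "\<dots> = (\<Sum>x<e. \<Sum>y<e. \<Sum>\<mu><N. cnj (u j x) * u j' y * (\<psi> a a \<mu> (x, j) * cnj (\<psi> a a \<mu> (y, j'))))"
            by (rule sum.cong[OF refl]) (rule sum.swap)
          also have "\<dots> = (\<Sum>x<e. \<Sum>y<e. cnj (u j x) * u j' y * (\<Sum>\<mu><N. \<psi> a a \<mu> (x, j) * cnj (\<psi> a a \<mu> (y, j'))))"
            by (simp only: sum_distrib_left)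
          also have "\<dots> = 0" by (simp add: zero)
          finally show ?thesis .
        qed
        then show ?thesis using classical_side[where T = T and N = N and z = z] finite_subset[OF T] g1 by simp
      qed
      also have "\<dots> \<le> \<gamma> * (\<Sum>j\<in>T. \<Sum>\<mu><N. \<Sum>j'<m. (cmod (ip e (u j) (\<lambda>x. \<psi> a a \<mu> (x, j'))))\<^sup>2)"
      proof (rule mult_left_mono)
        have "(\<Sum>\<mu><N. \<Sum>j\<in>T. (cmod (z \<mu> j))\<^sup>2) = (\<Sum>j\<in>T. \<Sum>\<mu><N. (cmod (z \<mu> j))\<^sup>2)" by (rule sum.swap)
        also have "\<dots> \<le> (\<Sum>j\<in>T. \<Sum>\<mu><N. \<Sum>j'<m. (cmod (ip e (u j) (\<lambda>x. \<psi> a a \<mu> (x, j'))))\<^sup>2)"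
        proof (rule sum_mono, rule sum_mono)
          fix j \<mu> assume "j \<in> T"
          then have "j \<in> {..<m}" using T by blast
          then show "(cmod (z \<mu> j))\<^sup>2 \<le> (\<Sum>j'<m. (cmod (ip e (u j) (\<lambda>x. \<psi> a a \<mu> (x, j'))))\<^sup>2)"
            unfolding z_def by (intro member_le_sum) auto
        qed
        finally show "(\<Sum>\<mu><N. \<Sum>j\<in>T. (cmod (z \<mu> j))\<^sup>2) \<le> (\<Sum>j\<in>T. \<Sum>\<mu><N. \<Sum>j'<m. (cmod (ip e (u j) (\<lambda>x. \<psi> a a \<mu> (x, j'))))\<^sup>2)" .
        show "0 \<le> \<gamma>" using \<gamma> by auto
      qed
      finally show ?thesis unfolding z_def .
    qed
  qed
  then obtain f where f: "\<And>a. f a < K" and amp: "\<And>W. (\<And>z. z < K \<Longrightarrow> contraction ?I (W z)) \<Longrightarrow>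
     cmod (\<Sum>z<K. \<Sum>a<2 ^ l. of_real ((if f a = z then 1 else 0) - 1 / K) *
        (\<Sum>\<mu><N. bil ?I (W z) (\<psi> a a \<mu>) (\<psi> a a \<mu>)))
      \<le> 4 * sqrt (2 * \<delta> + \<eta>) + sqrt (2 * card T * \<gamma> * (real K - 1) / real (2 ^ l))" by blast
  define \<Lambda>'' where "\<Lambda>'' = (\<lambda>X. hash_AB ?D3 K f (\<Lambda>' X))"
  let ?D'' = "(K, K, e * m)"
  have lo'': "lopc (tpow ?D2 n) ?D'' \<Lambda>''"
    unfolding \<Lambda>''_def tpow_add_eve m_def[symmetric] by (rule lopc_hash_AB[OF lo' f])
  \<comment> \<open>Eve's reduced state of the extended output. Comparing with the ideal key for
    this very state leaves only the uniformity of the key and its correlation with Eve to be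
    estimated.\<close>
  define \<tau>'' where "\<tau>'' = mat (e * m) (e * m) (\<lambda>(x, y). \<Sum>a<A. \<Sum>b<B. tent ?D3 Y (a, b, x) (a, b, y))"
  have bx: "(a, b, x) \<in> box ?D3" if "a < A" "b < B" "x < e * m" for a b x using that by simp
  have \<tau>''p: "psd (e * m) \<tau>''"
  proof -
    have "posf {..<e * m} (\<lambda>x y. \<Sum>a<A. \<Sum>b<B. \<Sum>\<mu><N. \<xi> \<mu> (a, b, x) * cnj (\<xi> \<mu> (a, b, y)))"
      by (intro posf_sum posf_gram)
    moreover have "posf {..<e * m} (\<lambda>x y. \<tau>'' $$ (x, y)) = posf {..<e * m} (\<lambda>x y. \<Sum>a<A. \<Sum>b<B. \<Sum>\<mu><N. \<xi> \<mu> (a, b, x) * cnj (\<xi> \<mu> (a, b, y)))"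
      by (rule posf_cong) (simp add: \<tau>''_def \<xi>)
    ultimately show ?thesis by (simp add: psd_iff \<tau>''_def)
  qed
  have nrm_\<xi>: "nrm {..<e * m} (\<lambda>x. \<xi> \<mu> (a, b, x)) = nrm ?I (\<psi> a b \<mu>)" for a b \<mu>
  proof -
    have "nrm {..<e * m} (\<lambda>x. \<xi> \<mu> (a, b, x)) = nrm ?I (\<lambda>q. \<xi> \<mu> (a, b, g' q))"
      unfolding nrm_def L2_set_def sum.reindex_bij_betw[OF g', symmetric] ..
    also have "\<dots> = nrm ?I (rot_vec m vn (\<psi> a b \<mu>))"
      unfolding nrm_def L2_set_def by (intro arg_cong[where f = sqrt] sum.cong refl) (simp only: rotvec)
    finally show ?thesis by (simp only: nrm_rot_vec[OF vn])
  qed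
  have \<tau>''t: "mtrace \<tau>'' = 1"
  proof -
    have "mtrace \<tau>'' = (\<Sum>x<e * m. \<Sum>a<A. \<Sum>b<B. tent ?D3 Y (a, b, x) (a, b, x))"
      by (simp add: mtrace_def \<tau>''_def)
    also have "\<dots> = (\<Sum>a<A. \<Sum>x<e * m. \<Sum>b<B. tent ?D3 Y (a, b, x) (a, b, x))" by (rule sum.swap)
    also have "\<dots> = (\<Sum>a<A. \<Sum>b<B. \<Sum>x<e * m. tent ?D3 Y (a, b, x) (a, b, x))"
      by (rule sum.cong[OF refl]) (rule sum.swap)
    also have "\<dots> = (\<Sum>a<A. \<Sum>b<B. of_real (Nab a b))"
    proof (intro sum.cong refl)
      fix a b assume ab: "a \<in> {..<A}" "b \<in> {..<B}"
      have "complex_of_real (Nab a b) = (\<Sum>\<mu><N. \<Sum>x<e * m. \<xi> \<mu> (a, b, x) * cnj (\<xi> \<mu> (a, b, x)))"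
        unfolding Nab_def nrm_\<xi>[symmetric] nrm_sq of_real_sum complex_norm_square ..
      also have "\<dots> = (\<Sum>x<e * m. \<Sum>\<mu><N. \<xi> \<mu> (a, b, x) * cnj (\<xi> \<mu> (a, b, x)))" by (rule sum.swap)
      also have "\<dots> = (\<Sum>x<e * m. tent ?D3 Y (a, b, x) (a, b, x))"
        using ab by (intro sum.cong refl) (simp add: \<xi>)
      finally show "(\<Sum>x<e * m. tent ?D3 Y (a, b, x) (a, b, x)) = complex_of_real (Nab a b)" ..
    qed
    also have "\<dots> = complex_of_real (\<Sum>a<A. \<Sum>b<B. Nab a b)" by simp
    finally show ?thesis unfolding Ntot by simp
  qed
  have \<tau>'': "density_op (e * m) \<tau>''" using \<tau>''p \<tau>''t by (simp add: density_op_def)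
  let ?F = "\<Lambda>'' ?P" and ?Q = "key_state ?D'' k \<tau>''"
  have Fp: "psd (tdim ?D'') ?F"
    using lopc_props[OF lo''] psd_tensor_power[OF \<rho>, of n] unfolding positive_op_def by blast
  \<comment> \<open>The optimal test for the hashed state. It depends on \<open>f\<close>, which is
    harmless because \<open>amp\<close> holds for all contractions.\<close>
  obtain W where W: "contraction (box ?D'') W"
    and val: "2 * trace_dist ?F ?Q = Re (\<Sum>s\<in>box ?D''. \<Sum>t\<in>box ?D''. W s t * (tent ?D'' ?F t s - tent ?D'' ?Q t s))"
    using trace_dist_box[OF psd_carrier[OF Fp] key_state_carrier psd_hermitian[OF Fp] key_state_hermitian, of \<tau>'' k] \<tau>''p
    by auto
  define C where "C z w a b = (\<Sum>p<e * m. \<Sum>q<e * m. W (z, w, p) (z, w, q) * tent ?D3 Y (a, b, q) (a, b, p))" for z w a b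
  \<comment> \<open>The test for fixed hashed keys, relabelled by \<open>g'\<close> and taken in the
    eigenbasis of the register.\<close>
  define R where "R z w = rot_test m vn (\<lambda>x y. W (z, w, g' x) (z, w, g' y))" for z w
  have Wzw: "contraction {..<e * m} (\<lambda>x y. W (z, w, x) (z, w, y))" if "z < K" "w < K" for z w
    using that by (intro contraction_pullback[OF W, of "\<lambda>x. (z, w, x)"]) (auto simp: inj_on_def)
  have R: "contraction ?I (R z w)" if "z < K" "w < K" for z w
    unfolding R_def using g' contraction_pullback[OF Wzw[OF that], of g' ?I]
    by (intro contraction_rot_test[OF vn]) (auto simp: bij_betw_def)
  have CR: "C z w a b = (\<Sum>\<mu><N. bil ?I (R z w) (\<psi> a b \<mu>) (\<psi> a b \<mu>))" if ab: "a < A" "b < B" for z w a b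
  proof -
    have "C z w a b = (\<Sum>p<e * m. \<Sum>q<e * m. \<Sum>\<mu><N. cnj (\<xi> \<mu> (a, b, p)) * W (z, w, p) (z, w, q) * \<xi> \<mu> (a, b, q))"
      unfolding C_def using ab by (intro sum.cong refl) (simp add: \<xi> sum_distrib_left mult_ac)
    also have "\<dots> = (\<Sum>p<e * m. \<Sum>\<mu><N. \<Sum>q<e * m. cnj (\<xi> \<mu> (a, b, p)) * W (z, w, p) (z, w, q) * \<xi> \<mu> (a, b, q))"
      by (rule sum.cong[OF refl]) (rule sum.swap)
    also have "\<dots> = (\<Sum>\<mu><N. bil {..<e * m} (\<lambda>x y. W (z, w, x) (z, w, y)) (\<lambda>x. \<xi> \<mu> (a, b, x)) (\<lambda>x. \<xi> \<mu> (a, b, x)))"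
      unfolding bil_def by (rule sum.swap)
    also have "\<dots> = (\<Sum>\<mu><N. bil ?I (R z w) (\<psi> a b \<mu>) (\<psi> a b \<mu>))"
    proof (rule sum.cong[OF refl])
      fix \<mu>
      have "bil {..<e * m} (\<lambda>x y. W (z, w, x) (z, w, y)) (\<lambda>x. \<xi> \<mu> (a, b, x)) (\<lambda>x. \<xi> \<mu> (a, b, x))
        = bil ?I (\<lambda>x y. W (z, w, g' x) (z, w, g' y)) (\<lambda>q. \<xi> \<mu> (a, b, g' q)) (\<lambda>q. \<xi> \<mu> (a, b, g' q))"
        by (rule bil_reindex[OF g'])
      also have "\<dots> = bil ?I (\<lambda>x y. W (z, w, g' x) (z, w, g' y)) (rot_vec m vn (\<psi> a b \<mu>)) (rot_vec m vn (\<psi> a b \<mu>))"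
        unfolding bil_def by (intro sum.cong refl) (simp only: rotvec)
      finally show "bil {..<e * m} (\<lambda>x y. W (z, w, x) (z, w, y)) (\<lambda>x. \<xi> \<mu> (a, b, x)) (\<lambda>x. \<xi> \<mu> (a, b, x))
        = bil ?I (R z w) (\<psi> a b \<mu>) (\<psi> a b \<mu>)" unfolding R_def bil_rot_test .
    qed
    finally show ?thesis .
  qed
  have Cle: "cmod (C z w a b) \<le> Nab a b" if "z < K" "w < K" "a < A" "b < B" for z w a b
    unfolding CR[OF that(3,4)] Nab_def power2_eq_square
    by (intro order_trans[OF norm_sum] sum_mono bil_le R that)
  have main: "cmod (\<Sum>z<K. \<Sum>a<2 ^ l. of_real ((if f a = z then 1 else 0) - 1 / K) * C z z a a)
     \<le> 4 * sqrt (2 * \<delta> + \<eta>) + sqrt (2 * card T * \<gamma> * (real K - 1) / real (2 ^ l))"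
  proof -
    have "(\<Sum>z<K. \<Sum>a<2 ^ l. complex_of_real ((if f a = z then 1 else 0) - 1 / K) * C z z a a)
      = (\<Sum>z<K. \<Sum>a<2 ^ l. of_real ((if f a = z then 1 else 0) - 1 / K) * (\<Sum>\<mu><N. bil ?I (R z z) (\<psi> a a \<mu>) (\<psi> a a \<mu>)))"
      using L by (intro sum.cong refl arg_cong2[where f = "(*)"] CR) auto
    then show ?thesis using amp[of "\<lambda>z. R z z"] R by simp
  qed
  have "(\<Sum>s\<in>box ?D''. \<Sum>t\<in>box ?D''. W s t * (tent ?D'' ?F t s - tent ?D'' ?Q t s))
     = (\<Sum>a<A. \<Sum>b<B. C (f a) (f b) a b) - (\<Sum>z<K. \<Sum>a<A. \<Sum>b<B. C z z a b) / of_nat K"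
  proof (rule test_value[where Y = "\<lambda>a b x y. tent ?D3 Y (a, b, x) (a, b, y)", OF f])
    fix z w x z' w' y assume r: "z < K" "w < K" "z' < K" "w' < K" "x < e * m" "y < e * m"
    show "tent ?D'' ?F (z, w, x) (z', w', y) = (if z = z' \<and> w = w' then \<Sum>a<A. \<Sum>b<B. if f a = z \<and> f b = w then tent ?D3 Y (a, b, x) (a, b, y) else 0 else 0)"
      unfolding \<Lambda>''_def Y_def[symmetric] using r by (intro tent_hash_AB)
    have bb: "(z, w, x) \<in> box ?D''" "(z', w', y) \<in> box ?D''" using r by auto
    show "tent ?D'' ?Q (z, w, x) (z', w', y) = (if w = z \<and> z' = z \<and> w' = z then (\<Sum>a<A. \<Sum>b<B. tent ?D3 Y (a, b, x) (a, b, y)) / of_nat K else 0)"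
      unfolding tent_key_state[OF bb] using r by (simp add: \<tau>''_def K_def)
  qed (rule C_def)
  then have "2 * trace_dist ?F ?Q \<le> cmod ((\<Sum>a<A. \<Sum>b<B. C (f a) (f b) a b) - (\<Sum>z<K. \<Sum>a<A. \<Sum>b<B. C z z a b) / of_nat K)"
    unfolding val by (simp only: complex_Re_le_cmod)
  also have "\<dots> \<le> 4 * sqrt (2 * \<delta> + \<eta>) + sqrt (2 * card T * \<gamma> * (real K - 1) / real (2 ^ l)) + 2 * (2 * \<delta>)"
    by (rule hashed_test[where C = C and N = Nab and f = f, OF L K f Cle main off])
  finally have "2 * trace_dist ?F ?Q \<le> 4 * sqrt (2 * \<delta> + \<eta>) + sqrt (2 * card T * \<gamma> * (2 ^ k - 1) / 2 ^ l) + 4 * \<delta>"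
    by (simp add: K_def)
  then show ?thesis using lo'' \<tau>'' unfolding K_def by (intro exI[of _ \<Lambda>''] exI[of _ \<tau>'']) simp
qed

section \<open>Asymptotic rates\<close>

lemma trace_dist_sym:
  assumes "P \<in> carrier_mat n n" "Q \<in> carrier_mat n n"
  shows "trace_dist P Q = trace_dist Q P"
proof -
  have c: "P - Q \<in> carrier_mat n n" "Q - P \<in> carrier_mat n n" using assms by (auto intro: minus_carrier_mat)
  have "mat_adjoint (P - Q) * (P - Q) = mat_adjoint (Q - P) * (Q - P)"
    using assms c by (intro eq_matI) (auto simp: scalar_prod_def algebra_simps intro!: sum.cong)
  moreover have "dim_col (P - Q) = dim_col (Q - P)" using assms by auto
  ultimately show ?thesis by (simp add: trace_dist_def mat_abs_def)
qed

lemma trace_dist_nonneg: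
  assumes "psd (tdim D) P" "psd (snd (snd D)) \<tau>"
  shows "0 \<le> trace_dist P (key_state D l \<tau>)"
proof -
  obtain E where "posf (box D) E" "Re (\<Sum>s\<in>box D. E s s) = 2 * trace_dist P (key_state D l \<tau>)"
    using trace_dist_box[OF psd_carrier[OF assms(1)] key_state_carrier psd_hermitian[OF assms(1)] key_state_hermitian[OF assms(2)]]
    by auto
  moreover have "0 \<le> Re (\<Sum>s\<in>box D. E s s)"
    using posf_diag[OF calculation(1)] by (auto intro!: sum_nonneg simp: less_eq_complex_def)
  ultimately show ?thesis by simp
qed

lemma mtrace_key_state:
  assumes \<tau>: "density_op e \<tau>" and L: "2 ^ l \<le> A" "2 ^ l \<le> B"
  shows "mtrace (key_state (A, B, e) l \<tau>) = 1"
proof -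
  have t: "(\<Sum>x<e. \<tau> $$ (x, x)) = 1" using \<tau> by (auto simp: density_op_def mtrace_def psd_def)
  have "mtrace (key_state (A, B, e) l \<tau>) = (\<Sum>a<A. \<Sum>b<B. \<Sum>x<e. if a < 2 ^ l \<and> b = a then \<tau> $$ (x, x) / 2 ^ l else 0)"
    unfolding mtrace_tent[OF key_state_carrier] sum_box by (intro sum.cong refl) (auto simp: tent_key_state)
  also have "\<dots> = (\<Sum>a<A. \<Sum>b<B. if b = a then (if a < 2 ^ l then 1 / 2 ^ l else 0) else 0)"
    by (intro sum.cong refl) (auto simp: t simp flip: sum_divide_distrib)
  also have "\<dots> = (\<Sum>a<A. if a \<in> {..<2 ^ l} then 1 / 2 ^ l else 0)"
    using L by (intro sum.cong refl) auto
  also have "\<dots> = (\<Sum>a\<in>{..<A} \<inter> {..<2 ^ l}. 1 / 2 ^ l)" by (rule sum.inter_restrict[symmetric]) simp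
  also have "{..<A} \<inter> {..<2 ^ l} = {..<2 ^ l}" using L by auto
  finally show ?thesis by simp
qed

text \<open>An operator that dominates the difference of the two states has trace at least 1 - 0.
  This excludes protocols that kill the trace as soon as the distance is below 1/2.\<close>

lemma trace_zero_far:
  assumes P: "psd (tdim (A, B, e)) P" and z: "mtrace P = 0"
    and \<tau>: "density_op e \<tau>" and L: "2 ^ l \<le> A" "2 ^ l \<le> B"
  shows "1 \<le> 2 * trace_dist P (key_state (A, B, e) l \<tau>)"
proof -
  let ?D = "(A, B, e)" and ?Q = "key_state (A, B, e) l \<tau>"
  have \<tau>p: "psd (snd (snd ?D)) \<tau>" using \<tau> by (simp add: density_op_def)
  obtain E where E: "posf (box ?D) (\<lambda>s t. E s t - (tent ?D ?Q s t - tent ?D P s t))"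
    "Re (\<Sum>s\<in>box ?D. E s s) = 2 * trace_dist ?Q P"
    using trace_dist_box[OF key_state_carrier psd_carrier[OF P] key_state_hermitian[OF \<tau>p] psd_hermitian[OF P]] by auto
  have "0 \<le> (\<Sum>s\<in>box ?D. Re (E s s - (tent ?D ?Q s s - tent ?D P s s)))"
    using posf_diag[OF E(1)] by (auto intro!: sum_nonneg simp: less_eq_complex_def)
  also have "\<dots> = Re (\<Sum>s\<in>box ?D. E s s) - (Re (mtrace ?Q) - Re (mtrace P))"
    unfolding mtrace_tent[OF key_state_carrier] mtrace_tent[OF psd_carrier[OF P]] by (simp add: sum_subtractf)
  finally show ?thesis
    using E(2) z mtrace_key_state[OF \<tau> L] trace_dist_sym[OF key_state_carrier psd_carrier[OF P]] by simp
qed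

lemma psd_ptrace_snd:
  assumes \<rho>: "psd (tdim (add_eve m D)) \<rho>"
  shows "psd (tdim D) (ptrace_snd (tdim D) m \<rho>)"
proof -
  have c: "ptrace_snd (tdim D) m \<rho> \<in> carrier_mat (tdim D) (tdim D)" by (simp add: ptrace_snd_def)
  have p: "posf (box (add_eve m D)) (tent (add_eve m D) \<rho>)" using \<rho> psd_tent[OF psd_carrier[OF \<rho>]] by simp
  have "posf (box D) (\<lambda>s t. \<Sum>j<m. tent (add_eve m D) \<rho> (put_eve (\<lambda>(e, j). e * m + j) j s) (put_eve (\<lambda>(e, j). e * m + j) j t))"
  proof (rule posf_sum)
    fix j assume "j \<in> {..<m}"
    then have "put_eve (\<lambda>(e, j). e * m + j) j ` box D \<subseteq> box (add_eve m D)"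
      using put_eve_box[of _ D j m] by blast
    then show "posf (box D) (\<lambda>s t. tent (add_eve m D) \<rho> (put_eve (\<lambda>(e, j). e * m + j) j s) (put_eve (\<lambda>(e, j). e * m + j) j t))"
      by (rule posf_pullback[OF p finite_box finite_box])
  qed
  moreover have "posf (box D) (tent D (ptrace_snd (tdim D) m \<rho>)) =
     posf (box D) (\<lambda>s t. \<Sum>j<m. tent (add_eve m D) \<rho> (put_eve (\<lambda>(e, j). e * m + j) j s) (put_eve (\<lambda>(e, j). e * m + j) j t))"
    by (rule posf_cong) (simp add: tent_ptrace_snd)
  ultimately show ?thesis unfolding psd_tent[OF c] by simp
qed

lemma density_op_ex: "0 < d \<Longrightarrow> \<exists>\<tau>. density_op d \<tau>"
proof -
  assume d: "0 < d"
  define \<tau> where "\<tau> = mat d d (\<lambda>(i, j). (if i = 0 then 1 else 0) * cnj (if j = 0 then 1 else 0) :: complex)"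
  have "posf {..<d} (\<lambda>i j. \<tau> $$ (i, j)) = posf {..<d} (\<lambda>i j. \<Sum>m<(1 :: nat). (if i = 0 then 1 else 0) * cnj (if j = 0 then 1 else 0))"
    by (rule posf_cong) (auto simp: \<tau>_def)
  also have "\<dots>" by (rule posf_gram)
  finally have "psd d \<tau>" by (simp add: psd_iff \<tau>_def)
  moreover have "mtrace \<tau> = (\<Sum>i<d. if i = 0 then 1 else 0)"
    unfolding mtrace_def by (intro sum.cong) (auto simp: \<tau>_def)
  then have "mtrace \<tau> = 1" using d by simp
  ultimately show ?thesis by (auto simp: density_op_def)
qed

text \<open>\<open>q\<close> counts how often the entropy is paid per copy. Block lengths with 2
  \<delta> < 1 receive a protocol from \<open>one_shot\<close>; the others are finitely many and
  receive a trivial one, which the limits do not see.\<close>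

lemma rate_bound:
  fixes \<rho> :: "complex mat" and p :: "nat \<Rightarrow> real" and dA dB dE d' q :: nat
  defines "D \<equiv> (dA, dB, dE)"
  assumes \<rho>: "density_op (tdim (add_eve d' D)) \<rho>"
    and v: "onb d' v" and p: "\<And>k. k < d' \<Longrightarrow> 0 \<le> p k" "(\<Sum>k<d'. p k) = 1"
    and marg: "\<And>j j'. j < d' \<Longrightarrow> j' < d' \<Longrightarrow> ptrace_fst (tdim D) d' \<rho> $$ (j, j') = spectral_op d' v p j j'"
    and q: "q = 2 \<or> q = 1 \<and> (\<forall>k<d'. \<forall>k'<d'. \<forall>s\<in>box D. \<forall>t\<in>box D. k \<noteq> k' \<longrightarrow> rot_block D d' v \<rho> k k' s t = 0)"
    and prot: "lopc_protocol D D' \<Lambda>" and dist: "distills_key D (ptrace_snd (tdim D) d' \<rho>) D' \<Lambda> R"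
    and \<epsilon>: "0 < \<epsilon>"
  defines "S \<equiv> - (\<Sum>k<d'. p k * log 2 (p k))"
  shows "R \<le> key_rate (add_eve d' D) \<rho> + ereal (real q * S + (real q + 2) * \<epsilon>)"
proof -
  let ?D2 = "add_eve d' D" and ?\<rho>1 = "ptrace_snd (tdim D) d' \<rho>"
  obtain l \<tau> where L: "\<And>n. 2 ^ l n \<le> fst (D' n)" "\<And>n. 2 ^ l n \<le> fst (snd (D' n))"
    and \<tau>: "\<And>n. density_op (snd (snd (D' n))) (\<tau> n)"
    and R: "limsup (\<lambda>n. ereal (real (l n) / real n)) = R"
    and lim: "(\<lambda>n. trace_dist (\<Lambda> n (tensor_power D n ?\<rho>1)) (key_state (D' n) (l n) (\<tau> n))) \<longlonglongrightarrow> 0"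
    using dist unfolding distills_key_def by blast
  have \<rho>p: "psd (tdim ?D2) \<rho>" and \<rho>t: "mtrace \<rho> = 1" using \<rho> by (auto simp: density_op_def)
  have lo: "lopc (tpow D n) (D' n) (\<Lambda> n)" for n using prot by (simp add: lopc_protocol_def)
  have \<rho>1: "psd (tdim D) ?\<rho>1" by (rule psd_ptrace_snd[OF \<rho>p])
  define \<delta> where "\<delta> n = trace_dist (\<Lambda> n (tensor_power D n ?\<rho>1)) (key_state (D' n) (l n) (\<tau> n))" for n
  have \<Lambda>p: "psd (tdim (D' n)) (\<Lambda> n (tensor_power D n ?\<rho>1))" for n
    using lopc_props[OF lo[of n]] psd_tensor_power[OF \<rho>1, of n] unfolding positive_op_def by blast
  have \<delta>0: "0 \<le> \<delta> n" for n
    unfolding \<delta>_def using \<tau>[of n] by (intro trace_dist_nonneg \<Lambda>p) (simp add: density_op_def)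
  define r where "r = S + \<epsilon>"
  define T where "T n = typical d' p n r" for n
  define \<eta> where "\<eta> n = (\<Sum>\<kappa>\<in>{..<d' ^ n} - T n. \<Prod>k<n. p (digit d' k \<kappa>))" for n
  have Sr: "- (\<Sum>k<d'. p k * log 2 (p k)) < r" using \<epsilon> by (simp add: r_def S_def)
  have \<eta>lim: "\<eta> \<longlonglongrightarrow> 0" unfolding \<eta>_def T_def by (rule atypical_tendsto_0[OF p Sr])
  define \<gamma> where "\<gamma> n = (if q = 2 then real (card (T n)) else 1)" for n
  have T\<gamma>: "real (card (T n)) * \<gamma> n \<le> 2 powr (real q * (real n * r))" for n
  proof -
    have c: "real (card (T n)) \<le> 2 powr (real n * r)" unfolding T_def by (rule card_typical[OF p])
    show ?thesis
    proof (cases "q = 2")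
      case True
      have "real (card (T n)) * real (card (T n)) \<le> 2 powr (real n * r) * 2 powr (real n * r)"
        using c by (intro mult_mono) auto
      then show ?thesis using True by (simp add: \<gamma>_def mult.commute flip: powr_add)
    next
      case False
      then show ?thesis using c q by (simp add: \<gamma>_def)
    qed
  qed
  \<comment> \<open>The key length: q r bits per copy pay for the product of
    \<open>card (T n)\<close> and \<open>\<gamma> n\<close>, and the further \<epsilon> makes the
    hash term decay. A negative length is turned into 0 by \<open>nat\<close>.\<close>
  define x where "x n = real (l n) - real n * (real q * r + \<epsilon>)" for n
  define k where "k n = nat \<lfloor>x n\<rfloor>" for n
  \<comment> \<open>For an empty key the factor 2^0 - 1 is 0, which covers the lengths at which
    \<open>x n\<close> is below 1; otherwise \<open>k n\<close> is at most
    \<open>x n\<close>.\<close>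
  have third: "real (card (T n)) * \<gamma> n * (2 ^ k n - 1) / 2 ^ l n \<le> 2 powr (- real n * \<epsilon>)" for n
  proof (cases "k n = 0")
    case False
    then have kx: "real (k n) \<le> x n" unfolding k_def by linarith
    have "(2 :: real) ^ k n = 2 powr real (k n)" by (simp add: powr_realpow)
    also have "\<dots> \<le> 2 powr x n" using kx by simp
    finally have "(2 :: real) ^ k n - 1 \<le> 2 powr x n" by simp
    then have "real (card (T n)) * \<gamma> n * (2 ^ k n - 1) \<le> 2 powr (real q * (real n * r)) * 2 powr x n"
      using T\<gamma>[of n] by (intro mult_mono) auto
    also have "\<dots> = 2 powr (- real n * \<epsilon>) * 2 ^ l n"
      by (simp add: x_def algebra_simps flip: powr_add powr_realpow)
    finally show ?thesis by (simp add: field_simps)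
  qed simp
  define bd where "bd n = 4 * sqrt (2 * \<delta> n + \<eta> n) + sqrt (2 * (2 powr (- real n * \<epsilon>))) + 4 * \<delta> n" for n
  have d0: "0 < tdim ?D2"
  proof (rule ccontr)
    assume "\<not> 0 < tdim ?D2"
    then have "dim_row \<rho> = 0" using psd_carrier[OF \<rho>p] by auto
    then show False using \<rho>t by (simp add: mtrace_def)
  qed
  have ex: "\<exists>e \<Lambda>'' \<tau>''. lopc (tpow ?D2 n) (2 ^ k n, 2 ^ k n, e) \<Lambda>'' \<and> density_op e \<tau>'' \<and>
     (2 * \<delta> n < 1 \<longrightarrow> 2 * trace_dist (\<Lambda>'' (tensor_power ?D2 n \<rho>)) (key_state (2 ^ k n, 2 ^ k n, e) (k n) \<tau>'') \<le> bd n)" for n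
  proof (cases "2 * \<delta> n < 1")
    case True
    obtain A B e where D'n: "D' n = (A, B, e)" by (cases "D' n")
    obtain c where c: "c \<in> {0, 1}" "trace_factor (tdim (tpow D n)) c (\<Lambda> n)" using lopc_props[OF lo[of n]] by blast
    have "c \<noteq> 0"
    proof
      assume "c = 0"
      then have "mtrace (\<Lambda> n (tensor_power D n ?\<rho>1)) = 0"
        using c psd_carrier[OF psd_tensor_power[OF \<rho>1, of n]] by (simp add: trace_factor_def)
      then have "1 \<le> 2 * \<delta> n"
        using trace_zero_far[of A B e "\<Lambda> n (tensor_power D n ?\<rho>1)" "\<tau> n" "l n"] \<Lambda>p[of n] \<tau>[of n] L[of n]
        unfolding \<delta>_def D'n by simp
      then show False using True by simp
    qed
    then have tr: "trace_factor (tdim (tpow D n)) 1 (\<Lambda> n)" using c by auto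
    have "\<exists>\<Lambda>'' \<tau>''. lopc (tpow ?D2 n) (2 ^ k n, 2 ^ k n, e * d' ^ n) \<Lambda>'' \<and> density_op (e * d' ^ n) \<tau>'' \<and>
      2 * trace_dist (\<Lambda>'' (tensor_power ?D2 n \<rho>)) (key_state (2 ^ k n, 2 ^ k n, e * d' ^ n) (k n) \<tau>'')
      \<le> 4 * sqrt (2 * \<delta> n + \<eta> n) + sqrt (2 * card (T n) * \<gamma> n * (2 ^ k n - 1) / 2 ^ l n) + 4 * \<delta> n"
      unfolding \<delta>_def D'n D_def
    proof (rule one_shot[where p = p and v = v])
      show "psd (tdim (add_eve d' (dA, dB, dE))) \<rho>" using \<rho>p by (simp add: D_def)
      show "onb d' v" by (rule v)
      show "\<And>k. k < d' \<Longrightarrow> 0 \<le> p k" "(\<Sum>k<d'. p k) = 1" using p by auto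
      show "\<And>j j'. j < d' \<Longrightarrow> j' < d' \<Longrightarrow> ptrace_fst (tdim (dA, dB, dE)) d' \<rho> $$ (j, j') = spectral_op d' v p j j'"
        using marg by (simp add: D_def)
      show "lopc (tpow (dA, dB, dE) n) (A, B, e) (\<Lambda> n)" using lo[of n] by (simp add: D_def D'n)
      show "trace_factor (tdim (tpow (dA, dB, dE) n)) 1 (\<Lambda> n)" using tr by (simp add: D_def)
      show "2 ^ l n \<le> A" "2 ^ l n \<le> B" using L[of n] by (simp_all add: D'n)
      show "density_op e (\<tau> n)" using \<tau>[of n] by (simp add: D'n)
      show "T n \<subseteq> {..<d' ^ n}" by (auto simp: T_def typical_def)
      show "(\<Sum>\<kappa>\<in>{..<d' ^ n} - T n. \<Prod>k<n. p (digit d' k \<kappa>)) \<le> \<eta> n" by (simp add: \<eta>_def)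
      show "\<gamma> n = card (T n) \<or> \<gamma> n = 1 \<and> (\<forall>k<d'. \<forall>k'<d'. \<forall>s\<in>box (dA, dB, dE). \<forall>t\<in>box (dA, dB, dE). k \<noteq> k' \<longrightarrow> rot_block (dA, dB, dE) d' v \<rho> k k' s t = 0)"
        using q unfolding \<gamma>_def D_def by auto
    qed
    then obtain \<Lambda>'' \<tau>'' where 1: "lopc (tpow ?D2 n) (2 ^ k n, 2 ^ k n, e * d' ^ n) \<Lambda>''" "density_op (e * d' ^ n) \<tau>''"
      and le: "2 * trace_dist (\<Lambda>'' (tensor_power ?D2 n \<rho>)) (key_state (2 ^ k n, 2 ^ k n, e * d' ^ n) (k n) \<tau>'')
      \<le> 4 * sqrt (2 * \<delta> n + \<eta> n) + sqrt (2 * card (T n) * \<gamma> n * (2 ^ k n - 1) / 2 ^ l n) + 4 * \<delta> n" by blast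
    have "sqrt (2 * card (T n) * \<gamma> n * (2 ^ k n - 1) / 2 ^ l n) \<le> sqrt (2 * (2 powr (- real n * \<epsilon>)))"
      using third[of n] by (intro real_sqrt_le_mono) (simp add: mult.assoc)
    then have "2 * trace_dist (\<Lambda>'' (tensor_power ?D2 n \<rho>)) (key_state (2 ^ k n, 2 ^ k n, e * d' ^ n) (k n) \<tau>'') \<le> bd n"
      using le unfolding bd_def by linarith
    then show ?thesis using 1 by blast
  next
    case False
    \<comment> \<open>No distance has to be bounded here. Hashing with a constant function is an
      LOPC operation with the required output dimensions.\<close>
    obtain A B e where t: "tpow ?D2 n = (A, B, e)" by (cases "tpow ?D2 n")
    have "e = (dE * d') ^ n" using t by (simp add: D_def)
    moreover have "0 < dE * d'" using d0 by (simp add: D_def)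
    ultimately have "0 < e" by simp
    then obtain \<tau>0 where \<tau>0: "density_op e \<tau>0" using density_op_ex by blast
    have "lopc (tpow ?D2 n) (2 ^ k n, 2 ^ k n, e) (\<lambda>X. hash_AB (A, B, e) (2 ^ k n) (\<lambda>_. 0) X)"
      by (rule lopc_hash_AB) (use lopc.none[of "tpow ?D2 n"] in \<open>simp_all add: t\<close>)
    then show ?thesis using \<tau>0 False by blast
  qed
  obtain e \<Lambda>2 \<tau>2 where lo2: "\<And>n. lopc (tpow ?D2 n) (2 ^ k n, 2 ^ k n, e n) (\<Lambda>2 n)"
    and \<tau>2: "\<And>n. density_op (e n) (\<tau>2 n)"
    and td2: "\<And>n. 2 * \<delta> n < 1 \<Longrightarrow> 2 * trace_dist (\<Lambda>2 n (tensor_power ?D2 n \<rho>)) (key_state (2 ^ k n, 2 ^ k n, e n) (k n) (\<tau>2 n)) \<le> bd n"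
    using ex by metis
  define D2 where "D2 n = ((2 :: nat) ^ k n, (2 :: nat) ^ k n, e n)" for n
  have bdlim: "bd \<longlonglongrightarrow> 0"
  proof -
    have dl: "\<delta> \<longlonglongrightarrow> 0" using lim by (simp add: \<delta>_def[abs_def])
    have "(\<lambda>n. (2 powr (- \<epsilon>)) ^ n) \<longlonglongrightarrow> 0"
      using \<epsilon> by (intro LIMSEQ_realpow_zero) (auto simp: powr_less_one)
    then have pl: "(\<lambda>n. 2 powr (- real n * \<epsilon>)) \<longlonglongrightarrow> 0"
      by (simp add: powr_powr mult.commute flip: powr_realpow)
    have "bd \<longlonglongrightarrow> 4 * sqrt (2 * 0 + 0) + sqrt (2 * 0) + 4 * 0"
      unfolding bd_def[abs_def] by (intro tendsto_intros dl \<eta>lim pl)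
    then show ?thesis by simp
  qed
  have ev: "\<forall>\<^sub>F n in sequentially. 2 * \<delta> n < 1"
  proof -
    have "\<delta> \<longlonglongrightarrow> 0" using lim by (simp add: \<delta>_def[abs_def])
    then have "(\<lambda>n. 2 * \<delta> n) \<longlonglongrightarrow> 0" by (rule tendsto_mult_right_zero)
    then show ?thesis by (rule order_tendstoD(2)) simp
  qed
  have tdlim: "(\<lambda>n. trace_dist (\<Lambda>2 n (tensor_power ?D2 n \<rho>)) (key_state (D2 n) (k n) (\<tau>2 n))) \<longlonglongrightarrow> 0"
  proof (rule tendsto_sandwich[where f = "\<lambda>_. 0" and h = "\<lambda>n. bd n / 2"])
    have "psd (tdim (D2 n)) (\<Lambda>2 n (tensor_power ?D2 n \<rho>))" for n
      using lopc_props[OF lo2[of n]] psd_tensor_power[OF \<rho>p, of n] unfolding positive_op_def D2_def by blast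
    then have "0 \<le> trace_dist (\<Lambda>2 n (tensor_power ?D2 n \<rho>)) (key_state (D2 n) (k n) (\<tau>2 n))" for n
      using \<tau>2[of n] by (intro trace_dist_nonneg) (auto simp: density_op_def D2_def)
    then show "\<forall>\<^sub>F n in sequentially. 0 \<le> trace_dist (\<Lambda>2 n (tensor_power ?D2 n \<rho>)) (key_state (D2 n) (k n) (\<tau>2 n))"
      by simp
    show "\<forall>\<^sub>F n in sequentially. trace_dist (\<Lambda>2 n (tensor_power ?D2 n \<rho>)) (key_state (D2 n) (k n) (\<tau>2 n)) \<le> bd n / 2"
      using ev
    proof eventually_elim
      case (elim n)
      then show ?case using td2[of n] unfolding D2_def by linarith
    qed
    show "(\<lambda>n. bd n / 2) \<longlonglongrightarrow> 0" using tendsto_divide[OF bdlim tendsto_const, of 2] by simp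
  qed simp
  define R' where "R' = limsup (\<lambda>n. ereal (real (k n) / real n))"
  have "lopc_protocol ?D2 D2 \<Lambda>2" using lo2 by (simp add: lopc_protocol_def D2_def)
  moreover have "distills_key ?D2 \<rho> D2 \<Lambda>2 R'"
    unfolding distills_key_def
    by (rule exI[of _ k], rule exI[of _ \<tau>2]) (use \<tau>2 tdlim in \<open>simp add: D2_def R'_def\<close>)
  ultimately have "R' \<le> key_rate ?D2 \<rho>" unfolding key_rate_def by (intro Sup_upper) blast
  define c where "c = real q * S + (real q + 2) * \<epsilon>"
  have "\<forall>\<^sub>F n in sequentially. ereal (real (l n) / real n) \<le> ereal (real (k n) / real n) + ereal c"
  proof -
    \<comment> \<open>Once n \<epsilon> \<ge> 1, rounding down the key length costs at most
      \<epsilon> per copy. Added to q r + \<epsilon> with r = S + \<epsilon>, this is the constant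
      \<open>c\<close>.\<close>
    obtain n0 :: nat where n0: "1 / \<epsilon> < real n0" using reals_Archimedean2 by blast
    have "ereal (real (l n) / real n) \<le> ereal (real (k n) / real n) + ereal c" if n: "n \<ge> max 1 n0" for n
    proof -
      have npos: "0 < real n" using n by simp
      have "1 / \<epsilon> < real n" using n n0 by linarith
      then have "1 \<le> real n * \<epsilon>" using \<epsilon> by (simp add: field_simps)
      moreover have "x n \<le> real (k n) + 1" unfolding k_def by linarith
      ultimately have "real (l n) \<le> real (k n) + real n * (real q * r + \<epsilon>) + real n * \<epsilon>" unfolding x_def by linarith
      also have "\<dots> = real (k n) + real n * c" by (simp add: c_def r_def algebra_simps)
      finally have "real (l n) / real n \<le> (real (k n) + real n * c) / real n" using npos by (intro divide_right_mono) auto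
      then show ?thesis using npos by (simp add: add_divide_distrib)
    qed
    then show ?thesis unfolding eventually_sequentially by blast
  qed
  then have "R \<le> limsup (\<lambda>n. ereal (real (k n) / real n) + ereal c)" unfolding R[symmetric] by (rule Limsup_mono)
  also have "\<dots> = R' + ereal c" unfolding R'_def by (rule Limsup_add_ereal_right) auto
  also have "\<dots> \<le> key_rate ?D2 \<rho> + ereal c" using \<open>R' \<le> key_rate ?D2 \<rho>\<close> by (rule add_right_mono)
  finally show ?thesis unfolding c_def .
qed

section \<open>The bound for a given eigenbasis of the state of E', and its two instances\<close>

lemma psd_ptrace_fst:
  assumes \<rho>: "psd (tdim (add_eve m D)) \<rho>"
  shows "psd m (ptrace_fst (tdim D) m \<rho>)"
proof -
  have p: "posf (box (add_eve m D)) (tent (add_eve m D) \<rho>)" using \<rho> psd_tent[OF psd_carrier[OF \<rho>]] by simp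
  have "posf {..<m} (\<lambda>j j'. \<Sum>s\<in>box D. tent (add_eve m D) \<rho> (put_eve (\<lambda>(e, j). e * m + j) j s) (put_eve (\<lambda>(e, j). e * m + j) j' s))"
  proof (rule posf_sum)
    fix s assume "s \<in> box D"
    then have "(\<lambda>j. put_eve (\<lambda>(e, j). e * m + j) j s) ` {..<m} \<subseteq> box (add_eve m D)"
      using put_eve_box[of s D _ m] by blast
    then show "posf {..<m} (\<lambda>j j'. tent (add_eve m D) \<rho> (put_eve (\<lambda>(e, j). e * m + j) j s) (put_eve (\<lambda>(e, j). e * m + j) j' s))"
      by (rule posf_pullback[OF p finite_lessThan finite_box])
  qed
  moreover have "posf {..<m} (\<lambda>j j'. ptrace_fst (tdim D) m \<rho> $$ (j, j')) =
    posf {..<m} (\<lambda>j j'. \<Sum>s\<in>box D. tent (add_eve m D) \<rho> (put_eve (\<lambda>(e, j). e * m + j) j s) (put_eve (\<lambda>(e, j). e * m + j) j' s))"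
    by (rule posf_cong) (simp add: ptrace_fst_tent)
  ultimately show ?thesis by (simp add: psd_iff ptrace_fst_def)
qed

lemma trace_ptrace_fst:
  assumes "\<rho> \<in> carrier_mat (d * m) (d * m)"
  shows "(\<Sum>j<m. ptrace_fst d m \<rho> $$ (j, j)) = mtrace \<rho>"
proof -
  have "mtrace \<rho> = (\<Sum>x<d * m. (\<lambda>q r. \<rho> $$ (q * m + r, q * m + r)) (x div m) (x mod m))"
    using assms by (simp add: mtrace_def)
  also have "\<dots> = (\<Sum>q<d. \<Sum>r<m. \<rho> $$ (q * m + r, q * m + r))" by (rule sum_divmod)
  also have "\<dots> = (\<Sum>r<m. \<Sum>q<d. \<rho> $$ (q * m + r, q * m + r))" by (rule sum.swap)
  finally show ?thesis by (simp add: ptrace_fst_def)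
qed

text \<open>A left inverse of a square matrix is also a right inverse, which turns orthonormality of
  \<open>m\<close> vectors into completeness.\<close>

lemma onb_of_orthonormal:
  assumes "\<And>j k. j < m \<Longrightarrow> k < m \<Longrightarrow> ip m (v j) (v k) = (if j = k then 1 else 0)"
  shows "onb m v"
proof -
  define U where "U = mat m m (\<lambda>(i, k). v k i)"
  have U: "U \<in> carrier_mat m m" by (simp add: U_def)
  have aU: "mat_adjoint U \<in> carrier_mat m m" using U by simp
  have 1: "mat_adjoint U * U = 1\<^sub>m m"
    using assms U by (intro eq_matI) (auto simp: scalar_prod_def U_def ip_def lessThan_atLeast0)
  have 2: "U * mat_adjoint U = 1\<^sub>m m" by (rule mat_mult_left_right_inverse[OF aU U 1])
  have "(\<Sum>k<m. v k i * cnj (v k j)) = (if i = j then 1 else 0)" if ij: "i < m" "j < m" for i j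
  proof -
    have "(U * mat_adjoint U) $$ (i, j) = (\<Sum>k<m. v k i * cnj (v k j))"
      using ij U by (simp add: scalar_prod_def lessThan_atLeast0) (simp add: U_def)
    then show ?thesis using ij by (simp add: 2)
  qed
  then show ?thesis using assms by (simp add: onb_def)
qed

text \<open>The rate bound holds for every positive \<epsilon>; dividing \<epsilon> by q + 2 absorbs
  its coefficient, and the supremum over protocols is taken afterwards.\<close>

lemma key_rate_bound:
  fixes \<rho> :: "complex mat" and p :: "nat \<Rightarrow> real" and dA dB dE d' q :: nat
  defines "D \<equiv> (dA, dB, dE)"
  assumes \<rho>: "density_op (tdim (add_eve d' D)) \<rho>"
    and v: "onb d' v" and p: "\<And>k. k < d' \<Longrightarrow> 0 \<le> p k" "(\<Sum>k<d'. p k) = 1"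
    and marg: "\<And>j j'. j < d' \<Longrightarrow> j' < d' \<Longrightarrow> ptrace_fst (tdim D) d' \<rho> $$ (j, j') = spectral_op d' v p j j'"
    and q: "q = 2 \<or> q = 1 \<and> (\<forall>k<d'. \<forall>k'<d'. \<forall>s\<in>box D. \<forall>t\<in>box D. k \<noteq> k' \<longrightarrow> rot_block D d' v \<rho> k k' s t = 0)"
  shows "key_rate D (ptrace_snd (tdim D) d' \<rho>) - ereal (real q * vn_entropy (ptrace_fst (tdim D) d' \<rho>))
    \<le> key_rate (add_eve d' D) \<rho>"
proof -
  have S: "vn_entropy (ptrace_fst (tdim D) d' \<rho>) = - (\<Sum>k<d'. p k * log 2 (p k))"
    by (rule vn_entropy_spectral[OF v _ marg]) (simp_all add: ptrace_fst_def)
  have "R \<le> key_rate (add_eve d' D) \<rho> + ereal (real q * vn_entropy (ptrace_fst (tdim D) d' \<rho>))"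
    if R: "lopc_protocol D D' \<Lambda>" "distills_key D (ptrace_snd (tdim D) d' \<rho>) D' \<Lambda> R" for R D' \<Lambda>
  proof (rule ereal_le_epsilon2)
    fix \<epsilon> :: real assume \<epsilon>: "0 < \<epsilon>"
    have "R \<le> key_rate (add_eve d' D) \<rho> + ereal (real q * (- (\<Sum>k<d'. p k * log 2 (p k))) + (real q + 2) * (\<epsilon> / (real q + 2)))"
      unfolding D_def using \<epsilon>
      by (intro rate_bound[OF \<rho>[unfolded D_def] v p marg[unfolded D_def] q[unfolded D_def] R[unfolded D_def]]) auto
    then show "R \<le> key_rate (add_eve d' D) \<rho> + ereal (real q * vn_entropy (ptrace_fst (tdim D) d' \<rho>)) + ereal \<epsilon>"
      unfolding S by (simp add: add.assoc)
  qed
  then have "key_rate D (ptrace_snd (tdim D) d' \<rho>) \<le> key_rate (add_eve d' D) \<rho> + ereal (real q * vn_entropy (ptrace_fst (tdim D) d' \<rho>))"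
    unfolding key_rate_def[of D] by (intro Sup_least) auto
  then show ?thesis by (simp add: ereal_minus_le)
qed

lemma kron_index:
  assumes "X \<in> carrier_mat d d" "Y \<in> carrier_mat m m" "x < d" "y < d" "j < m" "j' < m"
  shows "kron X Y $$ (x * m + j, y * m + j') = X $$ (x, y) * Y $$ (j, j')"
  using assms idx_less[of x d j m] idx_less[of y d j' m] by (simp add: kron_def)

theorem corollary5p2:
  fixes \<rho> :: "complex mat" and dA dB dE dE' :: nat
  assumes "density_op (tdim (dA, dB, dE * dE')) \<rho>"
  shows "key_rate (dA, dB, dE * dE') \<rho>
           \<ge> key_rate (dA, dB, dE) (ptrace_snd (tdim (dA, dB, dE)) dE' \<rho>)
              - ereal (2 * vn_entropy (ptrace_fst (tdim (dA, dB, dE)) dE' \<rho>)) \<and>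
         (classical_snd (tdim (dA, dB, dE)) dE' \<rho> \<longrightarrow>
          key_rate (dA, dB, dE * dE') \<rho>
           \<ge> key_rate (dA, dB, dE) (ptrace_snd (tdim (dA, dB, dE)) dE' \<rho>)
              - ereal (vn_entropy (ptrace_fst (tdim (dA, dB, dE)) dE' \<rho>)))"
proof (intro conjI impI)
  let ?D = "(dA, dB, dE)" and ?d = "tdim (dA, dB, dE)"
  have \<rho>: "density_op (tdim (add_eve dE' ?D)) \<rho>" using assms by simp
  then have \<rho>p: "psd (tdim (add_eve dE' ?D)) \<rho>" and \<rho>t: "mtrace \<rho> = 1" by (auto simp: density_op_def)
  have \<rho>c: "\<rho> \<in> carrier_mat (?d * dE') (?d * dE')" using psd_carrier[OF \<rho>p] by (simp add: mult.assoc)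
  define E where "E j j' = ptrace_fst ?d dE' \<rho> $$ (j, j')" for j j'
  have Ep: "posf {..<dE'} E" using psd_ptrace_fst[OF \<rho>p] by (simp add: psd_iff E_def[abs_def])
  obtain v p where v: "onb dE' v" and Ev: "\<And>i j. i < dE' \<Longrightarrow> j < dE' \<Longrightarrow> E i j = spectral_op dE' v p i j"
    and p: "\<And>k. k < dE' \<Longrightarrow> 0 \<le> p k" by (rule posf_spectral[OF Ep]) blast
  have "complex_of_real (\<Sum>k<dE'. p k) = (\<Sum>j<dE'. E j j)"
    unfolding spectral_op_trace[OF v, symmetric] using Ev by (intro sum.cong) auto
  also have "\<dots> = 1" unfolding E_def trace_ptrace_fst[OF \<rho>c] by (rule \<rho>t)
  finally have p1: "(\<Sum>k<dE'. p k) = 1" unfolding of_real_eq_1_iff .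
  show "key_rate (dA, dB, dE) (ptrace_snd ?d dE' \<rho>) - ereal (2 * vn_entropy (ptrace_fst ?d dE' \<rho>))
      \<le> key_rate (dA, dB, dE * dE') \<rho>"
    using key_rate_bound[OF \<rho> v p p1 Ev[unfolded E_def], of 2] by simp
  assume "classical_snd ?d dE' \<rho>"
  then obtain u w \<sigma> where u: "\<And>k. k < dE' \<Longrightarrow> u k \<in> carrier_vec dE'"
    and orth: "\<And>j k. j < dE' \<Longrightarrow> k < dE' \<Longrightarrow> u j \<bullet>c u k = (if j = k then 1 else 0)"
    and w: "\<And>k. k < dE' \<Longrightarrow> 0 \<le> w k" "(\<Sum>k<dE'. w k) = 1"
    and \<sigma>: "\<And>k. k < dE' \<Longrightarrow> density_op ?d (\<sigma> k)"
    and \<rho>_eq: "\<rho> = mat (?d * dE') (?d * dE') (\<lambda>(i, j). \<Sum>k<dE'. complex_of_real (w k) * kron (\<sigma> k) (proj (u k)) $$ (i, j))"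
    unfolding classical_snd_def by blast
  \<comment> \<open>The classical basis replaces \<open>v\<close> from here on. It is an eigenbasis
    of the marginal with eigenvalues \<open>w\<close>, but for a degenerate spectrum another
    eigenbasis need not make the off-diagonal blocks vanish.\<close>
  define z where "z k i = u k $ i" for k i
  have zip: "ip dE' (z j) (z k) = (if j = k then 1 else 0)" if jk: "j < dE'" "k < dE'" for j k
  proof -
    have "u k \<bullet>c u j = ip dE' (z j) (z k)"
      using u[OF jk(1)] u[OF jk(2)] by (simp add: scalar_prod_def ip_def z_def lessThan_atLeast0 mult.commute)
    then show ?thesis using orth[OF jk(2,1)] by auto
  qed
  have z: "onb dE' z" by (rule onb_of_orthonormal[OF zip])
  have \<rho>_el: "\<rho> $$ (x * dE' + j, y * dE' + j') = (\<Sum>k<dE'. of_real (w k) * (\<sigma> k $$ (x, y) * (z k j * cnj (z k j'))))"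
    if r: "x < ?d" "y < ?d" "j < dE'" "j' < dE'" for x y j j'
  proof -
    have "kron (\<sigma> k) (proj (u k)) $$ (x * dE' + j, y * dE' + j') = \<sigma> k $$ (x, y) * (z k j * cnj (z k j'))"
      if k: "k < dE'" for k
    proof -
      have "\<sigma> k \<in> carrier_mat ?d ?d" using \<sigma>[OF k] by (simp add: density_op_def psd_def)
      moreover have "proj (u k) \<in> carrier_mat dE' dE'" using u[OF k] by (simp add: proj_def)
      ultimately have "kron (\<sigma> k) (proj (u k)) $$ (x * dE' + j, y * dE' + j') = \<sigma> k $$ (x, y) * proj (u k) $$ (j, j')"
        by (rule kron_index[OF _ _ r])
      then show ?thesis using u[OF k] r by (simp add: proj_def z_def)
    qed
    moreover have "x * dE' + j < ?d * dE'" "y * dE' + j' < ?d * dE'" using r by (auto intro: idx_less simp del: tdim.simps)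
    ultimately show ?thesis unfolding \<rho>_eq by (simp del: tdim.simps)
  qed
  have marg: "ptrace_fst ?d dE' \<rho> $$ (j, j') = spectral_op dE' z w j j'" if jj: "j < dE'" "j' < dE'" for j j'
  proof -
    have "ptrace_fst ?d dE' \<rho> $$ (j, j') = (\<Sum>x<?d. \<Sum>k<dE'. of_real (w k) * (\<sigma> k $$ (x, x) * (z k j * cnj (z k j'))))"
      using jj by (simp add: ptrace_fst_def \<rho>_el del: tdim.simps)
    also have "\<dots> = (\<Sum>k<dE'. \<Sum>x<?d. of_real (w k) * (\<sigma> k $$ (x, x) * (z k j * cnj (z k j'))))" by (rule sum.swap)
    also have "\<dots> = (\<Sum>k<dE'. of_real (w k) * (mtrace (\<sigma> k) * (z k j * cnj (z k j'))))"
    proof (rule sum.cong[OF refl])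
      fix k assume "k \<in> {..<dE'}"
      then have "dim_row (\<sigma> k) = ?d" using \<sigma>[of k] by (auto simp: density_op_def psd_def)
      then show "(\<Sum>x<?d. of_real (w k) * (\<sigma> k $$ (x, x) * (z k j * cnj (z k j')))) = of_real (w k) * (mtrace (\<sigma> k) * (z k j * cnj (z k j')))"
        by (simp add: mtrace_def sum_distrib_left sum_distrib_right del: tdim.simps)
    qed
    also have "\<dots> = spectral_op dE' z w j j'"
      unfolding spectral_op_def using \<sigma> by (intro sum.cong refl) (simp add: density_op_def)
    finally show ?thesis .
  qed
  \<comment> \<open>Each term contains the products of \<open>z l\<close> with \<open>z k\<close>
    and with \<open>z k'\<close>, and no \<open>l\<close> equals both \<open>k\<close> and
    \<open>k'\<close>.\<close>
  have zero: "rot_block ?D dE' z \<rho> k k' s t = 0"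
    if kk: "k < dE'" "k' < dE'" "k \<noteq> k'" and s: "s \<in> box ?D" and t: "t \<in> box ?D" for k k' s t
  proof -
    have "rot_block ?D dE' z \<rho> k k' s t = (\<Sum>j<dE'. \<Sum>j'<dE'. cnj (z k j) * (\<Sum>l<dE'. of_real (w l) * (\<sigma> l $$ (enc ?D s, enc ?D t) * (z l j * cnj (z l j')))) * z k' j')"
      unfolding rot_block_def tent_def enc_put_eve
      by (intro sum.cong refl arg_cong2[where f = "(*)"] \<rho>_el enc_less[OF s] enc_less[OF t]) auto
    also have "\<dots> = (\<Sum>j<dE'. \<Sum>j'<dE'. \<Sum>l<dE'. of_real (w l) * \<sigma> l $$ (enc ?D s, enc ?D t) * (cnj (z k j) * z l j) * (cnj (z l j') * z k' j'))"
      unfolding sum_distrib_left sum_distrib_right by (intro sum.cong refl) (simp add: mult_ac)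
    also have "\<dots> = (\<Sum>j<dE'. \<Sum>l<dE'. \<Sum>j'<dE'. of_real (w l) * \<sigma> l $$ (enc ?D s, enc ?D t) * (cnj (z k j) * z l j) * (cnj (z l j') * z k' j'))"
      by (rule sum.cong[OF refl]) (rule sum.swap)
    also have "\<dots> = (\<Sum>l<dE'. \<Sum>j<dE'. \<Sum>j'<dE'. of_real (w l) * \<sigma> l $$ (enc ?D s, enc ?D t) * (cnj (z k j) * z l j) * (cnj (z l j') * z k' j'))"
      by (rule sum.swap)
    also have "\<dots> = (\<Sum>l<dE'. of_real (w l) * \<sigma> l $$ (enc ?D s, enc ?D t) * (ip dE' (z k) (z l) * ip dE' (z l) (z k')))"
      unfolding ip_def sum_product by (simp only: sum_distrib_left mult.assoc)
    also have "\<dots> = 0"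
    proof (rule sum.neutral, rule ballI)
      fix l assume "l \<in> {..<dE'}"
      then show "of_real (w l) * \<sigma> l $$ (enc ?D s, enc ?D t) * (ip dE' (z k) (z l) * ip dE' (z l) (z k')) = 0"
        using kk zip[of k l] zip[of l k'] by auto
    qed
    finally show ?thesis .
  qed
  show "key_rate (dA, dB, dE) (ptrace_snd ?d dE' \<rho>) - ereal (vn_entropy (ptrace_fst ?d dE' \<rho>))
      \<le> key_rate (dA, dB, dE * dE') \<rho>"
    using key_rate_bound[OF \<rho> z w marg, of 1] zero by simp
qed

end
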